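(* Let $A$ be a finite abelian group with a quadratic form $q:A\to k^\times$. The set $$P(A,q)=\{\text{homomorphisms } f:\widehat A\to A \ :\ \mathrm{id}_{\widehat A}-\tilde\sigma\circ f\text{ is invertible and }\langle\phi,f(\phi)\rangle=q(f(\phi))\ \text{for all }\phi\in\widehat A\}$$ with the operation $$f\diamond g=f+g-f\circ\tilde\sigma\circ g$$ is a group. Furthermore, the map $$f\mapsto\alpha_f:\ P(A,q)\to\mathrm{Aut}^{br}\big(\mathcal{Z}(\mathcal{C}(A,q));\,\mathcal{C}(A,q)\big),\qquad \alpha_f(a,\phi)=(a+f(\phi),\ \phi-\tilde\sigma f(\phi)),$$ is a group isomorphism.
   Context: $k$ is an algebraically closed field of characteristic $0$. A quadratic form $q:A\to k^\times$ satisfies $q(-x)=q(x)$ and $\sigma(x,y)=q(x+y)/(q(x)q(y))$ is bimultiplicative. $\widehat A=\mathrm{Hom}(A,k^\times)$, written additively, with evaluation $\langle\phi,a\rangle$; $\tilde\sigma:A\to\widehat A$ is given by $\langle\tilde\sigma(a),x\rangle=\sigma(a,x)$. $\mathcal{C}(A,q)$ is the pointed braided fusion category with group of simple objects $A$ and self-braiding of $x$ equal to $q(x)$; every braided autoequivalence of it is determined up to isomorphism by the induced automorphism of $A$, giving $\mathrm{Aut}^{br}(\mathcal{C}(A,q))=O(A,q)$, the group of automorphisms of $A$ preserving $q$. The Drinfeld center satisfies $\mathcal{Z}(\mathcal{C}(A,q))\cong\mathcal{C}(A\oplus\widehat A,Q)$ with $Q(a,\phi)=\langle\phi,a\rangle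 q(a)$, so that $\mathrm{Aut}^{br}(\mathcal{Z}(\mathcal{C}(A,q)))=O(A\oplus\widehat A,Q)$; the map $\alpha_f$ is regarded as an element of it. The category $\mathcal{C}(A,q)$ is embedded in its center via $X\mapsto(X,c_{-,X})$ ($c$ the braiding), corresponding to $a\mapsto(a,0)$. $\mathrm{Aut}^{br}(\mathcal{Z}(\mathcal{C});\mathcal{C})$ is the group of isomorphism classes of braided autoequivalences of $\mathcal{Z}(\mathcal{C})$ whose restriction to $\mathcal{C}$ is isomorphic to $\mathrm{id}_{\mathcal{C}}$ as a tensor functor. *)

theory Defs
  imports
    "HOL-Algebra.Group"
    "HOL-Computational_Algebra.Polynomial"
    "HOL-Library.FuncSet"
    "HOL-Library.Product_Plus"
begin

section \<open>Quadratic forms and the dual group\<close>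

definition sigma :: "('a::ab_group_add \<Rightarrow> 'k::field) \<Rightarrow> 'a \<Rightarrow> 'a \<Rightarrow> 'k" where
  "sigma q x y = q (x + y) / (q x * q y)"

definition quadratic_form :: "('a::ab_group_add \<Rightarrow> 'k::field) \<Rightarrow> bool" where
  "quadratic_form q \<longleftrightarrow>
     (\<forall>x. q x \<noteq> 0) \<and>
     (\<forall>x. q (- x) = q x) \<and>
     (\<forall>x y z. sigma q (x + y) z = sigma q x z * sigma q y z) \<and>
     (\<forall>x y z. sigma q x (y + z) = sigma q x y * sigma q x z)"

text \<open>The group of homomorphisms from the additive group \<open>'a\<close> to the multiplicative group of
  \<open>'k\<close>; it is written additively, so addition is the pointwise product.\<close>

typedef (overloaded) ('a, 'k) dual =
  "{\<phi> :: 'a::ab_group_add \<Rightarrow> 'k::field. (\<forall>x. \<phi> x \<noteq> 0) \<and> (\<forall>x y. \<phi> (x + y) = \<phi> x * \<phi> y)}"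
  morphisms ev Abs_dual
  by (rule exI[of _ "\<lambda>_. 1"]) simp

setup_lifting type_definition_dual

instantiation dual :: (ab_group_add, field) ab_group_add
begin

lift_definition zero_dual :: "('a, 'b) dual" is "\<lambda>_. 1" by simp
lift_definition plus_dual :: "('a, 'b) dual \<Rightarrow> ('a, 'b) dual \<Rightarrow> ('a, 'b) dual"
  is "\<lambda>\<phi> \<psi> x. \<phi> x * \<psi> x" by (simp add: ac_simps)
lift_definition uminus_dual :: "('a, 'b) dual \<Rightarrow> ('a, 'b) dual"
  is "\<lambda>\<phi> x. inverse (\<phi> x)" by simp
lift_definition minus_dual :: "('a, 'b) dual \<Rightarrow> ('a, 'b) dual \<Rightarrow> ('a, 'b) dual"
  is "\<lambda>\<phi> \<psi> x. \<phi> x / \<psi> x" by simp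

instance
  by standard (transfer; simp add: ac_simps divide_inverse)+

end

text \<open>\<open>Abs_dual\<close> is meaningful here because \<open>sigma q a\<close> is a character when \<open>q\<close> is a
  quadratic form.\<close>

definition sigma_tilde :: "('a::ab_group_add \<Rightarrow> 'k::field) \<Rightarrow> 'a \<Rightarrow> ('a, 'k) dual" where
  "sigma_tilde q a = Abs_dual (sigma q a)"

lemma ev_sigma_tilde:
  assumes "quadratic_form q"
  shows "ev (sigma_tilde q a) x = sigma q a x"
  using assms unfolding sigma_tilde_def
  by (subst Abs_dual_inverse) (auto simp: quadratic_form_def sigma_def)

section \<open>The group of homomorphisms\<close>

definition P_group ::
  "('a::ab_group_add \<Rightarrow> 'k::field) \<Rightarrow> (('a, 'k) dual \<Rightarrow> 'a) monoid" where
  "P_group q = \<lparr>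
     carrier = {f. (\<forall>\<phi> \<psi>. f (\<phi> + \<psi>) = f \<phi> + f \<psi>) \<and>
                   bij (\<lambda>\<phi>. \<phi> - sigma_tilde q (f \<phi>)) \<and>
                   (\<forall>\<phi>. ev \<phi> (f \<phi>) = q (f \<phi>))},
     monoid.mult = (\<lambda>f g \<phi>. f \<phi> + g \<phi> - f (sigma_tilde q (g \<phi>))),
     one = (\<lambda>_. 0) \<rparr>"

definition alpha ::
  "('a::ab_group_add \<Rightarrow> 'k::field) \<Rightarrow> (('a, 'k) dual \<Rightarrow> 'a) \<Rightarrow>
     'a \<times> ('a, 'k) dual \<Rightarrow> 'a \<times> ('a, 'k) dual" where
  "alpha q f = (\<lambda>(a, \<phi>). (a + f \<phi>, \<phi> - sigma_tilde q (f \<phi>)))"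

section \<open>Braided fusion categories\<close>

text \<open>Hom sets for different pairs of objects are not required to be disjoint; this is why
  functors below act on morphisms together with their source and target, and why zero morphisms
  carry theirs.
  \<open>X \<boxtimes> Y\<close> is the tensor product of objects and \<open>f \<odot> g\<close> the one of morphisms. The
  structure maps have the types
  \<open>Assoc X Y Z : (X \<boxtimes> Y) \<boxtimes> Z \<rightarrow> X \<boxtimes> (Y \<boxtimes> Z)\<close>, \<open>LUnit X : Unit \<boxtimes> X \<rightarrow> X\<close>,
  \<open>RUnit X : X \<boxtimes> Unit \<rightarrow> X\<close>, \<open>Braid X Y : X \<boxtimes> Y \<rightarrow> Y \<boxtimes> X\<close>.\<close>

record ('o, 'm) cat =
  Ob :: "'o set"
  Hom :: "'o \<Rightarrow> 'o \<Rightarrow> 'm set"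
  Id :: "'o \<Rightarrow> 'm"
  Comp :: "'m \<Rightarrow> 'm \<Rightarrow> 'm" (infixr "\<cdot>\<index>" 70)

record ('o, 'm, 'k) lin_cat = "('o, 'm) cat" +
  Zero :: "'o \<Rightarrow> 'o \<Rightarrow> 'm"
  Add :: "'m \<Rightarrow> 'm \<Rightarrow> 'm"
  Smult :: "'k \<Rightarrow> 'm \<Rightarrow> 'm"

record ('o, 'm, 'k) btc = "('o, 'm, 'k) lin_cat" +
  TenOb :: "'o \<Rightarrow> 'o \<Rightarrow> 'o" (infixr "\<boxtimes>\<index>" 75)
  TenMor :: "'m \<Rightarrow> 'm \<Rightarrow> 'm" (infixr "\<odot>\<index>" 75)
  Unit :: "'o"
  Assoc :: "'o \<Rightarrow> 'o \<Rightarrow> 'o \<Rightarrow> 'm"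
  LUnit :: "'o \<Rightarrow> 'm"
  RUnit :: "'o \<Rightarrow> 'm"
  Braid :: "'o \<Rightarrow> 'o \<Rightarrow> 'm"

locale category =
  fixes C :: "('o, 'm, 'z) cat_scheme" (structure)
  assumes Hom_Ob: "f \<in> Hom C X Y \<Longrightarrow> X \<in> Ob C \<and> Y \<in> Ob C"
    and Id_in_Hom: "X \<in> Ob C \<Longrightarrow> Id C X \<in> Hom C X X"
    and Comp_in_Hom: "\<lbrakk>f \<in> Hom C X Y; g \<in> Hom C Y Z\<rbrakk> \<Longrightarrow> g \<cdot> f \<in> Hom C X Z"
    and Comp_assoc: "\<lbrakk>f \<in> Hom C W X; g \<in> Hom C X Y; h \<in> Hom C Y Z\<rbrakk>
          \<Longrightarrow> (h \<cdot> g) \<cdot> f = h \<cdot> (g \<cdot> f)"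
    and Comp_Id: "f \<in> Hom C X Y \<Longrightarrow> f \<cdot> Id C X = f"
    and Id_Comp: "f \<in> Hom C X Y \<Longrightarrow> Id C Y \<cdot> f = f"

definition inverse_mors :: "('o, 'm, 'z) cat_scheme \<Rightarrow> 'o \<Rightarrow> 'o \<Rightarrow> 'm \<Rightarrow> 'm \<Rightarrow> bool" where
  "inverse_mors C X Y f g \<longleftrightarrow>
     f \<in> Hom C X Y \<and> g \<in> Hom C Y X \<and> g \<cdot>\<^bsub>C\<^esub> f = Id C X \<and> f \<cdot>\<^bsub>C\<^esub> g = Id C Y"

definition Iso :: "('o, 'm, 'z) cat_scheme \<Rightarrow> 'o \<Rightarrow> 'o \<Rightarrow> 'm set" where
  "Iso C X Y = {f. \<exists>g. inverse_mors C X Y f g}"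

definition Inv :: "('o, 'm, 'z) cat_scheme \<Rightarrow> 'o \<Rightarrow> 'o \<Rightarrow> 'm \<Rightarrow> 'm" where
  "Inv C X Y f = (THE g. inverse_mors C X Y f g)"

definition isomorphic :: "('o, 'm, 'z) cat_scheme \<Rightarrow> 'o \<Rightarrow> 'o \<Rightarrow> bool" where
  "isomorphic C X Y \<longleftrightarrow> Iso C X Y \<noteq> {}"

definition mono_mors :: "('o, 'm, 'z) cat_scheme \<Rightarrow> 'o \<Rightarrow> 'o \<Rightarrow> 'm set" where
  "mono_mors C X Y = {f \<in> Hom C X Y.
     \<forall>W. \<forall>g\<in>Hom C W X. \<forall>h\<in>Hom C W X. f \<cdot>\<^bsub>C\<^esub> g = f \<cdot>\<^bsub>C\<^esub> h \<longrightarrow> g = h}"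

definition epi_mors :: "('o, 'm, 'z) cat_scheme \<Rightarrow> 'o \<Rightarrow> 'o \<Rightarrow> 'm set" where
  "epi_mors C X Y = {f \<in> Hom C X Y.
     \<forall>W. \<forall>g\<in>Hom C Y W. \<forall>h\<in>Hom C Y W. g \<cdot>\<^bsub>C\<^esub> f = h \<cdot>\<^bsub>C\<^esub> f \<longrightarrow> g = h}"

locale linear_category = category C
  for C :: "('o, 'm, 'k::field, 'z) lin_cat_scheme" (structure) +
  assumes Zero_in_Hom: "\<lbrakk>X \<in> Ob C; Y \<in> Ob C\<rbrakk> \<Longrightarrow> Zero C X Y \<in> Hom C X Y"
    and Add_in_Hom: "\<lbrakk>f \<in> Hom C X Y; g \<in> Hom C X Y\<rbrakk> \<Longrightarrow> Add C f g \<in> Hom C X Y"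
    and Smult_in_Hom: "f \<in> Hom C X Y \<Longrightarrow> Smult C c f \<in> Hom C X Y"
    and Add_assoc: "\<lbrakk>f \<in> Hom C X Y; g \<in> Hom C X Y; h \<in> Hom C X Y\<rbrakk>
          \<Longrightarrow> Add C (Add C f g) h = Add C f (Add C g h)"
    and Add_commute: "\<lbrakk>f \<in> Hom C X Y; g \<in> Hom C X Y\<rbrakk> \<Longrightarrow> Add C f g = Add C g f"
    and Add_Zero: "f \<in> Hom C X Y \<Longrightarrow> Add C f (Zero C X Y) = f"
    and Smult_zero: "f \<in> Hom C X Y \<Longrightarrow> Smult C 0 f = Zero C X Y"
    and Smult_one: "f \<in> Hom C X Y \<Longrightarrow> Smult C 1 f = f"
    and Smult_Smult: "f \<in> Hom C X Y \<Longrightarrow> Smult C c (Smult C d f) = Smult C (c * d) f"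
    and Smult_add_left: "f \<in> Hom C X Y
          \<Longrightarrow> Smult C (c + d) f = Add C (Smult C c f) (Smult C d f)"
    and Smult_Add: "\<lbrakk>f \<in> Hom C X Y; g \<in> Hom C X Y\<rbrakk>
          \<Longrightarrow> Smult C c (Add C f g) = Add C (Smult C c f) (Smult C c g)"
    and Comp_Add_left: "\<lbrakk>f \<in> Hom C X Y; g \<in> Hom C Y Z; h \<in> Hom C Y Z\<rbrakk>
          \<Longrightarrow> Add C g h \<cdot> f = Add C (g \<cdot> f) (h \<cdot> f)"
    and Comp_Add_right: "\<lbrakk>f \<in> Hom C X Y; g \<in> Hom C X Y; h \<in> Hom C Y Z\<rbrakk>
          \<Longrightarrow> h \<cdot> Add C f g = Add C (h \<cdot> f) (h \<cdot> g)"
    and Comp_Smult_left: "\<lbrakk>f \<in> Hom C X Y; g \<in> Hom C Y Z\<rbrakk>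
          \<Longrightarrow> Smult C c g \<cdot> f = Smult C c (g \<cdot> f)"
    and Comp_Smult_right: "\<lbrakk>f \<in> Hom C X Y; g \<in> Hom C Y Z\<rbrakk>
          \<Longrightarrow> g \<cdot> Smult C c f = Smult C c (g \<cdot> f)"

definition zero_object :: "('o, 'm, 'k, 'z) lin_cat_scheme \<Rightarrow> 'o \<Rightarrow> bool" where
  "zero_object C X \<longleftrightarrow> X \<in> Ob C \<and> Id C X = Zero C X X"

definition direct_sum :: "('o, 'm, 'k, 'z) lin_cat_scheme \<Rightarrow> 'o \<Rightarrow> 'o \<Rightarrow> 'o \<Rightarrow> bool" where
  "direct_sum C X Y S \<longleftrightarrow>
     (\<exists>i\<in>Hom C X S. \<exists>j\<in>Hom C Y S. \<exists>p\<in>Hom C S X. \<exists>r\<in>Hom C S Y.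
        p \<cdot>\<^bsub>C\<^esub> i = Id C X \<and> r \<cdot>\<^bsub>C\<^esub> j = Id C Y \<and>
        p \<cdot>\<^bsub>C\<^esub> j = Zero C Y X \<and> r \<cdot>\<^bsub>C\<^esub> i = Zero C X Y \<and>
        Add C (i \<cdot>\<^bsub>C\<^esub> p) (j \<cdot>\<^bsub>C\<^esub> r) = Id C S)"

definition is_kernel :: "('o, 'm, 'k, 'z) lin_cat_scheme \<Rightarrow> 'o \<Rightarrow> 'o \<Rightarrow> 'm \<Rightarrow> 'o \<Rightarrow> 'm \<Rightarrow> bool" where
  "is_kernel C X Y f K i \<longleftrightarrow>
     f \<in> Hom C X Y \<and> i \<in> Hom C K X \<and> f \<cdot>\<^bsub>C\<^esub> i = Zero C K Y \<and>
     (\<forall>W. \<forall>g\<in>Hom C W X. f \<cdot>\<^bsub>C\<^esub> g = Zero C W Y \<longrightarrow> (\<exists>!u. u \<in> Hom C W K \<and> i \<cdot>\<^bsub>C\<^esub> u = g))"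

definition is_cokernel :: "('o, 'm, 'k, 'z) lin_cat_scheme \<Rightarrow> 'o \<Rightarrow> 'o \<Rightarrow> 'm \<Rightarrow> 'o \<Rightarrow> 'm \<Rightarrow> bool" where
  "is_cokernel C X Y f K p \<longleftrightarrow>
     f \<in> Hom C X Y \<and> p \<in> Hom C Y K \<and> p \<cdot>\<^bsub>C\<^esub> f = Zero C X K \<and>
     (\<forall>W. \<forall>g\<in>Hom C Y W. g \<cdot>\<^bsub>C\<^esub> f = Zero C X W \<longrightarrow> (\<exists>!u. u \<in> Hom C K W \<and> u \<cdot>\<^bsub>C\<^esub> p = g))"

locale abelian_category = linear_category C
  for C :: "('o, 'm, 'k::field, 'z) lin_cat_scheme" (structure) +
  assumes ex_zero_object: "\<exists>Z. zero_object C Z"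
    and ex_direct_sum: "\<lbrakk>X \<in> Ob C; Y \<in> Ob C\<rbrakk> \<Longrightarrow> \<exists>S. direct_sum C X Y S"
    and ex_kernel: "f \<in> Hom C X Y \<Longrightarrow> \<exists>K i. is_kernel C X Y f K i"
    and ex_cokernel: "f \<in> Hom C X Y \<Longrightarrow> \<exists>K p. is_cokernel C X Y f K p"
    and Mono_is_kernel: "f \<in> mono_mors C X Y \<Longrightarrow> \<exists>Z g. is_kernel C Y Z g X f"
    and Epi_is_cokernel: "f \<in> epi_mors C X Y \<Longrightarrow> \<exists>W g. is_cokernel C W X g Y f"

definition simple :: "('o, 'm, 'k, 'z) lin_cat_scheme \<Rightarrow> 'o \<Rightarrow> bool" where
  "simple C X \<longleftrightarrow> X \<in> Ob C \<and> \<not> zero_object C X \<and>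
     (\<forall>Y. \<forall>f\<in>mono_mors C Y X. zero_object C Y \<or> f \<in> Iso C Y X)"

inductive sum_of_simples :: "('o, 'm, 'k, 'z) lin_cat_scheme \<Rightarrow> 'o \<Rightarrow> bool" for C where
  zero: "zero_object C Z \<Longrightarrow> sum_of_simples C Z"
| add: "\<lbrakk>sum_of_simples C X; simple C Y; direct_sum C X Y S\<rbrakk> \<Longrightarrow> sum_of_simples C S"

definition lincomb ::
  "('o, 'm, 'k, 'z) lin_cat_scheme \<Rightarrow> 'o \<Rightarrow> 'o \<Rightarrow> ('k \<times> 'm) list \<Rightarrow> 'm" where
  "lincomb C X Y cs = foldr (\<lambda>(c, b) s. Add C (Smult C c b) s) cs (Zero C X Y)"

locale finite_semisimple_category = abelian_category C
  for C :: "('o, 'm, 'k::field, 'z) lin_cat_scheme" (structure) +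
  assumes Hom_finite_dim: "\<lbrakk>X \<in> Ob C; Y \<in> Ob C\<rbrakk> \<Longrightarrow>
          \<exists>bs. set bs \<subseteq> Hom C X Y \<and>
            (\<forall>f\<in>Hom C X Y. \<exists>cs. length cs = length bs \<and> f = lincomb C X Y (zip cs bs))"
    and semisimple: "X \<in> Ob C \<Longrightarrow> sum_of_simples C X"
    and finitely_many_simples:
          "\<exists>R. finite R \<and> (\<forall>X. simple C X \<longrightarrow> (\<exists>Y\<in>R. isomorphic C X Y))"

locale braided_monoidal_category = linear_category C
  for C :: "('o, 'm, 'k::field, 'z) btc_scheme" (structure) +
  assumes TenOb_in_Ob: "\<lbrakk>X \<in> Ob C; Y \<in> Ob C\<rbrakk> \<Longrightarrow> X \<boxtimes> Y \<in> Ob C"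
    and Unit_in_Ob: "Unit C \<in> Ob C"
    and TenMor_in_Hom: "\<lbrakk>f \<in> Hom C X X'; g \<in> Hom C Y Y'\<rbrakk>
          \<Longrightarrow> f \<odot> g \<in> Hom C (X \<boxtimes> Y) (X' \<boxtimes> Y')"
    and TenMor_Id: "\<lbrakk>X \<in> Ob C; Y \<in> Ob C\<rbrakk> \<Longrightarrow> Id C X \<odot> Id C Y = Id C (X \<boxtimes> Y)"
    and TenMor_Comp: "\<lbrakk>f \<in> Hom C X X'; f' \<in> Hom C X' X''; g \<in> Hom C Y Y'; g' \<in> Hom C Y' Y''\<rbrakk>
          \<Longrightarrow> (f' \<cdot> f) \<odot> (g' \<cdot> g) = (f' \<odot> g') \<cdot> (f \<odot> g)"
    and TenMor_Add_left: "\<lbrakk>f \<in> Hom C X X'; g \<in> Hom C X X'; h \<in> Hom C Y Y'\<rbrakk>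
          \<Longrightarrow> Add C f g \<odot> h = Add C (f \<odot> h) (g \<odot> h)"
    and TenMor_Add_right: "\<lbrakk>f \<in> Hom C X X'; g \<in> Hom C Y Y'; h \<in> Hom C Y Y'\<rbrakk>
          \<Longrightarrow> f \<odot> Add C g h = Add C (f \<odot> g) (f \<odot> h)"
    and TenMor_Smult_left: "\<lbrakk>f \<in> Hom C X X'; g \<in> Hom C Y Y'\<rbrakk>
          \<Longrightarrow> Smult C c f \<odot> g = Smult C c (f \<odot> g)"
    and TenMor_Smult_right: "\<lbrakk>f \<in> Hom C X X'; g \<in> Hom C Y Y'\<rbrakk>
          \<Longrightarrow> f \<odot> Smult C c g = Smult C c (f \<odot> g)"
    and Assoc_Iso: "\<lbrakk>X \<in> Ob C; Y \<in> Ob C; Z \<in> Ob C\<rbrakk>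
          \<Longrightarrow> Assoc C X Y Z \<in> Iso C ((X \<boxtimes> Y) \<boxtimes> Z) (X \<boxtimes> Y \<boxtimes> Z)"
    and Assoc_natural: "\<lbrakk>f \<in> Hom C X X'; g \<in> Hom C Y Y'; h \<in> Hom C Z Z'\<rbrakk>
          \<Longrightarrow> Assoc C X' Y' Z' \<cdot> ((f \<odot> g) \<odot> h) = (f \<odot> g \<odot> h) \<cdot> Assoc C X Y Z"
    and LUnit_Iso: "X \<in> Ob C \<Longrightarrow> LUnit C X \<in> Iso C (Unit C \<boxtimes> X) X"
    and LUnit_natural: "f \<in> Hom C X Y \<Longrightarrow> LUnit C Y \<cdot> (Id C (Unit C) \<odot> f) = f \<cdot> LUnit C X"
    and RUnit_Iso: "X \<in> Ob C \<Longrightarrow> RUnit C X \<in> Iso C (X \<boxtimes> Unit C) X"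
    and RUnit_natural: "f \<in> Hom C X Y \<Longrightarrow> RUnit C Y \<cdot> (f \<odot> Id C (Unit C)) = f \<cdot> RUnit C X"
    and pentagon: "\<lbrakk>W \<in> Ob C; X \<in> Ob C; Y \<in> Ob C; Z \<in> Ob C\<rbrakk>
          \<Longrightarrow> Assoc C W X (Y \<boxtimes> Z) \<cdot> Assoc C (W \<boxtimes> X) Y Z
            = (Id C W \<odot> Assoc C X Y Z) \<cdot> Assoc C W (X \<boxtimes> Y) Z \<cdot> (Assoc C W X Y \<odot> Id C Z)"
    and triangle: "\<lbrakk>X \<in> Ob C; Y \<in> Ob C\<rbrakk>
          \<Longrightarrow> (Id C X \<odot> LUnit C Y) \<cdot> Assoc C X (Unit C) Y = RUnit C X \<odot> Id C Y"
    and Braid_Iso: "\<lbrakk>X \<in> Ob C; Y \<in> Ob C\<rbrakk> \<Longrightarrow> Braid C X Y \<in> Iso C (X \<boxtimes> Y) (Y \<boxtimes> X)"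
    and Braid_natural: "\<lbrakk>f \<in> Hom C X X'; g \<in> Hom C Y Y'\<rbrakk>
          \<Longrightarrow> Braid C X' Y' \<cdot> (f \<odot> g) = (g \<odot> f) \<cdot> Braid C X Y"
    and hexagon1: "\<lbrakk>X \<in> Ob C; Y \<in> Ob C; Z \<in> Ob C\<rbrakk>
          \<Longrightarrow> Assoc C Y Z X \<cdot> Braid C X (Y \<boxtimes> Z) \<cdot> Assoc C X Y Z
            = (Id C Y \<odot> Braid C X Z) \<cdot> Assoc C Y X Z \<cdot> (Braid C X Y \<odot> Id C Z)"
    and hexagon2: "\<lbrakk>X \<in> Ob C; Y \<in> Ob C; Z \<in> Ob C\<rbrakk>
          \<Longrightarrow> Braid C (X \<boxtimes> Y) Z
            = Assoc C Z X Y \<cdot> (Braid C X Z \<odot> Id C Y) \<cdot> Inv C ((X \<boxtimes> Z) \<boxtimes> Y) (X \<boxtimes> Z \<boxtimes> Y) (Assoc C X Z Y)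
              \<cdot> (Id C X \<odot> Braid C Y Z) \<cdot> Assoc C X Y Z"

text \<open>\<open>is_dual C D X\<close>: \<open>D\<close> is a left dual of \<open>X\<close>, with evaluation \<open>D \<boxtimes> X \<rightarrow> Unit\<close> and
  coevaluation \<open>Unit \<rightarrow> X \<boxtimes> D\<close>; equivalently \<open>X\<close> is a right dual of \<open>D\<close>.\<close>

definition is_dual :: "('o, 'm, 'k, 'z) btc_scheme \<Rightarrow> 'o \<Rightarrow> 'o \<Rightarrow> bool" where
  "is_dual C D X \<longleftrightarrow>
     D \<in> Ob C \<and> X \<in> Ob C \<and>
     (\<exists>e\<in>Hom C (D \<boxtimes>\<^bsub>C\<^esub> X) (Unit C). \<exists>d\<in>Hom C (Unit C) (X \<boxtimes>\<^bsub>C\<^esub> D).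
        RUnit C X \<cdot>\<^bsub>C\<^esub> (Id C X \<odot>\<^bsub>C\<^esub> e) \<cdot>\<^bsub>C\<^esub> Assoc C X D X \<cdot>\<^bsub>C\<^esub> (d \<odot>\<^bsub>C\<^esub> Id C X) = LUnit C X \<and>
        LUnit C D \<cdot>\<^bsub>C\<^esub> (e \<odot>\<^bsub>C\<^esub> Id C D)
          \<cdot>\<^bsub>C\<^esub> Inv C ((D \<boxtimes>\<^bsub>C\<^esub> X) \<boxtimes>\<^bsub>C\<^esub> D) (D \<boxtimes>\<^bsub>C\<^esub> X \<boxtimes>\<^bsub>C\<^esub> D) (Assoc C D X D)
          \<cdot>\<^bsub>C\<^esub> (Id C D \<odot>\<^bsub>C\<^esub> d) = RUnit C D)"

definition invertible_object :: "('o, 'm, 'k, 'z) btc_scheme \<Rightarrow> 'o \<Rightarrow> bool" where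
  "invertible_object C X \<longleftrightarrow>
     X \<in> Ob C \<and>
     (\<exists>Y\<in>Ob C. isomorphic C (X \<boxtimes>\<^bsub>C\<^esub> Y) (Unit C) \<and> isomorphic C (Y \<boxtimes>\<^bsub>C\<^esub> X) (Unit C))"

locale braided_fusion_category =
  finite_semisimple_category C + braided_monoidal_category C
  for C :: "('o, 'm, 'k::field, 'z) btc_scheme" (structure) +
  assumes rigid: "X \<in> Ob C \<Longrightarrow> (\<exists>D. is_dual C D X) \<and> (\<exists>D. is_dual C X D)"
    and simple_Unit: "simple C (Unit C)"

locale pointed_braided_fusion_category = braided_fusion_category C
  for C :: "('o, 'm, 'k::field, 'z) btc_scheme" (structure) +
  assumes pointed: "simple C X \<Longrightarrow> invertible_object C X"

text \<open>\<open>C\<close> is the pointed braided fusion category of \<open>(A, q)\<close>, where \<open>A\<close> is the additive group of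
  the type \<open>'a\<close>: the map \<open>S\<close> picks a representative of each isomorphism class of simple objects
  and identifies the group of these classes with \<open>A\<close>.\<close>

locale pointed_category_of = pointed_braided_fusion_category C
  for C :: "('o, 'm, 'k::field, 'z) btc_scheme" (structure)
    and S :: "'a::ab_group_add \<Rightarrow> 'o"
    and q :: "'a \<Rightarrow> 'k" +
  assumes simple_S: "simple C (S a)"
    and S_inj: "isomorphic C (S a) (S b) \<Longrightarrow> a = b"
    and S_surj: "simple C X \<Longrightarrow> \<exists>a. isomorphic C X (S a)"
    and S_add: "isomorphic C (S a \<boxtimes> S b) (S (a + b))"
    and Braid_S: "Braid C (S a) (S a) = Smult C (q a) (Id C (S a \<boxtimes> S a))"

section \<open>Monoidal functors\<close>

text \<open>\<open>FMor X Y\<close> is the action on \<open>Hom X Y\<close>, and \<open>FTen X Y\<close> is the tensor structure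
  \<open>F X \<boxtimes> F Y \<rightarrow> F (X \<boxtimes> Y)\<close>. Preservation of the unit is only required up to an unspecified
  isomorphism, and monoidal isomorphisms need not mention it: the unit isomorphism compatible
  with the tensor structure exists uniquely and is respected automatically.\<close>

record ('o1, 'm1, 'o2, 'm2) monfun =
  FOb :: "'o1 \<Rightarrow> 'o2"
  FMor :: "'o1 \<Rightarrow> 'o1 \<Rightarrow> 'm1 \<Rightarrow> 'm2"
  FTen :: "'o1 \<Rightarrow> 'o1 \<Rightarrow> 'm2"

definition linear_functor ::
  "('o1, 'm1, 'k, 'z1) lin_cat_scheme \<Rightarrow> ('o2, 'm2, 'k, 'z2) lin_cat_scheme \<Rightarrow>
     ('o1, 'm1, 'o2, 'm2) monfun \<Rightarrow> bool" where
  "linear_functor C D F \<longleftrightarrow>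
     (\<forall>X\<in>Ob C. FOb F X \<in> Ob D) \<and>
     (\<forall>X Y. \<forall>f\<in>Hom C X Y. FMor F X Y f \<in> Hom D (FOb F X) (FOb F Y)) \<and>
     (\<forall>X\<in>Ob C. FMor F X X (Id C X) = Id D (FOb F X)) \<and>
     (\<forall>X Y Z. \<forall>f\<in>Hom C X Y. \<forall>g\<in>Hom C Y Z.
        FMor F X Z (g \<cdot>\<^bsub>C\<^esub> f) = FMor F Y Z g \<cdot>\<^bsub>D\<^esub> FMor F X Y f) \<and>
     (\<forall>X Y. \<forall>f\<in>Hom C X Y. \<forall>g\<in>Hom C X Y.
        FMor F X Y (Add C f g) = Add D (FMor F X Y f) (FMor F X Y g)) \<and>
     (\<forall>X Y c. \<forall>f\<in>Hom C X Y. FMor F X Y (Smult C c f) = Smult D c (FMor F X Y f))"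

definition tensor_functor ::
  "('o1, 'm1, 'k, 'z1) btc_scheme \<Rightarrow> ('o2, 'm2, 'k, 'z2) btc_scheme \<Rightarrow>
     ('o1, 'm1, 'o2, 'm2) monfun \<Rightarrow> bool" where
  "tensor_functor C D F \<longleftrightarrow>
     linear_functor C D F \<and>
     isomorphic D (FOb F (Unit C)) (Unit D) \<and>
     (\<forall>X\<in>Ob C. \<forall>Y\<in>Ob C.
        FTen F X Y \<in> Iso D (FOb F X \<boxtimes>\<^bsub>D\<^esub> FOb F Y) (FOb F (X \<boxtimes>\<^bsub>C\<^esub> Y))) \<and>
     (\<forall>X X' Y Y'. \<forall>f\<in>Hom C X X'. \<forall>g\<in>Hom C Y Y'.
        FTen F X' Y' \<cdot>\<^bsub>D\<^esub> (FMor F X X' f \<odot>\<^bsub>D\<^esub> FMor F Y Y' g)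
          = FMor F (X \<boxtimes>\<^bsub>C\<^esub> Y) (X' \<boxtimes>\<^bsub>C\<^esub> Y') (f \<odot>\<^bsub>C\<^esub> g) \<cdot>\<^bsub>D\<^esub> FTen F X Y) \<and>
     (\<forall>X\<in>Ob C. \<forall>Y\<in>Ob C. \<forall>Z\<in>Ob C.
        FMor F ((X \<boxtimes>\<^bsub>C\<^esub> Y) \<boxtimes>\<^bsub>C\<^esub> Z) (X \<boxtimes>\<^bsub>C\<^esub> Y \<boxtimes>\<^bsub>C\<^esub> Z) (Assoc C X Y Z)
            \<cdot>\<^bsub>D\<^esub> FTen F (X \<boxtimes>\<^bsub>C\<^esub> Y) Z \<cdot>\<^bsub>D\<^esub> (FTen F X Y \<odot>\<^bsub>D\<^esub> Id D (FOb F Z))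
          = FTen F X (Y \<boxtimes>\<^bsub>C\<^esub> Z) \<cdot>\<^bsub>D\<^esub> (Id D (FOb F X) \<odot>\<^bsub>D\<^esub> FTen F Y Z)
            \<cdot>\<^bsub>D\<^esub> Assoc D (FOb F X) (FOb F Y) (FOb F Z))"

definition braided_functor ::
  "('o1, 'm1, 'k, 'z1) btc_scheme \<Rightarrow> ('o2, 'm2, 'k, 'z2) btc_scheme \<Rightarrow>
     ('o1, 'm1, 'o2, 'm2) monfun \<Rightarrow> bool" where
  "braided_functor C D F \<longleftrightarrow>
     tensor_functor C D F \<and>
     (\<forall>X\<in>Ob C. \<forall>Y\<in>Ob C.
        FMor F (X \<boxtimes>\<^bsub>C\<^esub> Y) (Y \<boxtimes>\<^bsub>C\<^esub> X) (Braid C X Y) \<cdot>\<^bsub>D\<^esub> FTen F X Y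
          = FTen F Y X \<cdot>\<^bsub>D\<^esub> Braid D (FOb F X) (FOb F Y))"

definition equivalence_functor ::
  "('o1, 'm1, 'z1) cat_scheme \<Rightarrow> ('o2, 'm2, 'z2) cat_scheme \<Rightarrow>
     ('o1, 'm1, 'o2, 'm2) monfun \<Rightarrow> bool" where
  "equivalence_functor C D F \<longleftrightarrow>
     (\<forall>X\<in>Ob C. \<forall>Y\<in>Ob C. bij_betw (FMor F X Y) (Hom C X Y) (Hom D (FOb F X) (FOb F Y))) \<and>
     (\<forall>Y\<in>Ob D. \<exists>X\<in>Ob C. isomorphic D (FOb F X) Y)"

definition tensor_iso ::
  "('o1, 'm1, 'k, 'z1) btc_scheme \<Rightarrow> ('o2, 'm2, 'k, 'z2) btc_scheme \<Rightarrow>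
     ('o1, 'm1, 'o2, 'm2) monfun \<Rightarrow> ('o1, 'm1, 'o2, 'm2) monfun \<Rightarrow> bool" where
  "tensor_iso C D F G \<longleftrightarrow>
     (\<exists>\<eta>. (\<forall>X\<in>Ob C. \<eta> X \<in> Iso D (FOb F X) (FOb G X)) \<and>
          (\<forall>X Y. \<forall>f\<in>Hom C X Y. \<eta> Y \<cdot>\<^bsub>D\<^esub> FMor F X Y f = FMor G X Y f \<cdot>\<^bsub>D\<^esub> \<eta> X) \<and>
          (\<forall>X\<in>Ob C. \<forall>Y\<in>Ob C.
             \<eta> (X \<boxtimes>\<^bsub>C\<^esub> Y) \<cdot>\<^bsub>D\<^esub> FTen F X Y = FTen G X Y \<cdot>\<^bsub>D\<^esub> (\<eta> X \<odot>\<^bsub>D\<^esub> \<eta> Y)))"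

definition id_monfun :: "('o, 'm, 'k, 'z) btc_scheme \<Rightarrow> ('o, 'm, 'o, 'm) monfun" where
  "id_monfun C = \<lparr> FOb = (\<lambda>X. X), FMor = (\<lambda>_ _ f. f), FTen = (\<lambda>X Y. Id C (X \<boxtimes>\<^bsub>C\<^esub> Y)) \<rparr>"

text \<open>\<open>comp_monfun C D E G F\<close> is the composite of \<open>F : C \<rightarrow> D\<close> followed by
  \<open>G : D \<rightarrow> E\<close>.\<close>

definition comp_monfun ::
  "('o1, 'm1, 'k, 'z1) btc_scheme \<Rightarrow> ('o2, 'm2, 'k, 'z2) btc_scheme \<Rightarrow>
     ('o3, 'm3, 'k, 'z3) btc_scheme \<Rightarrow> ('o2, 'm2, 'o3, 'm3) monfun \<Rightarrow>
     ('o1, 'm1, 'o2, 'm2) monfun \<Rightarrow> ('o1, 'm1, 'o3, 'm3) monfun" where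
  "comp_monfun C D E G F = \<lparr>
     FOb = (\<lambda>X. FOb G (FOb F X)),
     FMor = (\<lambda>X Y f. FMor G (FOb F X) (FOb F Y) (FMor F X Y f)),
     FTen = (\<lambda>X Y. FMor G (FOb F X \<boxtimes>\<^bsub>D\<^esub> FOb F Y) (FOb F (X \<boxtimes>\<^bsub>C\<^esub> Y)) (FTen F X Y)
                     \<cdot>\<^bsub>E\<^esub> FTen G (FOb F X) (FOb F Y)) \<rparr>"

definition braided_autoequivs :: "('o, 'm, 'k, 'z) btc_scheme \<Rightarrow> ('o, 'm, 'o, 'm) monfun set" where
  "braided_autoequivs C = {F. braided_functor C C F \<and> equivalence_functor C C F}"

definition autoequiv_class ::
  "('o, 'm, 'k, 'z) btc_scheme \<Rightarrow> ('o, 'm, 'o, 'm) monfun \<Rightarrow> ('o, 'm, 'o, 'm) monfun set" where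
  "autoequiv_class C F = {G \<in> braided_autoequivs C. tensor_iso C C F G}"

definition Aut_br :: "('o, 'm, 'k, 'z) btc_scheme \<Rightarrow> ('o, 'm, 'o, 'm) monfun set monoid" where
  "Aut_br C = \<lparr>
     carrier = autoequiv_class C ` braided_autoequivs C,
     monoid.mult = (\<lambda>K L. {H \<in> braided_autoequivs C.
        \<exists>F\<in>K. \<exists>G\<in>L. tensor_iso C C (comp_monfun C C C F G) H}),
     one = autoequiv_class C (id_monfun C) \<rparr>"

section \<open>The Drinfeld center\<close>

text \<open>A half braiding on \<open>X\<close> is a natural family of isomorphisms \<open>Y \<boxtimes> X \<rightarrow> X \<boxtimes> Y\<close>, so that
  \<open>Braid C _ X\<close> is one.\<close>

definition half_braiding :: "('o, 'm, 'k, 'z) btc_scheme \<Rightarrow> 'o \<Rightarrow> ('o \<Rightarrow> 'm) \<Rightarrow> bool" where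
  "half_braiding C X \<gamma> \<longleftrightarrow>
     X \<in> Ob C \<and> \<gamma> \<in> extensional (Ob C) \<and>
     (\<forall>Y\<in>Ob C. \<gamma> Y \<in> Iso C (Y \<boxtimes>\<^bsub>C\<^esub> X) (X \<boxtimes>\<^bsub>C\<^esub> Y)) \<and>
     (\<forall>Y Z. \<forall>f\<in>Hom C Y Z. \<gamma> Z \<cdot>\<^bsub>C\<^esub> (f \<odot>\<^bsub>C\<^esub> Id C X) = (Id C X \<odot>\<^bsub>C\<^esub> f) \<cdot>\<^bsub>C\<^esub> \<gamma> Y) \<and>
     (\<forall>Y\<in>Ob C. \<forall>Z\<in>Ob C.
        \<gamma> (Y \<boxtimes>\<^bsub>C\<^esub> Z) =
          Assoc C X Y Z \<cdot>\<^bsub>C\<^esub> (\<gamma> Y \<odot>\<^bsub>C\<^esub> Id C Z)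
          \<cdot>\<^bsub>C\<^esub> Inv C ((Y \<boxtimes>\<^bsub>C\<^esub> X) \<boxtimes>\<^bsub>C\<^esub> Z) (Y \<boxtimes>\<^bsub>C\<^esub> X \<boxtimes>\<^bsub>C\<^esub> Z) (Assoc C Y X Z)
          \<cdot>\<^bsub>C\<^esub> (Id C Y \<odot>\<^bsub>C\<^esub> \<gamma> Z) \<cdot>\<^bsub>C\<^esub> Assoc C Y Z X)"

definition half_braiding_tensor ::
  "('o, 'm, 'k, 'z) btc_scheme \<Rightarrow> 'o \<Rightarrow> ('o \<Rightarrow> 'm) \<Rightarrow> 'o \<Rightarrow> ('o \<Rightarrow> 'm) \<Rightarrow> 'o \<Rightarrow> 'm" where
  "half_braiding_tensor C X \<gamma> Y \<delta> = (\<lambda>Z\<in>Ob C.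
     Inv C ((X \<boxtimes>\<^bsub>C\<^esub> Y) \<boxtimes>\<^bsub>C\<^esub> Z) (X \<boxtimes>\<^bsub>C\<^esub> Y \<boxtimes>\<^bsub>C\<^esub> Z) (Assoc C X Y Z)
     \<cdot>\<^bsub>C\<^esub> (Id C X \<odot>\<^bsub>C\<^esub> \<delta> Z) \<cdot>\<^bsub>C\<^esub> Assoc C X Z Y \<cdot>\<^bsub>C\<^esub> (\<gamma> Z \<odot>\<^bsub>C\<^esub> Id C Y)
     \<cdot>\<^bsub>C\<^esub> Inv C ((Z \<boxtimes>\<^bsub>C\<^esub> X) \<boxtimes>\<^bsub>C\<^esub> Y) (Z \<boxtimes>\<^bsub>C\<^esub> X \<boxtimes>\<^bsub>C\<^esub> Y) (Assoc C Z X Y))"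

definition center :: "('o, 'm, 'k) btc \<Rightarrow> ('o \<times> ('o \<Rightarrow> 'm), 'm, 'k) btc" where
  "center C = \<lparr>
     Ob = {(X, \<gamma>). half_braiding C X \<gamma>},
     Hom = (\<lambda>(X, \<gamma>) (Y, \<delta>). {f \<in> Hom C X Y. half_braiding C X \<gamma> \<and> half_braiding C Y \<delta> \<and>
        (\<forall>Z\<in>Ob C. (f \<odot>\<^bsub>C\<^esub> Id C Z) \<cdot>\<^bsub>C\<^esub> \<gamma> Z = \<delta> Z \<cdot>\<^bsub>C\<^esub> (Id C Z \<odot>\<^bsub>C\<^esub> f))}),
     Id = (\<lambda>(X, \<gamma>). Id C X),
     Comp = Comp C,
     Zero = (\<lambda>(X, \<gamma>) (Y, \<delta>). Zero C X Y),
     Add = Add C,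
     Smult = Smult C,
     TenOb = (\<lambda>(X, \<gamma>) (Y, \<delta>). (X \<boxtimes>\<^bsub>C\<^esub> Y, half_braiding_tensor C X \<gamma> Y \<delta>)),
     TenMor = TenMor C,
     Unit = (Unit C, \<lambda>Z\<in>Ob C. Inv C (Unit C \<boxtimes>\<^bsub>C\<^esub> Z) Z (LUnit C Z) \<cdot>\<^bsub>C\<^esub> RUnit C Z),
     Assoc = (\<lambda>(X, _) (Y, _) (Z, _). Assoc C X Y Z),
     LUnit = (\<lambda>(X, _). LUnit C X),
     RUnit = (\<lambda>(X, _). RUnit C X),
     Braid = (\<lambda>(X, _) (Y, \<delta>). \<delta> X) \<rparr>"

definition center_embedding ::
  "('o, 'm, 'k) btc \<Rightarrow> ('o, 'm, 'o \<times> ('o \<Rightarrow> 'm), 'm) monfun" where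
  "center_embedding C = \<lparr>
     FOb = (\<lambda>X. (X, \<lambda>Z\<in>Ob C. Braid C Z X)),
     FMor = (\<lambda>_ _ f. f),
     FTen = (\<lambda>X Y. Id C (X \<boxtimes>\<^bsub>C\<^esub> Y)) \<rparr>"

definition Aut_br_center_rel ::
  "('o, 'm, 'k) btc \<Rightarrow> ('o \<times> ('o \<Rightarrow> 'm), 'm, 'o \<times> ('o \<Rightarrow> 'm), 'm) monfun set monoid" where
  "Aut_br_center_rel C = (Aut_br (center C)) \<lparr>
     carrier := autoequiv_class (center C) `
       {F \<in> braided_autoequivs (center C).
          tensor_iso C (center C)
            (comp_monfun C (center C) (center C) F (center_embedding C)) (center_embedding C)} \<rparr>"

text \<open>The identification of simple objects of the center with pairs \<open>(a, \<phi>)\<close>: the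
  underlying object is \<open>S a\<close>, and the half braiding with \<open>S b\<close> is the braiding scaled by
  \<open>\<phi>(b)\<close>. The self-braiding of this object is \<open>\<phi>(a) q(a)\<close>, and \<open>S a\<close> embedded in the center
  is labelled \<open>(a, 0)\<close>.\<close>

definition center_label ::
  "('o, 'm, 'k::field) btc \<Rightarrow> ('a::ab_group_add \<Rightarrow> 'o) \<Rightarrow>
     'o \<times> ('o \<Rightarrow> 'm) \<Rightarrow> 'a \<times> ('a, 'k) dual \<Rightarrow> bool" where
  "center_label C S z l \<longleftrightarrow>
     z \<in> Ob (center C) \<and> isomorphic C (fst z) (S (fst l)) \<and>
     (\<forall>b. snd z (S b) = Smult C (ev (snd l) b) (Braid C (S b) (fst z)))"

text \<open>The element of \<open>Aut_br (center C)\<close> corresponding to an automorphism \<open>\<beta>\<close> of the group of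
  labels: all braided autoequivalences that act by \<open>\<beta>\<close> on the isomorphism classes of simple
  objects.\<close>

definition autoequivs_inducing ::
  "('o, 'm, 'k::field) btc \<Rightarrow> ('a::ab_group_add \<Rightarrow> 'o) \<Rightarrow>
     ('a \<times> ('a, 'k) dual \<Rightarrow> 'a \<times> ('a, 'k) dual) \<Rightarrow>
     ('o \<times> ('o \<Rightarrow> 'm), 'm, 'o \<times> ('o \<Rightarrow> 'm), 'm) monfun set" where
  "autoequivs_inducing C S \<beta> = {F \<in> braided_autoequivs (center C).
     \<forall>z l. center_label C S z l \<longrightarrow> center_label C S (FOb F z) (\<beta> l)}"

end

theory Submission
  imports Defs "HOL-Algebra.Ring"
begin

text \<open>Associator and braiding on a group of objects with scalar endomorphisms form an abelian 3-cocycle, and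
 such a cocycle is, up to coboundary, determined by the self-braidings: filter the finite group by subgroups
 with cyclic quotients and use that the units of the field are divisible. Hence in a semisimple category
 generated by such a group a braided autoequivalence is determined up to isomorphism by its action on the
 labels, and every automorphism that preserves the self-braidings occurs.

 The center is again of this kind, with labels in \<open>A\<close> times its dual. A half braiding on \<open>X\<close> compares with
 the braiding through an action of \<open>A\<close> on \<open>X\<close>, and the projections onto the characters of \<open>A\<close> split \<open>X\<close> into
 pieces on which the half braiding is the braiding twisted by a character. Finally, an automorphism of the
 labels that preserves \<open>Q(a, \<phi>) = \<phi>(a) q(a)\<close> and fixes all \<open>(a, 0)\<close> has the form \<open>alpha q f\<close>: its value at
 \<open>(0, \<phi>)\<close> provides \<open>f\<close>, and preservation of \<open>Q\<close> forces the second component.\<close>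

section \<open>Finite abelian groups\<close>

text \<open>Both the given category and its center are handled through one interface,
  \<open>pointed_family\<close>: a group of objects with scalar endomorphisms such that the identity
  of every object is a finite sum of morphisms through them. Morphisms are compared, and also
  constructed, on the arrows from these objects, so no decomposition into simple objects has to be
  chosen functorially. This suits the center, whose half braidings are verified on such arrows too.
  The obstacle to removing associators is that a cyclic group has nontrivial 3-cocycles with values
  in the units. The braiding overcomes it: in each cyclic step the last associator value equals the
  braiding of the generator with a multiple lying in the smaller subgroup, and this has been made
  trivial already. Division serves for the symmetric 2-cocycle by which two tensor structures
  differ, and for extending characters. Algebraic closedness also provides eigenvalues, hence scalar
  endomorphisms of simple objects. Characteristic 0 provides nontrivial \<open>n\<close>-th roots of
  unity for \<open>n > 1\<close> and makes the group order invertible in the character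
  projections.\<close>

definition subgrp :: "'a::ab_group_add set => bool" where
 "subgrp H \<longleftrightarrow> 0 \<in> H \<and> (\<forall>x\<in>H. \<forall>y\<in>H. x - y \<in> H)"

lemma subgrp_zero: "subgrp H ==> 0 \<in> H"
 by (simp add: subgrp_def)

lemma subgrp_diff: "subgrp H ==> x \<in> H ==> y \<in> H ==> x - y \<in> H"
 by (simp add: subgrp_def)

lemma subgrp_uminus: "subgrp H ==> x \<in> H ==> - x \<in> H"
 using subgrp_diff[of H 0 x] by (simp add: subgrp_zero)

lemma subgrp_add: "subgrp H ==> x \<in> H ==> y \<in> H ==> x + y \<in> H"
 using subgrp_diff[of H x "- y"] by (simp add: subgrp_uminus)

lemma subgrp_add_iff: "subgrp H ==> h \<in> H ==> h + x \<in> H \<longleftrightarrow> x \<in> H"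
 using subgrp_add subgrp_diff by (metis add_diff_cancel_left')

text \<open>On \<open>munit\<close>, the units of the field written additively, this is the power
  map.\<close>

primrec nscale :: "nat => 'a::ab_group_add => 'a" where
 "nscale 0 g = 0"
| "nscale (Suc i) g = nscale i g + g"

lemma nscale_add: "nscale (i + j) g = nscale i g + nscale j g"
 by (induction j) (simp_all add: ac_simps)

lemma nscale_zero [simp]: "nscale i 0 = 0"
 by (induction i) simp_all

lemma nscale_mult: "nscale (i * j) g = nscale i (nscale j g)"
 by (induction i) (simp_all add: nscale_add ac_simps)

lemma nscale_sum: "(\<Sum>j<n. f j + r) = (\<Sum>j<n. f j) + nscale n r"
 by (induction n) (simp_all add: ac_simps)

lemma ex_nscale_eq_0:
 fixes g :: "'a::ab_group_add"
 assumes "finite (UNIV :: 'a set)"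
 obtains n where "n > 0" "nscale n g = 0"
proof -
 have "\<not> inj (\<lambda>i. nscale i g)"
  using assms finite_UNIV_inj_surj infinite_UNIV_nat
  by (metis finite_imageD finite_subset top_greatest)
 then obtain i j where ij: "i < j" "nscale i g = nscale j g"
  by (metis injI linorder_neqE_nat)
 then have "nscale (i + (j - i)) g = nscale i g" by simp
 then have "nscale (j - i) g = 0" unfolding nscale_add by simp
 with ij that[of "j - i"] show thesis by simp
qed

text \<open>Nonnegative multiples suffice, because every element of a finite group has finite
  order.\<close>

definition adjoin :: "'a::ab_group_add set => 'a => 'a set" where
 "adjoin H g = {h + nscale i g | h i. h \<in> H}"

definition divisible :: "'a::ab_group_add itself => bool" where
 "divisible _ \<longleftrightarrow> (\<forall>n>0. \<forall>y::'a. \<exists>x. nscale n x = y)"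

locale cyclic_ext =
 fixes H :: "'a::ab_group_add set" and g :: 'a
 assumes fin: "finite (UNIV :: 'a set)" and sub: "subgrp H" and g_notin: "g \<notin> H"
begin

abbreviation "e i \<equiv> nscale i g"

text \<open>\<open>N\<close> is the order of \<open>g\<close> modulo \<open>H\<close>. On
  \<open>adjoin H g\<close>, \<open>idx\<close> is the exponent of the coset of \<open>x\<close> in
  the cyclic quotient, normalized to lie below \<open>N\<close>.\<close>

definition N :: nat where "N = (LEAST n. n > 0 \<and> e n \<in> H)"
definition idx :: "'a => nat" where "idx x = (LEAST i. x - e i \<in> H)"

lemma N: "N > 0" "e N \<in> H"
proof -
 obtain n where "n > 0 \<and> e n \<in> H"
  using ex_nscale_eq_0[OF fin, of g] subgrp_zero[OF sub] by metis
 then have "N > 0 \<and> e N \<in> H" unfolding N_def by (rule LeastI)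
 then show "N > 0" "e N \<in> H" by auto
qed

lemma N_least: "0 < n ==> n < N ==> e n \<notin> H"
 unfolding N_def using not_less_Least by blast

lemma N_gt_1: "N > 1"
proof -
 have "N ~= 1" using N(2) g_notin by auto
 with N(1) show ?thesis by simp
qed

lemma H_subset: "H \<subseteq> adjoin H g"
proof
 fix h assume "h \<in> H"
 then have "\<exists>h' i. h = h' + e i \<and> h' \<in> H" by (intro exI[of _ h] exI[of _ 0]) simp
 then show "h \<in> adjoin H g" by (simp add: adjoin_def)
qed

lemma g_adjoin: "g \<in> adjoin H g"
proof -
 have "\<exists>h' i. g = h' + e i \<and> h' \<in> H"
  using subgrp_zero[OF sub] by (intro exI[of _ 0] exI[of _ 1]) simp
 then show ?thesis by (simp add: adjoin_def)
qed

lemma adjoin_subgrp: "subgrp (adjoin H g)"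
proof -
 obtain n where n: "n > 0" "e n = 0" using ex_nscale_eq_0[OF fin] .
 \<comment> \<open>A negative multiple of \<open>g\<close> is also a nonnegative one, since
   \<open>n\<close> annihilates \<open>g\<close>.\<close>
 have neg: "- e i = e (i * (n - 1))" for i
 proof -
  have "e (i * (n - 1)) + e i = e (i * n)"
   using n(1) by (metis Suc_pred' add.commute mult_Suc_right nscale_add)
  also have "\<dots> = 0" by (simp add: nscale_mult n)
  finally show ?thesis by (metis minus_unique add.commute)
 qed
 show ?thesis
  unfolding subgrp_def
 proof (intro conjI ballI)
  show "0 \<in> adjoin H g" using H_subset subgrp_zero[OF sub] by auto
 next
  fix x y assume "x \<in> adjoin H g" "y \<in> adjoin H g"
  then obtain h i h' j where "h \<in> H" "h' \<in> H" "x = h + e i" "y = h' + e j"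
   unfolding adjoin_def by auto
  then have "x - y = (h - h') + e (i + j * (n - 1))" "h - h' \<in> H"
   by (simp_all only: nscale_add neg[symmetric] subgrp_diff[OF sub]) simp
  then show "x - y \<in> adjoin H g" unfolding adjoin_def by blast
 qed
qed

lemma adjoin_add: "x \<in> adjoin H g ==> y \<in> adjoin H g ==> x + y \<in> adjoin H g"
 by (rule subgrp_add[OF adjoin_subgrp])

lemma e_adjoin: "e i \<in> adjoin H g"
 by (induction i) (auto intro: adjoin_add g_adjoin subgrp_zero[OF adjoin_subgrp])

lemma idx_mem: assumes "x \<in> adjoin H g" shows "x - e (idx x) \<in> H"
proof -
 from assms obtain h i where "h \<in> H" "x = h + e i" unfolding adjoin_def by auto
 then have "x - e i \<in> H" by simp
 then show ?thesis unfolding idx_def by (rule LeastI)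
qed

text \<open>Lowering the exponent by \<open>N\<close> changes the remainder only by the element
  \<open>e N\<close> of \<open>H\<close>, so a minimal exponent is below \<open>N\<close>.\<close>

lemma idx_less: assumes "x \<in> adjoin H g" shows "idx x < N"
proof (rule ccontr)
 assume "\<not> idx x < N"
 then have *: "idx x = (idx x - N) + N" by simp
 have "x - e (idx x - N) = (x - e (idx x)) + e N"
  by (subst (2) *) (simp add: nscale_add)
 then have "x - e (idx x - N) \<in> H"
  using subgrp_add[OF sub idx_mem[OF assms] N(2)] by metis
 then have "idx x \<le> idx x - N" unfolding idx_def by (rule Least_le)
 with * N(1) show False by simp
qed

lemma idx_eqI: assumes "i < N" "x - e i \<in> H" shows "idx x = i"
proof -
 have "x \<in> adjoin H g" using assms unfolding adjoin_def
  by (metis (mono_tags, lifting) diff_add_cancel mem_Collect_eq)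
 note m = idx_mem[OF this]
 have "idx x \<le> i" unfolding idx_def using assms(2) by (rule Least_le)
 have "e (i - idx x) = (x - e (idx x)) - (x - e i)"
 proof -
  have "e i = e (i - idx x) + e (idx x)" using \<open>idx x \<le> i\<close> by (metis le_add_diff_inverse2 nscale_add)
  then show ?thesis by simp
 qed
 then have "e (i - idx x) \<in> H" using subgrp_diff[OF sub m assms(2)] by simp
 then have "\<not> 0 < i - idx x" using N_least[of "i - idx x"] assms(1) by force
 with \<open>idx x \<le> i\<close> show ?thesis by simp
qed

lemma idx_H: "h \<in> H ==> idx h = 0"
 using N(1) by (intro idx_eqI) auto

lemma idx_g: "idx g = 1"
 using N_gt_1 subgrp_zero[OF sub] by (intro idx_eqI) auto

lemma idx_add_H: assumes "x \<in> adjoin H g" "h \<in> H" shows "idx (h + x) = idx x" "idx (x + h) = idx x"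
proof -
 have "h + x - e (idx x) \<in> H" using subgrp_add[OF sub assms(2) idx_mem[OF assms(1)]]
  by (simp add: algebra_simps)
 then show "idx (h + x) = idx x" by (intro idx_eqI idx_less assms(1))
 then show "idx (x + h) = idx x" by (simp add: add.commute)
qed

text \<open>The carry at \<open>N\<close> is where the cyclic quotient differs from the natural
  numbers; every recursion along \<open>idx\<close> has to be checked there.\<close>

lemma idx_add_g: assumes "x \<in> adjoin H g"
 shows "idx (x + g) = (if Suc (idx x) < N then Suc (idx x) else 0)"
proof (cases "Suc (idx x) < N")
 case True
 then show ?thesis using idx_mem[OF assms]
  by (simp) (rule idx_eqI, auto simp: algebra_simps)
next
 case False
 then have "N = Suc (idx x)" using idx_less[OF assms] by simp
 then have "x + g = (x - e (idx x)) + e N" by simp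
 then have "x + g \<in> H" using subgrp_add[OF sub idx_mem[OF assms] N(2)] by metis
 then show ?thesis using idx_H False by simp
qed

end

text \<open>A finite group is reached from \<open>H0\<close> by adjoining single elements. The
  arbitrary start serves \<open>separating_hom\<close>, which begins with the cyclic group of the
  element to be separated.\<close>

lemma subgrp_induct:
 fixes H0 :: "'a::ab_group_add set"
 assumes fin: "finite (UNIV :: 'a set)" and "subgrp H0" "P H0"
  and step: "!!H g. subgrp H ==> H0 \<subseteq> H ==> P H ==> g \<notin> H ==> P (adjoin H g)"
 shows "P UNIV"
proof -
 have "P UNIV" if "subgrp H" "H0 \<subseteq> H" "P H" for H
  using that
 proof (induction "card (UNIV :: 'a set) - card H" arbitrary: H rule: less_induct)
  case less
  show ?case
  proof (cases "H = UNIV")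
   case False
   then obtain g where g: "g \<notin> H" by auto
   interpret cyclic_ext H g by unfold_locales (use fin less.prems g in auto)
   have "H \<subset> adjoin H g" using H_subset g_adjoin g by auto
   then have "card H < card (adjoin H g)" by (intro psubset_card_mono) (auto intro: finite_subset[OF _ fin])
   moreover have "card (adjoin H g) \<le> card (UNIV :: 'a set)" by (intro card_mono fin) auto
   ultimately have "card (UNIV :: 'a set) - card (adjoin H g) < card (UNIV :: 'a set) - card H" by linarith
   then show ?thesis
    using less.hyps[of "adjoin H g"] adjoin_subgrp H_subset less.prems step[OF less.prems g] by auto
  qed (use less.prems in simp)
 qed
 then show ?thesis using assms by auto
qed

lemma subgrp_singleton_0: "subgrp {0}"
 by (simp add: subgrp_def)

text \<open>A coset representative: the choice depends only on the coset, because the predicate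
  does. For \<open>H\<close> itself it is pinned to 0, so that corrections built from
  \<open>rep\<close> disappear on \<open>H\<close>.\<close>

definition rep :: "'a::ab_group_add set => 'a => 'a" where
 "rep H x = (if x \<in> H then 0 else SOME t. x - t \<in> H)"

lemma rep_H: "x \<in> H ==> rep H x = 0"
 by (simp add: rep_def)

lemma rep_mem: "subgrp H ==> x - rep H x \<in> H"
 unfolding rep_def using someI[of "\<lambda>t. x - t \<in> H" x] subgrp_zero[of H] by auto

lemma rep_cong: assumes "subgrp H" "h \<in> H" shows "rep H (h + x) = rep H x"
proof -
 have "h + x - t \<in> H \<longleftrightarrow> x - t \<in> H" for t
  using subgrp_add_iff[OF assms, of "x - t"] by (simp add: algebra_simps)
 then show ?thesis unfolding rep_def using subgrp_add_iff[OF assms] by simp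
qed

section \<open>Cocycles on finite abelian groups\<close>

definition cocycle2 :: "('a::ab_group_add => 'a => 'b::ab_group_add) => bool" where
 "cocycle2 l \<longleftrightarrow> (\<forall>x y z. l x y + l (x + y) z = l y z + l x (y + z)) \<and> (\<forall>x y. l x y = l y x)"

text \<open>Subtracts the coboundary of \<open>- v\<close>. The lemmas below look for
  \<open>v\<close> that make the result vanish on larger and larger subgroups.\<close>

definition gauge2 :: "('a::ab_group_add => 'b::ab_group_add) => ('a => 'a => 'b) => 'a => 'a => 'b" where
 "gauge2 v l x y = l x y + v x + v y - v (x + y)"

lemma cocycle2_gauge: assumes "cocycle2 l" shows "cocycle2 (gauge2 v l)"
 unfolding cocycle2_def
proof (intro conjI allI)
 fix x y z
 have "l x y + l (x + y) z = l y z + l x (y + z)" using assms unfolding cocycle2_def by blast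
 then show "gauge2 v l x y + gauge2 v l (x + y) z = gauge2 v l y z + gauge2 v l x (y + z)"
  unfolding gauge2_def by (simp add: add.assoc algebra_simps)
 show "gauge2 v l x y = gauge2 v l y x"
  using assms by (simp add: cocycle2_def gauge2_def add.commute add.left_commute)
qed

lemma gauge2_gauge2: "gauge2 v (gauge2 v' l) = gauge2 (\<lambda>x. v x + v' x) l"
 by (intro ext) (simp add: gauge2_def algebra_simps)

context cyclic_ext
begin

text \<open>Take \<open>v x = l (x - t) t\<close> for the coset representative \<open>t\<close> of
  \<open>x\<close>. The cocycle identity at \<open>h\<close>, \<open>x - t\<close>, \<open>t\<close>
  turns \<open>l h x\<close> into \<open>v (h + x) - v x\<close>, and \<open>v\<close> vanishes on
  \<open>H\<close>.\<close>

lemma cocycle2_step1: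
 fixes l :: "'a => 'a => 'b::ab_group_add"
 assumes l: "cocycle2 l" and lH: "!!x y. x \<in> H ==> y \<in> H ==> l x y = 0"
 obtains v where "!!h x. h \<in> H ==> gauge2 v l h x = 0"
proof -
 have cc: "l x y + l (x + y) z = l y z + l x (y + z)" for x y z using l unfolding cocycle2_def by blast
 have l0: "l 0 x = 0" for x
  using cc[of 0 0 x] lH[of 0 0] subgrp_zero[OF sub] by simp
 define v where "v x = l (x - rep H x) (rep H x)" for x
 have vH: "v h = 0" if "h \<in> H" for h using that lH subgrp_zero[OF sub] by (simp add: v_def rep_H)
 have *: "v (h + x) = v x + l h x" if "h \<in> H" for h x
 proof -
  let ?t = "rep H x"
  have "l h (x - ?t) = 0" using lH that rep_mem[OF sub] by simp
  then show ?thesis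
   using cc[of h "x - ?t" ?t] by (simp add: v_def rep_cong[OF sub that] add_diff_eq)
 qed
 have "gauge2 v l h x = 0" if "h \<in> H" for h x
  using *[OF that] vH[OF that] by (simp add: gauge2_def)
 then show thesis by (rule that)
qed

text \<open>Here \<open>l\<close> comes from the cyclic quotient. A recursion along the multiples of
  \<open>g\<close> removes the values \<open>l x g\<close>. It closes up after \<open>N\<close>
  steps only if the accumulated sum is zero, and this is arranged by dividing by \<open>N\<close>.
  Vanishing at \<open>g\<close> then spreads to all second arguments by the cocycle
  identity.\<close>

lemma cocycle2_step2:
 fixes l :: "'a => 'a => 'b::ab_group_add"
 assumes l: "cocycle2 l" and lH: "!!h x. h \<in> H ==> l h x = 0" and dv: "divisible TYPE('b)"
 obtains v where "!!x y. x \<in> adjoin H g ==> y \<in> adjoin H g ==> gauge2 v l x y = 0"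
proof -
 have cc: "l x y + l (x + y) z = l y z + l x (y + z)" and sy: "l x y = l y x" for x y z
  using l unfolding cocycle2_def by blast+
 have inv: "l (h + x) y = l x y" if "h \<in> H" for h x y
  using cc[of h x y] lH[OF that] by simp
 \<comment> \<open>\<open>r\<close> will be \<open>v g\<close>; its \<open>N\<close>-fold multiple
   cancels the total of the values \<open>l (e j) g\<close>, so that \<open>L\<close> returns to 0
   after one turn.\<close>
 obtain r where r: "nscale N r = - (\<Sum>j<N. l (e j) g)"
  using dv N(1) unfolding divisible_def by metis
 define L where "L i = (\<Sum>j<i. l (e j) g + r)" for i
 have LN: "L N = 0" by (simp add: L_def nscale_sum r)
 have L0: "L 0 = 0" by (simp add: L_def)
 have LS: "L (Suc i) = L i + l (e i) g + r" for i by (simp add: L_def ac_simps)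
 define v where "v x = L (idx x)" for x
 define l' where "l' = gauge2 v l"
 have vH: "v h = 0" if "h \<in> H" for h using that by (simp add: v_def idx_H L0)
 have vg: "v g = r" using lH subgrp_zero[OF sub] by (simp add: v_def idx_g LS[of 0, simplified] L0)
 have le: "l x y = l (e (idx x)) y" if "x \<in> adjoin H g" for x y
  using inv[OF idx_mem[OF that], of "e (idx x)" y] by simp
 have lg: "l' x g = 0" if x: "x \<in> adjoin H g" for x
 proof -
  \<comment> \<open>At the carry both sides are 0: the left one because \<open>idx\<close> drops to
    0, the right one by \<open>LN\<close>.\<close>
  have "v (x + g) = L (Suc (idx x))"
  proof (cases "Suc (idx x) < N")
   case False
   then have "Suc (idx x) = N" using idx_less[OF x] by simp
   then show ?thesis using LN L0 by (simp add: v_def idx_add_g[OF x])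
  qed (simp add: v_def idx_add_g[OF x])
  then show ?thesis unfolding l'_def gauge2_def using vg le[OF x, of g] LS[of "idx x"]
   by (simp add: v_def)
 qed
 have lh: "l' x h = 0" if x: "x \<in> adjoin H g" and h: "h \<in> H" for x h
  using lH[OF h, of x] sy[of x h] vH[OF h]
  by (simp add: l'_def gauge2_def v_def idx_add_H[OF x h])
 have cc': "l' x y + l' (x + y) z = l' y z + l' x (y + z)" for x y z
  using cocycle2_gauge[OF l, of v] unfolding cocycle2_def l'_def by blast
 have "l' x y = 0" if x: "x \<in> adjoin H g" and y: "y \<in> adjoin H g" for x y
 proof -
  from y obtain h i where hi: "h \<in> H" "y = h + e i" unfolding adjoin_def by auto
  have "l' x (h + e k) = 0" for k
  proof (induction k)
   case (Suc k)
   have "h + e k \<in> adjoin H g" using adjoin_add H_subset hi(1) e_adjoin by auto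
   then show ?case
    using cc'[of x "h + e k" g] lg[OF adjoin_add[OF x \<open>h + e k \<in> _\<close>]] lg[of "h + e k"] Suc
    by (simp add: add.assoc)
  qed (use lh x hi in simp)
  then show ?thesis using hi by simp
 qed
 then show thesis using that unfolding l'_def by blast
qed

end

text \<open>In terms of extensions: an abelian extension by a divisible group splits.\<close>

lemma cocycle2_coboundary:
 fixes l :: "'a::ab_group_add => 'a => 'b::ab_group_add"
 assumes fin: "finite (UNIV :: 'a set)" and dv: "divisible TYPE('b)" and l: "cocycle2 l"
 obtains v where "!!x y. l x y + v x + v y = v (x + y)"
proof -
 have "\<exists>v. \<forall>x\<in>UNIV. \<forall>y\<in>UNIV. gauge2 v l x y = 0"
 proof (rule subgrp_induct[OF fin subgrp_singleton_0, where P = "\<lambda>H. \<exists>v. \<forall>x\<in>H. \<forall>y\<in>H. gauge2 v l x y = 0"])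
  show "\<exists>v. \<forall>x\<in>{0}. \<forall>y\<in>{0}. gauge2 v l x y = 0"
   by (intro exI[of _ "\<lambda>_. - l 0 0"]) (simp add: gauge2_def)
 next
  fix H g assume H: "subgrp H" "g \<notin> H" and "\<exists>v. \<forall>x\<in>H. \<forall>y\<in>H. gauge2 v l x y = 0"
  interpret cyclic_ext H g by unfold_locales (use fin H in auto)
  from \<open>\<exists>v. _\<close> obtain v where v: "!!x y. x \<in> H ==> y \<in> H ==> gauge2 v l x y = 0" by auto
  obtain v' where v': "!!h x. h \<in> H ==> gauge2 v' (gauge2 v l) h x = 0"
   by (rule cocycle2_step1[OF cocycle2_gauge[OF l], of v]) (use v in auto)
  obtain v'' where "!!x y. x \<in> adjoin H g ==> y \<in> adjoin H g ==>
    gauge2 v'' (gauge2 v' (gauge2 v l)) x y = 0"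
   by (rule cocycle2_step2[OF cocycle2_gauge[OF cocycle2_gauge[OF l]] _ dv, of v' v]) (use v' in auto)
  then show "\<exists>v. \<forall>x\<in>adjoin H g. \<forall>y\<in>adjoin H g. gauge2 v l x y = 0" unfolding gauge2_gauge2 by blast
 qed
 then obtain v where v: "gauge2 v l x y = 0" for x y by blast
 have "l x y + v x + v y = v (x + y)" for x y
  using v[of x y] by (simp add: gauge2_def)
 then show thesis by (rule that)
qed

section \<open>Abelian 3-cocycles and their gauge transformations\<close>

definition gauge3w ::
 "('a::ab_group_add => 'a => 'b::ab_group_add) => ('a => 'a => 'a => 'b) => 'a => 'a => 'a => 'b" where
 "gauge3w k w x y z = w x y z + k (x + y) z + k x y - k x (y + z) - k y z"

text \<open>Together with \<open>gauge3w\<close> this is the effect on associators and braidings of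
  rescaling the isomorphism from the product of the objects \<open>x\<close> and \<open>y\<close> to
  the object \<open>x + y\<close> by \<open>k x y\<close>; compare
  \<open>msys_rescale\<close>.\<close>

definition gauge3c ::
 "('a::ab_group_add => 'a => 'b::ab_group_add) => ('a => 'a => 'b) => 'a => 'a => 'b" where
 "gauge3c k c x y = c x y + k y x - k x y"

lemma gauge3w_gauge3w: "gauge3w k (gauge3w k' w) = gauge3w (\<lambda>x y. k x y + k' x y) w"
 by (intro ext) (simp add: gauge3w_def algebra_simps)

lemma gauge3c_gauge3c: "gauge3c k (gauge3c k' w) = gauge3c (\<lambda>x y. k x y + k' x y) w"
 by (intro ext) (simp add: gauge3c_def algebra_simps)

text \<open>The values of \<open>w\<close> are the associators and those of \<open>c\<close> the braidings of a skeletal braided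
 category; the three equations are the pentagon and the two hexagons.\<close>

locale abelian_cocycle =
 fixes w :: "'a::ab_group_add => 'a => 'a => 'b::ab_group_add" and c :: "'a => 'a => 'b"
 assumes pent: "w x y z + w x (y + z) u + w y z u = w (x + y) z u + w x y (z + u)"
  and hex1: "c x (y + z) = c x y + c x z + w x y z + w y z x - w y x z"
  and hex2: "c (x + y) z = c x z + c y z + w x z y - w z x y - w x y z"
begin

lemma gauge: "abelian_cocycle (gauge3w k w) (gauge3c k c)"
proof
 fix x y z u
 have "w x y z = w (x + y) z u + w x y (z + u) - w x (y + z) u - w y z u"
  using pent[of x y z u] by (simp add: algebra_simps)
 then show "gauge3w k w x y z + gauge3w k w x (y + z) u + gauge3w k w y z u =
    gauge3w k w (x + y) z u + gauge3w k w x y (z + u)"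
  unfolding gauge3w_def by (simp add: add.assoc algebra_simps)
next
 fix x y z
 show "gauge3c k c x (y + z) = gauge3c k c x y + gauge3c k c x z + gauge3w k w x y z + gauge3w k w y z x -
    gauge3w k w y x z"
  unfolding gauge3c_def gauge3w_def hex1 by (simp add: add.commute add.left_commute algebra_simps)
 show "gauge3c k c (x + y) z = gauge3c k c x z + gauge3c k c y z + gauge3w k w x z y - gauge3w k w z x y -
    gauge3w k w x y z"
  unfolding gauge3c_def gauge3w_def hex2 by (simp add: add.commute add.left_commute algebra_simps)
qed

lemma w_mid_0: "w x 0 y = w x 0 0 + w 0 0 y"
 using pent[of x 0 0 y] by (simp add: algebra_simps)

text \<open>The sum \<open>c x y + c y x\<close> is the polarization of the diagonal: expanding
  \<open>c (x + y) (x + y)\<close> by both hexagons leaves it together with associator terms, which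
  cancel by the pentagon at \<open>x, y, x, y\<close>.\<close>

lemma braiding_antisym: assumes "!!x. c x x = 0" shows "c x y + c y x = 0"
proof -
 have a: "c x (x + y) = c x y + w x y x" using hex1[of x x y] assms by (simp add: algebra_simps)
 have b: "c y (x + y) = c y x + w y x y" using hex1[of y x y] assms by (simp add: algebra_simps)
 have "0 = c (x + y) (x + y)" using assms by simp
 also have "\<dots> = c x y + c y x + (w x y x + w x (y + x) y + w y x y - w (x + y) x y - w x y (x + y))"
  unfolding hex2[of x y "x + y"] a b by (simp add: algebra_simps)
 also have "\<dots> = c x y + c y x" using pent[of x y x y] by (simp add: algebra_simps)
 finally show ?thesis by simp
qed

text \<open>Gauges that make the left action of \<open>H\<close> strict and the right action its transport along the
 braiding.\<close>

lemma gauge_two_args: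
 assumes sub: "subgrp H" and wH: "!!x y z. x \<in> H ==> y \<in> H ==> z \<in> H ==> w x y z = 0"
  and cH: "!!x y. x \<in> H ==> y \<in> H ==> c x y = 0" and c_diag: "!!x. c x x = 0"
 obtains k where
  "!!h x. h \<in> H ==> gauge3c k c h x = 0" "!!h x. h \<in> H ==> gauge3c k c x h = 0"
  "!!h h' x. h \<in> H ==> h' \<in> H ==> gauge3w k w h h' x = 0"
  "!!h h' x. h \<in> H ==> h' \<in> H ==> gauge3w k w h x h' = 0"
  "!!h h' x. h \<in> H ==> h' \<in> H ==> gauge3w k w x h h' = 0"
proof -
 \<comment> \<open>The first clause is made for \<open>w' h h' t = 0\<close> at representatives
   \<open>t\<close>, the second for \<open>c' h x = 0\<close>, with \<open>h\<close> and
   \<open>h'\<close> in \<open>H\<close>.\<close>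
 define k where "k x y = (if x \<in> H then w x (y - rep H y) (rep H y)
   else if y \<in> H then w y (x - rep H x) (rep H x) - c y x else 0)" for x y
 define w' c' where "w' = gauge3w k w" and "c' = gauge3c k c"
 interpret g: abelian_cocycle w' c' unfolding w'_def c'_def by (rule gauge)
 note H0 = subgrp_zero[OF sub] and Hr = rep_mem[OF sub]
 have kH: "k h h' = 0" if "h \<in> H" "h' \<in> H" for h h'
  using that by (simp add: k_def rep_H wH H0)
 have w0: "w h 0 x = w 0 0 x" if "h \<in> H" for h x using w_mid_0[of h x] wH[OF that H0 H0] by simp
 have c'1: "c' h x = 0" if "h \<in> H" for h x
  using that kH cH by (cases "x \<in> H") (simp_all add: c'_def gauge3c_def k_def)
 \<comment> \<open>The other side follows, since a trivial diagonal makes the braiding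
   antisymmetric.\<close>
 have c'2: "c' x h = 0" if "h \<in> H" for h x
 proof -
  have "c' x h + c' h x = 0"
   by (rule g.braiding_antisym) (simp add: c'_def gauge3c_def c_diag)
  then show ?thesis using c'1[OF that] by simp
 qed
 have wt: "w' h h' (rep H x) = 0" if "h \<in> H" "h' \<in> H" for h h' x
 proof -
  have r: "rep H (rep H x) = rep H x"
   using rep_cong[OF sub Hr, of x "rep H x"] by simp
  have "h + h' \<in> H" using that sub subgrp_add by auto
  then show ?thesis
   using that kH[OF that] w0[of "h + h'" "rep H x"] w0[of h' "rep H x"]
   by (simp add: w'_def gauge3w_def k_def r rep_cong[OF sub])
 qed
 \<comment> \<open>The pentagon at \<open>h, h', x - t, t\<close> passes from the representative
   \<open>t\<close> to \<open>x\<close>, as \<open>x - t\<close> lies in \<open>H\<close>.\<close>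
 have w1: "w' h h' x = 0" if "h \<in> H" "h' \<in> H" for h h' x
 proof -
  let ?t = "rep H x"
  have "w' h h' (x - ?t) = 0"
   using that Hr[of x] subgrp_add[OF sub] by (simp add: w'_def gauge3w_def wH kH)
  then show ?thesis
   using g.pent[of h h' "x - ?t" ?t] wt[of h' "x - ?t" x] wt[of h "h' + (x - ?t)" x]
    wt[of "h + h'" "x - ?t" x] that Hr[of x] subgrp_add[OF sub] by simp
 qed
 \<comment> \<open>With trivial braidings against \<open>H\<close>, the hexagons become relations
   between associators with permuted arguments, which bring the two elements of \<open>H\<close>
   into any position.\<close>
 have w2: "w' h x h' = 0" if "h \<in> H" "h' \<in> H" for h h' x
  using g.hex1[of h' h x] c'1[OF that(2)] c'1[OF that(1)] w1[OF that] w1[OF that(2,1)] by simp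
 have w3: "w' x h h' = 0" if "h \<in> H" "h' \<in> H" for h h' x
  using g.hex1[of h x h'] c'1[OF that(1)] w2[OF that] w2[OF that(2,1)] g.hex1[of x h h'] c'2[OF that(1)]
   c'2[OF that(2)] c'2[OF subgrp_add[OF sub that]] w1[OF that] by simp
 show thesis
  by (rule that[of k]) (use c'1 c'2 w1 w2 w3 in \<open>simp_all add: w'_def c'_def\<close>)
qed

text \<open>The gauge is zero as soon as one of its arguments is in \<open>H\<close>, so the
  vanishing achieved before survives while the associators with a single argument in
  \<open>H\<close> are removed.\<close>

lemma gauge_one_arg:
 assumes sub: "subgrp H"
  and c1: "!!h x. h \<in> H ==> c h x = 0" and c2: "!!h x. h \<in> H ==> c x h = 0"
  and w1: "!!h h' x. h \<in> H ==> h' \<in> H ==> w h h' x = 0"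
  and w2: "!!h h' x. h \<in> H ==> h' \<in> H ==> w h x h' = 0"
  and w3: "!!h h' x. h \<in> H ==> h' \<in> H ==> w x h h' = 0"
 obtains k where
  "!!h x. h \<in> H ==> gauge3c k c h x = 0" "!!h x. h \<in> H ==> gauge3c k c x h = 0"
  "!!h x y. h \<in> H ==> gauge3w k w h x y = 0"
  "!!h x y. h \<in> H ==> gauge3w k w x h y = 0"
  "!!h x y. h \<in> H ==> gauge3w k w x y h = 0"
proof -
 let ?t = "rep H"
 \<comment> \<open>The last summand cancels \<open>w h (?t x) y\<close> (see \<open>a1\<close>), the
   first two cancel \<open>w (?t x) h (?t y)\<close> (see \<open>a2\<close>). The remaining cases
   follow by pentagons and a hexagon.\<close>
 define k where "k x y = w (?t x) (y - ?t y) (?t y) - w (y - ?t y) (?t x) (?t y) - w (x - ?t x) (?t x) y" for x y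
 define w' c' where "w' = gauge3w k w" and "c' = gauge3c k c"
 interpret g: abelian_cocycle w' c' unfolding w'_def c'_def by (rule gauge)
 note H0 = subgrp_zero[OF sub] and Hr = rep_mem[OF sub]
 have w0: "w 0 x y = 0" for x y
  using pent[of 0 0 x y] w1[OF H0 H0] by simp
 have w0': "w x 0 y = 0" for x y
  using w_mid_0[of x y] w1[OF H0 H0] w3[OF H0 H0] by simp
 have k1: "k h x = 0" if "h \<in> H" for h x
  using that by (simp add: k_def rep_H w0 w0' w2 H0 Hr)
 have k2: "k x h = 0" if "h \<in> H" for h x
  using that by (simp add: k_def rep_H w2 w3 H0 Hr)
 have c'1: "c' h x = 0" and c'2: "c' x h = 0" if "h \<in> H" for h x
  using that k1 k2 by (simp_all add: c'_def gauge3c_def c1 c2)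
 have ww: "w' h h' x = 0" "w' h x h' = 0" "w' x h h' = 0" if "h \<in> H" "h' \<in> H" for h h' x
  using that w1 w2 w3 k1 k2 subgrp_add[OF sub that]
  by (simp_all add: w'_def gauge3w_def)
 have rr: "?t (?t x) = ?t x" for x
  using rep_cong[OF sub Hr, of x "rep H x"] by simp
 have a1: "w' h (?t x) y = 0" if "h \<in> H" for h x y
 proof -
  have "k (h + ?t x) y = k (?t x) y - w h (?t x) y"
   by (simp add: k_def rep_cong[OF sub that] rr w0)
  then show ?thesis by (simp add: w'_def gauge3w_def k1[OF that])
 qed
 have a2: "w' (?t x) h (?t y) = 0" if "h \<in> H" for h x y
 proof -
  have "?t (?t x + h) = ?t x" using rep_cong[OF sub that, of "?t x"] rr[of x] by (simp add: add.commute)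
  then have "k (?t x + h) (?t y) = - w h (?t x) (?t y)" "k (?t x) (h + ?t y) = w (?t x) h (?t y) - w h (?t x) (?t y)"
   by (simp_all add: k_def rep_cong[OF sub that] rr w0 w0')
  then show ?thesis by (simp add: w'_def gauge3w_def k1[OF that] k2[OF that])
 qed
 have b1: "w' h x y = 0" if "h \<in> H" for h x y
  using g.pent[of h "x - ?t x" "?t x" y] a1[OF that] a1[OF Hr] a1[OF subgrp_add[OF sub that Hr]]
   ww[OF that Hr] by simp
 have b2: "w' x h (?t y) = 0" if "h \<in> H" for h x y
  using g.pent[of "x - ?t x" "?t x" h "?t y"] a2[OF that] b1[OF Hr] by simp
 have b3: "w' x h y = 0" if "h \<in> H" for h x y
  using g.pent[of x h "y - ?t y" "?t y"] ww[OF that Hr] b2[OF Hr] b2[OF that]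
   b2[OF subgrp_add[OF sub that Hr]] b1[OF that] by simp
 have b4: "w' x y h = 0" if "h \<in> H" for h x y
  using g.hex1[of h x y] c'1[OF that] b1[OF that] b3[OF that] by simp
 show thesis
  by (rule that[of k]) (use c'1 c'2 b1 b3 b4 in \<open>simp_all add: w'_def c'_def\<close>)
qed

text \<open>Here the associator comes from a 3-cocycle of the cyclic quotient, whose class need not
  be trivial by itself. The gauge settles \<open>w' x y g\<close> except at the carry. There a
  hexagon identifies the critical value with the braiding of \<open>g\<close> and
  \<open>e N\<close>, which vanishes because \<open>e N\<close> is in \<open>H\<close>.\<close>

lemma gauge_cyclic:
 assumes "cyclic_ext H g" and c_diag: "!!x. c x x = 0"
  and c1: "!!h x. h \<in> H ==> c h x = 0" and c2: "!!h x. h \<in> H ==> c x h = 0"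
  and w1: "!!h x y. h \<in> H ==> w h x y = 0" and w2: "!!h x y. h \<in> H ==> w x h y = 0"
  and w3: "!!h x y. h \<in> H ==> w x y h = 0"
 obtains k where
  "!!x y z. x \<in> adjoin H g ==> y \<in> adjoin H g ==> z \<in> adjoin H g ==> gauge3w k w x y z = 0"
  "!!x y. x \<in> adjoin H g ==> y \<in> adjoin H g ==> gauge3c k c x y = 0"
proof -
 interpret cyclic_ext H g by fact
 let ?A = "adjoin H g"
 note H0 = subgrp_zero[OF sub]
 have inv1: "w (h + x) y z = w x y z" if "h \<in> H" for h x y z
  using pent[of h x y z] w1[OF that] by simp
 have inv2: "w x (h + y) z = w x y z" if "h \<in> H" for h x y z
  using pent[of x h y z] w1[OF that] w2[OF that] inv1[OF that, of x y z] by (simp add: add.commute)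
 \<comment> \<open>\<open>K\<close> accumulates the associators met while the second argument grows
   from 0 in steps of \<open>g\<close>, so that \<open>k x (y + g) - k x y\<close> equals
   \<open>w x y g\<close> when no carry occurs.\<close>
 define K where "K i j = (\<Sum>m<j. w (e i) (e m) g)" for i j
 define k where "k x y = K (idx x) (idx y)" for x y
 define w' c' where "w' = gauge3w k w" and "c' = gauge3c k c"
 interpret g: abelian_cocycle w' c' unfolding w'_def c'_def by (rule gauge)
 have K0: "K 0 j = 0" for j using w1[OF H0] by (simp add: K_def)
 have k1: "k h x = 0" and k2: "k x h = 0" if "h \<in> H" for h x
  using that by (simp_all add: k_def idx_H K0) (simp add: K_def)
 \<comment> \<open>\<open>idx g\<close> is 1, so only the summand at \<open>e 0\<close> occurs, and
   0 lies in \<open>H\<close>.\<close>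
 have kg: "k x g = 0" for x using w2[OF H0] by (simp add: k_def idx_g K_def)
 have kc: "k (h + x) y = k x y" "k y (h + x) = k y x" if "h \<in> H" "x \<in> ?A" for h x y
  using that by (simp_all add: k_def idx_add_H)
 have wi: "w x y g = w (e (idx x)) (e (idx y)) g" if "x \<in> ?A" "y \<in> ?A" for x y
  using inv1[OF idx_mem[OF that(1)], of "e (idx x)" y g] inv2[OF idx_mem[OF that(2)], of "e (idx x)" "e (idx y)" g]
  by simp
 have c'1: "c' h x = 0" and c'2: "c' x h = 0" if "h \<in> H" for h x
  using that k1 k2 by (simp_all add: c'_def gauge3c_def c1 c2)
 have v1: "w' h x y = 0" if "h \<in> H" "x \<in> ?A" for h x y
  using that k1 kc w1 by (simp add: w'_def gauge3w_def)
 have v2: "w' x h y = 0" if "h \<in> H" "x \<in> ?A" "y \<in> ?A" for h x y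
  using that k1 k2 kc[OF that(1)] w2 by (simp add: w'_def gauge3w_def add.commute[of x h])
 have v3: "w' x y h = 0" if "h \<in> H" "y \<in> ?A" for h x y
  using that k1 k2 kc[OF that(1)] w3 by (simp add: w'_def gauge3w_def add.commute[of y h])
 have c'_diag: "c' x x = 0" for x by (simp add: c'_def gauge3c_def c_diag)
 have hA: "h \<in> ?A" if "h \<in> H" for h using that H_subset by auto
 note A = adjoin_add e_adjoin hA g_adjoin
 have step: "w' x y g = 0" if "x \<in> ?A" "y \<in> ?A" "Suc (idx y) < N" for x y
  using that wi[OF that(1,2)] by (simp add: w'_def gauge3w_def kg) (simp add: k_def idx_add_g K_def)
 \<comment> \<open>Below the carry, the hexagon adds \<open>c' g g\<close> and
   \<open>w' g (e j) g\<close> in each step, and both are zero.\<close>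
 have cg: "c' g (e j) = 0" if "j < N" for j
  using that
 proof (induction j)
  case (Suc j)
  have "idx (e j) = j" using Suc.prems H0 by (intro idx_eqI) auto
  then have "w' g (e j) g = 0" using Suc.prems A by (intro step) auto
  then show ?case using g.hex1[of g "e j" g] Suc c'_diag[of g] by simp
 qed (use c'2 H0 in simp)
 \<comment> \<open>At the carry the hexagon is read in the other direction: all braidings in it are
   known to vanish, which leaves the associator.\<close>
 have "w' g (e (N - 1)) g = 0"
 proof -
  have "e N = e (N - 1) + g" using N(1) by (metis Suc_pred' nscale.simps(2))
  then show ?thesis
   using g.hex1[of g "e (N - 1)" g] cg[of "N - 1"] c'2[OF N(2), of g] c'_diag[of g] N(1) by simp
 qed
 then have gyg0: "w' g (e j) g = 0" if "j < N" for j
 proof (cases "Suc j < N")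
  case False
  then have "j = N - 1" using that by simp
  then show ?thesis using \<open>w' g (e (N - 1)) g = 0\<close> by simp
 qed (use that A step[of g "e j"] idx_eqI[of j "e j"] H0 in simp)
 have inv2': "w' x (h + y) z = w' x y z" if "h \<in> H" "x \<in> ?A" "y \<in> ?A" "z \<in> ?A" for h x y z
  using that kc[OF that(1)] inv2[OF that(1)] k1 A
  by (simp add: w'_def gauge3w_def add.assoc add.left_commute[of x h])
 have gyg: "w' g y g = 0" if "y \<in> ?A" for y
  using inv2'[of "y - e (idx y)" g "e (idx y)" g] idx_mem[OF that] gyg0[OF idx_less[OF that]] A by simp
 have inv3': "w' x y (h + z) = w' x y z" if "h \<in> H" "x \<in> ?A" "y \<in> ?A" "z \<in> ?A" for h x y z
  using g.pent[of x y h z] inv2'[OF that] v2[OF that(1) that(3,4)] v2[OF that(1) A(1)[OF that(2,3)] that(4)]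
   v3[OF that(1,3), of x] by (simp add: add.commute)
 \<comment> \<open>The pentagon at \<open>g, y, e j, g\<close> raises the third argument. The
   multiples stay below \<open>N\<close>, where \<open>step\<close> applies, and
   \<open>inv3'\<close> covers the rest of the coset.\<close>
 have gyz: "w' g y z = 0" if y: "y \<in> ?A" and z: "z \<in> ?A" for y z
 proof -
  have "w' g y (e j) = 0" if "j < N" for j
   using that
  proof (induction j)
   case 0 then show ?case using v3 H0 y by simp
  next
   case (Suc j)
   have "idx (e j) = j" using Suc.prems H0 by (intro idx_eqI) auto
   then show ?case
    using g.pent[of g y "e j" g] step[of y "e j"] step[of "g + y" "e j"]
     gyg[of "y + e j"] Suc y A by simp
  qed
  then show ?thesis
   using inv3'[of "z - e (idx z)" g y "e (idx z)"] idx_mem[OF z] y A idx_less[OF z] by simp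
 qed
 \<comment> \<open>Now the first argument grows, by the pentagon at
   \<open>g, h + e j, y, g\<close>.\<close>
 have hyg: "w' x y g = 0" if x: "x \<in> ?A" and y: "y \<in> ?A" for x y
 proof -
  from x obtain h i where hi: "h \<in> H" "x = h + e i" unfolding adjoin_def by auto
  have "\<forall>y\<in>?A. w' (h + e j) y g = 0" for j
  proof (induction j)
   case 0 then show ?case using v1 hi by simp
  next
   case (Suc j)
   show ?case
   proof
    fix y assume y: "y \<in> ?A"
    have hj: "h + e j \<in> ?A" using hi A by auto
    show "w' (h + e (Suc j)) y g = 0"
     using g.pent[of g "h + e j" y g] gyz[OF hj y] gyz[OF hj] A(1)[OF y] A(1)[OF hj y] gyg Suc y A(4)
     by (simp add: ac_simps)
   qed
  qed
  then show ?thesis using hi y by simp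
 qed
 have w0: "w' x y z = 0" if "x \<in> ?A" "y \<in> ?A" "z \<in> ?A" for x y z
 proof -
  from that obtain h i where hi: "h \<in> H" "z = h + e i" unfolding adjoin_def by auto
  have "w' x y (h + e j) = 0" for j
  proof (induction j)
   case 0 then show ?case using v3 hi that by simp
  next
   case (Suc j)
   have "h + e j \<in> ?A" using hi A by auto
   then show ?case using g.pent[of x y "h + e j" g] hyg that Suc A(1) by (simp add: add.assoc)
  qed
  then show ?thesis using hi by simp
 qed
 have cg': "c' g y = 0" if "y \<in> ?A" for y
 proof -
  have "c' g y = c' g (y - e (idx y)) + c' g (e (idx y))"
   using g.hex1[of g "y - e (idx y)" "e (idx y)"] w0 idx_mem[OF that] A by simp
  then show ?thesis using cg[OF idx_less[OF that]] c'2[OF idx_mem[OF that]] by simp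
 qed
 have c0: "c' x y = 0" if x: "x \<in> ?A" and y: "y \<in> ?A" for x y
 proof -
  from x obtain h i where hi: "h \<in> H" "x = h + e i" unfolding adjoin_def by auto
  have "c' (h + e j) y = 0" for j
  proof (induction j)
   case 0 then show ?case using c'1 hi by simp
  next
   case (Suc j)
   have "h + e j \<in> ?A" using hi A by auto
   then show ?case using g.hex2[of "h + e j" g y] w0 y A cg'[OF y] Suc by (simp add: add.assoc)
  qed
  then show ?thesis using hi by simp
 qed
 show thesis by (rule that[of k]) (use w0 c0 in \<open>simp_all add: w'_def c'_def\<close>)
qed

end

text \<open>This is the injectivity in the theorem of Eilenberg and Mac Lane that identifies abelian
  3-cohomology with quadratic functions, the class of \<open>(w, c)\<close> being sent to its
  diagonal. Each cyclic step composes three gauges, which clear the associators with two, with one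
  and finally with no argument in \<open>H\<close>.\<close>

lemma abelian_cocycle_coboundary:
 fixes w :: "'a::ab_group_add => 'a => 'a => 'b::ab_group_add"
 assumes fin: "finite (UNIV :: 'a set)" and wc: "abelian_cocycle w c" and diag: "!!x. c x x = 0"
 obtains k where "!!x y z. w x y z + k (x + y) z + k x y = k x (y + z) + k y z"
  and "!!x y. c x y + k y x = k x y"
proof -
 let ?P = "\<lambda>H. \<exists>k. (\<forall>x\<in>H. \<forall>y\<in>H. \<forall>z\<in>H. gauge3w k w x y z = 0) \<and> (\<forall>x\<in>H. \<forall>y\<in>H. gauge3c k c x y = 0)"
 have diag': "gauge3c k c x x = 0" for k x by (simp add: gauge3c_def diag)
 have "?P UNIV"
 proof (rule subgrp_induct[OF fin subgrp_singleton_0, where P = ?P])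
  interpret abelian_cocycle w c by fact
  have "w 0 0 0 = 0" using pent[of 0 0 0 0] by simp
  then show "?P {0}"
   by (intro exI[of _ "\<lambda>_ _. 0"]) (simp add: gauge3w_def gauge3c_def diag)
 next
  fix H g assume H: "subgrp H" "g \<notin> H" and "?P H"
  interpret ext: cyclic_ext H g by unfold_locales (use fin H in auto)
  from \<open>?P H\<close> obtain k1 where k1: "!!x y z. x \<in> H ==> y \<in> H ==> z \<in> H ==> gauge3w k1 w x y z = 0"
   "!!x y. x \<in> H ==> y \<in> H ==> gauge3c k1 c x y = 0" by blast
  let ?w1 = "gauge3w k1 w" and ?c1 = "gauge3c k1 c"
  interpret g1: abelian_cocycle ?w1 ?c1 by (rule abelian_cocycle.gauge[OF wc])
  obtain k2 where k2:
   "!!h x. h \<in> H ==> gauge3c k2 ?c1 h x = 0" "!!h x. h \<in> H ==> gauge3c k2 ?c1 x h = 0"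
   "!!h h' x. h \<in> H ==> h' \<in> H ==> gauge3w k2 ?w1 h h' x = 0"
   "!!h h' x. h \<in> H ==> h' \<in> H ==> gauge3w k2 ?w1 h x h' = 0"
   "!!h h' x. h \<in> H ==> h' \<in> H ==> gauge3w k2 ?w1 x h h' = 0"
   by (rule g1.gauge_two_args[OF H(1)]) (use k1 diag' in blast)+
  let ?w2 = "gauge3w k2 ?w1" and ?c2 = "gauge3c k2 ?c1"
  interpret g2: abelian_cocycle ?w2 ?c2 by (rule g1.gauge)
  obtain k3 where k3:
   "!!h x. h \<in> H ==> gauge3c k3 ?c2 h x = 0" "!!h x. h \<in> H ==> gauge3c k3 ?c2 x h = 0"
   "!!h x y. h \<in> H ==> gauge3w k3 ?w2 h x y = 0"
   "!!h x y. h \<in> H ==> gauge3w k3 ?w2 x h y = 0"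
   "!!h x y. h \<in> H ==> gauge3w k3 ?w2 x y h = 0"
   by (rule g2.gauge_one_arg[OF H(1)]) (use k2 in blast)+
  let ?w3 = "gauge3w k3 ?w2" and ?c3 = "gauge3c k3 ?c2"
  interpret g3: abelian_cocycle ?w3 ?c3 by (rule g2.gauge)
  have d: "gauge3c k3 ?c2 x x = 0" for x by (simp add: gauge3c_def diag)
  obtain k4 where
   "!!x y z. x \<in> adjoin H g ==> y \<in> adjoin H g ==> z \<in> adjoin H g ==> gauge3w k4 ?w3 x y z = 0"
   "!!x y. x \<in> adjoin H g ==> y \<in> adjoin H g ==> gauge3c k4 ?c3 x y = 0"
   by (rule g3.gauge_cyclic[OF ext.cyclic_ext_axioms]) (use d k3 in blast)+
  then show "?P (adjoin H g)" unfolding gauge3w_gauge3w gauge3c_gauge3c by blast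
 qed
 then obtain k where k: "gauge3w k w x y z = 0" "gauge3c k c x y = 0" for x y z by blast
 show thesis
 proof
  show "w x y z + k (x + y) z + k x y = k x (y + z) + k y z" for x y z
   using k(1)[of x y z] by (simp add: gauge3w_def algebra_simps)
  show "c x y + k y x = k x y" for x y
   using k(2)[of x y] by (simp add: gauge3c_def algebra_simps)
 qed
qed

text \<open>Divisibility extends characters; \<open>r\<close> is a nonzero value for the image of \<open>b\<close>, which has torsion.\<close>

lemma (in cyclic_ext) hom_extend:
 fixes f :: "'a => 'b::ab_group_add"
 assumes f: "!!x y. x \<in> H ==> y \<in> H ==> f (x + y) = f x + f y" and r: "nscale N r = f (e N)"
 obtains f' where "!!x y. x \<in> adjoin H g ==> y \<in> adjoin H g ==> f' (x + y) = f' x + f' y"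
  "!!h. h \<in> H ==> f' h = f h" "f' g = r"
proof -
 let ?A = "adjoin H g"
 \<comment> \<open>In \<open>x = (x - e (idx x)) + e (idx x)\<close> the first summand is in
   \<open>H\<close>. At the carry the two descriptions of \<open>e N\<close> agree by the choice of
   \<open>r\<close>.\<close>
 define f' where "f' x = f (x - e (idx x)) + nscale (idx x) r" for x
 have f0: "f 0 = 0" using f[of 0 0] subgrp_zero[OF sub] by simp
 have f'H: "f' h = f h" if "h \<in> H" for h using that by (simp add: f'_def idx_H)
 have f'g: "f' g = r" by (simp add: f'_def idx_g f0)
 have addH: "f' (x + h) = f' x + f h" if "x \<in> ?A" "h \<in> H" for x h
 proof -
  have "f (x + h - e (idx x)) = f (x - e (idx x)) + f h"
   using f[OF idx_mem[OF that(1)] that(2)] by (simp add: algebra_simps)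
  then show ?thesis by (simp add: f'_def idx_add_H[OF that] ac_simps)
 qed
 have addg: "f' (x + g) = f' x + r" if x: "x \<in> ?A" for x
 proof (cases "Suc (idx x) < N")
  case True
  then have "idx (x + g) = Suc (idx x)" by (simp add: idx_add_g[OF x])
  then show ?thesis by (simp add: f'_def add.assoc)
 next
  case False
  then have i: "N = Suc (idx x)" using idx_less[OF x] by simp
  then have "x + g = (x - e (idx x)) + e N" by simp
  then have "f (x + g) = f (x - e (idx x)) + f (e N)" using f[OF idx_mem[OF x] N(2)] by metis
  then show ?thesis using False by (simp add: f'_def idx_add_g[OF x] r[symmetric]) (simp add: i)
 qed
 have f'_add: "f' (x + y) = f' x + f' y" if "x \<in> ?A" and y: "y \<in> ?A" for x y
 proof -
  from y obtain h i where hi: "h \<in> H" "y = h + e i" unfolding adjoin_def by auto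
  have "f' (z + (h + e j)) = f' z + f h + nscale j r" if "z \<in> ?A" for z j
  proof (induction j)
   case (Suc j)
   have "z + (h + e j) \<in> ?A" using that hi H_subset by (intro adjoin_add e_adjoin) auto
   from addg[OF this] Suc show ?case by (simp add: add.assoc)
  qed (simp add: addH that hi)
  from this[OF that(1), of i] this[of 0 i] hi show ?thesis
   using f'H[of 0] f0 subgrp_zero[OF sub] H_subset by (auto simp: add.assoc)
 qed
 show thesis by (rule that[of f']) (use f'H f'g f'_add in blast)+
qed

text \<open>Send \<open>b\<close> to a nonzero element annihilated by the order of \<open>b\<close>,
  then extend along \<open>subgrp_induct\<close>; divisibility supplies the value at each new
  generator.\<close>

lemma separating_hom:
 fixes b :: "'a::ab_group_add"
 assumes fin: "finite (UNIV :: 'a set)" and dv: "divisible TYPE('b::ab_group_add)"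
  and tors: "!!n. n > 1 ==> \<exists>r::'b::ab_group_add. r ~= 0 \<and> nscale n r = 0" and b: "b ~= 0"
 obtains f :: "'a => 'b::ab_group_add" where "!!x y. f (x + y) = f x + f y" "f b ~= 0"
proof -
 let ?P = "\<lambda>H. \<exists>f :: 'a => 'b. (\<forall>x\<in>H. \<forall>y\<in>H. f (x + y) = f x + f y) \<and> f b ~= 0"
 \<comment> \<open>Over the trivial subgroup, \<open>b.N\<close> is the order of
   \<open>b\<close>.\<close>
 interpret b: cyclic_ext "{0}" b by unfold_locales (use fin b subgrp_singleton_0 in auto)
 obtain r :: 'b where r: "r ~= 0" "nscale b.N r = 0" using tors[OF b.N_gt_1] by auto
 have "?P (adjoin {0} b)"
  by (rule b.hom_extend[of "\<lambda>_. 0" r]) (use r in auto)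
 have "?P UNIV"
 proof (rule subgrp_induct[OF fin b.adjoin_subgrp, where P = ?P])
  show "?P (adjoin {0} b)" by fact
 next
  fix H g assume H: "subgrp H" "adjoin {0} b \<subseteq> H" "?P H" "g \<notin> H"
  interpret ext: cyclic_ext H g by unfold_locales (use fin H in auto)
  from H obtain f :: "'a => 'b" where f: "!!x y. x \<in> H ==> y \<in> H ==> f (x + y) = f x + f y" "f b ~= 0" by auto
  obtain s where s: "nscale ext.N s = f (ext.e ext.N)" using dv ext.N(1) unfolding divisible_def by blast
  show "?P (adjoin H g)"
   by (rule ext.hom_extend[OF f(1) s]) (use f(2) b.g_adjoin H(2) in \<open>metis subsetD\<close>)+
 qed
 then show thesis using that by auto
qed

section \<open>Orthogonal automorphisms fixing the first summand\<close>

lemma character_nz [simp]: "ev \<phi> x ~= 0" and character_add: "ev \<phi> (x + y) = ev \<phi> x * ev \<phi> y"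
 using ev[of \<phi>] by auto

lemma character_0 [simp]: "ev \<phi> 0 = 1"
 using character_add[of \<phi> 0 0] by simp

lemma character_minus [simp]: "ev \<phi> (- x) = inverse (ev \<phi> x)"
 using character_add[of \<phi> x "- x"] by (simp add: field_simps)

locale quad_form =
 fixes q :: "'a::ab_group_add => 'k::field"
 assumes qf: "quadratic_form q"
begin

lemma q_nz [simp]: "q x ~= 0" and q_minus: "q (- x) = q x"
 and sigma_add_left: "sigma q (x + y) z = sigma q x z * sigma q y z"
 and sigma_add_right: "sigma q x (y + z) = sigma q x y * sigma q x z"
 using qf by (simp_all add: quadratic_form_def)

lemma sigma_nz [simp]: "sigma q x y ~= 0"
 by (simp add: sigma_def)

lemma q_add: "q (x + y) = q x * q y * sigma q x y"
 by (simp add: sigma_def)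

lemma sigma_commute: "sigma q x y = sigma q y x"
 by (simp add: sigma_def add.commute mult.commute)

lemma sigma_0 [simp]: "sigma q 0 x = 1" "sigma q x 0 = 1"
proof -
 show "sigma q 0 x = 1" using sigma_add_left[of 0 0 x] by simp
 then show "sigma q x 0 = 1" by (simp add: sigma_commute)
qed

lemma q_0 [simp]: "q 0 = 1"
 using q_add[of 0 0] by simp

text \<open>Both \<open>sigma q x x\<close> and \<open>q x * q x\<close> are inverse to
  \<open>sigma q x (- x)\<close>, the latter because \<open>q (- x) = q x\<close>.\<close>

lemma sigma_self: "sigma q x x = q x * q x"
proof -
 have "sigma q x x * sigma q x (- x) = 1" using sigma_add_right[of x x "- x"] by simp
 moreover have "q x * q x * sigma q x (- x) = 1" using q_add[of x "- x"] by (simp add: q_minus)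
 ultimately have "sigma q x x * sigma q x (- x) = (q x * q x) * sigma q x (- x)" by simp
 then show ?thesis by simp
qed

abbreviation "st \<equiv> sigma_tilde q"

lemma ev_st [simp]: "ev (st a) x = sigma q a x"
 by (rule ev_sigma_tilde[OF qf])

lemma dual_eqI: "(!!x. ev \<phi> x = ev \<psi> x) ==> \<phi> = \<psi>" for \<phi> \<psi> :: "('a, 'k) dual"
 by (simp add: ev_inject[symmetric] fun_eq_iff)

lemma st_add: "st (x + y) = st x + st y"
 by (rule dual_eqI) (simp add: plus_dual.rep_eq sigma_add_left)

lemma st_0 [simp]: "st 0 = 0"
 using st_add[of 0 0] by simp

lemma st_minus: "st (- x) = - st x"
 using st_add[of x "- x"] by (metis add.right_inverse minus_unique st_0)

lemma st_diff: "st (x - y) = st x - st y"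
 using st_add[of x "- y"] by (simp add: st_minus)

definition Q :: "'a \<times> ('a, 'k) dual => 'k" where
 "Q l = ev (snd l) (fst l) * q (fst l)"

text \<open>The orthogonal group of \<open>Q\<close>, cut down to the automorphisms that are the
  identity on the first summand. It is the image of the carrier of \<open>P_group q\<close> under
  \<open>alpha q\<close>.\<close>

definition O_fix :: "('a \<times> ('a, 'k) dual => 'a \<times> ('a, 'k) dual) set" where
 "O_fix = {\<beta>. bij \<beta> \<and> (\<forall>l m. \<beta> (l + m) = \<beta> l + \<beta> m) \<and> (\<forall>l. Q (\<beta> l) = Q l) \<and> (\<forall>a. \<beta> (a, 0) = (a, 0))}"

text \<open>The bimultiplicative form of \<open>Q\<close> pairs \<open>(a, 0)\<close> with
  \<open>(b, \<phi>)\<close> to \<open>ev \<phi> a * sigma q a b\<close>. Hence the pairings with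
  all \<open>(a, 0)\<close> determine \<open>\<phi>\<close> once \<open>b\<close> is known.\<close>

lemma Q_cross: "Q ((a, 0) + l) = q a * Q l * ev (snd l) a * sigma q a (fst l)"
 by (cases l) (simp add: Q_def character_add q_add sigma_commute[of a] ac_simps)

lemma P_carrier: "f \<in> carrier (P_group q) \<longleftrightarrow> (\<forall>\<phi> \<psi>. f (\<phi> + \<psi>) = f \<phi> + f \<psi>) \<and>
  bij (\<lambda>\<phi>. \<phi> - st (f \<phi>)) \<and> (\<forall>\<phi>. ev \<phi> (f \<phi>) = q (f \<phi>))"
 by (simp add: P_group_def)

text \<open>In \<open>Q (alpha q f l)\<close> the mixed terms cancel by symmetry of
  \<open>sigma\<close>. What remains beside \<open>Q l\<close> is \<open>ev \<phi> (f \<phi>) * q (f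
  \<phi>) / sigma q (f \<phi>) (f \<phi>)\<close>, which is 1 by the last condition on
  \<open>f\<close> and \<open>sigma_self\<close>.\<close>

lemma alpha_in_O_fix:
 assumes "f \<in> carrier (P_group q)"
 shows "alpha q f \<in> O_fix"
proof -
 from assms have add: "!!\<phi> \<psi>. f (\<phi> + \<psi>) = f \<phi> + f \<psi>" and b: "bij (\<lambda>\<phi>. \<phi> - st (f \<phi>))"
  and iso: "!!\<phi>. ev \<phi> (f \<phi>) = q (f \<phi>)" by (auto simp: P_carrier)
 have f0: "f 0 = 0" using add[of 0 0] by simp
 have "bij (alpha q f)"
 proof (rule bijI)
  show "inj (alpha q f)"
  proof (rule injI)
   fix l m assume eq: "alpha q f l = alpha q f m"
   then have "snd l - st (f (snd l)) = snd m - st (f (snd m))"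
    by (simp add: alpha_def split: prod.splits)
   then have "snd l = snd m" using bij_is_inj[OF b] by (auto dest: injD)
   with eq show "l = m" by (auto simp: alpha_def prod_eq_iff split: prod.splits)
  qed
  show "surj (alpha q f)"
   unfolding surj_def
  proof
   fix l :: "'a \<times> ('a, 'k) dual"
   obtain \<phi> where "snd l = \<phi> - st (f \<phi>)" using surjD[OF bij_is_surj[OF b]] by blast
   then have "l = alpha q f (fst l - f \<phi>, \<phi>)" by (simp add: alpha_def prod_eq_iff)
   then show "\<exists>m. l = alpha q f m" by blast
  qed
 qed
 moreover have "alpha q f (l + m) = alpha q f l + alpha q f m" for l m
  by (cases l; cases m) (simp add: alpha_def add st_add algebra_simps)
 moreover have "Q (alpha q f l) = Q l" for l
 proof (cases l)
  case (Pair a \<phi>)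
  have "Q (alpha q f l) = ev \<phi> a * ev \<phi> (f \<phi>) * (q a * q (f \<phi>) * sigma q a (f \<phi>)) /
    (sigma q (f \<phi>) a * sigma q (f \<phi>) (f \<phi>))"
   by (simp add: Pair alpha_def Q_def minus_dual.rep_eq character_add q_add sigma_add_right)
  also have "\<dots> = ev \<phi> a * q a"
   by (simp add: iso sigma_self sigma_commute[of "f \<phi>" a])
  finally show ?thesis by (simp add: Pair Q_def)
 qed
 moreover have "alpha q f (a, 0) = (a, 0)" for a by (simp add: alpha_def f0)
 ultimately show ?thesis unfolding O_fix_def by blast
qed

lemma O_fix_eq_alpha:
 assumes "\<beta> \<in> O_fix"
 obtains f where "f \<in> carrier (P_group q)" "\<beta> = alpha q f"
proof -
 from assms have b: "bij \<beta>" and add: "!!l m. \<beta> (l + m) = \<beta> l + \<beta> m" and QQ: "!!l. Q (\<beta> l) = Q l"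
  and fix1: "!!a. \<beta> (a, 0) = (a, 0)" by (auto simp: O_fix_def)
 define f where "f \<phi> = fst (\<beta> (0, \<phi>))" for \<phi>
 define h where "h \<phi> = snd (\<beta> (0, \<phi>))" for \<phi>
 have \<beta>: "\<beta> (a, \<phi>) = (a + f \<phi>, h \<phi>)" for a \<phi>
  using add[of "(a, 0)" "(0, \<phi>)"] by (simp add: fix1 f_def h_def prod_eq_iff)
 \<comment> \<open>\<open>\<beta>\<close> preserves \<open>Q\<close> and fixes
   \<open>(a, 0)\<close>, hence it preserves the pairing of \<open>(a, 0)\<close> with
   \<open>(0, \<phi>)\<close>; by \<open>Q_cross\<close> this determines the second component of the
   image.\<close>
 have hs: "ev \<phi> a = ev (h \<phi>) a * sigma q a (f \<phi>)" for a \<phi>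
 proof -
  have Q0: "Q (0, \<phi>) = 1" by (simp add: Q_def)
  have "Q (\<beta> ((a, 0) + (0, \<phi>))) = Q ((a, 0) + (0, \<phi>))" by (rule QQ)
  then have "Q ((a, 0) + \<beta> (0, \<phi>)) = Q ((a, 0) + (0, \<phi>))" by (simp only: add fix1)
  then show ?thesis
   unfolding Q_cross QQ Q0 by (simp add: \<beta>)
 qed
 have "ev (h \<phi>) a = ev (\<phi> - st (f \<phi>)) a" for a \<phi>
  unfolding minus_dual.rep_eq ev_st by (subst hs) (simp add: sigma_commute[of "f \<phi>" a])
 then have h: "h \<phi> = \<phi> - st (f \<phi>)" for \<phi> by (intro dual_eqI)
 have \<beta>_eq: "\<beta> = alpha q f" by (intro ext) (auto simp: \<beta> alpha_def h)
 have f_add: "f (\<phi> + \<psi>) = f \<phi> + f \<psi>" for \<phi> \<psi>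
  using add[of "(0, \<phi>)" "(0, \<psi>)"] by (simp add: \<beta>)
 have "bij h"
 proof (rule bijI)
  show "inj h"
  proof (rule injI)
   fix \<phi> \<psi> assume "h \<phi> = h \<psi>"
   \<comment> \<open>The first entries are chosen so that both images have first component
     0.\<close>
   then have "\<beta> (- f \<phi>, \<phi>) = \<beta> (- f \<psi>, \<psi>)" by (simp add: \<beta>)
   with b show "\<phi> = \<psi>" by (auto dest: injD[OF bij_is_inj])
  qed
  show "surj h"
  proof (rule surjI)
   fix \<psi>
   have "\<beta> (Hilbert_Choice.inv \<beta> (0, \<psi>)) = (0, \<psi>)" using b by (simp add: surj_f_inv_f bij_is_surj)
   then show "h (snd (Hilbert_Choice.inv \<beta> (0, \<psi>))) = \<psi>"
    using \<beta>[of "fst (Hilbert_Choice.inv \<beta> (0, \<psi>))" "snd (Hilbert_Choice.inv \<beta> (0, \<psi>))"] by simp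
  qed
 qed
 moreover have "ev \<phi> (f \<phi>) = q (f \<phi>)" for \<phi>
 proof -
  have "Q (\<beta> (0, \<phi>)) = 1" by (simp add: QQ) (simp add: Q_def)
  then show ?thesis by (simp add: \<beta> h Q_def minus_dual.rep_eq sigma_self frac_eq_eq)
 qed
 ultimately have "f \<in> carrier (P_group q)" using f_add by (simp add: P_carrier h[abs_def])
 with \<beta>_eq show thesis by (intro that)
qed

text \<open>The operation on \<open>P_group q\<close> is composition read through
  \<open>alpha q\<close>; the correction term comes from the second component of
  \<open>alpha q g\<close>.\<close>

lemma alpha_mult:
 assumes "f \<in> carrier (P_group q)"
 shows "alpha q (f \<otimes>\<^bsub>P_group q\<^esub> g) = alpha q f \<circ> alpha q g"
proof -
 from assms have add: "!!\<phi> \<psi>. f (\<phi> + \<psi>) = f \<phi> + f \<psi>" by (auto simp: P_carrier)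
 have diff: "f (\<phi> - \<psi>) = f \<phi> - f \<psi>" for \<phi> \<psi>
  using add[of "\<phi> - \<psi>" \<psi>] by (simp only: diff_add_cancel) simp
 show ?thesis
  by (intro ext) (auto simp: alpha_def P_group_def st_add st_diff diff algebra_simps)
qed

lemma alpha_inject: "alpha q f = alpha q g \<longleftrightarrow> f = g"
proof
 assume "alpha q f = alpha q g"
 then have "alpha q f (0, \<phi>) = alpha q g (0, \<phi>)" for \<phi> by simp
 then show "f = g" by (intro ext) (simp add: alpha_def)
qed simp

lemma O_fix_comp: "\<alpha> \<in> O_fix ==> \<beta> \<in> O_fix ==> \<alpha> \<circ> \<beta> \<in> O_fix"
 unfolding O_fix_def by (simp add: bij_comp del: split_paired_All)

lemma O_fix_inv:
 assumes "\<beta> \<in> O_fix" shows "Hilbert_Choice.inv \<beta> \<in> O_fix"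
proof -
 let ?i = "Hilbert_Choice.inv \<beta>"
 from assms have b: "bij \<beta>" and add: "!!l m. \<beta> (l + m) = \<beta> l + \<beta> m" and QQ: "!!l. Q (\<beta> l) = Q l"
  and fix1: "!!a. \<beta> (a, 0) = (a, 0)" by (auto simp: O_fix_def)
 have i: "\<beta> (?i l) = l" "?i (\<beta> l) = l" for l
  using b by (simp_all add: surj_f_inv_f bij_is_surj inv_f_f bij_is_inj)
 show ?thesis unfolding O_fix_def
 proof (intro CollectI conjI allI)
  show "bij ?i" using b by (rule bij_imp_bij_inv)
  show "?i (l + m) = ?i l + ?i m" for l m by (metis add i)
  show "Q (?i l) = Q l" for l by (metis QQ i(1))
  show "?i (a, 0) = (a, 0)" for a by (metis fix1 i(2))
 qed
qed

text \<open>\<open>alpha q\<close> maps the carrier injectively onto \<open>O_fix\<close>, so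
  closure, associativity and inverses are those of composition of maps; \<open>in_iff\<close> is the
  way back from \<open>O_fix\<close> to the carrier.\<close>

theorem group_P: "group (P_group q)"
proof (rule groupI)
 have one: "\<one>\<^bsub>P_group q\<^esub> = (\<lambda>_. 0)" by (simp add: P_group_def)
 show one_in: "\<one>\<^bsub>P_group q\<^esub> \<in> carrier (P_group q)"
  unfolding one P_carrier by (simp add: bij_id[unfolded id_def])
 have in_iff: "f \<in> carrier (P_group q)" if ab: "alpha q f \<in> O_fix" for f
 proof -
  obtain f' where "f' \<in> carrier (P_group q)" "alpha q f = alpha q f'" using O_fix_eq_alpha[OF ab] by metis
  then show ?thesis by (simp add: alpha_inject)
 qed
 show mult_in: "f \<otimes>\<^bsub>P_group q\<^esub> g \<in> carrier (P_group q)" if "f \<in> carrier (P_group q)" "g \<in> carrier (P_group q)" for f g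
  using that by (intro in_iff) (simp add: alpha_mult O_fix_comp alpha_in_O_fix)
 show "f \<otimes>\<^bsub>P_group q\<^esub> g \<otimes>\<^bsub>P_group q\<^esub> h = f \<otimes>\<^bsub>P_group q\<^esub> (g \<otimes>\<^bsub>P_group q\<^esub> h)"
  if "f \<in> carrier (P_group q)" "g \<in> carrier (P_group q)" "h \<in> carrier (P_group q)" for f g h
  using that by (subst alpha_inject[symmetric]) (simp add: alpha_mult mult_in comp_assoc)
 show "\<one>\<^bsub>P_group q\<^esub> \<otimes>\<^bsub>P_group q\<^esub> f = f" for f
  by (simp add: P_group_def)
 have alpha_1: "alpha q \<one>\<^bsub>P_group q\<^esub> = id"
  by (auto simp: one alpha_def fun_eq_iff)
 show "\<exists>g\<in>carrier (P_group q). g \<otimes>\<^bsub>P_group q\<^esub> f = \<one>\<^bsub>P_group q\<^esub>" if f: "f \<in> carrier (P_group q)" for f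
 proof -
  have \<alpha>: "alpha q f \<in> O_fix" by (rule alpha_in_O_fix[OF f])
  obtain g where g: "g \<in> carrier (P_group q)" "Hilbert_Choice.inv (alpha q f) = alpha q g"
   using O_fix_eq_alpha[OF O_fix_inv[OF \<alpha>]] by metis
  have "inj (alpha q f)" using \<alpha> by (simp add: O_fix_def bij_is_inj)
  then have "alpha q (g \<otimes>\<^bsub>P_group q\<^esub> f) = alpha q \<one>\<^bsub>P_group q\<^esub>"
   by (simp only: alpha_mult[OF g(1)] alpha_1 g(2)[symmetric] inv_o_cancel)
  with g(1) show ?thesis by (auto simp: alpha_inject)
 qed
qed

end

section \<open>Typed morphisms\<close>

text \<open>Composition of typed morphisms is total, with value \<open>Null\<close> for pairs that are not composable; this
 makes its associativity unconditional.\<close>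

datatype ('o, 'm) arrow = Null | Arrow (src: 'o) (mor: 'm) (tgt: 'o)

definition valid :: "('o, 'm, 'z) cat_scheme => ('o, 'm) arrow => bool" where
 "valid C f \<longleftrightarrow> f ~= Null \<and> mor f \<in> Hom C (src f) (tgt f)"

definition Ar :: "('o, 'm, 'z) cat_scheme => 'o => 'o => ('o, 'm) arrow set" where
 "Ar C X Y = {f. valid C f \<and> src f = X \<and> tgt f = Y}"

definition acomp :: "('o, 'm, 'z) cat_scheme => ('o, 'm) arrow => ('o, 'm) arrow => ('o, 'm) arrow"
  (infixr "**\<index>" 70) where
 "g **\<^bsub>C\<^esub> f = (if valid C f \<and> valid C g \<and> tgt f = src g
   then Arrow (src f) (mor g \<cdot>\<^bsub>C\<^esub> mor f) (tgt g) else Null)"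

definition idt :: "('o, 'm, 'z) cat_scheme => 'o => ('o, 'm) arrow" where
 "idt C X = Arrow X (Id C X) X"

definition azero :: "('o, 'm, 'k, 'z) lin_cat_scheme => 'o => 'o => ('o, 'm) arrow" where
 "azero C X Y = Arrow X (Zero C X Y) Y"

definition aadd :: "('o, 'm, 'k, 'z) lin_cat_scheme => ('o, 'm) arrow => ('o, 'm) arrow => ('o, 'm) arrow"
  (infixl "\<boxplus>\<index>" 65) where
 "f \<boxplus>\<^bsub>C\<^esub> g = (if valid C f \<and> valid C g \<and> src f = src g \<and> tgt f = tgt g
   then Arrow (src f) (Add C (mor f) (mor g)) (tgt f) else Null)"

definition asmult :: "('o, 'm, 'k, 'z) lin_cat_scheme => 'k => ('o, 'm) arrow => ('o, 'm) arrow"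
  (infixr "\<odot>\<^sub>s\<index>" 73) where
 "asmult C c f = (if valid C f then Arrow (src f) (Smult C c (mor f)) (tgt f) else Null)"

definition aten :: "('o, 'm, 'k, 'z) btc_scheme => ('o, 'm) arrow => ('o, 'm) arrow => ('o, 'm) arrow"
  (infixr "\<otimes>\<^sub>a\<index>" 75) where
 "f \<otimes>\<^sub>a\<^bsub>C\<^esub> g = (if valid C f \<and> valid C g
   then Arrow (src f \<boxtimes>\<^bsub>C\<^esub> src g) (mor f \<odot>\<^bsub>C\<^esub> mor g) (tgt f \<boxtimes>\<^bsub>C\<^esub> tgt g) else Null)"

definition inverse_arrows :: "('o, 'm, 'z) cat_scheme => ('o, 'm) arrow => ('o, 'm) arrow => bool" where
 "inverse_arrows C f g \<longleftrightarrow> valid C f \<and> valid C g \<and> src g = tgt f \<and> tgt g = src f \<and>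
   g **\<^bsub>C\<^esub> f = idt C (src f) \<and> f **\<^bsub>C\<^esub> g = idt C (tgt f)"

definition aiso :: "('o, 'm, 'z) cat_scheme => ('o, 'm) arrow => bool" where
 "aiso C f \<longleftrightarrow> (\<exists>g. inverse_arrows C f g)"

definition ainv :: "('o, 'm, 'z) cat_scheme => ('o, 'm) arrow => ('o, 'm) arrow" where
 "ainv C f = (SOME g. inverse_arrows C f g)"

text \<open>Sums of composites \<open>g ** p\<close> with \<open>g\<close> in \<open>G\<close> and
  arbitrary \<open>p\<close>, a right ideal of morphisms. Scalars are absorbed by
  \<open>p\<close>.\<close>

inductive_set Span ::
 "('o, 'm, 'k, 'z) lin_cat_scheme => ('o, 'm) arrow set => 'o => 'o => ('o, 'm) arrow set"
 for C G X Y where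
 zero: "X \<in> Ob C ==> Y \<in> Ob C ==> azero C X Y \<in> Span C G X Y"
| comp: "g \<in> G ==> valid C g ==> tgt g = Y ==> valid C p ==> src p = X ==> tgt p = src g
  ==> g **\<^bsub>C\<^esub> p \<in> Span C G X Y"
| add: "f \<in> Span C G X Y ==> h \<in> Span C G X Y ==> f \<boxplus>\<^bsub>C\<^esub> h \<in> Span C G X Y"

text \<open>Joint epimorphy in an absolute form: the identity is a finite sum of maps through
  members of \<open>G\<close>. In this form the property passes through linear functors and tensor
  products, which joint epimorphy alone need not do.\<close>

definition covers :: "('o, 'm, 'k, 'z) lin_cat_scheme => 'o => ('o, 'm) arrow set => bool" where
 "covers C Z G \<longleftrightarrow> Z \<in> Ob C \<and> idt C Z \<in> Span C G Z Z"

context category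
begin

lemma Ar_iff: "f \<in> Ar C X Y \<longleftrightarrow> valid C f \<and> src f = X \<and> tgt f = Y"
 by (simp add: Ar_def)

lemma valid_Ob [simp]: "valid C f ==> src f \<in> Ob C" "valid C f ==> tgt f \<in> Ob C"
 using Hom_Ob by (auto simp: valid_def)

lemma not_valid_Null [simp]: "\<not> valid C Null"
 by (simp add: valid_def)

lemma arrow_eqI: "valid C f ==> valid C g ==> src f = src g ==> tgt f = tgt g ==> mor f = mor g ==> f = g"
 by (cases f; cases g) auto

lemma mor_in_Hom: "valid C f ==> mor f \<in> Hom C (src f) (tgt f)"
 by (simp add: valid_def)

lemma mor_in_Hom' [simp]: "valid C f ==> src f = X ==> tgt f = Y ==> mor f \<in> Hom C X Y"
 by (auto simp: valid_def)

lemma valid_Arrow [simp]: "valid C (Arrow X f Y) \<longleftrightarrow> f \<in> Hom C X Y"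
 by (simp add: valid_def)

lemma Arrow_mor [simp]: "valid C f ==> Arrow (src f) (mor f) (tgt f) = f"
 by (cases f) auto

lemma valid_acomp [simp]: "valid C (g ** f) \<longleftrightarrow> valid C f \<and> valid C g \<and> tgt f = src g"
 by (auto simp: acomp_def valid_def intro: Comp_in_Hom)

lemma src_acomp [simp]: "valid C f ==> valid C g ==> tgt f = src g ==> src (g ** f) = src f"
 and tgt_acomp [simp]: "valid C f ==> valid C g ==> tgt f = src g ==> tgt (g ** f) = tgt g"
 and mor_acomp: "valid C f ==> valid C g ==> tgt f = src g ==> mor (g ** f) = mor g \<cdot> mor f"
 by (simp_all add: acomp_def)

lemma acomp_assoc: "(h ** g) ** f = h ** g ** f"
proof (cases "valid C f \<and> valid C g \<and> valid C h \<and> tgt f = src g \<and> tgt g = src h")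
 case True
 then show ?thesis
  using Comp_assoc[of "mor f" "src f" "tgt f" "mor g" "tgt g" "mor h" "tgt h"] mor_in_Hom[of f] mor_in_Hom[of g] mor_in_Hom[of h]
  by (intro arrow_eqI) (simp_all add: mor_acomp)
next
 case False
 then have "\<not> valid C ((h ** g) ** f)" "\<not> valid C (h ** g ** f)" by auto
 then show ?thesis by (metis acomp_def valid_acomp)
qed

text \<open>Composites are kept associated to the right; in this shape an equation can act at the
  head of a longer composite.\<close>

lemma reassoc: "a ** b = c ==> a ** b ** x = c ** x"
 by (simp flip: acomp_assoc)

lemma valid_idt [simp]: "valid C (idt C X) \<longleftrightarrow> X \<in> Ob C"
 using Hom_Ob Id_in_Hom by (auto simp: valid_def idt_def)

lemma src_idt [simp]: "src (idt C X) = X" and tgt_idt [simp]: "tgt (idt C X) = X"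
 and mor_idt: "mor (idt C X) = Id C X"
 by (simp_all add: idt_def)

lemma acomp_idt [simp]: "valid C f ==> src f = X ==> f ** idt C X = f"
 using Comp_Id[OF mor_in_Hom, of f] by (intro arrow_eqI) (auto simp: mor_acomp mor_idt)

lemma idt_acomp [simp]: "valid C f ==> tgt f = X ==> idt C X ** f = f"
 using Id_Comp[OF mor_in_Hom, of f] by (intro arrow_eqI) (auto simp: mor_acomp mor_idt)

lemma idt_acomp' [simp]: "valid C f ==> tgt f = X ==> idt C X ** f ** x = f ** x"
 by (simp flip: acomp_assoc)

lemma inverse_arrows_iff: "inverse_arrows C f g \<longleftrightarrow>
  valid C f \<and> valid C g \<and> src g = tgt f \<and> tgt g = src f \<and> inverse_mors C (src f) (tgt f) (mor f) (mor g)"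
 (is "?L \<longleftrightarrow> ?R")
proof
 assume ?L
 then show ?R
  unfolding inverse_arrows_def inverse_mors_def
  by (auto simp: valid_def acomp_def idt_def)
next
 assume R: ?R
 then have "g ** f = idt C (src f)" "f ** g = idt C (tgt f)"
  by (auto intro!: arrow_eqI simp: mor_acomp mor_idt inverse_mors_def)
 with R show ?L by (simp add: inverse_arrows_def)
qed

lemma inverse_arrows_unique: "inverse_arrows C f g ==> inverse_arrows C f h ==> g = h"
 unfolding inverse_arrows_def by (metis acomp_assoc acomp_idt idt_acomp)

lemma inverse_arrows_sym: "inverse_arrows C f g \<longleftrightarrow> inverse_arrows C g f"
 unfolding inverse_arrows_def by metis

lemma inverse_arrows_ainv: "aiso C f ==> inverse_arrows C f (ainv C f)"
 unfolding aiso_def ainv_def by (rule someI_ex)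

lemma ainv_eqI: "inverse_arrows C f g ==> ainv C f = g"
 using inverse_arrows_ainv inverse_arrows_unique aiso_def by metis

lemma aiso_valid [simp]: "aiso C f ==> valid C f"
 by (auto simp: aiso_def inverse_arrows_def)

lemma ainv_simps [simp]:
 assumes "aiso C f"
 shows "valid C (ainv C f)" "src (ainv C f) = tgt f" "tgt (ainv C f) = src f"
  "ainv C f ** f = idt C (src f)" "f ** ainv C f = idt C (tgt f)"
 using inverse_arrows_ainv[OF assms] by (simp_all add: inverse_arrows_def)

lemma ainv_cancel [simp]:
 assumes "aiso C f"
 shows "valid C x ==> tgt x = src f ==> ainv C f ** f ** x = x"
  "valid C x ==> tgt x = tgt f ==> f ** ainv C f ** x = x"
 using assms by (simp_all flip: acomp_assoc)

lemma aiso_ainv [simp]: "aiso C f ==> aiso C (ainv C f)"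
 using inverse_arrows_ainv[of f] inverse_arrows_sym[of f] unfolding aiso_def[of C "ainv C f"] by blast

lemma ainv_ainv [simp]: "aiso C f ==> ainv C (ainv C f) = f"
 by (rule ainv_eqI, subst inverse_arrows_sym, rule inverse_arrows_ainv)

lemma aisoI: "valid C f ==> valid C g ==> src g = tgt f ==> tgt g = src f ==>
  g ** f = idt C (src f) ==> f ** g = idt C (tgt f) ==> aiso C f"
 unfolding aiso_def inverse_arrows_def by blast

lemma aiso_idt [simp]: "X \<in> Ob C ==> aiso C (idt C X)"
 by (rule aisoI[of _ "idt C X"]) simp_all

lemma aiso_acomp [simp]: "aiso C f ==> aiso C g ==> tgt f = src g ==> aiso C (g ** f)"
 by (rule aisoI[of _ "ainv C f ** ainv C g"]) (simp_all add: acomp_assoc)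

lemma aiso_monic: "aiso C f ==> f ** g = f ** h ==> valid C g ==> valid C h ==> tgt g = src f ==> tgt h = src f ==> g = h"
 by (metis ainv_cancel(1))

lemma aiso_epic: "aiso C f ==> g ** f = h ** f ==> valid C g ==> valid C h ==> src g = tgt f ==> src h = tgt f ==> g = h"
 by (metis acomp_assoc ainv_simps(5) acomp_idt)

lemma aiso_iff: "aiso C f \<longleftrightarrow> valid C f \<and> mor f \<in> Iso C (src f) (tgt f)"
proof
 assume "aiso C f"
 then show "valid C f \<and> mor f \<in> Iso C (src f) (tgt f)"
  unfolding aiso_def inverse_arrows_iff Iso_def by auto
next
 assume *: "valid C f \<and> mor f \<in> Iso C (src f) (tgt f)"
 then obtain g where "inverse_mors C (src f) (tgt f) (mor f) g" by (auto simp: Iso_def)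
 then have "inverse_arrows C f (Arrow (tgt f) g (src f))"
  using * by (auto simp: inverse_arrows_iff inverse_mors_def)
 then show "aiso C f" by (auto simp: aiso_def)
qed

lemma Iso_iff: "f \<in> Iso C X Y \<longleftrightarrow> aiso C (Arrow X f Y)"
 by (auto simp: aiso_iff Iso_def inverse_mors_def)

lemma Inv_eq:
 assumes "aiso C f" shows "Inv C (src f) (tgt f) (mor f) = mor (ainv C f)"
 unfolding Inv_def
proof (rule the_equality)
 show "inverse_mors C (src f) (tgt f) (mor f) (mor (ainv C f))"
  using inverse_arrows_ainv[OF assms] by (simp add: inverse_arrows_iff)
 fix g assume g: "inverse_mors C (src f) (tgt f) (mor f) g"
 then have "inverse_arrows C f (Arrow (tgt f) g (src f))"
  using assms by (auto simp: inverse_arrows_iff inverse_mors_def)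
 then show "g = mor (ainv C f)" by (auto dest: ainv_eqI)
qed

lemma isomorphic_iff: "isomorphic C X Y \<longleftrightarrow> (\<exists>f. aiso C f \<and> src f = X \<and> tgt f = Y)"
proof
 assume "isomorphic C X Y"
 then obtain f where "f \<in> Iso C X Y" by (auto simp: isomorphic_def)
 then show "\<exists>f. aiso C f \<and> src f = X \<and> tgt f = Y" by (intro exI[of _ "Arrow X f Y"]) (simp add: Iso_iff)
next
 assume "\<exists>f. aiso C f \<and> src f = X \<and> tgt f = Y"
 then show "isomorphic C X Y" by (auto simp: isomorphic_def aiso_iff)
qed

lemma isomorphic_refl: "X \<in> Ob C ==> isomorphic C X X"
 unfolding isomorphic_iff by (intro exI[of _ "idt C X"]) simp

lemma isomorphic_sym: "isomorphic C X Y ==> isomorphic C Y X"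
 unfolding isomorphic_iff by (blast intro: aiso_ainv ainv_simps(2,3))

lemma isomorphic_trans: "isomorphic C X Y ==> isomorphic C Y Z ==> isomorphic C X Z"
proof -
 assume "isomorphic C X Y" "isomorphic C Y Z"
 then obtain f g where "aiso C f" "src f = X" "tgt f = Y" "aiso C g" "src g = Y" "tgt g = Z"
  by (auto simp: isomorphic_iff)
 then have "aiso C (g ** f)" "src (g ** f) = X" "tgt (g ** f) = Z" by simp_all
 then show ?thesis unfolding isomorphic_iff by blast
qed

end

context linear_category
begin

lemma valid_azero [simp]: "valid C (azero C X Y) \<longleftrightarrow> X \<in> Ob C \<and> Y \<in> Ob C"
 using Hom_Ob Zero_in_Hom by (auto simp: azero_def)

lemma azero_simps [simp]: "src (azero C X Y) = X" "tgt (azero C X Y) = Y" "mor (azero C X Y) = Zero C X Y"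
 by (simp_all add: azero_def)

lemma valid_aadd [simp]: "valid C (f \<boxplus> g) \<longleftrightarrow> valid C f \<and> valid C g \<and> src f = src g \<and> tgt f = tgt g"
 by (auto simp: aadd_def valid_def Add_in_Hom)

lemma aadd_simps [simp]:
 assumes "valid C f" "valid C g" "src f = src g" "tgt f = tgt g"
 shows "src (f \<boxplus> g) = src g" "tgt (f \<boxplus> g) = tgt g"
 using assms by (simp_all add: aadd_def)

lemma mor_aadd:
 assumes "valid C f" "valid C g" "src f = src g" "tgt f = tgt g"
 shows "mor (f \<boxplus> g) = Add C (mor f) (mor g)"
 using assms by (simp_all add: aadd_def)

lemma valid_asmult [simp]: "valid C (c \<odot>\<^sub>s f) \<longleftrightarrow> valid C f"
 by (auto simp: asmult_def valid_def Smult_in_Hom)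

lemma asmult_simps [simp]:
 "valid C f ==> src (c \<odot>\<^sub>s f) = src f" "valid C f ==> tgt (c \<odot>\<^sub>s f) = tgt f"
 by (simp_all add: asmult_def)

lemma mor_asmult: "valid C f ==> mor (c \<odot>\<^sub>s f) = Smult C c (mor f)"
 by (simp add: asmult_def)

lemma aadd_assoc: "valid C f ==> valid C g ==> valid C h ==> src f = src g ==> tgt f = tgt g ==>
  src g = src h ==> tgt g = tgt h ==> (f \<boxplus> g) \<boxplus> h = f \<boxplus> (g \<boxplus> h)"
 by (intro arrow_eqI) (auto simp: mor_aadd Add_assoc[OF mor_in_Hom])

lemma aadd_commute: "f \<boxplus> g = g \<boxplus> f"
proof (cases "valid C f \<and> valid C g \<and> src f = src g \<and> tgt f = tgt g")
 case True
 then show ?thesis using Add_commute[of "mor f" "src f" "tgt f" "mor g"]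
  by (intro arrow_eqI) (simp_all add: mor_aadd)
next
 case False
 then have "f \<boxplus> g = Null" "g \<boxplus> f = Null" by (auto simp: aadd_def)
 then show ?thesis by simp
qed

lemma aadd_azero [simp]: "valid C f ==> src f = X ==> tgt f = Y ==> f \<boxplus> azero C X Y = f"
 by (intro arrow_eqI) (auto simp: mor_aadd Add_Zero[OF mor_in_Hom])

lemma azero_aadd [simp]: "valid C f ==> src f = X ==> tgt f = Y ==> azero C X Y \<boxplus> f = f"
 by (subst aadd_commute) simp

lemma asmult_0 [simp]: "valid C f ==> 0 \<odot>\<^sub>s f = azero C (src f) (tgt f)"
 by (intro arrow_eqI) (auto simp: mor_asmult Smult_zero[OF mor_in_Hom])

lemma asmult_1 [simp]: "valid C f ==> 1 \<odot>\<^sub>s f = f"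
 by (intro arrow_eqI) (auto simp: mor_asmult Smult_one[OF mor_in_Hom])

lemma asmult_asmult [simp]: "c \<odot>\<^sub>s d \<odot>\<^sub>s f = (c * d) \<odot>\<^sub>s f"
proof (cases "valid C f")
 case True
 then show ?thesis by (intro arrow_eqI) (auto simp: mor_asmult Smult_Smult[OF mor_in_Hom])
qed (simp add: asmult_def)

lemma asmult_add_left: "(c + d) \<odot>\<^sub>s f = c \<odot>\<^sub>s f \<boxplus> d \<odot>\<^sub>s f"
proof (cases "valid C f")
 case True
 then show ?thesis by (intro arrow_eqI) (auto simp: mor_asmult mor_aadd Smult_add_left[OF mor_in_Hom])
qed (simp add: asmult_def aadd_def)

lemma asmult_aadd: "c \<odot>\<^sub>s (f \<boxplus> g) = c \<odot>\<^sub>s f \<boxplus> c \<odot>\<^sub>s g"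
proof (cases "valid C f \<and> valid C g \<and> src f = src g \<and> tgt f = tgt g")
 case True
 then show ?thesis by (intro arrow_eqI) (auto simp: mor_asmult mor_aadd Smult_Add[OF mor_in_Hom])
qed (auto simp: asmult_def aadd_def)

lemma aadd_acomp: "(g \<boxplus> h) ** f = (g ** f) \<boxplus> (h ** f)"
proof (cases "valid C f \<and> valid C g \<and> valid C h \<and> src g = src h \<and> tgt g = tgt h \<and> tgt f = src g")
 case True
 then show ?thesis by (intro arrow_eqI) (auto simp: mor_acomp mor_aadd Comp_Add_left[OF mor_in_Hom mor_in_Hom'[OF _ _ refl]])
next
 case False
 then have "\<not> valid C ((g \<boxplus> h) ** f)" "\<not> valid C ((g ** f) \<boxplus> (h ** f))" by auto
 then show ?thesis by (metis aadd_def acomp_def valid_aadd valid_acomp)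
qed

lemma acomp_aadd: "h ** (f \<boxplus> g) = (h ** f) \<boxplus> (h ** g)"
proof (cases "valid C f \<and> valid C g \<and> valid C h \<and> src f = src g \<and> tgt f = tgt g \<and> tgt f = src h")
 case True
 then show ?thesis by (intro arrow_eqI) (auto simp: mor_acomp mor_aadd Comp_Add_right[OF mor_in_Hom _ mor_in_Hom'[OF _ _ refl]])
next
 case False
 then have "\<not> valid C (h ** (f \<boxplus> g))" "\<not> valid C ((h ** f) \<boxplus> (h ** g))" by auto
 then show ?thesis by (metis aadd_def acomp_def valid_aadd valid_acomp)
qed

lemma asmult_acomp [simp]: "(c \<odot>\<^sub>s g) ** f = c \<odot>\<^sub>s (g ** f)"
proof (cases "valid C f \<and> valid C g \<and> tgt f = src g")
 case True
 then show ?thesis by (intro arrow_eqI) (auto simp: mor_acomp mor_asmult Comp_Smult_left[OF mor_in_Hom mor_in_Hom'[OF _ _ refl]])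
qed (auto simp: asmult_def acomp_def)

lemma acomp_asmult [simp]: "g ** (c \<odot>\<^sub>s f) = c \<odot>\<^sub>s (g ** f)"
proof (cases "valid C f \<and> valid C g \<and> tgt f = src g")
 case True
 then show ?thesis by (intro arrow_eqI) (auto simp: mor_acomp mor_asmult Comp_Smult_right[OF mor_in_Hom mor_in_Hom'[OF _ _ refl]])
qed (auto simp: asmult_def acomp_def)

lemma acomp_azero [simp]: "valid C g ==> src g = Y ==> X \<in> Ob C ==> g ** azero C X Y = azero C X (tgt g)"
 using acomp_asmult[of g 0 "azero C X (src g)"] by (auto simp del: acomp_asmult)

lemma azero_acomp [simp]: "valid C f ==> tgt f = Y ==> Z \<in> Ob C ==> azero C Y Z ** f = azero C (src f) Z"
 using asmult_acomp[of 0 "azero C (tgt f) Z" f] by (auto simp del: asmult_acomp)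

lemma asmult_azero [simp]: "X \<in> Ob C ==> Y \<in> Ob C ==> c \<odot>\<^sub>s azero C X Y = azero C X Y"
 using asmult_asmult[of c 0 "azero C X Y"] by simp

lemma aadd_cancel: "valid C f ==> f \<boxplus> (- 1) \<odot>\<^sub>s f = azero C (src f) (tgt f)"
 using asmult_add_left[of 1 "- 1" f] by simp

lemma asmult_right_cancel:
 assumes "c \<odot>\<^sub>s f = d \<odot>\<^sub>s f" "valid C f" "f ~= azero C (src f) (tgt f)"
 shows "c = d"
proof (rule ccontr)
 assume "c ~= d"
 have "(c - d) \<odot>\<^sub>s f = d \<odot>\<^sub>s f \<boxplus> (- d) \<odot>\<^sub>s f"
  using asmult_add_left[of c "- d" f] assms(1) by simp
 also have "\<dots> = 0 \<odot>\<^sub>s f" using asmult_add_left[of d "- d" f] by simp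
 finally have "inverse (c - d) \<odot>\<^sub>s (c - d) \<odot>\<^sub>s f = inverse (c - d) \<odot>\<^sub>s 0 \<odot>\<^sub>s f" by metis
 with \<open>c ~= d\<close> assms show False by (auto simp: valid_Ob)
qed

lemma eq_if_diff_zero:
 assumes "valid C f" "valid C g" "src f = src g" "tgt f = tgt g" "f \<boxplus> (- 1) \<odot>\<^sub>s g = azero C (src f) (tgt f)"
 shows "f = g"
proof -
 have "g = (f \<boxplus> (- 1) \<odot>\<^sub>s g) \<boxplus> g" using assms by simp
 also have "\<dots> = f \<boxplus> (g \<boxplus> (- 1) \<odot>\<^sub>s g)" using assms(1-4) by (simp add: aadd_assoc aadd_commute[of "(- 1) \<odot>\<^sub>s g" g])
 also have "\<dots> = f" using assms by (simp add: aadd_cancel)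
 finally show ?thesis by simp
qed

lemma aiso_asmult [simp]: "aiso C f ==> c ~= 0 ==> aiso C (c \<odot>\<^sub>s f)"
 by (rule aisoI[of _ "inverse c \<odot>\<^sub>s ainv C f"]) simp_all

lemma Span_valid: "f \<in> Span C G X Y ==> valid C f \<and> src f = X \<and> tgt f = Y"
 by (induction rule: Span.induct) simp_all

lemma Span_mono: "f \<in> Span C G X Y ==> (!!g. g \<in> G ==> valid C g ==> tgt g = Y ==> g \<in> H) ==> f \<in> Span C H X Y"
 by (induction rule: Span.induct) (auto intro: Span.intros)

lemma Span_acomp_right:
 assumes "f \<in> Span C G X Y" "valid C x" "tgt x = X"
 shows "f ** x \<in> Span C G (src x) Y"
 using assms
proof (induction rule: Span.induct)
 case (comp g p)
 then show ?case by (auto simp: acomp_assoc intro: Span.comp)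
qed (auto simp: aadd_acomp intro: Span.intros)

lemma Span_acomp_left:
 assumes "f \<in> Span C G X Y" "valid C h" "src h = Y" "!!g. g \<in> G ==> valid C g ==> tgt g = Y ==> h ** g \<in> Span C H (src g) (tgt h)"
 shows "h ** f \<in> Span C H X (tgt h)"
 using assms
proof (induction rule: Span.induct)
 case (comp g p)
 then show ?case using Span_acomp_right[of "h ** g" H "src g" "tgt h" p] by (simp add: acomp_assoc)
qed (auto simp: acomp_aadd intro: Span.intros)

lemma Span_gen: "g \<in> G ==> valid C g ==> g \<in> Span C G (src g) (tgt g)"
 using Span.comp[of g G C "tgt g" "idt C (src g)" "src g"] by simp

lemma Span_asmult: "f \<in> Span C G X Y ==> c \<odot>\<^sub>s f \<in> Span C G X Y"
proof (induction rule: Span.induct)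
 case (comp g p)
 then have "g ** (c \<odot>\<^sub>s p) \<in> Span C G X Y" by (intro Span.comp) auto
 then show ?case by simp
qed (auto simp: asmult_aadd intro: Span.intros)

lemma covers_idt: "Z \<in> Ob C ==> idt C Z \<in> G ==> covers C Z G"
 unfolding covers_def using Span_gen[of "idt C Z" G] by simp

lemma covers_mono: "covers C Z G ==> (!!g. g \<in> G ==> valid C g ==> tgt g = Z ==> g \<in> H) ==> covers C Z H"
 unfolding covers_def using Span_mono by metis

lemma covers_trans:
 assumes "covers C Z G" "!!g. g \<in> G ==> valid C g ==> tgt g = Z ==> g \<in> Span C H (src g) Z"
 shows "covers C Z H"
 using assms Span_acomp_left[of "idt C Z" G Z Z "idt C Z" H] unfolding covers_def by simp

text \<open>The arrows \<open>h\<close> with \<open>f ** h = f' ** h\<close> are closed under sums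
  and precomposition; if they include \<open>G\<close>, they include the identity. Most equations
  between arrows out of tensor products are proved this way.\<close>

lemma covers_eqI:
 assumes "covers C Z G" "valid C f" "valid C f'" "src f = Z" "src f' = Z" "tgt f = tgt f'"
  and "!!g. g \<in> G ==> valid C g ==> tgt g = Z ==> f ** g = f' ** g"
 shows "f = f'"
proof -
 have "f ** h = f' ** h" if "h \<in> Span C G Z Z" for h
  using that
 proof (induction rule: Span.induct)
  case (comp g p)
  then show ?case using assms(7)[of g] by (simp flip: acomp_assoc)
 qed (use assms in \<open>auto simp: acomp_aadd\<close>)
 from this[of "idt C Z"] show ?thesis using assms by (simp add: covers_def)
qed

end

section \<open>Braided monoidal structure on typed morphisms\<close>

definition aass :: "('o, 'm, 'k, 'z) btc_scheme => 'o => 'o => 'o => ('o, 'm) arrow" where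
 "aass C X Y Z = Arrow ((X \<boxtimes>\<^bsub>C\<^esub> Y) \<boxtimes>\<^bsub>C\<^esub> Z) (Assoc C X Y Z) (X \<boxtimes>\<^bsub>C\<^esub> Y \<boxtimes>\<^bsub>C\<^esub> Z)"

definition abr :: "('o, 'm, 'k, 'z) btc_scheme => 'o => 'o => ('o, 'm) arrow" where
 "abr C X Y = Arrow (X \<boxtimes>\<^bsub>C\<^esub> Y) (Braid C X Y) (Y \<boxtimes>\<^bsub>C\<^esub> X)"

definition alu :: "('o, 'm, 'k, 'z) btc_scheme => 'o => ('o, 'm) arrow" where
 "alu C X = Arrow (Unit C \<boxtimes>\<^bsub>C\<^esub> X) (LUnit C X) X"

definition aru :: "('o, 'm, 'k, 'z) btc_scheme => 'o => ('o, 'm) arrow" where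
 "aru C X = Arrow (X \<boxtimes>\<^bsub>C\<^esub> Unit C) (RUnit C X) X"

context braided_monoidal_category
begin

declare TenOb_in_Ob [simp] Unit_in_Ob [simp]

abbreviation lwhisk (infixr "\<rhd>" 76) where "X \<rhd> f \<equiv> idt C X \<otimes>\<^sub>a f"
abbreviation rwhisk (infixl "\<lhd>" 76) where "f \<lhd> X \<equiv> f \<otimes>\<^sub>a idt C X"

lemma valid_aten [simp]: "valid C (f \<otimes>\<^sub>a g) \<longleftrightarrow> valid C f \<and> valid C g"
 by (auto simp: aten_def TenMor_in_Hom)

lemma src_aten [simp]: "valid C f ==> valid C g ==> src (f \<otimes>\<^sub>a g) = src f \<boxtimes> src g"
 and tgt_aten [simp]: "valid C f ==> valid C g ==> tgt (f \<otimes>\<^sub>a g) = tgt f \<boxtimes> tgt g"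
 and mor_aten: "valid C f ==> valid C g ==> mor (f \<otimes>\<^sub>a g) = mor f \<odot> mor g"
 by (simp_all add: aten_def)

lemma interchange: "tgt f = src f' ==> tgt g = src g' ==> (f' \<otimes>\<^sub>a g') ** (f \<otimes>\<^sub>a g) = (f' ** f) \<otimes>\<^sub>a (g' ** g)"
proof (cases "valid C f \<and> valid C f' \<and> valid C g \<and> valid C g'")
 case True
 assume "tgt f = src f'" "tgt g = src g'"
 with True show ?thesis
  using TenMor_Comp[of "mor f" "src f" "tgt f" "mor f'" "tgt f'" "mor g" "src g" "tgt g" "mor g'" "tgt g'"]
  by (intro arrow_eqI) (simp_all add: mor_acomp mor_aten)
next
 case False
 then have "\<not> valid C ((f' \<otimes>\<^sub>a g') ** (f \<otimes>\<^sub>a g))" "\<not> valid C ((f' ** f) \<otimes>\<^sub>a (g' ** g))" by auto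
 then show ?thesis by (metis acomp_def aten_def valid_acomp valid_aten)
qed

lemma interchange': "tgt f = src f' ==> tgt g = src g' ==>
  (f' \<otimes>\<^sub>a g') ** (f \<otimes>\<^sub>a g) ** x = ((f' ** f) \<otimes>\<^sub>a (g' ** g)) ** x"
 by (rule reassoc) (rule interchange)

lemma aten_idt [simp]: "X \<in> Ob C ==> Y \<in> Ob C ==> X \<rhd> idt C Y = idt C (X \<boxtimes> Y)"
 by (intro arrow_eqI) (simp_all add: mor_aten mor_idt TenMor_Id)

lemma aadd_aten:
 assumes "valid C f" "valid C g" "src f = src g" "tgt f = tgt g"
 shows "(f \<boxplus> g) \<otimes>\<^sub>a h = (f \<otimes>\<^sub>a h) \<boxplus> (g \<otimes>\<^sub>a h)"
proof (cases "valid C h")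
 case True
 with assms TenMor_Add_left[of "mor f" "src f" "tgt f" "mor g" "mor h" "src h" "tgt h"] show ?thesis
  by (intro arrow_eqI) (simp_all add: mor_aadd mor_aten)
qed (auto simp: aadd_def aten_def)

lemma aten_aadd:
 assumes "valid C g" "valid C h" "src g = src h" "tgt g = tgt h"
 shows "f \<otimes>\<^sub>a (g \<boxplus> h) = (f \<otimes>\<^sub>a g) \<boxplus> (f \<otimes>\<^sub>a h)"
proof (cases "valid C f")
 case True
 with assms TenMor_Add_right[of "mor f" "src f" "tgt f" "mor g" "src g" "tgt g" "mor h"] show ?thesis
  by (intro arrow_eqI) (simp_all add: mor_aadd mor_aten)
qed (auto simp: aadd_def aten_def)

lemma asmult_aten [simp]: "(c \<odot>\<^sub>s f) \<otimes>\<^sub>a g = c \<odot>\<^sub>s (f \<otimes>\<^sub>a g)"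
proof (cases "valid C f \<and> valid C g")
 case True
 with TenMor_Smult_left[of "mor f" "src f" "tgt f" "mor g" "src g" "tgt g"] show ?thesis
  by (intro arrow_eqI) (simp_all add: mor_asmult mor_aten)
qed (auto simp: asmult_def aten_def)

lemma aten_asmult [simp]: "f \<otimes>\<^sub>a (c \<odot>\<^sub>s g) = c \<odot>\<^sub>s (f \<otimes>\<^sub>a g)"
proof (cases "valid C f \<and> valid C g")
 case True
 with TenMor_Smult_right[of "mor f" "src f" "tgt f" "mor g" "src g" "tgt g"] show ?thesis
  by (intro arrow_eqI) (simp_all add: mor_asmult mor_aten)
qed (auto simp: asmult_def aten_def)

lemma azero_aten [simp]: "X \<in> Ob C ==> Y \<in> Ob C ==> valid C g ==>
  azero C X Y \<otimes>\<^sub>a g = azero C (X \<boxtimes> src g) (Y \<boxtimes> tgt g)"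
 using asmult_aten[of 0 "azero C X Y" g] by (simp del: asmult_aten)

lemma aten_azero [simp]: "X \<in> Ob C ==> Y \<in> Ob C ==> valid C g ==>
  g \<otimes>\<^sub>a azero C X Y = azero C (src g \<boxtimes> X) (tgt g \<boxtimes> Y)"
 using aten_asmult[of g 0 "azero C X Y"] by (simp del: aten_asmult)

lemma aiso_aten [simp]: "aiso C f ==> aiso C g ==> aiso C (f \<otimes>\<^sub>a g)"
 by (rule aisoI[of _ "ainv C f \<otimes>\<^sub>a ainv C g"]) (simp_all add: interchange)

lemma aass_simps [simp]:
 "src (aass C X Y Z) = (X \<boxtimes> Y) \<boxtimes> Z" "tgt (aass C X Y Z) = X \<boxtimes> Y \<boxtimes> Z"
 "X \<in> Ob C ==> Y \<in> Ob C ==> Z \<in> Ob C ==> aiso C (aass C X Y Z)"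
 using Assoc_Iso[of X Y Z] by (simp_all add: aass_def Iso_iff)

lemma abr_simps [simp]:
 "src (abr C X Y) = X \<boxtimes> Y" "tgt (abr C X Y) = Y \<boxtimes> X"
 "X \<in> Ob C ==> Y \<in> Ob C ==> aiso C (abr C X Y)"
 using Braid_Iso[of X Y] by (simp_all add: abr_def Iso_iff)

lemma alu_simps [simp]:
 "src (alu C X) = Unit C \<boxtimes> X" "tgt (alu C X) = X" "X \<in> Ob C ==> aiso C (alu C X)"
 using LUnit_Iso[of X] by (simp_all add: alu_def Iso_iff)

lemma aru_simps [simp]:
 "src (aru C X) = X \<boxtimes> Unit C" "tgt (aru C X) = X" "X \<in> Ob C ==> aiso C (aru C X)"
 using RUnit_Iso[of X] by (simp_all add: aru_def Iso_iff)

lemma valid_struct [simp]: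
 "X \<in> Ob C ==> Y \<in> Ob C ==> Z \<in> Ob C ==> valid C (aass C X Y Z)"
 "X \<in> Ob C ==> Y \<in> Ob C ==> valid C (abr C X Y)"
 "X \<in> Ob C ==> valid C (alu C X)" "X \<in> Ob C ==> valid C (aru C X)"
 by simp_all

lemma mor_struct: "mor (aass C X Y Z) = Assoc C X Y Z" "mor (abr C X Y) = Braid C X Y"
 "mor (alu C X) = LUnit C X" "mor (aru C X) = RUnit C X"
 by (simp_all add: aass_def abr_def alu_def aru_def)

lemma mor_ainv_aass: "X \<in> Ob C ==> Y \<in> Ob C ==> Z \<in> Ob C ==>
  Inv C ((X \<boxtimes> Y) \<boxtimes> Z) (X \<boxtimes> Y \<boxtimes> Z) (Assoc C X Y Z) = mor (ainv C (aass C X Y Z))"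
 using Inv_eq[of "aass C X Y Z"] by (simp add: mor_struct)

lemma aass_natural:
 assumes "valid C f" "valid C g" "valid C h" "tgt f = X'" "tgt g = Y'" "tgt h = Z'"
 shows "aass C X' Y' Z' ** ((f \<otimes>\<^sub>a g) \<otimes>\<^sub>a h) = (f \<otimes>\<^sub>a g \<otimes>\<^sub>a h) ** aass C (src f) (src g) (src h)"
 using assms Assoc_natural[of "mor f" "src f" X' "mor g" "src g" Y' "mor h" "src h" Z']
 by (intro arrow_eqI) (auto simp: mor_acomp mor_aten mor_struct)

lemma aass_natural_inv:
 assumes "valid C f" "valid C g" "valid C h" "tgt f = X'" "tgt g = Y'" "tgt h = Z'"
 shows "ainv C (aass C X' Y' Z') ** (f \<otimes>\<^sub>a g \<otimes>\<^sub>a h) = ((f \<otimes>\<^sub>a g) \<otimes>\<^sub>a h) ** ainv C (aass C (src f) (src g) (src h))"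
proof (rule aiso_monic[of "aass C X' Y' Z'"])
 show "aass C X' Y' Z' ** ainv C (aass C X' Y' Z') ** (f \<otimes>\<^sub>a g \<otimes>\<^sub>a h) =
   aass C X' Y' Z' ** ((f \<otimes>\<^sub>a g) \<otimes>\<^sub>a h) ** ainv C (aass C (src f) (src g) (src h))"
  using assms by (auto simp: reassoc[OF aass_natural] acomp_assoc)
qed (use assms in auto)

lemma abr_natural:
 assumes "valid C f" "valid C g" "tgt f = X'" "tgt g = Y'"
 shows "abr C X' Y' ** (f \<otimes>\<^sub>a g) = (g \<otimes>\<^sub>a f) ** abr C (src f) (src g)"
 using assms Braid_natural[of "mor f" "src f" X' "mor g" "src g" Y']
 by (intro arrow_eqI) (auto simp: mor_acomp mor_aten mor_struct)

lemma alu_natural: "valid C f ==> alu C (tgt f) ** (Unit C \<rhd> f) = f ** alu C (src f)"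
 using LUnit_natural[of "mor f" "src f" "tgt f"]
 by (intro arrow_eqI) (auto simp: mor_acomp mor_aten mor_struct mor_idt)

lemma aru_natural: "valid C f ==> aru C (tgt f) ** (f \<lhd> Unit C) = f ** aru C (src f)"
 using RUnit_natural[of "mor f" "src f" "tgt f"]
 by (intro arrow_eqI) (auto simp: mor_acomp mor_aten mor_struct mor_idt)

lemma a_pentagon:
 assumes "W \<in> Ob C" "X \<in> Ob C" "Y \<in> Ob C" "Z \<in> Ob C"
 shows "aass C W X (Y \<boxtimes> Z) ** aass C (W \<boxtimes> X) Y Z =
   (W \<rhd> aass C X Y Z) ** aass C W (X \<boxtimes> Y) Z ** (aass C W X Y \<lhd> Z)"
 using assms pentagon[of W X Y Z]
 by (intro arrow_eqI) (auto simp: mor_acomp mor_aten mor_struct mor_idt)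

lemma a_triangle:
 assumes "X \<in> Ob C" "Y \<in> Ob C"
 shows "(X \<rhd> alu C Y) ** aass C X (Unit C) Y = aru C X \<lhd> Y"
 using assms triangle[of X Y]
 by (intro arrow_eqI) (auto simp: mor_acomp mor_aten mor_struct mor_idt)

lemma a_hexagon1:
 assumes "X \<in> Ob C" "Y \<in> Ob C" "Z \<in> Ob C"
 shows "aass C Y Z X ** abr C X (Y \<boxtimes> Z) ** aass C X Y Z =
   (Y \<rhd> abr C X Z) ** aass C Y X Z ** (abr C X Y \<lhd> Z)"
 using assms hexagon1[of X Y Z]
 by (intro arrow_eqI) (auto simp: mor_acomp mor_aten mor_struct mor_idt)

lemma a_hexagon2:
 assumes "X \<in> Ob C" "Y \<in> Ob C" "Z \<in> Ob C"
 shows "abr C (X \<boxtimes> Y) Z =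
   aass C Z X Y ** (abr C X Z \<lhd> Y) ** ainv C (aass C X Z Y) ** (X \<rhd> abr C Y Z) ** aass C X Y Z"
 using assms hexagon2[of X Y Z]
 by (intro arrow_eqI) (auto simp: mor_acomp mor_aten mor_struct mor_idt mor_ainv_aass)

text \<open>By bilinearity, with one induction for each factor.\<close>

lemma Span_aten:
 assumes s: "s \<in> Span C G X X'" and t: "t \<in> Span C H Y Y'"
 shows "s \<otimes>\<^sub>a t \<in> Span C {g \<otimes>\<^sub>a h | g h. g \<in> G \<and> h \<in> H \<and> valid C g \<and> valid C h \<and> tgt g = X' \<and> tgt h = Y'}
  (X \<boxtimes> Y) (X' \<boxtimes> Y')"
  (is "_ \<in> Span C ?K _ _")
 using s
proof (induction rule: Span.induct)
 case zero
 with Span_valid[OF t] show ?case by (auto intro: Span.zero)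
next
 case (add f h)
 with Span_valid[OF t] Span_valid[OF add(1)] Span_valid[OF add(2)] show ?case
  by (auto simp: aadd_aten intro: Span.add)
next
 case (comp g p)
 note gp = comp
 show ?case
  using t
 proof (induction rule: Span.induct)
  case zero
  with gp show ?case by (auto intro: Span.zero)
 next
  case (add f h)
  with Span_valid[OF add(1)] Span_valid[OF add(2)] show ?case
   by (auto simp: aten_aadd intro: Span.add)
 next
  case (comp g' p')
  then have "(g \<otimes>\<^sub>a g') ** (p \<otimes>\<^sub>a p') \<in> Span C ?K (X \<boxtimes> Y) (X' \<boxtimes> Y')"
   using gp by (intro Span.comp) auto
  then show ?case using comp gp by (simp add: interchange)
 qed
qed

lemma covers_aten:
 assumes "covers C X G" "covers C Y H"
 shows "covers C (X \<boxtimes> Y) {g \<otimes>\<^sub>a h | g h. g \<in> G \<and> h \<in> H \<and> valid C g \<and> valid C h \<and> tgt g = X \<and> tgt h = Y}"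
 using Span_aten[of "idt C X" G X X "idt C Y" H Y Y] assms by (simp add: covers_def)

end

section \<open>Cocycles with values in the units of a field\<close>

text \<open>Units in additive notation, so that the cocycle theory for \<open>ab_group_add\<close>
  applies to them.\<close>

typedef (overloaded) 'k munit = "{x :: 'k::field. x ~= 0}"
 morphisms mval Munit
 by (rule exI[of _ 1]) simp

setup_lifting type_definition_munit

instantiation munit :: (field) ab_group_add
begin

lift_definition zero_munit :: "'a munit" is 1 by simp
lift_definition plus_munit :: "'a munit => 'a munit => 'a munit" is "(*)" by simp
lift_definition uminus_munit :: "'a munit => 'a munit" is inverse by simp
lift_definition minus_munit :: "'a munit => 'a munit => 'a munit" is "(/)" by simp

instance
 by standard (transfer; simp add: ac_simps divide_inverse)+

end

lemma mval_nz [simp]: "mval x ~= 0"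
 using mval[of x] by simp

lemma mval_Munit [simp]: "x ~= 0 ==> mval (Munit x) = x"
 by (simp add: Munit_inverse)

lemma munit_eqI: "mval x = mval y ==> x = y"
 by (simp add: mval_inject)

lemma mval_nscale: "mval (nscale n x) = mval x ^ n"
 by (induction n) (simp_all add: zero_munit.rep_eq plus_munit.rep_eq)

lemma divisible_munit: "divisible TYPE('k::alg_closed_field munit)"
 unfolding divisible_def
proof (intro allI impI)
 fix n :: nat and y :: "'k munit"
 assume "n > 0"
 then obtain x where x: "x ^ n = mval y" using nth_root_exists by metis
 then have "x ~= 0" using mval_nz[of y] \<open>n > 0\<close> by (metis zero_power)
 then have "nscale n (Munit x) = y" by (intro munit_eqI) (simp add: mval_nscale x)
 then show "\<exists>x. nscale n x = y" ..
qed

lemma torsion_munit: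
 assumes "n > 1"
 shows "\<exists>r :: 'k::{alg_closed_field, field_char_0} munit. r ~= 0 \<and> nscale n r = 0"
proof -
 \<comment> \<open>A root of \<open>1 + x + ... + x^(n-1)\<close> is an \<open>n\<close>-th root of
   unity. It differs from 1, because the value of \<open>p\<close> at 1 is \<open>n\<close>, which
   is nonzero in characteristic 0.\<close>
 define p :: "'k poly" where "p = (\<Sum>i<n. monom 1 i)"
 have "coeff p 1 = 1" using assms by (simp add: p_def coeff_sum coeff_monom)
 then have "degree p > 0" using le_degree[of p 1] by auto
 then obtain x where x: "poly p x = 0" using alg_closed_imp_poly_has_root by blast
 have px: "poly p y = (\<Sum>i<n. y ^ i)" for y by (simp add: p_def poly_sum poly_monom)
 have "x ^ n = 1" using power_diff_1_eq[of x n] x px[of x] by simp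
 moreover have "x ~= 1" using x px[of 1] assms by auto
 moreover have "x ~= 0" using \<open>x ^ n = 1\<close> assms by (cases n) auto
 ultimately show ?thesis
  by (intro exI[of _ "Munit x"]) (auto simp: mval_nscale zero_munit.rep_eq simp flip: mval_inject)
qed

lemma units_abelian_cocycle_coboundary:
 fixes w :: "'b::ab_group_add => 'b => 'b => 'k::field"
 assumes fin: "finite (UNIV :: 'b set)" and nz: "!!x y z. w x y z ~= 0" "!!x y. c x y ~= 0"
  and pent: "!!x y z u. w x y z * w x (y + z) u * w y z u = w (x + y) z u * w x y (z + u)"
  and hex1: "!!x y z. c x (y + z) = c x y * c x z * w x y z * w y z x / w y x z"
  and hex2: "!!x y z. c (x + y) z = c x z * c y z * w x z y / w z x y / w x y z"
  and diag: "!!x. c x x = 1"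
 obtains k where "!!x y. k x y ~= 0" "!!x y z. w x y z * k (x + y) z * k x y = k x (y + z) * k y z"
  "!!x y. c x y * k y x = k x y"
proof -
 define w' c' where "w' x y z = Munit (w x y z)" and "c' x y = Munit (c x y)" for x y z
 have v: "mval (w' x y z) = w x y z" "mval (c' x y) = c x y" for x y z
  by (simp_all add: w'_def c'_def nz)
 have "abelian_cocycle w' c'"
  by standard (auto intro!: munit_eqI simp: plus_munit.rep_eq minus_munit.rep_eq v pent hex1 hex2)
 moreover have "c' x x = 0" for x by (rule munit_eqI) (simp add: v diag zero_munit.rep_eq)
 ultimately obtain k where k: "!!x y z. w' x y z + k (x + y) z + k x y = k x (y + z) + k y z"
  "!!x y. c' x y + k y x = k x y"
  using abelian_cocycle_coboundary[OF fin] by metis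
 show thesis
 proof
  show "w x y z * mval (k (x + y) z) * mval (k x y) = mval (k x (y + z)) * mval (k y z)" for x y z
   using arg_cong[OF k(1)[of x y z], of mval] by (simp add: plus_munit.rep_eq v)
  show "c x y * mval (k y x) = mval (k x y)" for x y
   using arg_cong[OF k(2)[of x y], of mval] by (simp add: plus_munit.rep_eq v)
 qed simp
qed

section \<open>Multiplicative systems of objects with scalar endomorphisms\<close>

text \<open>Simplicity in the form in which it is used: two isomorphisms with the same source onto
  such an object differ by a unique nonzero factor.\<close>

definition scalar :: "('o, 'm, 'k, 'z) lin_cat_scheme => 'o => bool" where
 "scalar C X \<longleftrightarrow> X \<in> Ob C \<and> idt C X ~= azero C X X \<and>
   (\<forall>f. valid C f --> src f = X --> tgt f = X --> (\<exists>c. f = c \<odot>\<^sub>s\<^bsub>C\<^esub> idt C X))"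

text \<open>\<open>w\<close> and \<open>c\<close> express the associator and the braiding on the objects \<open>M l\<close> through the isomorphisms
 \<open>\<mu> l m : M l \<boxtimes> M m \<rightarrow> M (l + m)\<close>.\<close>

definition msys :: "('o, 'm, 'k::field, 'z) btc_scheme => ('b::ab_group_add => 'o) =>
  ('b => 'b => ('o, 'm) arrow) => ('b => 'b => 'b => 'k) => ('b => 'b => 'k) => bool" where
 "msys C M \<mu> w c \<longleftrightarrow>
   (\<forall>l. scalar C (M l)) \<and>
   (\<forall>l m. aiso C (\<mu> l m) \<and> src (\<mu> l m) = M l \<boxtimes>\<^bsub>C\<^esub> M m \<and> tgt (\<mu> l m) = M (l + m)) \<and>
   (\<forall>l m n. w l m n ~= 0) \<and> (\<forall>l m. c l m ~= 0) \<and>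
   (\<forall>l m n. \<mu> (l + m) n **\<^bsub>C\<^esub> (\<mu> l m \<otimes>\<^sub>a\<^bsub>C\<^esub> idt C (M n)) =
    w l m n \<odot>\<^sub>s\<^bsub>C\<^esub> (\<mu> l (m + n) **\<^bsub>C\<^esub> (idt C (M l) \<otimes>\<^sub>a\<^bsub>C\<^esub> \<mu> m n) **\<^bsub>C\<^esub> aass C (M l) (M m) (M n))) \<and>
   (\<forall>l m. \<mu> m l **\<^bsub>C\<^esub> abr C (M l) (M m) = c l m \<odot>\<^sub>s\<^bsub>C\<^esub> \<mu> l m)"

context linear_category
begin

lemma scalar_Ob: "scalar C X ==> X \<in> Ob C"
 by (simp add: scalar_def)

lemma scalar_iso:
 assumes X: "scalar C X" and f: "aiso C f" "src f = X" "tgt f = Y"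
 shows "scalar C Y"
 unfolding scalar_def
proof (intro conjI allI impI)
 show "Y \<in> Ob C" using f by auto
 show "idt C Y ~= azero C Y Y"
 proof
  assume "idt C Y = azero C Y Y"
  then have "ainv C f ** idt C Y ** f = ainv C f ** azero C Y Y ** f" by simp
  with f X show False by (auto simp: scalar_def)
 qed
 fix g assume g: "valid C g" "src g = Y" "tgt g = Y"
 then have "valid C (ainv C f ** g ** f)" "src (ainv C f ** g ** f) = X" "tgt (ainv C f ** g ** f) = X"
  using f by auto
 then obtain c where "ainv C f ** g ** f = c \<odot>\<^sub>s idt C X" using X unfolding scalar_def by blast
 then have "f ** (ainv C f ** g ** f) ** ainv C f = f ** (c \<odot>\<^sub>s idt C X) ** ainv C f" by simp
 then show "\<exists>c. g = c \<odot>\<^sub>s idt C Y" using f g by (auto simp: acomp_assoc)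
qed

lemma scalar_ratio:
 assumes X: "scalar C X" and f: "aiso C f" "tgt f = X" and g: "valid C g" "src g = src f" "tgt g = X"
 obtains c where "g = c \<odot>\<^sub>s f"
proof -
 have "valid C (g ** ainv C f)" "src (g ** ainv C f) = X" "tgt (g ** ainv C f) = X" using f g by auto
 then obtain c where "g ** ainv C f = c \<odot>\<^sub>s idt C X" using X unfolding scalar_def by blast
 then have "(g ** ainv C f) ** f = (c \<odot>\<^sub>s idt C X) ** f" by simp
 then have "g = c \<odot>\<^sub>s f" using f g by (simp add: acomp_assoc)
 then show thesis by (rule that)
qed

lemma aiso_not_azero:
 assumes X: "scalar C (tgt f)" and f: "aiso C f"
 shows "f ~= azero C (src f) (tgt f)"
proof
 assume "f = azero C (src f) (tgt f)"
 then have "f ** ainv C f = azero C (src f) (tgt f) ** ainv C f" by metis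
 with X f show False by (simp add: scalar_def)
qed

lemma scalar_cancel:
 assumes "scalar C (tgt f)" "aiso C f" "c \<odot>\<^sub>s f = d \<odot>\<^sub>s f"
 shows "c = d"
 using asmult_right_cancel[OF assms(3)] aiso_not_azero[OF assms(1,2)] assms(2) by simp

lemma scalar_ratio_iso:
 assumes X: "scalar C X" and f: "aiso C f" "tgt f = X" and g: "aiso C g" "src g = src f" "tgt g = X"
 obtains c where "c ~= 0" "g = c \<odot>\<^sub>s f"
proof -
 obtain c where c: "g = c \<odot>\<^sub>s f" by (rule scalar_ratio[OF X f aiso_valid[OF g(1)] g(2,3)])
 have "c ~= 0"
  using aiso_not_azero[of g] X f g c by auto
 with c show thesis by (rule that[rotated])
qed

end

context braided_monoidal_category
begin

lemma msysD:
 assumes "msys C M \<mu> w c"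
 shows "scalar C (M l)" "M l \<in> Ob C" "aiso C (\<mu> l m)" "valid C (\<mu> l m)" "src (\<mu> l m) = M l \<boxtimes> M m" "tgt (\<mu> l m) = M (l + m)"
  "w l m n ~= 0" "c l m ~= 0"
  "\<mu> (l + m) n ** (\<mu> l m \<lhd> M n) = w l m n \<odot>\<^sub>s (\<mu> l (m + n) ** (M l \<rhd> \<mu> m n) ** aass C (M l) (M m) (M n))"
  "\<mu> m l ** abr C (M l) (M m) = c l m \<odot>\<^sub>s \<mu> l m"
 using assms unfolding msys_def by (auto intro: scalar_Ob)

text \<open>Any choice of the isomorphisms \<open>\<mu>\<close> works: in both compatibility
  equations the two sides are isomorphisms onto the same scalar object, so they differ by a nonzero
  factor.\<close>

lemma ex_msys:
 fixes M :: "'b::ab_group_add => 'o"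
 assumes M: "!!l. scalar C (M l)" and iso: "!!l m. isomorphic C (M l \<boxtimes> M m) (M (l + m))"
 obtains \<mu> w c where "msys C M \<mu> w c"
proof -
 from iso obtain \<mu> where \<mu>: "!!l m. aiso C (\<mu> l m)" "!!l m. src (\<mu> l m) = M l \<boxtimes> M m" "!!l m. tgt (\<mu> l m) = M (l + m)"
  unfolding isomorphic_iff by metis
 note Ob = scalar_Ob[OF M]
 have "\<exists>w. w ~= 0 \<and> \<mu> (l + m) n ** (\<mu> l m \<lhd> M n) = w \<odot>\<^sub>s (\<mu> l (m + n) ** (M l \<rhd> \<mu> m n) ** aass C (M l) (M m) (M n))" for l m n
  by (rule scalar_ratio_iso[OF M[of "l + m + n"], of "\<mu> l (m + n) ** (M l \<rhd> \<mu> m n) ** aass C (M l) (M m) (M n)"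
     "\<mu> (l + m) n ** (\<mu> l m \<lhd> M n)"])
    (auto simp: \<mu> Ob add.assoc)
 then obtain w where w: "!!l m n. w l m n ~= 0 \<and> \<mu> (l + m) n ** (\<mu> l m \<lhd> M n) = w l m n \<odot>\<^sub>s (\<mu> l (m + n) ** (M l \<rhd> \<mu> m n) ** aass C (M l) (M m) (M n))"
  by metis
 have "\<exists>c. c ~= 0 \<and> \<mu> m l ** abr C (M l) (M m) = c \<odot>\<^sub>s \<mu> l m" for l m
  by (rule scalar_ratio_iso[OF M[of "l + m"], of "\<mu> l m" "\<mu> m l ** abr C (M l) (M m)"])
    (auto simp: \<mu> Ob add.commute)
 then have "\<forall>l. \<exists>c. \<forall>m. c m ~= 0 \<and> \<mu> m l ** abr C (M l) (M m) = c m \<odot>\<^sub>s \<mu> l m"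
  by (intro allI choice)
 then have "\<exists>c. \<forall>l m. c l m ~= 0 \<and> \<mu> m l ** abr C (M l) (M m) = c l m \<odot>\<^sub>s \<mu> l m"
  by (rule choice)
 then obtain c where c: "!!l m. c l m ~= 0 \<and> \<mu> m l ** abr C (M l) (M m) = c l m \<odot>\<^sub>s \<mu> l m" by blast
 have "msys C M \<mu> w c" unfolding msys_def using M \<mu> w c by auto
 then show thesis by (rule that)
qed

lemma msys_diag:
 assumes "msys C M \<mu> w c" "abr C (M l) (M l) = t \<odot>\<^sub>s idt C (M l \<boxtimes> M l)"
 shows "c l l = t"
proof -
 note d = msysD[OF assms(1)]
 have "t \<odot>\<^sub>s \<mu> l l = c l l \<odot>\<^sub>s \<mu> l l"
  using d(10)[where l=l and m=l] d(4,5) by (simp add: assms(2))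
 then show ?thesis using scalar_cancel[of "\<mu> l l"] d by metis
qed

text \<open>The multiplicative form of \<open>gauge3w\<close> and \<open>gauge3c\<close>.\<close>

lemma msys_rescale:
 assumes "msys C M \<mu> w c" and k: "!!l m. k l m ~= 0"
  and w': "!!l m n. w' l m n * (k l (m + n) * k m n) = w l m n * (k (l + m) n * k l m)"
  and c': "!!l m. c' l m * k l m = c l m * k m l"
 shows "msys C M (\<lambda>l m. k l m \<odot>\<^sub>s \<mu> l m) w' c'"
proof -
 note d = msysD[OF assms(1)]
 have nz: "w' l m n ~= 0" "c' l m ~= 0" for l m n
  using c'[of l m] w'[of l m n] k d(7,8) by (metis mult_eq_0_iff)+
 show ?thesis
  unfolding msys_def
 proof (intro conjI allI)
  fix l m n
  let ?n = "\<mu> l (m + n) ** (M l \<rhd> \<mu> m n) ** aass C (M l) (M m) (M n)"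
  have "(k (l + m) n \<odot>\<^sub>s \<mu> (l + m) n) ** ((k l m \<odot>\<^sub>s \<mu> l m) \<lhd> M n) = (w l m n * (k (l + m) n * k l m)) \<odot>\<^sub>s ?n"
   by (simp add: d ac_simps)
  also have "\<dots> = w' l m n \<odot>\<^sub>s ((k l (m + n) \<odot>\<^sub>s \<mu> l (m + n)) ** (M l \<rhd> (k m n \<odot>\<^sub>s \<mu> m n)) ** aass C (M l) (M m) (M n))"
   by (simp add: mult.commute[of "k m n"] flip: w')
  finally show "(k (l + m) n \<odot>\<^sub>s \<mu> (l + m) n) ** ((k l m \<odot>\<^sub>s \<mu> l m) \<lhd> M n) =
    w' l m n \<odot>\<^sub>s ((k l (m + n) \<odot>\<^sub>s \<mu> l (m + n)) ** (M l \<rhd> (k m n \<odot>\<^sub>s \<mu> m n)) ** aass C (M l) (M m) (M n))" .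
 qed (auto simp: d k c' nz mult.commute[of "k _ _"])
qed

text \<open>The left-nested product of four factors, \<open>?top\<close>, is rewritten along both
  sides of the pentagon into one right-nested isomorphism. The collected factors agree because the
  target is scalar.\<close>

lemma msys_pentagon:
 assumes "msys C M \<mu> w c"
 shows "w x y z * w x (y + z) u * w y z u = w (x + y) z u * w x y (z + u)"
proof -
 note d = msysD[OF assms] and e = msysD(9)[OF assms]
 let ?X = "M x" and ?Y = "M y" and ?Z = "M z" and ?U = "M u"
 let ?top = "\<mu> (x + y + z) u ** (\<mu> (x + y) z \<lhd> ?U) ** ((\<mu> x y \<lhd> ?Z) \<lhd> ?U)"
 let ?bot = "\<mu> x (y + z + u) ** (?X \<rhd> \<mu> y (z + u)) ** (?X \<rhd> (?Y \<rhd> \<mu> z u))"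
 let ?path = "aass C ?X ?Y (?Z \<boxtimes> ?U) ** aass C (?X \<boxtimes> ?Y) ?Z ?U"
 note e' = reassoc[OF e, unfolded asmult_acomp acomp_assoc]
 \<comment> \<open>The side with two associators.\<close>
 have 1: "?top = (w (x + y) z u * w x y (z + u)) \<odot>\<^sub>s (?bot ** ?path)"
 proof -
  have "?top = w (x + y) z u \<odot>\<^sub>s (\<mu> (x + y) (z + u) ** (M (x + y) \<rhd> \<mu> z u) ** aass C (M (x + y)) ?Z ?U ** ((\<mu> x y \<lhd> ?Z) \<lhd> ?U))"
   by (rule e')
  also have "aass C (M (x + y)) ?Z ?U ** ((\<mu> x y \<lhd> ?Z) \<lhd> ?U) = (\<mu> x y \<otimes>\<^sub>a idt C (?Z \<boxtimes> ?U)) ** aass C (?X \<boxtimes> ?Y) ?Z ?U"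
   by (subst aass_natural) (simp_all add: d)
  also have "(M (x + y) \<rhd> \<mu> z u) ** (\<mu> x y \<otimes>\<^sub>a idt C (?Z \<boxtimes> ?U)) ** aass C (?X \<boxtimes> ?Y) ?Z ?U =
    (\<mu> x y \<lhd> M (z + u)) ** (idt C (?X \<boxtimes> ?Y) \<otimes>\<^sub>a \<mu> z u) ** aass C (?X \<boxtimes> ?Y) ?Z ?U"
   by (simp add: d interchange')
  also have "\<mu> (x + y) (z + u) ** (\<mu> x y \<lhd> M (z + u)) ** (idt C (?X \<boxtimes> ?Y) \<otimes>\<^sub>a \<mu> z u) ** aass C (?X \<boxtimes> ?Y) ?Z ?U =
    w x y (z + u) \<odot>\<^sub>s (\<mu> x (y + (z + u)) ** (?X \<rhd> \<mu> y (z + u)) ** aass C ?X ?Y (M (z + u)) ** (idt C (?X \<boxtimes> ?Y) \<otimes>\<^sub>a \<mu> z u) ** aass C (?X \<boxtimes> ?Y) ?Z ?U)"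
   by (rule e')
  also have "aass C ?X ?Y (M (z + u)) ** (idt C (?X \<boxtimes> ?Y) \<otimes>\<^sub>a \<mu> z u) ** aass C (?X \<boxtimes> ?Y) ?Z ?U =
    (?X \<rhd> (?Y \<rhd> \<mu> z u)) ** ?path"
   using reassoc[OF aass_natural[of "idt C ?X" "idt C ?Y" "\<mu> z u" ?X ?Y "M (z + u)"]] by (simp add: d acomp_assoc)
  finally show ?thesis by (simp add: acomp_assoc add.assoc)
 qed
 \<comment> \<open>The side with three associators, the outer two of them whiskered; the pentagon of
   the category joins the paths at the end.\<close>
 have 2: "?top = (w x y z * w x (y + z) u * w y z u) \<odot>\<^sub>s (?bot ** ?path)"
 proof -
  let ?tail = "aass C ?X (?Y \<boxtimes> ?Z) ?U ** (aass C ?X ?Y ?Z \<lhd> ?U)"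
  have "?top = \<mu> (x + y + z) u ** ((\<mu> (x + y) z ** (\<mu> x y \<lhd> ?Z)) \<lhd> ?U)"
   by (simp add: d interchange)
  also have "\<dots> = w x y z \<odot>\<^sub>s (\<mu> (x + (y + z)) u ** (\<mu> x (y + z) \<lhd> ?U) ** ((?X \<rhd> \<mu> y z) \<lhd> ?U) ** (aass C ?X ?Y ?Z \<lhd> ?U))"
   unfolding e by (simp add: d interchange add.assoc)
  also have "\<mu> (x + (y + z)) u ** (\<mu> x (y + z) \<lhd> ?U) ** ((?X \<rhd> \<mu> y z) \<lhd> ?U) ** (aass C ?X ?Y ?Z \<lhd> ?U) =
    w x (y + z) u \<odot>\<^sub>s (\<mu> x (y + z + u) ** (?X \<rhd> \<mu> (y + z) u) ** aass C ?X (M (y + z)) ?U ** ((?X \<rhd> \<mu> y z) \<lhd> ?U) ** (aass C ?X ?Y ?Z \<lhd> ?U))"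
   by (rule e')
  also have "aass C ?X (M (y + z)) ?U ** ((?X \<rhd> \<mu> y z) \<lhd> ?U) ** (aass C ?X ?Y ?Z \<lhd> ?U) = (?X \<rhd> (\<mu> y z \<lhd> ?U)) ** ?tail"
   using reassoc[OF aass_natural[of "idt C ?X" "\<mu> y z" "idt C ?U" ?X "M (y + z)" ?U]] by (simp add: d acomp_assoc)
  also have "(?X \<rhd> \<mu> (y + z) u) ** (?X \<rhd> (\<mu> y z \<lhd> ?U)) ** ?tail = (?X \<rhd> (\<mu> (y + z) u ** (\<mu> y z \<lhd> ?U))) ** ?tail"
   by (simp add: d interchange')
  also have "\<dots> = w y z u \<odot>\<^sub>s ((?X \<rhd> \<mu> y (z + u)) ** (?X \<rhd> (?Y \<rhd> \<mu> z u)) ** (?X \<rhd> aass C ?Y ?Z ?U) ** ?tail)"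
   unfolding e by (simp add: d interchange')
  also have "(?X \<rhd> aass C ?Y ?Z ?U) ** ?tail = ?path"
   using a_pentagon[of ?X ?Y ?Z ?U] by (simp add: d)
  finally show ?thesis by (simp add: acomp_assoc add.assoc mult.assoc)
 qed
 have "aiso C (?bot ** ?path)" by (simp add: d add.assoc)
 moreover have "tgt (?bot ** ?path) = M (x + (y + z + u))" by (simp add: d add.assoc)
 ultimately show ?thesis using scalar_cancel[of "?bot ** ?path"] 1 2 d(1) by metis
qed

text \<open>The braiding of \<open>x\<close> past the product of \<open>y\<close> and
  \<open>z\<close> is computed once by naturality along \<open>\<mu> y z\<close>, and once by the
  hexagon of the category.\<close>

lemma msys_hexagon1:
 assumes "msys C M \<mu> w c"
 shows "c x (y + z) = c x y * c x z * w x y z * w y z x / w y x z"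
proof -
 note d = msysD[OF assms] and e = msysD(9)[OF assms] and b = msysD(10)[OF assms]
 let ?X = "M x" and ?Y = "M y" and ?Z = "M z"
 note e' = reassoc[OF e, unfolded asmult_acomp acomp_assoc] and b' = reassoc[OF b, unfolded asmult_acomp]
 let ?m = "\<mu> y (z + x) ** (?Y \<rhd> \<mu> z x)"
 let ?top = "\<mu> (x + y) z ** (\<mu> x y \<lhd> ?Z)"
 have "\<mu> (y + z) x ** (\<mu> y z \<lhd> ?X) ** abr C ?X (?Y \<boxtimes> ?Z) ** aass C ?X ?Y ?Z =
   w y z x \<odot>\<^sub>s (?m ** (aass C ?Y ?Z ?X ** abr C ?X (?Y \<boxtimes> ?Z) ** aass C ?X ?Y ?Z))"
  by (simp add: e' acomp_assoc)
 also have "\<mu> (y + z) x ** (\<mu> y z \<lhd> ?X) ** abr C ?X (?Y \<boxtimes> ?Z) ** aass C ?X ?Y ?Z =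
   \<mu> (y + z) x ** abr C ?X (M (y + z)) ** (?X \<rhd> \<mu> y z) ** aass C ?X ?Y ?Z"
  using reassoc[OF abr_natural[of "idt C ?X" "\<mu> y z" ?X "M (y + z)"]] by (simp add: d acomp_assoc)
 also have "\<dots> = c x (y + z) \<odot>\<^sub>s (\<mu> x (y + z) ** (?X \<rhd> \<mu> y z) ** aass C ?X ?Y ?Z)"
  by (rule b')
 also have "aass C ?Y ?Z ?X ** abr C ?X (?Y \<boxtimes> ?Z) ** aass C ?X ?Y ?Z =
   (?Y \<rhd> abr C ?X ?Z) ** aass C ?Y ?X ?Z ** (abr C ?X ?Y \<lhd> ?Z)"
  by (rule a_hexagon1) (simp_all add: d)
 also have "?m ** \<dots> = \<mu> y (x + z) ** (?Y \<rhd> (\<mu> z x ** abr C ?X ?Z)) ** aass C ?Y ?X ?Z ** (abr C ?X ?Y \<lhd> ?Z)"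
  by (simp add: d interchange' acomp_assoc add.commute)
 also have "\<dots> = c x z \<odot>\<^sub>s (\<mu> y (x + z) ** (?Y \<rhd> \<mu> x z) ** aass C ?Y ?X ?Z ** (abr C ?X ?Y \<lhd> ?Z))"
  unfolding b by simp
 \<comment> \<open>The two extra factors turn both sides into multiples of \<open>?top\<close>
   without any division.\<close>
 finally have "w y x z \<odot>\<^sub>s w x y z \<odot>\<^sub>s c x (y + z) \<odot>\<^sub>s (\<mu> x (y + z) ** (?X \<rhd> \<mu> y z) ** aass C ?X ?Y ?Z) =
   w y x z \<odot>\<^sub>s w x y z \<odot>\<^sub>s w y z x \<odot>\<^sub>s c x z \<odot>\<^sub>s (\<mu> y (x + z) ** (?Y \<rhd> \<mu> x z) ** aass C ?Y ?X ?Z ** (abr C ?X ?Y \<lhd> ?Z))"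
  by simp
 also have "\<dots> = (w x y z * w y z x * c x z) \<odot>\<^sub>s w y x z \<odot>\<^sub>s (\<mu> y (x + z) ** (?Y \<rhd> \<mu> x z) ** aass C ?Y ?X ?Z ** (abr C ?X ?Y \<lhd> ?Z))"
  by (simp add: ac_simps)
 also have "w y x z \<odot>\<^sub>s (\<mu> y (x + z) ** (?Y \<rhd> \<mu> x z) ** aass C ?Y ?X ?Z ** (abr C ?X ?Y \<lhd> ?Z)) =
   \<mu> (y + x) z ** (\<mu> y x \<lhd> ?Z) ** (abr C ?X ?Y \<lhd> ?Z)"
  by (simp add: e')
 also have "\<dots> = \<mu> (x + y) z ** ((\<mu> y x ** abr C ?X ?Y) \<lhd> ?Z)"
  by (simp add: d interchange add.commute)
 also have "\<dots> = c x y \<odot>\<^sub>s ?top" unfolding b by simp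
 also have "w y x z \<odot>\<^sub>s w x y z \<odot>\<^sub>s c x (y + z) \<odot>\<^sub>s (\<mu> x (y + z) ** (?X \<rhd> \<mu> y z) ** aass C ?X ?Y ?Z) =
   (w y x z * c x (y + z)) \<odot>\<^sub>s ?top"
  by (simp add: e ac_simps)
 finally have "(w y x z * c x (y + z)) \<odot>\<^sub>s ?top = (w x y z * w y z x * c x z * c x y) \<odot>\<^sub>s ?top" by simp
 then have "w y x z * c x (y + z) = w x y z * w y z x * c x z * c x y"
  by (rule scalar_cancel[rotated 2]) (simp_all add: d)
 then show ?thesis using d(7)[of y x z] by (simp add: field_simps)
qed

lemma msys_hexagon2:
 assumes "msys C M \<mu> w c"
 shows "c (x + y) z = c x z * c y z * w x z y / w z x y / w x y z"
proof -
 note d = msysD[OF assms] and e = msysD(9)[OF assms] and b = msysD(10)[OF assms]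
 let ?X = "M x" and ?Y = "M y" and ?Z = "M z"
 note e' = reassoc[OF e, unfolded asmult_acomp acomp_assoc] and b' = reassoc[OF b, unfolded asmult_acomp]
 let ?top = "\<mu> (x + y) z ** (\<mu> x y \<lhd> ?Z)"
 let ?t1 = "ainv C (aass C ?X ?Z ?Y) ** (?X \<rhd> abr C ?Y ?Z) ** aass C ?X ?Y ?Z"
 have "w z x y \<odot>\<^sub>s (\<mu> z (x + y) ** (?Z \<rhd> \<mu> x y) ** abr C (?X \<boxtimes> ?Y) ?Z) =
   w z x y \<odot>\<^sub>s (\<mu> z (x + y) ** (?Z \<rhd> \<mu> x y) ** aass C ?Z ?X ?Y ** (abr C ?X ?Z \<lhd> ?Y) ** ?t1)"
  by (subst a_hexagon2) (simp_all add: d)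
 also have "\<dots> = \<mu> (z + x) y ** (\<mu> z x \<lhd> ?Y) ** (abr C ?X ?Z \<lhd> ?Y) ** ?t1"
  by (simp add: e')
 also have "\<dots> = \<mu> (x + z) y ** ((\<mu> z x ** abr C ?X ?Z) \<lhd> ?Y) ** ?t1"
  by (simp add: d interchange' add.commute)
 also have "\<dots> = c x z \<odot>\<^sub>s (\<mu> (x + z) y ** (\<mu> x z \<lhd> ?Y) ** ?t1)"
  unfolding b by simp
 also have "\<mu> (x + z) y ** (\<mu> x z \<lhd> ?Y) ** ?t1 =
   w x z y \<odot>\<^sub>s (\<mu> x (z + y) ** (?X \<rhd> \<mu> z y) ** aass C ?X ?Z ?Y ** ?t1)"
  by (simp only: e')
 also have "aass C ?X ?Z ?Y ** ?t1 = (?X \<rhd> abr C ?Y ?Z) ** aass C ?X ?Y ?Z"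
  by (simp add: d)
 also have "\<mu> x (z + y) ** (?X \<rhd> \<mu> z y) ** (?X \<rhd> abr C ?Y ?Z) ** aass C ?X ?Y ?Z =
   \<mu> x (y + z) ** (?X \<rhd> (\<mu> z y ** abr C ?Y ?Z)) ** aass C ?X ?Y ?Z"
  by (simp add: d interchange' add.commute)
 also have "\<dots> = c y z \<odot>\<^sub>s (\<mu> x (y + z) ** (?X \<rhd> \<mu> y z) ** aass C ?X ?Y ?Z)"
  unfolding b by simp
 also have "(?Z \<rhd> \<mu> x y) ** abr C (?X \<boxtimes> ?Y) ?Z = abr C (M (x + y)) ?Z ** (\<mu> x y \<lhd> ?Z)"
  by (subst abr_natural) (simp_all add: d)
 also have "\<mu> z (x + y) ** abr C (M (x + y)) ?Z ** (\<mu> x y \<lhd> ?Z) = c (x + y) z \<odot>\<^sub>s ?top"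
  by (rule b')
 finally have "w x y z \<odot>\<^sub>s w z x y \<odot>\<^sub>s c (x + y) z \<odot>\<^sub>s ?top =
   w x y z \<odot>\<^sub>s c x z \<odot>\<^sub>s w x z y \<odot>\<^sub>s c y z \<odot>\<^sub>s (\<mu> x (y + z) ** (?X \<rhd> \<mu> y z) ** aass C ?X ?Y ?Z)"
  by simp
 also have "\<dots> = (c x z * w x z y * c y z) \<odot>\<^sub>s ?top" by (simp add: e ac_simps)
 finally have "(w x y z * (w z x y * c (x + y) z)) \<odot>\<^sub>s ?top = (c x z * w x z y * c y z) \<odot>\<^sub>s ?top" by simp
 then have "w x y z * (w z x y * c (x + y) z) = c x z * w x z y * c y z"
  by (rule scalar_cancel[rotated 2]) (simp_all add: d)
 then show ?thesis using d(7)[of z x y] d(7)[of x y z] by (simp add: field_simps)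
qed

text \<open>With equal \<open>w\<close> and \<open>c\<close>, the ratio of two multiplications is a
  symmetric 2-cocycle. Its trivialization \<open>v\<close> rescales the objects so that one
  multiplication becomes the other.\<close>

lemma msys_unique:
 fixes M :: "'b::ab_group_add => 'o"
 assumes fin: "finite (UNIV :: 'b set)" and dv: "divisible TYPE('k munit)"
  and m: "msys C M \<mu> w c" and m': "msys C M \<mu>' w c"
 obtains v where "!!l. v l ~= 0" "!!l m. (v l * v m) \<odot>\<^sub>s \<mu>' l m = v (l + m) \<odot>\<^sub>s \<mu> l m"
proof -
 note d = msysD[OF m] and d' = msysD[OF m']
 have "\<exists>t. t ~= 0 \<and> \<mu>' l m = t \<odot>\<^sub>s \<mu> l m" for l m
  by (rule scalar_ratio_iso[OF d(1)[of "l + m"], of "\<mu> l m" "\<mu>' l m"]) (auto simp: d d')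
 then obtain t where t: "!!l m. t l m ~= 0" and \<mu>': "!!l m. \<mu>' l m = t l m \<odot>\<^sub>s \<mu> l m" by metis
 have coc: "t x y * t (x + y) z = t y z * t x (y + z)" for x y z
 proof -
  let ?n = "\<mu> x (y + z) ** (M x \<rhd> \<mu> y z) ** aass C (M x) (M y) (M z)"
  have "(t x y * t (x + y) z * w x y z) \<odot>\<^sub>s ?n = (w x y z * (t y z * t x (y + z))) \<odot>\<^sub>s ?n"
   using d'(9)[where l=x and m=y and n=z] by (simp add: \<mu>' d(9) ac_simps)
  then have "t x y * t (x + y) z * w x y z = w x y z * (t y z * t x (y + z))"
   by (rule scalar_cancel[rotated 2]) (simp_all add: d)
  then show ?thesis using d(7)[of x y z] by simp
 qed
 have sym: "t x y = t y x" for x y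
 proof -
  have "(t y x * c x y) \<odot>\<^sub>s \<mu> x y = (c x y * t x y) \<odot>\<^sub>s \<mu> x y"
   using d'(10)[where l=x and m=y] by (simp add: \<mu>' d(10))
  then have "t y x * c x y = c x y * t x y" by (rule scalar_cancel[rotated 2]) (simp_all add: d)
  then show ?thesis using d(8)[of x y] by simp
 qed
 have "\<exists>v. (\<forall>x. v x ~= 0) \<and> (\<forall>x y. t x y * v x * v y = v (x + y))"
 proof -
  define t' where "t' x y = Munit (t x y)" for x y
  have tv: "mval (t' x y) = t x y" for x y by (simp add: t'_def t)
  have "cocycle2 t'"
   unfolding cocycle2_def using coc sym by (auto intro!: munit_eqI simp: plus_munit.rep_eq tv)
  from cocycle2_coboundary[OF fin dv this] obtain u
   where u: "!!x y. t' x y + u x + u y = u (x + y)" by blast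
  have "t x y * mval (u x) * mval (u y) = mval (u (x + y))" for x y
   unfolding u[symmetric] by (simp add: plus_munit.rep_eq tv)
  then show ?thesis by (intro exI[of _ "\<lambda>x. mval (u x)"]) simp
 qed
 then obtain v where "!!x. v x ~= 0" "!!x y. t x y * v x * v y = v (x + y)" by blast
 then show thesis by (intro that[of v]) (simp_all add: \<mu>' ac_simps)
qed

end

text \<open>The braided structure on a group of objects with scalar endomorphisms is determined by the
 self-braidings.\<close>

lemma msys_match:
 fixes C1 :: "('o1, 'm1, 'k::field, 'z1) btc_scheme" and C2 :: "('o2, 'm2, 'k, 'z2) btc_scheme"
  and M1 :: "'b::ab_group_add => 'o1"
 assumes fin: "finite (UNIV :: 'b set)"
  and C1: "braided_monoidal_category C1" and C2: "braided_monoidal_category C2"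
  and m1: "msys C1 M1 \<mu>1 w1 c1" and m2: "msys C2 M2 \<mu>2 w2 c2"
  and diag: "!!l. c1 l l = c2 l l"
 obtains \<mu> where "msys C2 M2 \<mu> w1 c1"
proof -
 interpret C1: braided_monoidal_category C1 by fact
 interpret C2: braided_monoidal_category C2 by fact
 note n1 = C1.msysD(7,8)[OF m1] and n2 = C2.msysD(7,8)[OF m2]
 \<comment> \<open>The quotient of two abelian cocycles is again one, and \<open>diag\<close> says
   that its diagonal is 1.\<close>
 let ?w = "\<lambda>x y z. w2 x y z / w1 x y z" and ?c = "\<lambda>x y. c2 x y / c1 x y"
 obtain k where k: "!!x y. k x y ~= 0" "!!x y z. ?w x y z * k (x + y) z * k x y = k x (y + z) * k y z"
  "!!x y. ?c x y * k y x = k x y"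
 proof (rule units_abelian_cocycle_coboundary[OF fin, of ?w ?c])
  show "?w x y z * ?w x (y + z) u * ?w y z u = ?w (x + y) z u * ?w x y (z + u)" for x y z u
   using C1.msys_pentagon[OF m1, of x y z u] C2.msys_pentagon[OF m2, of x y z u]
   by (simp add: times_divide_times_eq)
  show "?c x (y + z) = ?c x y * ?c x z * ?w x y z * ?w y z x / ?w y x z" for x y z
   unfolding C1.msys_hexagon1[OF m1, of x y z] C2.msys_hexagon1[OF m2, of x y z]
   by (simp add: times_divide_times_eq divide_divide_times_eq ac_simps)
  show "?c (x + y) z = ?c x z * ?c y z * ?w x z y / ?w z x y / ?w x y z" for x y z
   unfolding C1.msys_hexagon2[OF m1, of x y z] C2.msys_hexagon2[OF m2, of x y z]
   by (simp add: times_divide_times_eq divide_divide_times_eq ac_simps)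
 qed (use n1 n2 diag that in auto)
 have "msys C2 M2 (\<lambda>l m. k l m \<odot>\<^sub>s\<^bsub>C2\<^esub> \<mu>2 l m) w1 c1"
 proof (rule C2.msys_rescale[OF m2 k(1)])
  show "w1 l m n * (k l (m + n) * k m n) = w2 l m n * (k (l + m) n * k l m)" for l m n
   unfolding k(2)[symmetric] by (simp add: n1)
  show "c1 l m * k l m = c2 l m * k m l" for l m
   using k(3)[of l m, symmetric] n1(2)[of l m] by (metis mult.assoc nonzero_mult_div_cancel_left times_divide_eq_left times_divide_eq_right)
 qed
 then show thesis by (rule that)
qed

section \<open>Functors on typed morphisms\<close>

text \<open>With \<open>bfun\<close>, the functor conditions for unbundled data on typed arrows.
  \<open>linear_functor_iff\<close> and \<open>braided_functor_iff\<close> translate the given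
  notions into these, and constructed functors are packed again by \<open>monfun_of\<close>.\<close>

definition lfun :: "('o1, 'm1, 'k, 'z1) lin_cat_scheme => ('o2, 'm2, 'k, 'z2) lin_cat_scheme =>
  ('o1 => 'o2) => (('o1, 'm1) arrow => ('o2, 'm2) arrow) => bool" where
 "lfun C D FO FA \<longleftrightarrow>
   (\<forall>X\<in>Ob C. FO X \<in> Ob D) \<and>
   (\<forall>f. valid C f --> valid D (FA f) \<and> src (FA f) = FO (src f) \<and> tgt (FA f) = FO (tgt f)) \<and>
   (\<forall>X\<in>Ob C. FA (idt C X) = idt D (FO X)) \<and>
   (\<forall>f g. valid C f --> valid C g --> tgt f = src g --> FA (g **\<^bsub>C\<^esub> f) = FA g **\<^bsub>D\<^esub> FA f) \<and>
   (\<forall>f g. valid C f --> valid C g --> src f = src g --> tgt f = tgt g --> FA (f \<boxplus>\<^bsub>C\<^esub> g) = FA f \<boxplus>\<^bsub>D\<^esub> FA g) \<and>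
   (\<forall>c f. valid C f --> FA (c \<odot>\<^sub>s\<^bsub>C\<^esub> f) = c \<odot>\<^sub>s\<^bsub>D\<^esub> FA f)"

definition bfun :: "('o1, 'm1, 'k, 'z1) btc_scheme => ('o2, 'm2, 'k, 'z2) btc_scheme =>
  ('o1 => 'o2) => (('o1, 'm1) arrow => ('o2, 'm2) arrow) => ('o1 => 'o1 => ('o2, 'm2) arrow) => bool" where
 "bfun C D FO FA FT \<longleftrightarrow> lfun C D FO FA \<and> isomorphic D (FO (Unit C)) (Unit D) \<and>
   (\<forall>X\<in>Ob C. \<forall>Y\<in>Ob C. aiso D (FT X Y) \<and> src (FT X Y) = FO X \<boxtimes>\<^bsub>D\<^esub> FO Y \<and> tgt (FT X Y) = FO (X \<boxtimes>\<^bsub>C\<^esub> Y)) \<and>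
   (\<forall>f g. valid C f --> valid C g -->
    FT (tgt f) (tgt g) **\<^bsub>D\<^esub> (FA f \<otimes>\<^sub>a\<^bsub>D\<^esub> FA g) = FA (f \<otimes>\<^sub>a\<^bsub>C\<^esub> g) **\<^bsub>D\<^esub> FT (src f) (src g)) \<and>
   (\<forall>X\<in>Ob C. \<forall>Y\<in>Ob C. \<forall>Z\<in>Ob C.
    FA (aass C X Y Z) **\<^bsub>D\<^esub> FT (X \<boxtimes>\<^bsub>C\<^esub> Y) Z **\<^bsub>D\<^esub> (FT X Y \<otimes>\<^sub>a\<^bsub>D\<^esub> idt D (FO Z)) =
    FT X (Y \<boxtimes>\<^bsub>C\<^esub> Z) **\<^bsub>D\<^esub> (idt D (FO X) \<otimes>\<^sub>a\<^bsub>D\<^esub> FT Y Z) **\<^bsub>D\<^esub> aass D (FO X) (FO Y) (FO Z)) \<and>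
   (\<forall>X\<in>Ob C. \<forall>Y\<in>Ob C.
    FA (abr C X Y) **\<^bsub>D\<^esub> FT X Y = FT Y X **\<^bsub>D\<^esub> abr D (FO X) (FO Y))"

definition arrow_map :: "('o1, 'm1, 'o2, 'm2) monfun => ('o1, 'm1) arrow => ('o2, 'm2) arrow" where
 "arrow_map F f = Arrow (FOb F (src f)) (FMor F (src f) (tgt f) (mor f)) (FOb F (tgt f))"

definition arrow_ten :: "('o1, 'm1, 'k, 'z1) btc_scheme => ('o2, 'm2, 'k, 'z2) btc_scheme =>
  ('o1, 'm1, 'o2, 'm2) monfun => 'o1 => 'o1 => ('o2, 'm2) arrow" where
 "arrow_ten C D F X Y = Arrow (FOb F X \<boxtimes>\<^bsub>D\<^esub> FOb F Y) (FTen F X Y) (FOb F (X \<boxtimes>\<^bsub>C\<^esub> Y))"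

locale two_braided = C: braided_monoidal_category C + D: braided_monoidal_category D
 for C :: "('o1, 'm1, 'k::field, 'z1) btc_scheme" (structure) and D :: "('o2, 'm2, 'k, 'z2) btc_scheme"
begin

abbreviation compD (infixr "\<bullet>" 70) where "g \<bullet> f \<equiv> g **\<^bsub>D\<^esub> f"
abbreviation tenD (infixr "\<otimes>\<^sub>D" 75) where "f \<otimes>\<^sub>D g \<equiv> f \<otimes>\<^sub>a\<^bsub>D\<^esub> g"

lemma lfunD:
 assumes "lfun C D FO FA"
 shows "X \<in> Ob C ==> FO X \<in> Ob D"
  "valid C f ==> valid D (FA f)" "valid C f ==> src (FA f) = FO (src f)" "valid C f ==> tgt (FA f) = FO (tgt f)"
  "X \<in> Ob C ==> FA (idt C X) = idt D (FO X)"
  "valid C f ==> valid C g ==> tgt f = src g ==> FA (g ** f) = FA g \<bullet> FA f"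
  "valid C f ==> valid C g ==> src f = src g ==> tgt f = tgt g ==> FA (f \<boxplus> g) = FA f \<boxplus>\<^bsub>D\<^esub> FA g"
  "valid C f ==> FA (c \<odot>\<^sub>s f) = c \<odot>\<^sub>s\<^bsub>D\<^esub> FA f"
 using assms unfolding lfun_def by blast+

lemma lfun_azero:
 assumes F: "lfun C D FO FA" and "X \<in> Ob C" "Y \<in> Ob C"
 shows "FA (azero C X Y) = azero D (FO X) (FO Y)"
 using lfunD(8)[OF F, of "azero C X Y" 0] lfunD(2,3,4)[OF F, of "azero C X Y"] assms by simp

lemma lfun_aiso:
 assumes F: "lfun C D FO FA" and f: "aiso C f"
 shows "aiso D (FA f)" "ainv D (FA f) = FA (ainv C f)"
proof -
 note d = lfunD[OF F]
 have "inverse_arrows D (FA f) (FA (ainv C f))"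
  using f d(6)[of f "ainv C f"] d(6)[of "ainv C f" f] unfolding inverse_arrows_def by (auto simp: d)
 then show "aiso D (FA f)" "ainv D (FA f) = FA (ainv C f)" by (auto simp: aiso_def intro: D.ainv_eqI)
qed

lemma lfun_isomorphic: "lfun C D FO FA ==> isomorphic C X Y ==> isomorphic D (FO X) (FO Y)"
 unfolding C.isomorphic_iff D.isomorphic_iff using lfun_aiso(1) lfunD(3,4) C.aiso_valid by metis

lemma lfun_Span:
 assumes F: "lfun C D FO FA" and k: "k \<in> Span C G X Z"
 shows "FA k \<in> Span D (FA ` {g \<in> G. valid C g \<and> tgt g = Z}) (FO X) (FO Z)"
 using k
proof (induction rule: Span.induct)
 case zero
 then show ?case using lfunD(1)[OF F] by (auto simp: lfun_azero[OF F] intro: Span.zero)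
next
 case (comp g p)
 then show ?case using lfunD[OF F] by (auto intro: Span.comp)
next
 case (add f h)
 then show ?case using lfunD(7)[OF F] C.Span_valid by (metis (no_types, lifting) Span.add)
qed

lemma lfun_covers:
 assumes F: "lfun C D FO FA" and Z: "covers C Z G"
 shows "covers D (FO Z) (FA ` {g \<in> G. valid C g \<and> tgt g = Z})"
 using lfun_Span[OF F, of "idt C Z" G Z Z] Z lfunD(1,5)[OF F] by (simp add: covers_def)

lemma linear_functor_iff: "linear_functor C D F \<longleftrightarrow> lfun C D (FOb F) (arrow_map F)"
proof
 assume L: "linear_functor C D F"
 show "lfun C D (FOb F) (arrow_map F)"
  unfolding lfun_def
 proof (intro conjI allI ballI impI)
  show *: "valid D (arrow_map F f)" if "valid C f" for f
   using L that by (simp add: linear_functor_def arrow_map_def)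
  show "arrow_map F (idt C X) = idt D (FOb F X)" if "X \<in> Ob C" for X
   using L that by (simp add: linear_functor_def arrow_map_def idt_def)
  show "arrow_map F (g ** f) = arrow_map F g \<bullet> arrow_map F f" if "valid C f" "valid C g" "tgt f = src g" for f g
  proof -
   have "FMor F (src f) (tgt g) (mor g \<cdot> mor f) = FMor F (src g) (tgt g) (mor g) \<cdot>\<^bsub>D\<^esub> FMor F (src f) (src g) (mor f)"
    using L that unfolding linear_functor_def by (metis C.mor_in_Hom)
   then show ?thesis using that *[of f] *[of g]
    by (simp add: acomp_def arrow_map_def)
  qed
  show "arrow_map F (f \<boxplus> g) = arrow_map F f \<boxplus>\<^bsub>D\<^esub> arrow_map F g" if "valid C f" "valid C g" "src f = src g" "tgt f = tgt g" for f g
  proof -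
   have "FMor F (src f) (tgt f) (Add C (mor f) (mor g)) = Add D (FMor F (src f) (tgt f) (mor f)) (FMor F (src f) (tgt f) (mor g))"
    using L that unfolding linear_functor_def by (metis C.mor_in_Hom)
   then show ?thesis using that *[of f] *[of g]
    by (simp add: aadd_def arrow_map_def)
  qed
  show "arrow_map F (c \<odot>\<^sub>s f) = c \<odot>\<^sub>s\<^bsub>D\<^esub> arrow_map F f" if "valid C f" for c f
  proof -
   have "FMor F (src f) (tgt f) (Smult C c (mor f)) = Smult D c (FMor F (src f) (tgt f) (mor f))"
    using L that unfolding linear_functor_def by (metis C.mor_in_Hom)
   then show ?thesis using that *[of f]
    by (simp add: asmult_def arrow_map_def)
  qed
 qed (use L in \<open>auto simp: linear_functor_def arrow_map_def\<close>)
next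
 assume L: "lfun C D (FOb F) (arrow_map F)"
 note d = lfunD[OF L]
 have H: "FMor F X Y f \<in> Hom D (FOb F X) (FOb F Y)" if "f \<in> Hom C X Y" for X Y f
  using d(2)[of "Arrow X f Y"] that by (simp add: arrow_map_def)
 show "linear_functor C D F"
  unfolding linear_functor_def
 proof (intro conjI allI ballI)
  show "FMor F X X (Id C X) = Id D (FOb F X)" if "X \<in> Ob C" for X
   using d(5)[OF that] by (simp add: arrow_map_def idt_def)
  show "FMor F X Z (g \<cdot> f) = FMor F Y Z g \<cdot>\<^bsub>D\<^esub> FMor F X Y f"
   if "f \<in> Hom C X Y" "g \<in> Hom C Y Z" for X Y Z f g
   using d(6)[of "Arrow X f Y" "Arrow Y g Z"] that H[OF that(1)] H[OF that(2)]
   by (simp add: arrow_map_def acomp_def)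
  show "FMor F X Y (Add C f g) = Add D (FMor F X Y f) (FMor F X Y g)"
   if "f \<in> Hom C X Y" "g \<in> Hom C X Y" for X Y f g
   using d(7)[of "Arrow X f Y" "Arrow X g Y"] that H[OF that(1)] H[OF that(2)]
   by (simp add: arrow_map_def aadd_def)
  show "FMor F X Y (Smult C c f) = Smult D c (FMor F X Y f)" if "f \<in> Hom C X Y" for X Y c f
   using d(8)[of "Arrow X f Y" c] that H[OF that(1)]
   by (simp add: arrow_map_def asmult_def)
 qed (use H d(1) in auto)
qed

lemma braided_functor_iff:
 "braided_functor C D F \<longleftrightarrow> bfun C D (FOb F) (arrow_map F) (arrow_ten C D F)"
proof (cases "linear_functor C D F")
 case True
 then have L: "lfun C D (FOb F) (arrow_map F)" by (simp add: linear_functor_iff)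
 note d = lfunD[OF L]
 \<comment> \<open>Invertibility of \<open>FTen\<close> is compared first: it makes the composites
   in the remaining equations valid, so that these equations can be read off the underlying
   morphisms.\<close>
 have iso: "(\<forall>X\<in>Ob C. \<forall>Y\<in>Ob C. aiso D (arrow_ten C D F X Y) \<and> src (arrow_ten C D F X Y) = FOb F X \<boxtimes>\<^bsub>D\<^esub> FOb F Y \<and>
    tgt (arrow_ten C D F X Y) = FOb F (X \<boxtimes> Y)) \<longleftrightarrow>
  (\<forall>X\<in>Ob C. \<forall>Y\<in>Ob C. FTen F X Y \<in> Iso D (FOb F X \<boxtimes>\<^bsub>D\<^esub> FOb F Y) (FOb F (X \<boxtimes> Y)))"
  by (simp add: arrow_ten_def D.Iso_iff)
 show ?thesis
 proof (cases "\<forall>X\<in>Ob C. \<forall>Y\<in>Ob C. FTen F X Y \<in> Iso D (FOb F X \<boxtimes>\<^bsub>D\<^esub> FOb F Y) (FOb F (X \<boxtimes> Y))")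
  case False
  then have "\<not> braided_functor C D F" unfolding braided_functor_def tensor_functor_def by blast
  moreover have "\<not> bfun C D (FOb F) (arrow_map F) (arrow_ten C D F)"
   using False iso unfolding bfun_def by blast
  ultimately show ?thesis by simp
 next
  case iso2: True
  have t: "aiso D (arrow_ten C D F X Y)" "valid D (arrow_ten C D F X Y)" "src (arrow_ten C D F X Y) = FOb F X \<boxtimes>\<^bsub>D\<^esub> FOb F Y"
   "tgt (arrow_ten C D F X Y) = FOb F (X \<boxtimes> Y)" "mor (arrow_ten C D F X Y) = FTen F X Y"
   if "X \<in> Ob C" "Y \<in> Ob C" for X Y
   using iso2 that by (simp_all add: arrow_ten_def flip: D.Iso_iff) (simp_all add: Iso_def inverse_mors_def)
  have eq_iff: "f = g \<longleftrightarrow> mor f = mor g" if "valid D f" "valid D g" "src f = src g" "tgt f = tgt g" for f g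
   using that by (auto intro: D.arrow_eqI)
  have m: "mor (arrow_map F f) = FMor F (src f) (tgt f) (mor f)" for f by (simp add: arrow_map_def)
  have nat: "(\<forall>f g. valid C f --> valid C g -->
    arrow_ten C D F (tgt f) (tgt g) \<bullet> (arrow_map F f \<otimes>\<^sub>D arrow_map F g) = arrow_map F (f \<otimes>\<^sub>a g) \<bullet> arrow_ten C D F (src f) (src g)) \<longleftrightarrow>
   (\<forall>X X' Y Y'. \<forall>f\<in>Hom C X X'. \<forall>g\<in>Hom C Y Y'.
    FTen F X' Y' \<cdot>\<^bsub>D\<^esub> (FMor F X X' f \<odot>\<^bsub>D\<^esub> FMor F Y Y' g)
     = FMor F (X \<boxtimes> Y) (X' \<boxtimes> Y') (f \<odot> g) \<cdot>\<^bsub>D\<^esub> FTen F X Y)" (is "?L = ?R")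
  proof -
   have *: "arrow_ten C D F (tgt f) (tgt g) \<bullet> (arrow_map F f \<otimes>\<^sub>D arrow_map F g) = arrow_map F (f \<otimes>\<^sub>a g) \<bullet> arrow_ten C D F (src f) (src g)
    \<longleftrightarrow> FTen F (tgt f) (tgt g) \<cdot>\<^bsub>D\<^esub> (FMor F (src f) (tgt f) (mor f) \<odot>\<^bsub>D\<^esub> FMor F (src g) (tgt g) (mor g))
     = FMor F (src f \<boxtimes> src g) (tgt f \<boxtimes> tgt g) (mor f \<odot> mor g) \<cdot>\<^bsub>D\<^esub> FTen F (src f) (src g)"
    if "valid C f" "valid C g" for f g
    using that
    by (subst eq_iff) (simp_all add: d t D.mor_acomp D.mor_aten C.mor_aten m)
   show ?thesis
   proof
    assume L': ?L
    show ?R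
    proof (intro allI ballI)
     fix X X' Y Y' f g assume "f \<in> Hom C X X'" "g \<in> Hom C Y Y'"
     then show "FTen F X' Y' \<cdot>\<^bsub>D\<^esub> (FMor F X X' f \<odot>\<^bsub>D\<^esub> FMor F Y Y' g)
       = FMor F (X \<boxtimes> Y) (X' \<boxtimes> Y') (f \<odot> g) \<cdot>\<^bsub>D\<^esub> FTen F X Y"
      using *[of "Arrow X f X'" "Arrow Y g Y'"] L'[rule_format, of "Arrow X f X'" "Arrow Y g Y'"] by simp
    qed
   next
    assume ?R
    then show ?L using * C.mor_in_Hom by blast
   qed
  qed
  have ass: "(\<forall>X\<in>Ob C. \<forall>Y\<in>Ob C. \<forall>Z\<in>Ob C.
    arrow_map F (aass C X Y Z) \<bullet> arrow_ten C D F (X \<boxtimes> Y) Z \<bullet> (arrow_ten C D F X Y \<otimes>\<^sub>D idt D (FOb F Z)) =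
    arrow_ten C D F X (Y \<boxtimes> Z) \<bullet> (idt D (FOb F X) \<otimes>\<^sub>D arrow_ten C D F Y Z) \<bullet> aass D (FOb F X) (FOb F Y) (FOb F Z)) \<longleftrightarrow>
   (\<forall>X\<in>Ob C. \<forall>Y\<in>Ob C. \<forall>Z\<in>Ob C.
    FMor F ((X \<boxtimes> Y) \<boxtimes> Z) (X \<boxtimes> Y \<boxtimes> Z) (Assoc C X Y Z)
      \<cdot>\<^bsub>D\<^esub> FTen F (X \<boxtimes> Y) Z \<cdot>\<^bsub>D\<^esub> (FTen F X Y \<odot>\<^bsub>D\<^esub> Id D (FOb F Z))
     = FTen F X (Y \<boxtimes> Z) \<cdot>\<^bsub>D\<^esub> (Id D (FOb F X) \<odot>\<^bsub>D\<^esub> FTen F Y Z)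
      \<cdot>\<^bsub>D\<^esub> Assoc D (FOb F X) (FOb F Y) (FOb F Z))"
   by (intro ball_cong refl, subst eq_iff)
    (simp_all add: d t D.mor_acomp D.mor_aten m D.mor_idt D.mor_struct C.mor_struct)
  have br: "(\<forall>X\<in>Ob C. \<forall>Y\<in>Ob C.
    arrow_map F (abr C X Y) \<bullet> arrow_ten C D F X Y = arrow_ten C D F Y X \<bullet> abr D (FOb F X) (FOb F Y)) \<longleftrightarrow>
   (\<forall>X\<in>Ob C. \<forall>Y\<in>Ob C.
    FMor F (X \<boxtimes> Y) (Y \<boxtimes> X) (Braid C X Y) \<cdot>\<^bsub>D\<^esub> FTen F X Y
     = FTen F Y X \<cdot>\<^bsub>D\<^esub> Braid D (FOb F X) (FOb F Y))"
   by (intro ball_cong refl, subst eq_iff)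
    (simp_all add: d t D.mor_acomp D.mor_aten m D.mor_idt D.mor_struct C.mor_struct)
  show ?thesis
   unfolding braided_functor_def tensor_functor_def bfun_def iso nat ass br using True L by simp
 qed
next
 case False
 then show ?thesis
  unfolding braided_functor_def tensor_functor_def bfun_def linear_functor_iff by simp
qed

lemma tensor_isoI:
 assumes \<eta>: "!!X. X \<in> Ob C ==> aiso D (\<eta> X) \<and> src (\<eta> X) = FOb F X \<and> tgt (\<eta> X) = FOb G X"
  and F: "bfun C D (FOb F) (arrow_map F) (arrow_ten C D F)" and G: "bfun C D (FOb G) (arrow_map G) (arrow_ten C D G)"
  and nat: "!!f. valid C f ==> \<eta> (tgt f) \<bullet> arrow_map F f = arrow_map G f \<bullet> \<eta> (src f)"
  and ten: "!!X Y. X \<in> Ob C ==> Y \<in> Ob C ==>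
    \<eta> (X \<boxtimes> Y) \<bullet> arrow_ten C D F X Y = arrow_ten C D G X Y \<bullet> (\<eta> X \<otimes>\<^sub>D \<eta> Y)"
 shows "tensor_iso C D F G"
proof -
 have e: "aiso D (\<eta> X)" "valid D (\<eta> X)" "src (\<eta> X) = FOb F X" "tgt (\<eta> X) = FOb G X" if "X \<in> Ob C" for X
  using \<eta>[OF that] by auto
 from F have LF: "lfun C D (FOb F) (arrow_map F)" by (simp add: bfun_def)
 from G have LG: "lfun C D (FOb G) (arrow_map G)" by (simp add: bfun_def)
 have tF: "valid D (arrow_ten C D F X Y)" "src (arrow_ten C D F X Y) = FOb F X \<boxtimes>\<^bsub>D\<^esub> FOb F Y"
   "tgt (arrow_ten C D F X Y) = FOb F (X \<boxtimes> Y)" if "X \<in> Ob C" "Y \<in> Ob C" for X Y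
  using F that by (simp_all add: bfun_def)
 have tG: "valid D (arrow_ten C D G X Y)" "src (arrow_ten C D G X Y) = FOb G X \<boxtimes>\<^bsub>D\<^esub> FOb G Y"
   "tgt (arrow_ten C D G X Y) = FOb G (X \<boxtimes> Y)" if "X \<in> Ob C" "Y \<in> Ob C" for X Y
  using G that by (simp_all add: bfun_def)
 have m: "mor (arrow_map F f) = FMor F (src f) (tgt f) (mor f)" "mor (arrow_ten C D F X Y) = FTen F X Y" for F f X Y
  by (simp_all add: arrow_map_def arrow_ten_def)
 show ?thesis
  unfolding tensor_iso_def
 proof (intro exI[of _ "\<lambda>X. mor (\<eta> X)"] conjI ballI allI)
  show "mor (\<eta> X) \<in> Iso D (FOb F X) (FOb G X)" if "X \<in> Ob C" for X
   using e[OF that] D.aiso_iff[of "\<eta> X"] by simp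
  show "mor (\<eta> Y) \<cdot>\<^bsub>D\<^esub> FMor F X Y f = FMor G X Y f \<cdot>\<^bsub>D\<^esub> mor (\<eta> X)" if "f \<in> Hom C X Y" for X Y f
   using arg_cong[OF nat[of "Arrow X f Y"], of mor] that C.Hom_Ob[OF that] lfunD(2-4)[OF LF, of "Arrow X f Y"] lfunD(2-4)[OF LG, of "Arrow X f Y"]
   by (simp add: e D.mor_acomp m)
  show "mor (\<eta> (X \<boxtimes> Y)) \<cdot>\<^bsub>D\<^esub> FTen F X Y = FTen G X Y \<cdot>\<^bsub>D\<^esub> (mor (\<eta> X) \<odot>\<^bsub>D\<^esub> mor (\<eta> Y))"
   if "X \<in> Ob C" "Y \<in> Ob C" for X Y
   using arg_cong[OF ten[OF that], of mor] that
   by (simp add: e D.mor_acomp D.mor_aten m tF tG)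
 qed
qed

lemma tensor_iso_isomorphic: "tensor_iso C D F G ==> X \<in> Ob C ==> isomorphic D (FOb F X) (FOb G X)"
 unfolding tensor_iso_def isomorphic_def by auto

end

section \<open>Categories generated by a group of scalar objects\<close>

text \<open>What the classification uses of a pointed fusion category. It holds for the category
  itself (\<open>pointed_family_pointed_category\<close>) and for its center
  (\<open>pointed_family_center\<close>), so the results below apply to both.\<close>

locale pointed_family = braided_monoidal_category C
 for C :: "('o, 'm, 'k::field, 'z) btc_scheme" (structure) +
 fixes S :: "'b::ab_group_add => 'o"
 assumes S_scalar: "scalar C (S l)"
  and S_orth: "valid C f ==> src f = S l ==> tgt f = S m ==> l ~= m ==> f = azero C (S l) (S m)"
  and S_mult: "isomorphic C (S l \<boxtimes> S m) (S (l + m))"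
  and S_unit: "isomorphic C (Unit C) (S 0)"
  and S_covers: "Z \<in> Ob C ==> covers C Z {s. src s \<in> range S}"
  and S_sum: "Z \<in> Ob C ==> \<exists>V. direct_sum C Z (S l) V"
  and ex_zero: "\<exists>Z. zero_object C Z"
begin

abbreviation Sg where "Sg \<equiv> {s :: ('o, 'm) arrow. src s \<in> range S}"

lemma S_Ob [simp]: "S l \<in> Ob C"
 using S_scalar by (rule scalar_Ob)

lemma S_idt_nz: "idt C (S l) ~= azero C (S l) (S l)"
 using S_scalar by (simp add: scalar_def)

lemma S_hom:
 assumes "valid C f" "src f = S l" "tgt f = S m"
 obtains "f = azero C (S l) (S m)" | c where "l = m" "f = c \<odot>\<^sub>s idt C (S l)"
 using S_orth[OF assms] S_scalar[of l] assms unfolding scalar_def by metis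

lemma S_isomorphic: "isomorphic C (S l) (S m) ==> l = m"
proof (rule ccontr)
 assume "isomorphic C (S l) (S m)" "l ~= m"
 then obtain f where f: "aiso C f" "src f = S l" "tgt f = S m" by (auto simp: isomorphic_iff)
 then have "f = azero C (S l) (S m)" using \<open>l ~= m\<close> by (intro S_orth) auto
 then show False using aiso_not_azero[of f] f S_scalar by simp
qed

text \<open>The identity is a sum of maps through the \<open>S l\<close>, so some composite
  \<open>g ** p\<close> through \<open>S l\<close> is nonzero, hence \<open>c\<close> times the
  identity with \<open>c\<close> nonzero. Comparing two bracketings of
  \<open>g ** p ** g ** p\<close> shows that \<open>p ** g\<close> is \<open>c\<close> times the
  identity as well, so \<open>p\<close> is invertible.\<close>

lemma scalar_iso_S:
 assumes X: "scalar C X"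
 obtains l where "isomorphic C X (S l)"
proof -
 note XOb = scalar_Ob[OF X]
 have "\<exists>g p. valid C g \<and> valid C p \<and> tgt g = X \<and> src p = X \<and> tgt p = src g \<and> src g \<in> range S \<and> g ** p ~= azero C X X"
 proof (rule ccontr)
  assume *: "\<not> ?thesis"
  have "k = azero C X X" if "k \<in> Span C Sg X X" for k
   using that by (induction rule: Span.induct) (use * XOb in auto)
  then show False using S_covers[OF XOb] X by (auto simp: covers_def scalar_def)
 qed
 then obtain g p l where g: "valid C g" "tgt g = X" "src g = S l" and p: "valid C p" "src p = X" "tgt p = S l"
  and nz: "g ** p ~= azero C X X" by auto
 obtain c where c: "g ** p = c \<odot>\<^sub>s idt C X"
  using X g p unfolding scalar_def by (metis src_acomp tgt_acomp valid_acomp)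
 have c0: "c ~= 0" using nz c XOb by auto
 obtain d where d: "p ** g = d \<odot>\<^sub>s idt C (S l)"
  using S_scalar[of l] g p unfolding scalar_def by (metis src_acomp tgt_acomp valid_acomp)
 have "(c * c) \<odot>\<^sub>s idt C X = (d * c) \<odot>\<^sub>s idt C X"
 proof -
  have "(c * c) \<odot>\<^sub>s idt C X = (g ** p) ** (g ** p)" using c XOb by simp
  also have "\<dots> = g ** (p ** g) ** p" by (simp add: acomp_assoc)
  also have "\<dots> = (d * c) \<odot>\<^sub>s idt C X" unfolding d using g p c by simp
  finally show ?thesis .
 qed
 then have "d = c" using scalar_cancel[of "idt C X" "c * c" "d * c"] X XOb c0 by simp
 then have "aiso C p"
  using g p c d c0 XOb by (intro aisoI[of p "inverse c \<odot>\<^sub>s g"]) simp_all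
 then show thesis using p that[of l] unfolding isomorphic_iff by blast
qed

lemma Sg_covers2:
 assumes "X \<in> Ob C" "Y \<in> Ob C"
 shows "covers C (X \<boxtimes> Y) {s \<otimes>\<^sub>a t | s t. valid C s \<and> valid C t \<and> src s \<in> range S \<and> src t \<in> range S \<and> tgt s = X \<and> tgt t = Y}"
 by (rule covers_mono[OF covers_aten[OF S_covers S_covers]]) (use assms in auto)

end

locale pointed_source = two_braided C D + C: pointed_family C S
 for C :: "('o1, 'm1, 'k::field, 'z1) btc_scheme" (structure) and D :: "('o2, 'm2, 'k, 'z2) btc_scheme"
  and S :: "'b::ab_group_add => 'o1"
begin

lemma F_covers:
 assumes F: "lfun C D FO FA" and "X \<in> Ob C"
 shows "covers D (FO X) {FA s | s. valid C s \<and> src s \<in> range S \<and> tgt s = X}"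
 by (rule D.covers_mono[OF lfun_covers[OF F C.S_covers]]) (use assms in auto)

lemma F_covers2:
 assumes F: "lfun C D FO FA" and XY: "X \<in> Ob C" "Y \<in> Ob C"
 shows "covers D (FO X \<boxtimes>\<^bsub>D\<^esub> FO Y) {FA s \<otimes>\<^sub>D FA t | s t. valid C s \<and> valid C t \<and>
  src s \<in> range S \<and> src t \<in> range S \<and> tgt s = X \<and> tgt t = Y}"
 by (rule D.covers_mono[OF D.covers_aten[OF F_covers[OF F] F_covers[OF F]]]) (use XY in auto)

lemma F_covers3:
 assumes F: "lfun C D FO FA" and XY: "X \<in> Ob C" "Y \<in> Ob C" "Z \<in> Ob C"
 shows "covers D ((FO X \<boxtimes>\<^bsub>D\<^esub> FO Y) \<boxtimes>\<^bsub>D\<^esub> FO Z) {(FA s \<otimes>\<^sub>D FA t) \<otimes>\<^sub>D FA u | s t u. valid C s \<and> valid C t \<and> valid C u \<and>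
  src s \<in> range S \<and> src t \<in> range S \<and> src u \<in> range S \<and> tgt s = X \<and> tgt t = Y \<and> tgt u = Z}"
 by (rule D.covers_mono[OF D.covers_aten[OF F_covers2[OF F] F_covers[OF F]]]) (use XY in auto)

text \<open>The wanted \<open>h\<close> is the case of an identity \<open>k\<close> in a statement
  about every \<open>k\<close> in the span of the arrows from the \<open>S l\<close>, which admits
  induction: for \<open>k = a ** p\<close> the composite of \<open>FA p\<close>,
  \<open>\<theta>\<close> and \<open>GA a\<close> serves. It works because maps between the
  \<open>S l\<close> are zero or scalars, and these commute with \<open>\<theta>\<close>.\<close>

lemma extend_nat:
 assumes F: "lfun C D FO FA" and G: "lfun C D GO GA"
  and \<theta>: "!!l. valid D (\<theta> l)" "!!l. src (\<theta> l) = FO (S l)" "!!l. tgt (\<theta> l) = GO (S l)" and Z: "Z \<in> Ob C"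
 obtains h where "valid D h" "src h = FO Z" "tgt h = GO Z"
  "!!l s. valid C s ==> src s = S l ==> tgt s = Z ==> h \<bullet> FA s = GA s \<bullet> \<theta> l"
proof -
 note f = lfunD[OF F] and g = lfunD[OF G]
 have "\<exists>h. valid D h \<and> src h = FO Z \<and> tgt h = GO Z \<and>
  (\<forall>l s. valid C s --> src s = S l --> tgt s = Z --> h \<bullet> FA s = GA (k ** s) \<bullet> \<theta> l)"
  if "k \<in> Span C C.Sg Z Z" for k
  using that
 proof (induction rule: Span.induct)
  case zero
  show ?case
   by (intro exI[of _ "azero D (FO Z) (GO Z)"])
    (use Z in \<open>auto simp: f g \<theta> lfun_azero[OF G]\<close>)
 next
  case (add k k')
  then obtain h h' where h: "valid D h" "src h = FO Z" "tgt h = GO Z"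
    "!!l s. valid C s ==> src s = S l ==> tgt s = Z ==> h \<bullet> FA s = GA (k ** s) \<bullet> \<theta> l"
   and h': "valid D h'" "src h' = FO Z" "tgt h' = GO Z"
    "!!l s. valid C s ==> src s = S l ==> tgt s = Z ==> h' \<bullet> FA s = GA (k' ** s) \<bullet> \<theta> l"
   by blast
  note kv = C.Span_valid[OF add(1)] C.Span_valid[OF add(2)]
  show ?case
   by (intro exI[of _ "h \<boxplus>\<^bsub>D\<^esub> h'"])
    (use kv in \<open>auto simp: h h' D.aadd_acomp C.aadd_acomp g(7)\<close>)
 next
  case (comp a p)
  then obtain m where m: "src a = S m" by auto
  show ?case
  proof (intro exI[of _ "GA a \<bullet> \<theta> m \<bullet> FA p"] conjI allI impI)
   fix l s assume s: "valid C s" "src s = S l" "tgt s = Z"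
   then have ps: "valid C (p ** s)" "src (p ** s) = S l" "tgt (p ** s) = S m" using comp m by auto
   have 1: "(GA a \<bullet> \<theta> m \<bullet> FA p) \<bullet> FA s = GA a \<bullet> \<theta> m \<bullet> FA (p ** s)"
    using comp s by (simp add: D.acomp_assoc f)
   have 2: "GA ((a ** p) ** s) \<bullet> \<theta> l = GA a \<bullet> GA (p ** s) \<bullet> \<theta> l"
    using comp s m by (simp add: D.acomp_assoc C.acomp_assoc g)
   have "\<theta> m \<bullet> FA (p ** s) = GA (p ** s) \<bullet> \<theta> l"
    by (rule C.S_hom[OF ps]) (simp_all add: \<theta> f g lfun_azero[OF F] lfun_azero[OF G])
   then show "(GA a \<bullet> \<theta> m \<bullet> FA p) \<bullet> FA s = GA ((a ** p) ** s) \<bullet> \<theta> l"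
    unfolding 1 2 by simp
  qed (use comp m in \<open>auto simp: f g \<theta>\<close>)
 qed
 from this[of "idt C Z"] C.S_covers[OF Z] Z that show thesis
  by (auto simp: covers_def)
qed

text \<open>The inverses of \<open>\<theta>\<close> extend too, and the composites of the two
  extensions are identities because they are so on covers. Naturality is tested on covers
  likewise.\<close>

lemma extend_nat_iso:
 assumes F: "lfun C D FO FA" and G: "lfun C D GO GA"
  and \<theta>: "!!l. aiso D (\<theta> l)" "!!l. src (\<theta> l) = FO (S l)" "!!l. tgt (\<theta> l) = GO (S l)"
 obtains \<eta> where "!!X. X \<in> Ob C ==> aiso D (\<eta> X) \<and> src (\<eta> X) = FO X \<and> tgt (\<eta> X) = GO X"
  "!!X l s. X \<in> Ob C ==> valid C s ==> src s = S l ==> tgt s = X ==> \<eta> X \<bullet> FA s = GA s \<bullet> \<theta> l"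
  "!!f. valid C f ==> \<eta> (tgt f) \<bullet> FA f = GA f \<bullet> \<eta> (src f)"
proof -
 note f = lfunD[OF F] and g = lfunD[OF G]
 have "\<exists>h. valid D h \<and> src h = FO Z \<and> tgt h = GO Z \<and>
  (\<forall>l s. valid C s --> src s = S l --> tgt s = Z --> h \<bullet> FA s = GA s \<bullet> \<theta> l)" if "Z \<in> Ob C" for Z
  by (rule extend_nat[OF F G _ _ _ that, of \<theta>]) (use \<theta> in auto)
 then obtain \<eta> where \<eta>: "!!Z. Z \<in> Ob C ==> valid D (\<eta> Z)" "!!Z. Z \<in> Ob C ==> src (\<eta> Z) = FO Z" "!!Z. Z \<in> Ob C ==> tgt (\<eta> Z) = GO Z"
  "!!Z l s. Z \<in> Ob C ==> valid C s ==> src s = S l ==> tgt s = Z ==> \<eta> Z \<bullet> FA s = GA s \<bullet> \<theta> l" by metis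
 have iso: "aiso D (\<eta> Z)" if Z: "Z \<in> Ob C" for Z
 proof -
  obtain h where h: "valid D h" "src h = GO Z" "tgt h = FO Z"
   "!!l s. valid C s ==> src s = S l ==> tgt s = Z ==> h \<bullet> GA s = FA s \<bullet> ainv D (\<theta> l)"
   by (rule extend_nat[OF G F _ _ _ Z, of "\<lambda>l. ainv D (\<theta> l)"]) (use \<theta> in auto)
  have 1: "h \<bullet> \<eta> Z = idt D (FO Z)"
  proof (rule D.covers_eqI[OF F_covers[OF F Z]])
   fix a assume "a \<in> {FA s |s. valid C s \<and> src s \<in> range S \<and> tgt s = Z}"
   then obtain s l where s: "a = FA s" "valid C s" "src s = S l" "tgt s = Z" by auto
   then show "(h \<bullet> \<eta> Z) \<bullet> a = idt D (FO Z) \<bullet> a"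
    using D.reassoc[OF h(4)[OF s(2,3,4)], of "\<theta> l"] Z \<theta>
    by (simp add: D.acomp_assoc \<eta> f)
  qed (use Z in \<open>auto simp: \<eta> h f\<close>)
  have 2: "\<eta> Z \<bullet> h = idt D (GO Z)"
  proof (rule D.covers_eqI[OF F_covers[OF G Z]])
   fix a assume "a \<in> {GA s |s. valid C s \<and> src s \<in> range S \<and> tgt s = Z}"
   then obtain s l where s: "a = GA s" "valid C s" "src s = S l" "tgt s = Z" by auto
   then show "(\<eta> Z \<bullet> h) \<bullet> a = idt D (GO Z) \<bullet> a"
    using D.reassoc[OF \<eta>(4)[OF Z s(2,3,4)], of "ainv D (\<theta> l)"] Z \<theta>
    by (simp add: D.acomp_assoc h g)
  qed (use Z in \<open>auto simp: \<eta> h g\<close>)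
  show ?thesis using 1 2 Z by (intro D.aisoI[of _ h]) (auto simp: \<eta> h)
 qed
 have nat: "\<eta> (tgt a) \<bullet> FA a = GA a \<bullet> \<eta> (src a)" if a: "valid C a" for a
 proof (rule D.covers_eqI[OF F_covers[OF F, of "src a"]])
  fix x assume "x \<in> {FA s |s. valid C s \<and> src s \<in> range S \<and> tgt s = src a}"
  then obtain s l where s: "x = FA s" "valid C s" "src s = S l" "tgt s = src a" by auto
  have "\<eta> (tgt a) \<bullet> FA (a ** s) = GA (a ** s) \<bullet> \<theta> l"
   using s a by (intro \<eta>(4)) auto
  then show "(\<eta> (tgt a) \<bullet> FA a) \<bullet> x = (GA a \<bullet> \<eta> (src a)) \<bullet> x"
   using s a \<eta>(4)[of "src a" s l] by (simp add: D.acomp_assoc f g)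
 qed (use a in \<open>auto simp: \<eta> f g\<close>)
 show thesis by (rule that[of \<eta>]) (use \<eta> iso nat in auto)
qed

text \<open>Coherence of the tensor structure moves \<open>FA\<close> past associator and braiding,
  so the constants \<open>w\<close> and \<open>c\<close> do not change.\<close>

lemma push_msys:
 assumes F: "bfun C D FO FA FT" and J: "msys C S J w c" and sc: "!!l. scalar D (FO (S l))"
 shows "msys D (\<lambda>l. FO (S l)) (\<lambda>l m. FA (J l m) \<bullet> FT (S l) (S m)) w c"
proof -
 from F have L: "lfun C D FO FA" by (simp add: bfun_def)
 note d = lfunD[OF L] and j = C.msysD(1-8)[OF J] and j9 = C.msysD(9)[OF J] and j10 = C.msysD(10)[OF J]
 have t: "aiso D (FT X Y)" "valid D (FT X Y)" "src (FT X Y) = FO X \<boxtimes>\<^bsub>D\<^esub> FO Y" "tgt (FT X Y) = FO (X \<boxtimes> Y)"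
  if "X \<in> Ob C" "Y \<in> Ob C" for X Y using F that by (auto simp: bfun_def)
 have nat: "FT (tgt f) (tgt g) \<bullet> (FA f \<otimes>\<^sub>D FA g) = FA (f \<otimes>\<^sub>a g) \<bullet> FT (src f) (src g)"
  if "valid C f" "valid C g" for f g using F that unfolding bfun_def by blast
 have ass: "FA (aass C X Y Z) \<bullet> FT (X \<boxtimes> Y) Z \<bullet> (FT X Y \<otimes>\<^sub>D idt D (FO Z)) =
    FT X (Y \<boxtimes> Z) \<bullet> (idt D (FO X) \<otimes>\<^sub>D FT Y Z) \<bullet> aass D (FO X) (FO Y) (FO Z)"
  if "X \<in> Ob C" "Y \<in> Ob C" "Z \<in> Ob C" for X Y Z using F that unfolding bfun_def by blast
 have br: "FA (abr C X Y) \<bullet> FT X Y = FT Y X \<bullet> abr D (FO X) (FO Y)"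
  if "X \<in> Ob C" "Y \<in> Ob C" for X Y using F that unfolding bfun_def by blast
 show ?thesis
  unfolding msys_def
 proof (intro conjI allI)
  fix l m n
  let ?X = "S l" and ?Y = "S m" and ?Z = "S n"
  have "(FA (J (l + m) n) \<bullet> FT (S (l + m)) ?Z) \<bullet> ((FA (J l m) \<bullet> FT ?X ?Y) \<otimes>\<^sub>D idt D (FO ?Z)) =
   FA (J (l + m) n) \<bullet> FT (S (l + m)) ?Z \<bullet> (FA (J l m) \<otimes>\<^sub>D FA (idt C ?Z)) \<bullet> (FT ?X ?Y \<otimes>\<^sub>D idt D (FO ?Z))"
   by (simp add: d t j D.acomp_assoc D.interchange)
  also have "\<dots> = FA (J (l + m) n) \<bullet> FA (J l m \<otimes>\<^sub>a idt C ?Z) \<bullet> FT (?X \<boxtimes> ?Y) ?Z \<bullet> (FT ?X ?Y \<otimes>\<^sub>D idt D (FO ?Z))"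
   using D.reassoc[OF nat[of "J l m" "idt C ?Z"]] by (simp add: j D.acomp_assoc)
  also have "\<dots> = FA (J (l + m) n ** (J l m \<otimes>\<^sub>a idt C ?Z)) \<bullet> FT (?X \<boxtimes> ?Y) ?Z \<bullet> (FT ?X ?Y \<otimes>\<^sub>D idt D (FO ?Z))"
   by (simp add: d j D.acomp_assoc)
  also have "\<dots> = w l m n \<odot>\<^sub>s\<^bsub>D\<^esub> (FA (J l (m + n)) \<bullet> FA (idt C ?X \<otimes>\<^sub>a J m n) \<bullet> FA (aass C ?X ?Y ?Z) \<bullet> FT (?X \<boxtimes> ?Y) ?Z \<bullet> (FT ?X ?Y \<otimes>\<^sub>D idt D (FO ?Z)))"
   unfolding j9 by (simp add: d j D.acomp_assoc)
  also have "FA (aass C ?X ?Y ?Z) \<bullet> FT (?X \<boxtimes> ?Y) ?Z \<bullet> (FT ?X ?Y \<otimes>\<^sub>D idt D (FO ?Z)) =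
    FT ?X (?Y \<boxtimes> ?Z) \<bullet> (idt D (FO ?X) \<otimes>\<^sub>D FT ?Y ?Z) \<bullet> aass D (FO ?X) (FO ?Y) (FO ?Z)"
   by (rule ass) simp_all
  also have "FA (idt C ?X \<otimes>\<^sub>a J m n) \<bullet> FT ?X (?Y \<boxtimes> ?Z) \<bullet> (idt D (FO ?X) \<otimes>\<^sub>D FT ?Y ?Z) \<bullet> aass D (FO ?X) (FO ?Y) (FO ?Z) =
    FT ?X (S (m + n)) \<bullet> (FA (idt C ?X) \<otimes>\<^sub>D FA (J m n)) \<bullet> (idt D (FO ?X) \<otimes>\<^sub>D FT ?Y ?Z) \<bullet> aass D (FO ?X) (FO ?Y) (FO ?Z)"
   using D.reassoc[OF nat[of "idt C ?X" "J m n"]] by (simp add: j D.acomp_assoc)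
  finally show "(FA (J (l + m) n) \<bullet> FT (S (l + m)) ?Z) \<bullet> ((FA (J l m) \<bullet> FT ?X ?Y) \<otimes>\<^sub>D idt D (FO ?Z)) =
   w l m n \<odot>\<^sub>s\<^bsub>D\<^esub> ((FA (J l (m + n)) \<bullet> FT ?X (S (m + n))) \<bullet> (idt D (FO ?X) \<otimes>\<^sub>D (FA (J m n) \<bullet> FT ?Y ?Z)) \<bullet> aass D (FO ?X) (FO ?Y) (FO ?Z))"
   by (simp add: d t j D.acomp_assoc D.interchange')
  have "(FA (J m l) \<bullet> FT ?Y ?X) \<bullet> abr D (FO ?X) (FO ?Y) = FA (J m l ** abr C ?X ?Y) \<bullet> FT ?X ?Y"
   by (simp add: d j D.acomp_assoc br)
  also have "\<dots> = c l m \<odot>\<^sub>s\<^bsub>D\<^esub> (FA (J l m) \<bullet> FT ?X ?Y)"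
   unfolding j10 by (simp add: d j)
  finally show "(FA (J m l) \<bullet> FT ?Y ?X) \<bullet> abr D (FO ?X) (FO ?Y) = c l m \<odot>\<^sub>s\<^bsub>D\<^esub> (FA (J l m) \<bullet> FT ?X ?Y)" .
 qed (auto simp: sc t j d lfun_aiso[OF L])
qed

end

context braided_monoidal_category
begin

text \<open>Conjugation by isomorphisms leaves the constants unchanged. It is applied where a
  functor sends \<open>S l\<close> to an object that is only isomorphic to the one carrying the
  multiplication.\<close>

lemma transport_msys:
 assumes m: "msys C M \<mu> w c"
  and \<theta>: "!!l. aiso C (\<theta> l)" "!!l. src (\<theta> l) = M l" "!!l. tgt (\<theta> l) = N l"
 shows "msys C N (\<lambda>l m. \<theta> (l + m) ** \<mu> l m ** (ainv C (\<theta> l) \<otimes>\<^sub>a ainv C (\<theta> m))) w c"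
proof -
 note d = msysD[OF m]
 have NOb [simp]: "N l \<in> Ob C" for l using \<theta> valid_Ob aiso_valid by metis
 have v: "valid C (\<theta> l)" for l using \<theta> by simp
 let ?i = "\<lambda>l. ainv C (\<theta> l)"
 let ?n = "\<lambda>l m. \<theta> (l + m) ** \<mu> l m ** (?i l \<otimes>\<^sub>a ?i m)"
 show ?thesis
  unfolding msys_def
 proof (intro conjI allI)
  show "scalar C (N l)" for l by (rule scalar_iso[OF d(1) \<theta>])
  fix l m n
  have "?n (l + m) n ** (?n l m \<lhd> N n) =
    \<theta> (l + m + n) ** \<mu> (l + m) n ** (\<mu> l m \<lhd> M n) ** ((?i l \<otimes>\<^sub>a ?i m) \<otimes>\<^sub>a ?i n)"
   by (simp add: d \<theta> v acomp_assoc interchange)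
  also have "\<dots> = w l m n \<odot>\<^sub>s (\<theta> (l + m + n) ** \<mu> l (m + n) ** (M l \<rhd> \<mu> m n) ** aass C (M l) (M m) (M n) ** ((?i l \<otimes>\<^sub>a ?i m) \<otimes>\<^sub>a ?i n))"
   using reassoc[OF d(9)] by (simp add: acomp_assoc)
  also have "aass C (M l) (M m) (M n) ** ((?i l \<otimes>\<^sub>a ?i m) \<otimes>\<^sub>a ?i n) = (?i l \<otimes>\<^sub>a ?i m \<otimes>\<^sub>a ?i n) ** aass C (N l) (N m) (N n)"
   by (subst aass_natural) (simp_all add: \<theta>)
  finally show "?n (l + m) n ** (?n l m \<lhd> N n) = w l m n \<odot>\<^sub>s (?n l (m + n) ** (N l \<rhd> ?n m n) ** aass C (N l) (N m) (N n))"
   by (simp add: d \<theta> v acomp_assoc interchange' add.assoc)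
  have "?n m l ** abr C (N l) (N m) = \<theta> (l + m) ** \<mu> m l ** abr C (M l) (M m) ** (?i l \<otimes>\<^sub>a ?i m)"
   by (simp add: acomp_assoc abr_natural \<theta> add.commute)
  also have "\<dots> = c l m \<odot>\<^sub>s ?n l m" using reassoc[OF d(10)] by simp
  finally show "?n m l ** abr C (N l) (N m) = c l m \<odot>\<^sub>s ?n l m" .
 qed (auto simp: d \<theta> v)
qed

end

section \<open>Uniqueness of braided functors with given values on the generators\<close>

context pointed_source
begin

text \<open>Both functors carry one multiplication \<open>J\<close> of the source to multiplications
  with the same constants. After transport along \<open>\<theta>\<close> these differ by scalars
  \<open>v\<close>, by \<open>msys_unique\<close>, and dividing \<open>\<theta>\<close> by
  \<open>v\<close> makes it monoidal on the generators. Its extension to all objects is then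
  monoidal, since this can be tested on covers.\<close>

theorem braided_functor_unique:
 assumes fin: "finite (UNIV :: 'b set)" and dv: "divisible TYPE('k munit)"
  and F: "bfun C D FO FA FT" and G: "bfun C D GO GA GT"
  and sc: "!!l. scalar D (FO (S l))" and iso: "!!l. isomorphic D (FO (S l)) (GO (S l))"
 obtains \<eta> where "!!X. X \<in> Ob C ==> aiso D (\<eta> X) \<and> src (\<eta> X) = FO X \<and> tgt (\<eta> X) = GO X"
  "!!f. valid C f ==> \<eta> (tgt f) **\<^bsub>D\<^esub> FA f = GA f **\<^bsub>D\<^esub> \<eta> (src f)"
  "!!X Y. X \<in> Ob C ==> Y \<in> Ob C ==> \<eta> (X \<boxtimes>\<^bsub>C\<^esub> Y) **\<^bsub>D\<^esub> FT X Y = GT X Y **\<^bsub>D\<^esub> (\<eta> X \<otimes>\<^sub>a\<^bsub>D\<^esub> \<eta> Y)"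
proof -
 from F have LF: "lfun C D FO FA" by (simp add: bfun_def)
 from G have LG: "lfun C D GO GA" by (simp add: bfun_def)
 note f = lfunD[OF LF] and g = lfunD[OF LG]
 obtain \<theta> where \<theta>: "!!l. aiso D (\<theta> l)" "!!l. src (\<theta> l) = FO (S l)" "!!l. tgt (\<theta> l) = GO (S l)"
  using iso unfolding D.isomorphic_iff by metis
 have scG: "scalar D (GO (S l))" for l by (rule D.scalar_iso[OF sc \<theta>])
 obtain J w c where J: "msys C S J w c" by (rule C.ex_msys[OF C.S_scalar C.S_mult])
 note j = C.msysD(3-6)[OF J]
 let ?mF = "\<lambda>l m. FA (J l m) **\<^bsub>D\<^esub> FT (S l) (S m)" and ?mG = "\<lambda>l m. GA (J l m) **\<^bsub>D\<^esub> GT (S l) (S m)"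
 have mF: "msys D (\<lambda>l. FO (S l)) ?mF w c" by (rule push_msys[OF F J sc])
 have mG: "msys D (\<lambda>l. GO (S l)) ?mG w c" by (rule push_msys[OF G J scG])
 let ?m' = "\<lambda>l m. \<theta> (l + m) **\<^bsub>D\<^esub> ?mF l m **\<^bsub>D\<^esub> (ainv D (\<theta> l) \<otimes>\<^sub>a\<^bsub>D\<^esub> ainv D (\<theta> m))"
 have m': "msys D (\<lambda>l. GO (S l)) ?m' w c" by (rule D.transport_msys[OF mF \<theta>])
 obtain v where v: "!!l. v l ~= 0" "!!l m. (v l * v m) \<odot>\<^sub>s\<^bsub>D\<^esub> ?m' l m = v (l + m) \<odot>\<^sub>s\<^bsub>D\<^esub> ?mG l m"
  using D.msys_unique[OF fin dv mG m'] by blast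
 define \<theta>' where "\<theta>' l = inverse (v l) \<odot>\<^sub>s\<^bsub>D\<^esub> \<theta> l" for l
 have \<theta>': "aiso D (\<theta>' l)" "valid D (\<theta>' l)" "src (\<theta>' l) = FO (S l)" "tgt (\<theta>' l) = GO (S l)" for l
  using v \<theta> by (auto simp: \<theta>'_def)
 have key: "\<theta>' (l + m) **\<^bsub>D\<^esub> ?mF l m = ?mG l m **\<^bsub>D\<^esub> (\<theta>' l \<otimes>\<^sub>a\<^bsub>D\<^esub> \<theta>' m)" for l m
 proof -
  note dF = D.msysD(3-6)[OF mF, of l m]
  have "?m' l m **\<^bsub>D\<^esub> (\<theta> l \<otimes>\<^sub>a\<^bsub>D\<^esub> \<theta> m) = \<theta> (l + m) **\<^bsub>D\<^esub> ?mF l m"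
   using dF \<theta> f(1)[OF C.S_Ob] by (simp add: D.acomp_assoc D.interchange)
  then have "(v l * v m) \<odot>\<^sub>s\<^bsub>D\<^esub> (\<theta> (l + m) **\<^bsub>D\<^esub> ?mF l m) = v (l + m) \<odot>\<^sub>s\<^bsub>D\<^esub> (?mG l m **\<^bsub>D\<^esub> (\<theta> l \<otimes>\<^sub>a\<^bsub>D\<^esub> \<theta> m))"
   using v(2)[of l m] by (metis D.asmult_acomp)
  then have "(inverse (v l) * inverse (v m) * inverse (v (l + m))) \<odot>\<^sub>s\<^bsub>D\<^esub> (v l * v m) \<odot>\<^sub>s\<^bsub>D\<^esub> (\<theta> (l + m) **\<^bsub>D\<^esub> ?mF l m) =
    (inverse (v l) * inverse (v m) * inverse (v (l + m))) \<odot>\<^sub>s\<^bsub>D\<^esub> v (l + m) \<odot>\<^sub>s\<^bsub>D\<^esub> (?mG l m **\<^bsub>D\<^esub> (\<theta> l \<otimes>\<^sub>a\<^bsub>D\<^esub> \<theta> m))" by simp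
  moreover have "inverse (v l) * inverse (v m) * inverse (v (l + m)) * (v l * v m) = inverse (v (l + m))"
   "inverse (v l) * inverse (v m) * inverse (v (l + m)) * v (l + m) = inverse (v l) * inverse (v m)"
   using v(1)[of l] v(1)[of m] v(1)[of "l + m"] by (simp_all add: field_simps)
  ultimately show ?thesis by (simp only: D.asmult_asmult) (simp add: \<theta>'_def mult.commute[of "inverse (v m)"])
 qed
 obtain \<eta> where \<eta>: "!!X. X \<in> Ob C ==> aiso D (\<eta> X) \<and> src (\<eta> X) = FO X \<and> tgt (\<eta> X) = GO X"
  "!!X l s. X \<in> Ob C ==> valid C s ==> src s = S l ==> tgt s = X ==> \<eta> X **\<^bsub>D\<^esub> FA s = GA s **\<^bsub>D\<^esub> \<theta>' l"
  "!!f. valid C f ==> \<eta> (tgt f) **\<^bsub>D\<^esub> FA f = GA f **\<^bsub>D\<^esub> \<eta> (src f)"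
  using extend_nat_iso[OF LF LG \<theta>'(1,3,4)] by blast
 have e: "valid D (\<eta> X)" "src (\<eta> X) = FO X" "tgt (\<eta> X) = GO X" if "X \<in> Ob C" for X
  using \<eta>(1)[OF that] by auto
 have tF: "valid D (FT X Y)" "src (FT X Y) = FO X \<boxtimes>\<^bsub>D\<^esub> FO Y" "tgt (FT X Y) = FO (X \<boxtimes>\<^bsub>C\<^esub> Y)"
  if "X \<in> Ob C" "Y \<in> Ob C" for X Y using F that by (auto simp: bfun_def)
 have tG: "valid D (GT X Y)" "src (GT X Y) = GO X \<boxtimes>\<^bsub>D\<^esub> GO Y" "tgt (GT X Y) = GO (X \<boxtimes>\<^bsub>C\<^esub> Y)"
  if "X \<in> Ob C" "Y \<in> Ob C" for X Y using G that by (auto simp: bfun_def)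
 have natF: "FT (tgt f) (tgt g) **\<^bsub>D\<^esub> (FA f \<otimes>\<^sub>a\<^bsub>D\<^esub> FA g) = FA (f \<otimes>\<^sub>a\<^bsub>C\<^esub> g) **\<^bsub>D\<^esub> FT (src f) (src g)"
  if "valid C f" "valid C g" for f g using F that unfolding bfun_def by blast
 have natG: "GT (tgt f) (tgt g) **\<^bsub>D\<^esub> (GA f \<otimes>\<^sub>a\<^bsub>D\<^esub> GA g) = GA (f \<otimes>\<^sub>a\<^bsub>C\<^esub> g) **\<^bsub>D\<^esub> GT (src f) (src g)"
  if "valid C f" "valid C g" for f g using G that unfolding bfun_def by blast
 have ten: "\<eta> (X \<boxtimes>\<^bsub>C\<^esub> Y) **\<^bsub>D\<^esub> FT X Y = GT X Y **\<^bsub>D\<^esub> (\<eta> X \<otimes>\<^sub>a\<^bsub>D\<^esub> \<eta> Y)" if XY: "X \<in> Ob C" "Y \<in> Ob C" for X Y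
 proof (rule D.covers_eqI[OF F_covers2[OF LF XY]])
  fix x assume "x \<in> {FA s \<otimes>\<^sub>a\<^bsub>D\<^esub> FA t | s t. valid C s \<and> valid C t \<and>
   src s \<in> range S \<and> src t \<in> range S \<and> tgt s = X \<and> tgt t = Y}"
  then obtain s t l m where x: "x = FA s \<otimes>\<^sub>a\<^bsub>D\<^esub> FA t" and s: "valid C s" "src s = S l" "tgt s = X"
   and t: "valid C t" "src t = S m" "tgt t = Y" by auto
  \<comment> \<open>The tensor product of \<open>s\<close> and \<open>t\<close> starts at
    \<open>S l \<boxtimes> S m\<close>; composition with the inverse of \<open>J l m\<close> makes
    it start at \<open>S (l + m)\<close>, where \<open>\<eta>\<close> is known.\<close>
  let ?\<sigma> = "(s \<otimes>\<^sub>a\<^bsub>C\<^esub> t) **\<^bsub>C\<^esub> ainv C (J l m)"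
  have \<sigma>: "valid C ?\<sigma>" "src ?\<sigma> = S (l + m)" "tgt ?\<sigma> = X \<boxtimes>\<^bsub>C\<^esub> Y" using s t j by auto
  have st: "s \<otimes>\<^sub>a\<^bsub>C\<^esub> t = ?\<sigma> **\<^bsub>C\<^esub> J l m" using s t j by (simp add: C.acomp_assoc)
  have Fst: "FA (s \<otimes>\<^sub>a\<^bsub>C\<^esub> t) = FA ?\<sigma> **\<^bsub>D\<^esub> FA (J l m)"
   using \<sigma> j by (intro trans[OF arg_cong[where f = FA, OF st] f(6)]) auto
  have Gst: "GA (s \<otimes>\<^sub>a\<^bsub>C\<^esub> t) = GA ?\<sigma> **\<^bsub>D\<^esub> GA (J l m)"
   using \<sigma> j by (intro trans[OF arg_cong[where f = GA, OF st] g(6)]) auto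
  have "(\<eta> (X \<boxtimes>\<^bsub>C\<^esub> Y) **\<^bsub>D\<^esub> FT X Y) **\<^bsub>D\<^esub> x = \<eta> (X \<boxtimes>\<^bsub>C\<^esub> Y) **\<^bsub>D\<^esub> FA ?\<sigma> **\<^bsub>D\<^esub> ?mF l m"
   using natF[OF s(1) t(1)] s t unfolding x by (simp add: D.acomp_assoc Fst)
  also have "\<dots> = GA ?\<sigma> **\<^bsub>D\<^esub> \<theta>' (l + m) **\<^bsub>D\<^esub> ?mF l m"
   using D.reassoc[OF \<eta>(2)[OF _ \<sigma>]] XY by (simp add: D.acomp_assoc)
  also have "\<dots> = GA ?\<sigma> **\<^bsub>D\<^esub> ?mG l m **\<^bsub>D\<^esub> (\<theta>' l \<otimes>\<^sub>a\<^bsub>D\<^esub> \<theta>' m)" by (simp only: key)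
  also have "\<dots> = GA (s \<otimes>\<^sub>a\<^bsub>C\<^esub> t) **\<^bsub>D\<^esub> GT (S l) (S m) **\<^bsub>D\<^esub> (\<theta>' l \<otimes>\<^sub>a\<^bsub>D\<^esub> \<theta>' m)"
   by (simp only: Gst D.acomp_assoc)
  also have "\<dots> = GT X Y **\<^bsub>D\<^esub> (GA s \<otimes>\<^sub>a\<^bsub>D\<^esub> GA t) **\<^bsub>D\<^esub> (\<theta>' l \<otimes>\<^sub>a\<^bsub>D\<^esub> \<theta>' m)"
   using D.reassoc[OF natG[OF s(1) t(1)]] s t by (simp add: D.acomp_assoc)
  also have "\<dots> = GT X Y **\<^bsub>D\<^esub> ((\<eta> X **\<^bsub>D\<^esub> FA s) \<otimes>\<^sub>a\<^bsub>D\<^esub> (\<eta> Y **\<^bsub>D\<^esub> FA t))"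
   using \<eta>(2)[OF XY(1) s] \<eta>(2)[OF XY(2) t] s t by (simp add: D.interchange \<theta>' g)
  also have "\<dots> = (GT X Y **\<^bsub>D\<^esub> (\<eta> X \<otimes>\<^sub>a\<^bsub>D\<^esub> \<eta> Y)) **\<^bsub>D\<^esub> x"
   unfolding x using XY s t by (simp add: D.acomp_assoc D.interchange e f)
  finally show "(\<eta> (X \<boxtimes>\<^bsub>C\<^esub> Y) **\<^bsub>D\<^esub> FT X Y) **\<^bsub>D\<^esub> x = (GT X Y **\<^bsub>D\<^esub> (\<eta> X \<otimes>\<^sub>a\<^bsub>D\<^esub> \<eta> Y)) **\<^bsub>D\<^esub> x" .
 qed (use XY in \<open>auto simp: e tF tG f\<close>)
 show thesis by (rule that[OF \<eta>(1,3) ten])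
qed

end

section \<open>Braided structures on a linear functor\<close>

context pointed_source
begin

text \<open>The device of \<open>extend_nat\<close>, with one span element for each factor.
  Invertibility of \<open>h\<close> calls for a map out of \<open>FO (X \<boxtimes> Y)\<close> as
  well, and the same induction builds it.\<close>

lemma extend_ten:
 assumes F: "lfun C D FO FA" and J: "msys C S J w c" and m: "msys D (\<lambda>l. FO (S l)) \<mu> w' c'"
  and X: "X \<in> Ob C" and Y: "Y \<in> Ob C"
 obtains h where "aiso D h" "src h = FO X \<boxtimes>\<^bsub>D\<^esub> FO Y" "tgt h = FO (X \<boxtimes> Y)"
  "!!l m s t. valid C s ==> valid C t ==> src s = S l ==> src t = S m ==> tgt s = X ==> tgt t = Y ==>
    h \<bullet> (FA s \<otimes>\<^sub>D FA t) = FA ((s \<otimes>\<^sub>a t) ** ainv C (J l m)) \<bullet> \<mu> l m"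
proof -
 note f = lfunD[OF F] and j = C.msysD(3-6)[OF J] and u = D.msysD(3-6)[OF m]
 \<comment> \<open>For identities \<open>k\<close> and \<open>k'\<close>, these predicates say that
   \<open>h\<close> is prescribed by \<open>\<mu>\<close> on the covers, respectively that it undoes
   this prescription. General \<open>k\<close> and \<open>k'\<close> make them accessible to
   induction.\<close>
 let ?good = "\<lambda>k k' h. valid D h \<and> src h = FO X \<boxtimes>\<^bsub>D\<^esub> FO Y \<and> tgt h = FO (X \<boxtimes> Y) \<and>
  (\<forall>l m s t. valid C s --> valid C t --> src s = S l --> src t = S m --> tgt s = X --> tgt t = Y -->
    h \<bullet> (FA s \<otimes>\<^sub>D FA t) = FA (((k ** s) \<otimes>\<^sub>a (k' ** t)) ** ainv C (J l m)) \<bullet> \<mu> l m)"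
 let ?inv = "\<lambda>k k' h. valid D h \<and> src h = FO (X \<boxtimes> Y) \<and> tgt h = FO X \<boxtimes>\<^bsub>D\<^esub> FO Y \<and>
  (\<forall>l m s t. valid C s --> valid C t --> src s = S l --> src t = S m --> tgt s = X --> tgt t = Y -->
    h \<bullet> FA ((s \<otimes>\<^sub>a t) ** ainv C (J l m)) \<bullet> \<mu> l m = FA (k ** s) \<otimes>\<^sub>D FA (k' ** t))"
 have scal: "(\<exists>t. x = t \<odot>\<^sub>s idt C (S l) \<and> l = a) \<or> x = azero C (S l) (S a)"
  if "valid C x" "src x = S l" "tgt x = S a" for x l a
  using C.S_hom[OF that] by metis
 have gen: "(\<exists>h. ?good (g ** p) (g' ** p') h) \<and> (\<exists>h. ?inv (g ** p) (g' ** p') h)"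
  if g: "valid C g" "src g = S a" "tgt g = X" "valid C p" "src p = X" "tgt p = S a"
   "valid C g'" "src g' = S b" "tgt g' = Y" "valid C p'" "src p' = Y" "tgt p' = S b" for g p g' p' a b
 proof (intro conjI)
  let ?\<sigma> = "(g \<otimes>\<^sub>a g') ** ainv C (J a b)"
  show "\<exists>h. ?good (g ** p) (g' ** p') h"
  proof (intro exI[of _ "FA ?\<sigma> \<bullet> \<mu> a b \<bullet> (FA p \<otimes>\<^sub>D FA p')"] conjI allI impI)
   fix l m s t assume st: "valid C s" "valid C t" "src s = S l" "src t = S m" "tgt s = X" "tgt t = Y"
   define x y where "x = p ** s" and "y = p' ** t"
   have xy: "valid C x" "src x = S l" "tgt x = S a" "valid C y" "src y = S m" "tgt y = S b"
    using g st by (auto simp: x_def y_def)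
   have 1: "(FA ?\<sigma> \<bullet> \<mu> a b \<bullet> (FA p \<otimes>\<^sub>D FA p')) \<bullet> (FA s \<otimes>\<^sub>D FA t) =
     FA ?\<sigma> \<bullet> \<mu> a b \<bullet> (FA x \<otimes>\<^sub>D FA y)"
    using g st by (simp add: x_def y_def D.acomp_assoc D.interchange f)
   have 2: "((g ** p) ** s) \<otimes>\<^sub>a ((g' ** p') ** t) = (g \<otimes>\<^sub>a g') ** (x \<otimes>\<^sub>a y)"
    using g xy by (simp add: x_def y_def C.acomp_assoc C.interchange)
   from scal[OF xy(1-3)] scal[OF xy(4-6)]
   have "FA ?\<sigma> \<bullet> \<mu> a b \<bullet> (FA x \<otimes>\<^sub>D FA y) =
     FA (((g \<otimes>\<^sub>a g') ** (x \<otimes>\<^sub>a y)) ** ainv C (J l m)) \<bullet> \<mu> l m"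
    using g X Y by (auto simp: f j u lfun_azero[OF F] C.acomp_assoc D.acomp_assoc)
   then show "(FA ?\<sigma> \<bullet> \<mu> a b \<bullet> (FA p \<otimes>\<^sub>D FA p')) \<bullet> (FA s \<otimes>\<^sub>D FA t) =
     FA ((((g ** p) ** s) \<otimes>\<^sub>a ((g' ** p') ** t)) ** ainv C (J l m)) \<bullet> \<mu> l m"
    unfolding 1 2 .
  qed (use g in \<open>auto simp: f j u\<close>)
  show "\<exists>h. ?inv (g ** p) (g' ** p') h"
  proof (intro exI[of _ "(FA g \<otimes>\<^sub>D FA g') \<bullet> ainv D (\<mu> a b) \<bullet> FA (J a b ** (p \<otimes>\<^sub>a p'))"] conjI allI impI)
   fix l m s t assume st: "valid C s" "valid C t" "src s = S l" "src t = S m" "tgt s = X" "tgt t = Y"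
   define x y where "x = p ** s" and "y = p' ** t"
   have xy: "valid C x" "src x = S l" "tgt x = S a" "valid C y" "src y = S m" "tgt y = S b"
    using g st by (auto simp: x_def y_def)
   let ?h = "(FA g \<otimes>\<^sub>D FA g') \<bullet> ainv D (\<mu> a b) \<bullet> FA (J a b ** (p \<otimes>\<^sub>a p'))"
   have "FA (J a b ** (p \<otimes>\<^sub>a p')) \<bullet> FA ((s \<otimes>\<^sub>a t) ** ainv C (J l m)) =
     FA ((J a b ** (p \<otimes>\<^sub>a p')) ** ((s \<otimes>\<^sub>a t) ** ainv C (J l m)))"
    using g st j by (subst f(6)) auto
   also have "(J a b ** (p \<otimes>\<^sub>a p')) ** ((s \<otimes>\<^sub>a t) ** ainv C (J l m)) =
     J a b ** (x \<otimes>\<^sub>a y) ** ainv C (J l m)"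
    using g st by (simp add: x_def y_def C.acomp_assoc C.interchange')
   finally have 1: "?h \<bullet> FA ((s \<otimes>\<^sub>a t) ** ainv C (J l m)) \<bullet> \<mu> l m =
     (FA g \<otimes>\<^sub>D FA g') \<bullet> ainv D (\<mu> a b) \<bullet> FA (J a b ** (x \<otimes>\<^sub>a y) ** ainv C (J l m)) \<bullet> \<mu> l m"
    unfolding D.acomp_assoc using D.reassoc by metis
   have 2: "FA ((g ** p) ** s) \<otimes>\<^sub>D FA ((g' ** p') ** t) = (FA g \<otimes>\<^sub>D FA g') \<bullet> (FA x \<otimes>\<^sub>D FA y)"
    using g xy st by (simp add: x_def y_def C.acomp_assoc D.interchange f)
   from scal[OF xy(1-3)] scal[OF xy(4-6)]
   have "ainv D (\<mu> a b) \<bullet> FA (J a b ** (x \<otimes>\<^sub>a y) ** ainv C (J l m)) \<bullet> \<mu> l m = FA x \<otimes>\<^sub>D FA y"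
    using g X Y by (auto simp: f j u lfun_azero[OF F] C.acomp_assoc D.acomp_assoc)
   then show "?h \<bullet> FA ((s \<otimes>\<^sub>a t) ** ainv C (J l m)) \<bullet> \<mu> l m =
     FA ((g ** p) ** s) \<otimes>\<^sub>D FA ((g' ** p') ** t)"
    unfolding 1 2 by simp
  qed (use g in \<open>auto simp: f j u\<close>)
 qed
 have main: "(\<exists>h. ?good k k' h) \<and> (\<exists>h. ?inv k k' h)"
  if k: "k \<in> Span C C.Sg X X" and k': "k' \<in> Span C C.Sg Y Y" for k k'
  using k
 proof (induction rule: Span.induct)
  case zero
  note kv' = C.Span_valid[OF k']
  show ?case
   by (intro conjI exI[of _ "azero D (FO X \<boxtimes>\<^bsub>D\<^esub> FO Y) (FO (X \<boxtimes> Y))"]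
     exI[of _ "azero D (FO (X \<boxtimes> Y)) (FO X \<boxtimes>\<^bsub>D\<^esub> FO Y)"])
    (use X Y kv' in \<open>auto simp: f j u lfun_azero[OF F]\<close>)
 next
  case (add k1 k2)
  note kv' = C.Span_valid[OF k'] C.Span_valid[OF add(1)] C.Span_valid[OF add(2)]
  from add obtain h1 h2 i1 i2 where h: "?good k1 k' h1" "?good k2 k' h2" "?inv k1 k' i1" "?inv k2 k' i2" by blast
  have "?good (k1 \<boxplus> k2) k' (h1 \<boxplus>\<^bsub>D\<^esub> h2)"
   using h(1,2) kv' by (auto simp: D.aadd_acomp C.aadd_acomp C.aadd_aten f j u)
  moreover have "?inv (k1 \<boxplus> k2) k' (i1 \<boxplus>\<^bsub>D\<^esub> i2)"
   using h(3,4) kv' by (auto simp: D.aadd_acomp C.aadd_acomp D.aadd_aten f j u)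
  ultimately show ?case by blast
 next
  case (comp g p)
  then obtain a where ga: "src g = S a" by auto
  note gp = comp ga
  show ?case
   using k'
  proof (induction rule: Span.induct)
   case zero
   show ?case
    by (intro conjI exI[of _ "azero D (FO X \<boxtimes>\<^bsub>D\<^esub> FO Y) (FO (X \<boxtimes> Y))"]
      exI[of _ "azero D (FO (X \<boxtimes> Y)) (FO X \<boxtimes>\<^bsub>D\<^esub> FO Y)"])
     (use X Y gp in \<open>auto simp: f j u lfun_azero[OF F]\<close>)
  next
   case (add k1 k2)
   note kv' = C.Span_valid[OF add(1)] C.Span_valid[OF add(2)]
   let ?k = "g ** p"
   have kv: "valid C ?k" "src ?k = X" "tgt ?k = X" using gp by auto
   from add obtain h1 h2 i1 i2 where h: "?good ?k k1 h1" "?good ?k k2 h2" "?inv ?k k1 i1" "?inv ?k k2 i2" by blast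
   have "?good ?k (k1 \<boxplus> k2) (h1 \<boxplus>\<^bsub>D\<^esub> h2)"
    using h(1,2) kv' kv by (auto simp: D.aadd_acomp C.aadd_acomp C.aten_aadd f(7) f(2,3,4) j u)
   moreover have "?inv ?k (k1 \<boxplus> k2) (i1 \<boxplus>\<^bsub>D\<^esub> i2)"
    using h(3,4) kv' kv by (auto simp: D.aadd_acomp C.aadd_acomp D.aten_aadd f(7) f(2,3,4) j u)
   ultimately show ?case by blast
  next
   case (comp g' p')
   then obtain b where "src g' = S b" by auto
   with comp gp show ?case by (intro gen) auto
  qed
 qed
 have id: "idt C X \<in> Span C C.Sg X X" "idt C Y \<in> Span C C.Sg Y Y"
  using C.S_covers X Y by (auto simp: covers_def)
 from main[OF id] obtain h i where h: "?good (idt C X) (idt C Y) h" and i: "?inv (idt C X) (idt C Y) i" by blast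
 have h': "h \<bullet> (FA s \<otimes>\<^sub>D FA t) = FA ((s \<otimes>\<^sub>a t) ** ainv C (J l m)) \<bullet> \<mu> l m"
  if "valid C s" "valid C t" "src s = S l" "src t = S m" "tgt s = X" "tgt t = Y" for l m s t
  using h that by simp
 have i': "i \<bullet> FA ((s \<otimes>\<^sub>a t) ** ainv C (J l m)) \<bullet> \<mu> l m = FA s \<otimes>\<^sub>D FA t"
  if "valid C s" "valid C t" "src s = S l" "src t = S m" "tgt s = X" "tgt t = Y" for l m s t
  using i that by simp
 have ih: "i \<bullet> h = idt D (FO X \<boxtimes>\<^bsub>D\<^esub> FO Y)"
 proof (rule D.covers_eqI[OF F_covers2[OF F X Y]])
  fix x assume "x \<in> {FA s \<otimes>\<^sub>D FA t | s t. valid C s \<and> valid C t \<and>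
   src s \<in> range S \<and> src t \<in> range S \<and> tgt s = X \<and> tgt t = Y}"
  then obtain s t l m where x: "x = FA s \<otimes>\<^sub>D FA t" and st: "valid C s" "valid C t" "src s = S l" "src t = S m" "tgt s = X" "tgt t = Y"
   by auto
  show "(i \<bullet> h) \<bullet> x = idt D (FO X \<boxtimes>\<^bsub>D\<^esub> FO Y) \<bullet> x"
   using st unfolding x D.acomp_assoc h'[OF st] i'[OF st] by (simp add: f)
 qed (use h i X Y in \<open>auto simp: f\<close>)
 \<comment> \<open>\<open>FO (X \<boxtimes> Y)\<close> is covered by the images of the products
   \<open>s \<otimes>\<^sub>a t\<close>, because \<open>FA\<close> preserves covers. The rule for
   \<open>i\<close> applies after composition with the isomorphism \<open>\<mu> l m\<close>, which
   is then cancelled.\<close>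
 have hi: "h \<bullet> i = idt D (FO (X \<boxtimes> Y))"
 proof (rule D.covers_eqI[OF lfun_covers[OF F C.Sg_covers2[OF X Y]]])
  fix x assume "x \<in> FA ` {g \<in> {s \<otimes>\<^sub>a t | s t. valid C s \<and> valid C t \<and> src s \<in> range S \<and> src t \<in> range S \<and> tgt s = X \<and> tgt t = Y}.
   valid C g \<and> tgt g = X \<boxtimes> Y}"
  then obtain s t l m where x: "x = FA (s \<otimes>\<^sub>a t)" and st: "valid C s" "valid C t" "src s = S l" "src t = S m" "tgt s = X" "tgt t = Y"
   by auto
  let ?\<sigma> = "(s \<otimes>\<^sub>a t) ** ainv C (J l m)"
  have \<sigma>: "valid C ?\<sigma>" "src ?\<sigma> = S (l + m)" "tgt ?\<sigma> = X \<boxtimes> Y" using st j by auto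
  have "((h \<bullet> i) \<bullet> FA ?\<sigma>) \<bullet> \<mu> l m = FA ?\<sigma> \<bullet> \<mu> l m"
   unfolding D.acomp_assoc i'[OF st] h'[OF st] ..
  then have "(h \<bullet> i) \<bullet> FA ?\<sigma> = FA ?\<sigma>"
   by (rule D.aiso_epic[rotated]) (use h i f \<sigma> u X Y in auto)
  then have "((h \<bullet> i) \<bullet> FA ?\<sigma>) \<bullet> FA (J l m) = FA ?\<sigma> \<bullet> FA (J l m)" by simp
  moreover have "FA ?\<sigma> \<bullet> FA (J l m) = x"
   using \<sigma> st j unfolding x by (subst f(6)[symmetric]) (simp_all add: C.acomp_assoc)
  ultimately have "(h \<bullet> i) \<bullet> x = x" unfolding D.acomp_assoc by simp
  moreover have "idt D (FO (X \<boxtimes> Y)) \<bullet> x = x" unfolding x using st f by simp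
  ultimately show "(h \<bullet> i) \<bullet> x = idt D (FO (X \<boxtimes> Y)) \<bullet> x" by simp
 qed (use h i X Y in \<open>auto simp: f\<close>)
 have "aiso D h" using ih hi h i by (intro D.aisoI[of h i]) auto
 with h h' show thesis by (intro that) auto
qed

text \<open>The tensor structure is forced on covers by \<open>\<mu>\<close>, and each coherence
  equation reduces there to the corresponding equations for \<open>J\<close> and
  \<open>\<mu>\<close>. These match because the two systems have the same constants \<open>w\<close>
  and \<open>c\<close>.\<close>

theorem braided_structure:
 assumes F: "lfun C D FO FA" and J: "msys C S J w c" and m: "msys D (\<lambda>l. FO (S l)) \<mu> w c"
  and un: "isomorphic D (FO (Unit C)) (Unit D)"
 obtains FT where "bfun C D FO FA FT"
proof -
 note f = lfunD[OF F] and j = C.msysD(3-6)[OF J] and u = D.msysD(3-6)[OF m]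
 have "\<exists>h. aiso D h \<and> src h = FO X \<boxtimes>\<^bsub>D\<^esub> FO Y \<and> tgt h = FO (X \<boxtimes> Y) \<and>
  (\<forall>l m s t. valid C s --> valid C t --> src s = S l --> src t = S m --> tgt s = X --> tgt t = Y -->
    h \<bullet> (FA s \<otimes>\<^sub>D FA t) = FA ((s \<otimes>\<^sub>a t) ** ainv C (J l m)) \<bullet> \<mu> l m)"
  if "X \<in> Ob C" "Y \<in> Ob C" for X Y
  by (rule extend_ten[OF F J m that]) blast
 then obtain FT where "!!X Y. X \<in> Ob C ==> Y \<in> Ob C ==> aiso D (FT X Y) \<and> src (FT X Y) = FO X \<boxtimes>\<^bsub>D\<^esub> FO Y \<and> tgt (FT X Y) = FO (X \<boxtimes> Y) \<and>
  (\<forall>l m s t. valid C s --> valid C t --> src s = S l --> src t = S m --> tgt s = X --> tgt t = Y -->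
    FT X Y \<bullet> (FA s \<otimes>\<^sub>D FA t) = FA ((s \<otimes>\<^sub>a t) ** ainv C (J l m)) \<bullet> \<mu> l m)" by metis
 note FT0 = this
 have t: "aiso D (FT X Y)" "valid D (FT X Y)" "src (FT X Y) = FO X \<boxtimes>\<^bsub>D\<^esub> FO Y" "tgt (FT X Y) = FO (X \<boxtimes> Y)"
  if "X \<in> Ob C" "Y \<in> Ob C" for X Y
  using FT0[OF that] by auto
 have FT: "FT (tgt s) (tgt t) \<bullet> (FA s \<otimes>\<^sub>D FA t) = FA ((s \<otimes>\<^sub>a t) ** ainv C (J l m)) \<bullet> \<mu> l m"
  if "valid C s" "valid C t" "src s = S l" "src t = S m" for s t l m
  using FT0[of "tgt s" "tgt t"] that by auto
 have "bfun C D FO FA FT"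
  unfolding bfun_def
 proof (intro conjI ballI allI impI)
  fix a b assume a: "valid C a" and b: "valid C b"
  show "FT (tgt a) (tgt b) \<bullet> (FA a \<otimes>\<^sub>D FA b) = FA (a \<otimes>\<^sub>a b) \<bullet> FT (src a) (src b)"
  proof (rule D.covers_eqI[OF F_covers2[OF F, of "src a" "src b"]])
   fix x assume "x \<in> {FA s \<otimes>\<^sub>D FA t | s t. valid C s \<and> valid C t \<and>
    src s \<in> range S \<and> src t \<in> range S \<and> tgt s = src a \<and> tgt t = src b}"
   then obtain s t l m where x: "x = FA s \<otimes>\<^sub>D FA t" and st: "valid C s" "valid C t" "src s = S l" "src t = S m" "tgt s = src a" "tgt t = src b"
    by auto
   have "(FT (tgt a) (tgt b) \<bullet> (FA a \<otimes>\<^sub>D FA b)) \<bullet> x = FT (tgt (a ** s)) (tgt (b ** t)) \<bullet> (FA (a ** s) \<otimes>\<^sub>D FA (b ** t))"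
    unfolding x using st a b by (simp add: D.acomp_assoc D.interchange f)
   also have "\<dots> = FA (((a ** s) \<otimes>\<^sub>a (b ** t)) ** ainv C (J l m)) \<bullet> \<mu> l m"
    by (rule FT) (use st a b in auto)
   also have "((a ** s) \<otimes>\<^sub>a (b ** t)) ** ainv C (J l m) = (a \<otimes>\<^sub>a b) ** ((s \<otimes>\<^sub>a t) ** ainv C (J l m))"
    using st a b by (simp add: C.interchange')
   also have "FA \<dots> = FA (a \<otimes>\<^sub>a b) \<bullet> FA ((s \<otimes>\<^sub>a t) ** ainv C (J l m))"
    using st a b j by (intro f(6)) auto
   finally show "(FT (tgt a) (tgt b) \<bullet> (FA a \<otimes>\<^sub>D FA b)) \<bullet> x = (FA (a \<otimes>\<^sub>a b) \<bullet> FT (src a) (src b)) \<bullet> x"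
    using FT[OF st(1-4)] st unfolding x by (simp add: D.acomp_assoc)
  qed (use a b in \<open>auto simp: t f\<close>)
 next
  fix X Y Z assume XYZ: "X \<in> Ob C" "Y \<in> Ob C" "Z \<in> Ob C"
  show "FA (aass C X Y Z) \<bullet> FT (X \<boxtimes> Y) Z \<bullet> (FT X Y \<otimes>\<^sub>D idt D (FO Z)) =
    FT X (Y \<boxtimes> Z) \<bullet> (idt D (FO X) \<otimes>\<^sub>D FT Y Z) \<bullet> aass D (FO X) (FO Y) (FO Z)" (is "?L = ?R")
  proof (rule D.covers_eqI[OF F_covers3[OF F XYZ]])
   fix x assume "x \<in> {(FA s \<otimes>\<^sub>D FA t) \<otimes>\<^sub>D FA r | s t r. valid C s \<and> valid C t \<and> valid C r \<and>
    src s \<in> range S \<and> src t \<in> range S \<and> src r \<in> range S \<and> tgt s = X \<and> tgt t = Y \<and> tgt r = Z}"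
   then obtain s t r l m n where x: "x = (FA s \<otimes>\<^sub>D FA t) \<otimes>\<^sub>D FA r"
    and st: "valid C s" "valid C t" "valid C r" "src s = S l" "src t = S m" "src r = S n" "tgt s = X" "tgt t = Y" "tgt r = Z"
    by auto
   let ?\<sigma> = "(s \<otimes>\<^sub>a t) ** ainv C (J l m)" and ?\<tau> = "(t \<otimes>\<^sub>a r) ** ainv C (J m n)"
   have \<sigma>: "valid C ?\<sigma>" "src ?\<sigma> = S (l + m)" "tgt ?\<sigma> = X \<boxtimes> Y" using st j by auto
   have \<tau>: "valid C ?\<tau>" "src ?\<tau> = S (m + n)" "tgt ?\<tau> = Y \<boxtimes> Z" using st j by auto
   define a where "a = (?\<sigma> \<otimes>\<^sub>a r) ** ainv C (J (l + m) n)"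
   define b where "b = (s \<otimes>\<^sub>a ?\<tau>) ** ainv C (J l (m + n))"
   have av: "valid C a" "src a = S (l + m + n)" "tgt a = (X \<boxtimes> Y) \<boxtimes> Z" using \<sigma> st j by (auto simp: a_def)
   have bv: "valid C b" "src b = S (l + m + n)" "tgt b = X \<boxtimes> (Y \<boxtimes> Z)" using \<tau> st j by (auto simp: b_def add.assoc)
   \<comment> \<open>\<open>a\<close> and \<open>b\<close> are two ways of seeing \<open>s\<close>,
     \<open>t\<close>, \<open>r\<close> as a single arrow from \<open>S (l + m + n)\<close>; they
     differ by the associator and the factor \<open>w l m n\<close>.\<close>
   have ab: "w l m n \<odot>\<^sub>s (aass C X Y Z ** a) = b"
   proof (rule C.aiso_epic[of "J (l + m) n ** (J l m \<otimes>\<^sub>a idt C (S n))"])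
    have "(w l m n \<odot>\<^sub>s (aass C X Y Z ** a)) ** J (l + m) n ** (J l m \<otimes>\<^sub>a idt C (S n)) =
      w l m n \<odot>\<^sub>s (aass C X Y Z ** ((s \<otimes>\<^sub>a t) \<otimes>\<^sub>a r))"
     using st j unfolding a_def by (simp add: C.acomp_assoc C.interchange)
    also have "\<dots> = w l m n \<odot>\<^sub>s ((s \<otimes>\<^sub>a t \<otimes>\<^sub>a r) ** aass C (S l) (S m) (S n))"
     using st by (simp add: C.aass_natural)
    also have "\<dots> = b ** J (l + m) n ** (J l m \<otimes>\<^sub>a idt C (S n))"
     unfolding C.msysD(9)[OF J] using st j by (simp add: b_def C.acomp_assoc C.interchange C.interchange')
    finally show "(w l m n \<odot>\<^sub>s (aass C X Y Z ** a)) ** J (l + m) n ** (J l m \<otimes>\<^sub>a idt C (S n)) =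
     b ** J (l + m) n ** (J l m \<otimes>\<^sub>a idt C (S n))" .
   qed (use XYZ j av bv in \<open>auto\<close>)
   have FTs: "FT X Y \<bullet> (FA s \<otimes>\<^sub>D FA t) = FA ?\<sigma> \<bullet> \<mu> l m" "FT Y Z \<bullet> (FA t \<otimes>\<^sub>D FA r) = FA ?\<tau> \<bullet> \<mu> m n"
    "FT (X \<boxtimes> Y) Z \<bullet> (FA ?\<sigma> \<otimes>\<^sub>D FA r) = FA a \<bullet> \<mu> (l + m) n"
    "FT X (Y \<boxtimes> Z) \<bullet> (FA s \<otimes>\<^sub>D FA ?\<tau>) = FA b \<bullet> \<mu> l (m + n)"
    using FT[OF st(1,2,4,5)] FT[OF st(2,3,5,6)] FT[OF \<sigma>(1) st(3) \<sigma>(2) st(6)] FT[OF st(1) \<tau>(1) st(4) \<tau>(2)] \<sigma>(3) \<tau>(3) st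
    unfolding a_def b_def by simp_all
   have "?L \<bullet> x = FA (aass C X Y Z) \<bullet> FT (X \<boxtimes> Y) Z \<bullet> ((FT X Y \<bullet> (FA s \<otimes>\<^sub>D FA t)) \<otimes>\<^sub>D FA r)"
    unfolding x using st XYZ by (simp add: D.acomp_assoc D.interchange f t)
   also have "\<dots> = FA (aass C X Y Z) \<bullet> FT (X \<boxtimes> Y) Z \<bullet> (FA ?\<sigma> \<otimes>\<^sub>D FA r) \<bullet> (\<mu> l m \<otimes>\<^sub>D idt D (FO (S n)))"
    unfolding FTs using \<sigma> st u by (simp add: D.interchange f(2-4))
   also have "\<dots> = FA (aass C X Y Z) \<bullet> FA a \<bullet> \<mu> (l + m) n \<bullet> (\<mu> l m \<otimes>\<^sub>D idt D (FO (S n)))"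
    unfolding D.reassoc[OF FTs(3)] D.acomp_assoc ..
   also have "\<dots> = (w l m n \<odot>\<^sub>s\<^bsub>D\<^esub> FA (aass C X Y Z ** a)) \<bullet> \<mu> l (m + n) \<bullet> (idt D (FO (S l)) \<otimes>\<^sub>D \<mu> m n) \<bullet> aass D (FO (S l)) (FO (S m)) (FO (S n))"
    unfolding D.msysD(9)[OF m] using XYZ av by (simp add: f D.acomp_assoc)
   also have "w l m n \<odot>\<^sub>s\<^bsub>D\<^esub> FA (aass C X Y Z ** a) = FA b"
    unfolding ab[symmetric] using XYZ av by (subst f(8)) auto
   also have "FA b \<bullet> \<mu> l (m + n) \<bullet> (idt D (FO (S l)) \<otimes>\<^sub>D \<mu> m n) \<bullet> aass D (FO (S l)) (FO (S m)) (FO (S n)) =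
    FT X (Y \<boxtimes> Z) \<bullet> (FA s \<otimes>\<^sub>D FA ?\<tau>) \<bullet> (idt D (FO (S l)) \<otimes>\<^sub>D \<mu> m n) \<bullet> aass D (FO (S l)) (FO (S m)) (FO (S n))"
    unfolding D.reassoc[OF FTs(4)] D.acomp_assoc ..
   also have "\<dots> = FT X (Y \<boxtimes> Z) \<bullet> (FA s \<otimes>\<^sub>D (FT Y Z \<bullet> (FA t \<otimes>\<^sub>D FA r))) \<bullet> aass D (FO (S l)) (FO (S m)) (FO (S n))"
    unfolding FTs using \<tau> st u by (simp add: D.interchange' f(2-4))
   also have "\<dots> = FT X (Y \<boxtimes> Z) \<bullet> (idt D (FO X) \<otimes>\<^sub>D FT Y Z) \<bullet> (FA s \<otimes>\<^sub>D (FA t \<otimes>\<^sub>D FA r)) \<bullet> aass D (FO (S l)) (FO (S m)) (FO (S n))"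
    using st XYZ by (simp add: D.interchange' f t)
   also have "\<dots> = ?R \<bullet> x"
    unfolding x using st by (simp add: D.acomp_assoc D.aass_natural f)
   finally show "?L \<bullet> x = ?R \<bullet> x" .
  qed (use XYZ in \<open>auto simp: t f\<close>)
 next
  fix X Y assume XY: "X \<in> Ob C" "Y \<in> Ob C"
  show "FA (abr C X Y) \<bullet> FT X Y = FT Y X \<bullet> abr D (FO X) (FO Y)" (is "?L = ?R")
  proof (rule D.covers_eqI[OF F_covers2[OF F XY]])
   fix x assume "x \<in> {FA s \<otimes>\<^sub>D FA t | s t. valid C s \<and> valid C t \<and>
    src s \<in> range S \<and> src t \<in> range S \<and> tgt s = X \<and> tgt t = Y}"
   then obtain s t l m where x: "x = FA s \<otimes>\<^sub>D FA t" and st: "valid C s" "valid C t" "src s = S l" "src t = S m" "tgt s = X" "tgt t = Y"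
    by auto
   let ?a = "(s \<otimes>\<^sub>a t) ** ainv C (J l m)" and ?b = "(t \<otimes>\<^sub>a s) ** ainv C (J m l)"
   have av: "valid C ?a" "src ?a = S (l + m)" "tgt ?a = X \<boxtimes> Y" "valid C ?b" "src ?b = S (l + m)" "tgt ?b = Y \<boxtimes> X"
    using st j by (auto simp: add.commute)
   have ab: "abr C X Y ** ?a = c l m \<odot>\<^sub>s ?b"
   proof (rule C.aiso_epic[of "J l m"])
    have "(abr C X Y ** ?a) ** J l m = (t \<otimes>\<^sub>a s) ** abr C (S l) (S m)"
     using st j by (simp add: C.acomp_assoc C.abr_natural)
    also have "\<dots> = ?b ** J m l ** abr C (S l) (S m)"
     using st j by (simp add: C.acomp_assoc)
    also have "\<dots> = (c l m \<odot>\<^sub>s ?b) ** J l m" unfolding C.msysD(10)[OF J] by simp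
    finally show "(abr C X Y ** ?a) ** J l m = (c l m \<odot>\<^sub>s ?b) ** J l m" .
   qed (use j av XY in auto)
   have "?L \<bullet> x = FA (abr C X Y) \<bullet> FA ?a \<bullet> \<mu> l m"
    unfolding x D.acomp_assoc using FT[OF st(1-4)] st by simp
   also have "\<dots> = FA (abr C X Y ** ?a) \<bullet> \<mu> l m"
    using av XY by (subst f(6)) (auto simp: D.acomp_assoc)
   also have "\<dots> = FA ?b \<bullet> c l m \<odot>\<^sub>s\<^bsub>D\<^esub> \<mu> l m"
    unfolding ab using av by (subst f(8)) auto
   also have "\<dots> = (FA ?b \<bullet> \<mu> m l) \<bullet> abr D (FO (S l)) (FO (S m))"
    unfolding D.acomp_assoc D.msysD(10)[OF m] ..
   also have "FA ?b \<bullet> \<mu> m l = FT Y X \<bullet> (FA t \<otimes>\<^sub>D FA s)"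
    using FT[OF st(2,1,4,3)] st by simp
   also have "(FT Y X \<bullet> (FA t \<otimes>\<^sub>D FA s)) \<bullet> abr D (FO (S l)) (FO (S m)) = ?R \<bullet> x"
    unfolding x using st by (simp add: D.acomp_assoc D.abr_natural f)
   finally show "?L \<bullet> x = ?R \<bullet> x" .
  qed (use XY in \<open>auto simp: t f\<close>)
 qed (use F un t in auto)
 then show thesis by (rule that)
qed

end

section \<open>Permuting the simple objects\<close>

context linear_category
begin

lemma zero_object_iff: "zero_object C Z \<longleftrightarrow> Z \<in> Ob C \<and> idt C Z = azero C Z Z"
 by (auto simp: zero_object_def idt_def azero_def)

lemma zero_object_eq:
 assumes "zero_object C Z" "valid C f" "tgt f = Z"
 shows "f = azero C (src f) Z"
proof -
 have "f = idt C Z ** f" using assms by simp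
 also have "\<dots> = azero C Z Z ** f" using assms by (simp add: zero_object_iff)
 also have "\<dots> = azero C (src f) Z" using assms by (simp add: zero_object_iff)
 finally show ?thesis .
qed

lemma direct_sumE:
 assumes "direct_sum C X Y V"
 obtains i j p r where "valid C i" "src i = X" "tgt i = V" "valid C j" "src j = Y" "tgt j = V"
  "valid C p" "src p = V" "tgt p = X" "valid C r" "src r = V" "tgt r = Y"
  "p ** i = idt C X" "r ** j = idt C Y" "p ** j = azero C Y X" "r ** i = azero C X Y"
  "(i ** p) \<boxplus> (j ** r) = idt C V"
proof -
 from assms obtain i j p r where h: "i \<in> Hom C X V" "j \<in> Hom C Y V" "p \<in> Hom C V X" "r \<in> Hom C V Y"
  "p \<cdot> i = Id C X" "r \<cdot> j = Id C Y" "p \<cdot> j = Zero C Y X" "r \<cdot> i = Zero C X Y"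
  "Add C (i \<cdot> p) (j \<cdot> r) = Id C V"
  unfolding direct_sum_def by blast
 have "i \<cdot> p \<in> Hom C V V" "j \<cdot> r \<in> Hom C V V" using h Comp_in_Hom by blast+
 then show thesis
  using h by (intro that[of "Arrow X i V" "Arrow Y j V" "Arrow V p X" "Arrow V r Y"])
   (simp_all add: acomp_def idt_def azero_def aadd_def)
qed

lemma direct_sumI:
 assumes "valid C i" "src i = X" "tgt i = V" "valid C j" "src j = Y" "tgt j = V"
  "valid C p" "src p = V" "tgt p = X" "valid C r" "src r = V" "tgt r = Y"
  "p ** i = idt C X" "r ** j = idt C Y" "p ** j = azero C Y X" "r ** i = azero C X Y"
  "(i ** p) \<boxplus> (j ** r) = idt C V"
 shows "direct_sum C X Y V"
 unfolding direct_sum_def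
proof (intro bexI conjI)
 show "mor p \<cdot> mor i = Id C X" "mor r \<cdot> mor j = Id C Y" "mor p \<cdot> mor j = Zero C Y X" "mor r \<cdot> mor i = Zero C X Y"
  using arg_cong[OF assms(13), of mor] arg_cong[OF assms(14), of mor] arg_cong[OF assms(15), of mor] arg_cong[OF assms(16), of mor] assms(1-12)
  by (simp_all add: mor_acomp mor_idt)
 show "Add C (mor i \<cdot> mor p) (mor j \<cdot> mor r) = Id C V"
  using arg_cong[OF assms(17), of mor] assms(1-12) by (simp add: mor_aadd mor_acomp mor_idt)
qed (use assms in auto)

text \<open>Reduces covers to finite ones, for the induction in
  \<open>ex_dsum_retract\<close>.\<close>

lemma Span_finite:
 assumes "f \<in> Span C G X Y"
 shows "\<exists>G0. finite G0 \<and> G0 \<subseteq> G \<and> f \<in> Span C G0 X Y"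
 using assms
proof (induction rule: Span.induct)
 case zero
 then show ?case by (intro exI[of _ "{}"]) (auto intro: Span.zero)
next
 case (comp g p)
 then show ?case by (intro exI[of _ "{g}"]) (auto intro: Span.comp)
next
 case (add f h)
 then obtain G1 G2 where "finite G1" "G1 \<subseteq> G" "f \<in> Span C G1 X Y" "finite G2" "G2 \<subseteq> G" "h \<in> Span C G2 X Y"
  by blast
 moreover have "f \<in> Span C (G1 \<union> G2) X Y" by (rule Span_mono[OF \<open>f \<in> Span C G1 X Y\<close>]) simp
 moreover have "h \<in> Span C (G1 \<union> G2) X Y" by (rule Span_mono[OF \<open>h \<in> Span C G2 X Y\<close>]) simp
 ultimately show ?case by (intro exI[of _ "G1 \<union> G2"]) (auto intro: Span.add)
qed

text \<open>With a single generator, a sum of composites is one composite, because the sum can be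
  taken in the second factor.\<close>

lemma Span_singleton:
 assumes "k \<in> Span C {t} X W" "valid C t" "tgt t = W" "X \<in> Ob C"
 obtains p where "valid C p" "src p = X" "tgt p = src t" "k = t ** p"
proof -
 have "\<exists>p. valid C p \<and> src p = X \<and> tgt p = src t \<and> k = t ** p"
  using assms(1)
 proof (induction rule: Span.induct)
  case zero
  then show ?case using assms by (intro exI[of _ "azero C X (src t)"]) simp
 next
  case (add f h)
  then obtain p p' where "valid C p" "src p = X" "tgt p = src t" "f = t ** p"
   "valid C p'" "src p' = X" "tgt p' = src t" "h = t ** p'" by auto
  then show ?case by (intro exI[of _ "p \<boxplus> p'"]) (simp add: acomp_aadd)
 qed auto
 then show thesis using that by blast
qed

end

inductive dsum :: "('o, 'm, 'k, 'z) lin_cat_scheme => ('b => 'o) => 'o => bool" for C S where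
 zero: "zero_object C Z ==> dsum C S Z"
| add: "dsum C S W ==> direct_sum C W (S l) V ==> dsum C S V"

lemma (in linear_category) dsum_Ob: "dsum C S Z ==> Z \<in> Ob C"
proof (induction rule: dsum.induct)
 case (zero Z)
 then show ?case by (simp add: zero_object_iff)
next
 case (add W l V)
 from direct_sumE[OF add(2)] show ?case using valid_Ob by metis
qed

section \<open>Decomposition of objects into generators\<close>

context pointed_family
begin

text \<open>As the identity of \<open>Z\<close> factors through generators, a nonzero
  \<open>s\<close> stays nonzero after some \<open>p\<close> back to \<open>S l\<close>, and there
  the composite is an invertible scalar.\<close>

lemma left_inverse:
 assumes s: "valid C s" "src s = S l" "tgt s = Z" "s ~= azero C (S l) Z"
 obtains p where "valid C p" "src p = Z" "tgt p = S l" "p ** s = idt C (S l)"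
proof -
 have Z: "Z \<in> Ob C" using s by auto
 have "\<exists>p. valid C p \<and> src p = Z \<and> tgt p = S l \<and> p ** s ~= azero C (S l) (S l)"
 proof (rule ccontr)
  assume *: "\<not> ?thesis"
  have "k ** s = azero C (S l) Z" if "k \<in> Span C Sg Z Z" for k
   using that
  proof (induction rule: Span.induct)
   case (comp g p)
   then obtain m where m: "src g = S m" by auto
   have "p ** s = azero C (S l) (S m)"
   proof (cases "l = m")
    case True
    then show ?thesis using * comp m by auto
   next
    case False
    then show ?thesis using comp m s by (intro S_orth) auto
   qed
   then show ?case using comp m by (simp add: acomp_assoc)
  qed (use s Z in \<open>auto simp: aadd_acomp\<close>)
  from this[of "idt C Z"] show False using S_covers[OF Z] s by (simp add: covers_def)
 qed
 then obtain p where p: "valid C p" "src p = Z" "tgt p = S l" "p ** s ~= azero C (S l) (S l)" by blast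
 have "valid C (p ** s)" "src (p ** s) = S l" "tgt (p ** s) = S l" using p s by auto
 then obtain c where c: "p ** s = c \<odot>\<^sub>s idt C (S l)"
  using S_scalar[of l] unfolding scalar_def by blast
 with p have "c ~= 0" by auto
 then show thesis using p c by (intro that[of "inverse c \<odot>\<^sub>s p"]) simp_all
qed

text \<open>A splitting process: \<open>e = i ** r\<close> projects onto the part of
  \<open>Z\<close> already split off, and \<open>q\<close> is the complementary idempotent. If
  \<open>g\<close> is not yet reached, \<open>q ** g\<close> is nonzero, and
  \<open>left_inverse\<close> splits off one more copy of \<open>S l\<close>.\<close>

lemma ex_dsum_retract:
 assumes Z: "Z \<in> Ob C" and "finite G0" "G0 \<subseteq> Sg"
 shows "\<exists>W i r. dsum C S W \<and> valid C i \<and> src i = W \<and> tgt i = Z \<and> valid C r \<and> src r = Z \<and> tgt r = W \<and>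
  r ** i = idt C W \<and> (\<forall>g\<in>G0. valid C g --> tgt g = Z --> i ** r ** g = g)"
 using assms(2,3)
proof (induction rule: finite_induct)
 case empty
 obtain W where W: "zero_object C W" using ex_zero by blast
 then show ?case
  using Z by (intro exI[of _ W] exI[of _ "azero C W Z"] exI[of _ "azero C Z W"])
   (auto simp: zero_object_iff intro: dsum.zero)
next
 case (insert g G)
 then obtain W i r where W: "dsum C S W" and i: "valid C i" "src i = W" "tgt i = Z"
  and r: "valid C r" "src r = Z" "tgt r = W" "r ** i = idt C W"
  and G: "!!x. x \<in> G ==> valid C x ==> tgt x = Z ==> i ** r ** x = x" by auto
 note W_Ob = dsum_Ob[OF W]
 show ?case
 proof (cases "valid C g \<and> tgt g = Z \<and> i ** r ** g ~= g")
  case False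
  then show ?thesis using W i r G by (intro exI[of _ W] exI[of _ i] exI[of _ r]) auto
 next
  case True
  then have g: "valid C g" "tgt g = Z" "i ** r ** g ~= g" by auto
  from insert.prems obtain l where l: "src g = S l" by auto
  define e where "e = i ** r"
  define q where "q = idt C Z \<boxplus> (- 1) \<odot>\<^sub>s e"
  have e: "valid C e" "src e = Z" "tgt e = Z" using i r by (auto simp: e_def)
  have q: "valid C q" "src q = Z" "tgt q = Z" using e Z by (auto simp: q_def)
  have ee: "e ** e = e" using i r by (simp add: e_def acomp_assoc reassoc[OF r(4)])
  have q_app: "q ** x = x \<boxplus> (- 1) \<odot>\<^sub>s (e ** x)" if "valid C x" "tgt x = Z" for x
   using that by (simp add: q_def aadd_acomp)
  have qe: "q ** e = azero C Z Z" using q_app[of e] e ee by (simp add: aadd_cancel)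
  have qi: "q ** i = azero C W Z"
   using q_app[OF i(1,3)] i r by (simp add: e_def acomp_assoc aadd_cancel)
  have rq: "r ** q = azero C Z W"
   using i r Z e by (simp add: q_def acomp_aadd e_def reassoc[OF r(4)] aadd_cancel)
  have qq: "q ** q = q"
  proof -
   have "q ** q = q \<boxplus> (- 1) \<odot>\<^sub>s (q ** e)"
    using e Z q by (subst (2) q_def) (simp add: acomp_aadd)
   then show ?thesis using q e Z by (simp add: qe)
  qed
  have tq: "tgt g = src q" using q(2) g(2) by (rule trans[OF _ sym, rotated])
  have s': "valid C (q ** g)" "src (q ** g) = S l" "tgt (q ** g) = Z"
   unfolding valid_acomp src_acomp[OF g(1) q(1) tq] tgt_acomp[OF g(1) q(1) tq] using g q tq l by blast+
  have "q ** g ~= azero C (S l) Z"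
  proof
   assume "q ** g = azero C (S l) Z"
   then have z: "g \<boxplus> (- 1) \<odot>\<^sub>s (e ** g) = azero C (src g) (tgt g)"
    using q_app[OF g(1,2)] g(2) l by simp
   have "g = e ** g" by (rule eq_if_diff_zero[OF g(1) _ _ _ z]) (use g(1,2) e in simp_all)
   then have "g = i ** r ** g" unfolding e_def acomp_assoc .
   with g(3) show False by metis
  qed
  from left_inverse[OF s' this] obtain p0 where p0: "valid C p0" "src p0 = Z" "tgt p0 = S l" "p0 ** q ** g = idt C (S l)"
   by blast
  obtain V where V: "direct_sum C W (S l) V" using S_sum[OF W_Ob] by blast
  from direct_sumE[OF V] obtain i1 j1 p1 r1 where
   s: "valid C i1" "src i1 = W" "tgt i1 = V" "valid C j1" "src j1 = S l" "tgt j1 = V"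
   "valid C p1" "src p1 = V" "tgt p1 = W" "valid C r1" "src r1 = V" "tgt r1 = S l"
   "p1 ** i1 = idt C W" "r1 ** j1 = idt C (S l)" "p1 ** j1 = azero C (S l) W" "r1 ** i1 = azero C W (S l)"
   "(i1 ** p1) \<boxplus> (j1 ** r1) = idt C V" by blast
  \<comment> \<open>The new summand is embedded by \<open>q ** g\<close> and projected by
    \<open>p0 ** q\<close>; the factors \<open>q\<close> keep it orthogonal to the old part.\<close>
  define i' where "i' = (i ** p1) \<boxplus> (q ** g ** r1)"
  define r' where "r' = (i1 ** r) \<boxplus> (j1 ** p0 ** q)"
  note ty = i r g q p0 s(1-12) l W_Ob Z
  have i': "valid C i'" "src i' = V" "tgt i' = Z" using ty by (auto simp: i'_def)
  have r': "valid C r'" "src r' = Z" "tgt r' = V" using ty by (auto simp: r'_def)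
  have V_Ob: "V \<in> Ob C" using i' by auto
  have "r' ** i' = ((i1 ** r ** i ** p1) \<boxplus> (i1 ** r ** q ** g ** r1)) \<boxplus> ((j1 ** p0 ** q ** i ** p1) \<boxplus> (j1 ** p0 ** q ** q ** g ** r1))"
   unfolding r'_def aadd_acomp by (simp add: i'_def acomp_aadd acomp_assoc)
  also have "\<dots> = (i1 ** p1) \<boxplus> (j1 ** r1)"
   using ty V_Ob by (simp add: reassoc[OF r(4)] reassoc[OF rq] reassoc[OF qi] reassoc[OF qq] reassoc[OF p0(4), unfolded acomp_assoc])
  finally have r'i': "r' ** i' = idt C V" using s by simp
  have i'r': "i' ** r' ** x = (i ** r ** x) \<boxplus> (q ** g ** p0 ** q ** x)" if x: "valid C x" "tgt x = Z" for x
  proof -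
   have "i' ** r' ** x = ((i ** p1 ** i1 ** r ** x) \<boxplus> (i ** p1 ** j1 ** p0 ** q ** x)) \<boxplus>
     ((q ** g ** r1 ** i1 ** r ** x) \<boxplus> (q ** g ** r1 ** j1 ** p0 ** q ** x))"
    unfolding i'_def aadd_acomp by (simp add: r'_def aadd_acomp acomp_aadd acomp_assoc)
   also have "\<dots> = (i ** r ** x) \<boxplus> (q ** g ** p0 ** q ** x)"
    using ty x by (simp add: reassoc[OF s(13)] reassoc[OF s(14)] reassoc[OF s(15)] reassoc[OF s(16)])
   finally show ?thesis .
  qed
  have "i' ** r' ** x = x" if x: "x \<in> insert g G" "valid C x" "tgt x = Z" for x
  proof (cases "x = g")
   case True
   have "(i ** r ** g) \<boxplus> (q ** g) = (i ** r ** g) \<boxplus> (g \<boxplus> (- 1) \<odot>\<^sub>s (i ** r ** g))"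
    using q_app[OF g(1,2)] by (simp add: e_def acomp_assoc)
   also have "\<dots> = ((i ** r ** g) \<boxplus> (- 1) \<odot>\<^sub>s (i ** r ** g)) \<boxplus> g"
    using ty by (subst aadd_commute[of g]) (simp add: aadd_assoc)
   also have "\<dots> = g" using ty by (simp add: aadd_cancel)
   finally show ?thesis unfolding True using i'r'[OF g(1,2)] p0(4) ty by simp
  next
   case False
   then have "i ** r ** x = x" using G x by simp
   moreover from this have "q ** x = azero C (src x) Z"
    using q_app[OF x(2,3)] x by (simp add: e_def acomp_assoc aadd_cancel)
   ultimately show ?thesis using i'r'[OF x(2,3)] ty x by simp
  qed
  then show ?thesis
   using i' r' r'i' dsum.add[OF W V] by (intro exI[of _ V] exI[of _ i'] exI[of _ r']) auto
 qed
qed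

lemma ex_dsum_iso:
 assumes Z: "Z \<in> Ob C"
 obtains W f where "dsum C S W" "aiso C f" "src f = Z" "tgt f = W"
proof -
 obtain G0 where G0: "finite G0" "G0 \<subseteq> Sg" "idt C Z \<in> Span C G0 Z Z"
  using Span_finite[of "idt C Z" Sg Z Z] S_covers[OF Z] by (auto simp: covers_def)
 from ex_dsum_retract[OF Z G0(1,2)] obtain W i r where W: "dsum C S W" "valid C i" "src i = W" "tgt i = Z" "valid C r"
  "src r = Z" "tgt r = W" "r ** i = idt C W" and G: "\<forall>g\<in>G0. valid C g --> tgt g = Z --> i ** r ** g = g" by blast
 have "i ** r = idt C Z"
 proof (rule covers_eqI[of Z G0])
  show "covers C Z G0" using G0(3) Z by (simp add: covers_def)
  show "(i ** r) ** g = idt C Z ** g" if "g \<in> G0" "valid C g" "tgt g = Z" for g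
   using G that by (simp add: acomp_assoc)
 qed (use W Z in auto)
 then have "aiso C r" using W by (intro aisoI[of r i]) auto
 then show thesis using W by (intro that[of W r]) auto
qed

end

text \<open>\<open>R\<close> is a linear bijection between the multiplicity spaces of \<open>S1 l\<close> in \<open>Z\<close> and of \<open>S2 l\<close> in \<open>W\<close>, for
 all \<open>l\<close>.\<close>

definition mult_rel :: "('o, 'm, 'k, 'z) lin_cat_scheme => ('b => 'o) => ('b => 'o) => 'o => 'o =>
  ('b => ('o, 'm) arrow => ('o, 'm) arrow => bool) => bool" where
 "mult_rel C S1 S2 Z W R \<longleftrightarrow> Z \<in> Ob C \<and> W \<in> Ob C \<and>
   (\<forall>l s t. R l s t --> s \<in> Ar C (S1 l) Z \<and> t \<in> Ar C (S2 l) W) \<and>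
   (\<forall>l. \<forall>s\<in>Ar C (S1 l) Z. \<exists>t. R l s t) \<and> (\<forall>l. \<forall>t\<in>Ar C (S2 l) W. \<exists>s. R l s t) \<and>
   (\<forall>l s t t'. R l s t --> R l s t' --> t = t') \<and> (\<forall>l s s' t. R l s t --> R l s' t --> s = s') \<and>
   (\<forall>l s t s' t'. R l s t --> R l s' t' --> R l (s \<boxplus>\<^bsub>C\<^esub> s') (t \<boxplus>\<^bsub>C\<^esub> t')) \<and>
   (\<forall>l s t c. R l s t --> R l (c \<odot>\<^sub>s\<^bsub>C\<^esub> s) (c \<odot>\<^sub>s\<^bsub>C\<^esub> t))"

text \<open>The part of \<open>pointed_family\<close> that survives every permutation of the labels,
  additive or not.\<close>

definition generators :: "('o, 'm, 'k, 'z) lin_cat_scheme => ('b => 'o) => bool" where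
 "generators C S \<longleftrightarrow> (\<forall>l. scalar C (S l)) \<and>
   (\<forall>f l m. valid C f --> src f = S l --> tgt f = S m --> l ~= m --> f = azero C (S l) (S m)) \<and>
   (\<forall>Z\<in>Ob C. covers C Z {s. src s \<in> range S})"

context linear_category
begin

lemma mult_relD:
 assumes "mult_rel C S1 S2 Z W R"
 shows "Z \<in> Ob C" "W \<in> Ob C"
  "R l s t ==> valid C s \<and> src s = S1 l \<and> tgt s = Z \<and> valid C t \<and> src t = S2 l \<and> tgt t = W"
  "valid C s ==> src s = S1 l ==> tgt s = Z ==> \<exists>t. R l s t"
  "valid C t ==> src t = S2 l ==> tgt t = W ==> \<exists>s. R l s t"
  "R l s t ==> R l s t' ==> t = t'" "R l s t ==> R l s' t ==> s = s'"
  "R l s t ==> R l s' t' ==> R l (s \<boxplus> s') (t \<boxplus> t')" "R l s t ==> R l (c \<odot>\<^sub>s s) (c \<odot>\<^sub>s t)"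
proof -
 note m = assms[unfolded mult_rel_def]
 note m3 = m[THEN conjunct2, THEN conjunct2] and m4 = m[THEN conjunct2, THEN conjunct2, THEN conjunct2]
 note m5 = m4[THEN conjunct2] and m6 = m4[THEN conjunct2, THEN conjunct2]
 note m7 = m6[THEN conjunct2] and m8 = m6[THEN conjunct2, THEN conjunct2] and m9 = m6[THEN conjunct2, THEN conjunct2, THEN conjunct2]
 show "Z \<in> Ob C" "W \<in> Ob C" using m by simp_all
 show "R l s t ==> valid C s \<and> src s = S1 l \<and> tgt s = Z \<and> valid C t \<and> src t = S2 l \<and> tgt t = W"
  using m3[THEN conjunct1, rule_format, of l s t] by (simp add: Ar_iff)
 show "valid C s ==> src s = S1 l ==> tgt s = Z ==> \<exists>t. R l s t"
  using m4[THEN conjunct1, rule_format, of s l] by (simp add: Ar_iff)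
 show "valid C t ==> src t = S2 l ==> tgt t = W ==> \<exists>s. R l s t"
  using m5[THEN conjunct1, rule_format, of t l] by (simp add: Ar_iff)
 show "R l s t ==> R l s t' ==> t = t'" using m6[THEN conjunct1] by blast
 show "R l s t ==> R l s' t ==> s = s'" using m7[THEN conjunct1] by blast
 show "R l s t ==> R l s' t' ==> R l (s \<boxplus> s') (t \<boxplus> t')" using m8[THEN conjunct1] by blast
 show "R l s t ==> R l (c \<odot>\<^sub>s s) (c \<odot>\<^sub>s t)" using m9 by blast
qed

text \<open>A relation in place of a function makes the inversion immediate; it yields fullness of
  the permuting functor.\<close>

lemma mult_rel_converse:
 assumes "mult_rel C S1 S2 Z W R"
 shows "mult_rel C S2 S1 W Z (\<lambda>l s t. R l t s)"
proof -
 note d = mult_relD[OF assms]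
 show ?thesis unfolding mult_rel_def
 proof (intro conjI allI ballI impI)
  show "s \<in> Ar C (S2 l) W" "t \<in> Ar C (S1 l) Z" if "R l t s" for l s t
   using d(3)[OF that] by (simp_all add: Ar_iff)
  show "W \<in> Ob C" "Z \<in> Ob C" by (fact d)+
  show "\<exists>t. R l t s" if "s \<in> Ar C (S2 l) W" for l s using d(5)[of s l] that by (simp add: Ar_iff)
  show "\<exists>s. R l t s" if "t \<in> Ar C (S1 l) Z" for l t using d(4)[of t l] that by (simp add: Ar_iff)
  show "t = t'" if "R l t s" "R l t' s" for l s t t' using d(7)[OF that] .
  show "s = s'" if "R l t s" "R l t s'" for l s s' t using d(6)[OF that] .
  show "R l (t \<boxplus> t') (s \<boxplus> s')" if "R l t s" "R l t' s'" for l s t s' t' using d(8)[OF that] .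
  show "R l (c \<odot>\<^sub>s t) (c \<odot>\<^sub>s s)" if "R l t s" for l s t c using d(9)[OF that] .
 qed
qed

lemma mult_rel_azero:
 assumes R: "mult_rel C S1 S2 Z W R" and "S1 l \<in> Ob C" "S2 l \<in> Ob C"
 shows "R l (azero C (S1 l) Z) (azero C (S2 l) W)"
proof -
 note d = mult_relD[OF R]
 obtain t where t: "R l (azero C (S1 l) Z) t" using d(4)[of "azero C (S1 l) Z" l] assms d(1) by auto
 from d(9)[OF t, of 0] d(3)[OF t] show ?thesis using assms d(1) by simp
qed

lemma generators_hom:
 assumes "generators C S" "valid C f" "src f = S l" "tgt f = S m"
 obtains "f = azero C (S l) (S m)" | c where "l = m" "f = c \<odot>\<^sub>s idt C (S l)"
 using assms unfolding generators_def scalar_def by metis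

text \<open>Existence is an induction over the span as in \<open>extend_nat\<close>, uniqueness is
  tested on a cover of \<open>W\<close>. Uniqueness is what later makes the transfer of morphisms
  functorial.\<close>

lemma mult_rel_transfer:
 assumes S1: "generators C S1" and S2: "generators C S2"
  and R: "mult_rel C S1 S2 Z W R" and R': "mult_rel C S1 S2 Z' W' R'" and f: "valid C f" "src f = Z" "tgt f = Z'"
 shows "\<exists>!h. valid C h \<and> src h = W \<and> tgt h = W' \<and> (\<forall>l s t. R l s t --> R' l (f ** s) (h ** t))"
proof -
 note d = mult_relD[OF R] and d' = mult_relD[OF R']
 have Ob [simp]: "S1 l \<in> Ob C" "S2 l \<in> Ob C" for l
  using S1 S2 by (auto simp: generators_def scalar_def)
 have zz: "R l (azero C (S1 l) Z) (azero C (S2 l) W)" "R' l (azero C (S1 l) Z') (azero C (S2 l) W')" for l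
  by (rule mult_rel_azero[OF R] mult_rel_azero[OF R'], simp_all)+
 have cov: "covers C W {s. src s \<in> range S2}" using S2 d(2) by (simp add: generators_def)
 have main: "\<exists>h. valid C h \<and> src h = W \<and> tgt h = W' \<and>
  (\<forall>l t s. valid C t --> src t = S2 l --> tgt t = W --> R l s (k ** t) --> R' l (f ** s) (h ** t))"
  if "k \<in> Span C {s. src s \<in> range S2} W W" for k
  using that
 proof (induction rule: Span.induct)
  case zero
  show ?case
  proof (intro exI[of _ "azero C W W'"] conjI allI impI)
   fix l t s assume t: "valid C t" "src t = S2 l" "tgt t = W" "R l s (azero C W W ** t)"
   then have "R l s (azero C (S2 l) W)" using d(2) by simp
   then have "s = azero C (S1 l) Z" using d(7) zz(1) by blast
   then show "R' l (f ** s) (azero C W W' ** t)" using t f zz(2)[of l] d'(2) by simp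
  qed (use d(2) d'(2) in auto)
 next
  case (add k1 k2)
  then obtain h1 h2 where h: "valid C h1" "src h1 = W" "tgt h1 = W'"
   "!!l t s. valid C t ==> src t = S2 l ==> tgt t = W ==> R l s (k1 ** t) ==> R' l (f ** s) (h1 ** t)"
   "valid C h2" "src h2 = W" "tgt h2 = W'"
   "!!l t s. valid C t ==> src t = S2 l ==> tgt t = W ==> R l s (k2 ** t) ==> R' l (f ** s) (h2 ** t)" by blast
  note kv = Span_valid[OF add(1)] Span_valid[OF add(2)]
  show ?case
  proof (intro exI[of _ "h1 \<boxplus> h2"] conjI allI impI)
   fix l t s assume t: "valid C t" "src t = S2 l" "tgt t = W" and s: "R l s ((k1 \<boxplus> k2) ** t)"
   obtain s1 s2 where s12: "R l s1 (k1 ** t)" "R l s2 (k2 ** t)"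
    using d(5)[of "k1 ** t" l] d(5)[of "k2 ** t" l] t kv by auto
   then have "s = s1 \<boxplus> s2" using d(7)[OF s] d(8)[OF s12] by (simp add: aadd_acomp)
   then show "R' l (f ** s) ((h1 \<boxplus> h2) ** t)"
    using d'(8)[OF h(4)[OF t s12(1)] h(8)[OF t s12(2)]] by (simp add: aadd_acomp acomp_aadd)
  qed (use h in auto)
 next
  case (comp g p)
  then obtain m where m: "src g = S2 m" by auto
  \<comment> \<open>\<open>g\<close> is the partner of \<open>u\<close>, so \<open>h\<close> has to
    send it to the partner \<open>t0\<close> of \<open>f ** u\<close>.\<close>
  obtain u where u: "R m u g" using d(5)[of g m] comp m by auto
  note ud = d(3)[OF u]
  obtain t0 where t0: "R' m (f ** u) t0" using d'(4)[of "f ** u" m] ud f by auto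
  note t0d = d'(3)[OF t0]
  show ?case
  proof (intro exI[of _ "t0 ** p"] conjI allI impI)
   fix l t s assume t: "valid C t" "src t = S2 l" "tgt t = W" and s: "R l s ((g ** p) ** t)"
   have pt: "valid C (p ** t)" "src (p ** t) = S2 l" "tgt (p ** t) = S2 m" using comp t m by auto
   show "R' l (f ** s) ((t0 ** p) ** t)"
   proof (rule generators_hom[OF S2 pt])
    assume z: "p ** t = azero C (S2 l) (S2 m)"
    then have "R l s (azero C (S2 l) W)" using s comp m by (simp add: acomp_assoc)
    then have "s = azero C (S1 l) Z" using d(7) zz(1) by blast
    then show ?thesis using f t0d zz(2)[of l] by (simp add: acomp_assoc z)
   next
    fix c assume lm: "l = m" and z: "p ** t = c \<odot>\<^sub>s idt C (S2 l)"
    then have "R l s (c \<odot>\<^sub>s g)" using s comp m by (simp add: acomp_assoc)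
    then have "s = c \<odot>\<^sub>s u" using d(7) d(9)[OF u, of c] lm by blast
    then show ?thesis using d'(9)[OF t0, of c] lm t0d by (simp add: acomp_assoc z)
   qed
  qed (use comp t0d m in auto)
 qed
 obtain h where h: "valid C h" "src h = W" "tgt h = W'"
  "!!l t s. valid C t ==> src t = S2 l ==> tgt t = W ==> R l s (idt C W ** t) ==> R' l (f ** s) (h ** t)"
  using main[of "idt C W"] cov by (auto simp: covers_def)
 show ?thesis
 proof (rule ex1I[of _ h])
  show "valid C h \<and> src h = W \<and> tgt h = W' \<and> (\<forall>l s t. R l s t --> R' l (f ** s) (h ** t))"
   using h d(3) by auto
  fix h' assume h': "valid C h' \<and> src h' = W \<and> tgt h' = W' \<and> (\<forall>l s t. R l s t --> R' l (f ** s) (h' ** t))"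
  show "h' = h"
  proof (rule covers_eqI[OF cov])
   fix g assume g: "g \<in> {s. src s \<in> range S2}" "valid C g" "tgt g = W"
   then obtain l where l: "src g = S2 l" by auto
   obtain s where s: "R l s g" using d(5)[OF g(2) l g(3)] by blast
   have a: "R' l (f ** s) (h' ** g)" using h' s by blast
   have b: "R' l (f ** s) (h ** g)" using h(4)[OF g(2) l g(3)] s g by simp
   show "h' ** g = h ** g" by (rule d'(6)[OF a b])
  qed (use h h' in auto)
 qed
qed

text \<open>The construction of \<open>Z\<close> from zero by adding summands is copied, with
  \<open>S2 l\<close> in place of each \<open>S1 l\<close>.\<close>

lemma mult_rel_dsum:
 assumes S1: "generators C S1" and S2: "generators C S2" and Z: "dsum C S1 Z"
  and sum: "!!W l. W \<in> Ob C ==> \<exists>V. direct_sum C W (S2 l) V" and zero: "\<exists>Z. zero_object C Z"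
 shows "\<exists>W R. mult_rel C S1 S2 Z W R"
 using Z
proof (induction rule: dsum.induct)
 case (zero Z)
 obtain W where W: "zero_object C W" using assms(5) by blast
 have Ob: "S1 l \<in> Ob C" "S2 l \<in> Ob C" for l
  using S1 S2 by (auto simp: generators_def scalar_def)
 have ZW: "Z \<in> Ob C" "W \<in> Ob C" using zero W by (auto simp: zero_object_iff)
 have u: "s = azero C (S1 l) Z" if "s \<in> Ar C (S1 l) Z" for s l
  using zero_object_eq[OF zero, of s] that by (simp add: Ar_iff)
 have u': "s = azero C (S2 l) W" if "s \<in> Ar C (S2 l) W" for s l
  using zero_object_eq[OF W, of s] that by (simp add: Ar_iff)
 have z: "azero C (S1 l) Z \<in> Ar C (S1 l) Z" "azero C (S2 l) W \<in> Ar C (S2 l) W" for l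
  using Ob ZW by (auto simp: Ar_iff)
 have cl: "s \<in> Ar C X Y ==> t \<in> Ar C X Y ==> s \<boxplus> t \<in> Ar C X Y" "s \<in> Ar C X Y ==> c \<odot>\<^sub>s s \<in> Ar C X Y" for s t c X Y
  by (auto simp: Ar_iff)
 show ?case
  unfolding mult_rel_def
 proof (intro exI[of _ W] exI[of _ "\<lambda>l s t. s \<in> Ar C (S1 l) Z \<and> t \<in> Ar C (S2 l) W"] conjI allI ballI impI)
  show "Z \<in> Ob C" "W \<in> Ob C" by fact+
  show "\<exists>t. s \<in> Ar C (S1 l) Z \<and> t \<in> Ar C (S2 l) W" if "s \<in> Ar C (S1 l) Z" for l s using z(2)[of l] that by blast
  show "\<exists>s. s \<in> Ar C (S1 l) Z \<and> t \<in> Ar C (S2 l) W" if "t \<in> Ar C (S2 l) W" for l t using z(1)[of l] that by blast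
  show "t = t'" if "s \<in> Ar C (S1 l) Z \<and> t \<in> Ar C (S2 l) W" "s \<in> Ar C (S1 l) Z \<and> t' \<in> Ar C (S2 l) W" for l s t t'
   using u'[of t l] u'[of t' l] that by simp
  show "s = s'" if "s \<in> Ar C (S1 l) Z \<and> t \<in> Ar C (S2 l) W" "s' \<in> Ar C (S1 l) Z \<and> t \<in> Ar C (S2 l) W" for l s s' t
   using u[of s l] u[of s' l] that by simp
 qed (simp_all add: cl)
next
 case (add Z l0 V)
 then obtain W R where R: "mult_rel C S1 S2 Z W R" by blast
 note d = mult_relD[OF R]
 have Ob [simp]: "S1 l \<in> Ob C" "S2 l \<in> Ob C" for l
  using S1 S2 by (auto simp: generators_def scalar_def)
 obtain V' where V': "direct_sum C W (S2 l0) V'" using sum[OF d(2)] by blast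
 from direct_sumE[OF add(2)] obtain i j p r where
  s: "valid C i" "src i = Z" "tgt i = V" "valid C j" "src j = S1 l0" "tgt j = V"
  "valid C p" "src p = V" "tgt p = Z" "valid C r" "src r = V" "tgt r = S1 l0"
  "p ** i = idt C Z" "r ** j = idt C (S1 l0)" "p ** j = azero C (S1 l0) Z" "r ** i = azero C Z (S1 l0)"
  "(i ** p) \<boxplus> (j ** r) = idt C V" by blast
 from direct_sumE[OF V'] obtain i' j' p' r' where
  s': "valid C i'" "src i' = W" "tgt i' = V'" "valid C j'" "src j' = S2 l0" "tgt j' = V'"
  "valid C p'" "src p' = V'" "tgt p' = W" "valid C r'" "src r' = V'" "tgt r' = S2 l0"
  "p' ** i' = idt C W" "r' ** j' = idt C (S2 l0)" "p' ** j' = azero C (S2 l0) W" "r' ** i' = azero C W (S2 l0)"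
  "(i' ** p') \<boxplus> (j' ** r') = idt C V'" by blast
 \<comment> \<open>The relation for the new summand alone. At \<open>l0\<close> its multiplicity
   space is a line, and equal multiples of the two identities correspond; at other labels there is
   only zero.\<close>
 define T where "T l x y \<longleftrightarrow> (l = l0 \<and> (\<exists>c. x = c \<odot>\<^sub>s idt C (S1 l0) \<and> y = c \<odot>\<^sub>s idt C (S2 l0))) \<or>
   (l ~= l0 \<and> x = azero C (S1 l) (S1 l0) \<and> y = azero C (S2 l) (S2 l0))" for l x y
 have T1: "\<exists>y. T l x y" if "valid C x" "src x = S1 l" "tgt x = S1 l0" for l x
  using generators_hom[OF S1 that] that S1 unfolding T_def generators_def scalar_def by metis
 have T2: "\<exists>x. T l x y" if "valid C y" "src y = S2 l" "tgt y = S2 l0" for l y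
  using generators_hom[OF S2 that] that S2 unfolding T_def generators_def scalar_def by metis
 have sc: "scalar C (S1 l0)" "scalar C (S2 l0)" using S1 S2 by (auto simp: generators_def)
 have inj: "c = e" if "c \<odot>\<^sub>s idt C (S1 l0) = e \<odot>\<^sub>s idt C (S1 l0) \<or> c \<odot>\<^sub>s idt C (S2 l0) = e \<odot>\<^sub>s idt C (S2 l0)" for c e
  using that scalar_cancel[of "idt C (S1 l0)" c e] scalar_cancel[of "idt C (S2 l0)" c e] sc by auto
 have T3: "y = y'" if "T l x y" "T l x y'" for l x y y' using that inj unfolding T_def by metis
 have T4: "x = x'" if "T l x y" "T l x' y" for l x x' y using that inj unfolding T_def by metis
 have T5: "T l (x \<boxplus> x') (y \<boxplus> y')" if "T l x y" "T l x' y'" for l x x' y y'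
  using that asmult_add_left unfolding T_def by (auto simp flip: asmult_add_left)
 have T6: "T l (c \<odot>\<^sub>s x) (c \<odot>\<^sub>s y)" if "T l x y" for l x y c
  using that unfolding T_def by auto
 have T7: "valid C x \<and> src x = S1 l \<and> tgt x = S1 l0 \<and> valid C y \<and> src y = S2 l \<and> tgt y = S2 l0" if "T l x y" for l x y
  using that unfolding T_def by auto
 have VOb: "V \<in> Ob C" "V' \<in> Ob C" using s s' by auto
 define Q where "Q l x y \<longleftrightarrow> x \<in> Ar C (S1 l) V \<and> y \<in> Ar C (S2 l) V' \<and> R l (p ** x) (p' ** y) \<and> T l (r ** x) (r' ** y)" for l x y
 have dec: "x = (i ** p ** x) \<boxplus> (j ** r ** x)" if "valid C x" "tgt x = V" for x
  using that s(17) by (metis aadd_acomp acomp_assoc idt_acomp)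
 have dec': "x = (i' ** p' ** x) \<boxplus> (j' ** r' ** x)" if "valid C x" "tgt x = V'" for x
  using that s'(17) by (metis aadd_acomp acomp_assoc idt_acomp)
 have "mult_rel C S1 S2 V V' Q"
  unfolding mult_rel_def
 proof (intro conjI allI ballI impI)
  show "V \<in> Ob C" "V' \<in> Ob C" by fact+
  show "x \<in> Ar C (S1 l) V" "y \<in> Ar C (S2 l) V'" if "Q l x y" for l x y using that by (auto simp: Q_def)
  show "\<exists>y. Q l x y" if "x \<in> Ar C (S1 l) V" for l x
  proof -
   from that have x: "valid C x" "src x = S1 l" "tgt x = V" by (auto simp: Ar_iff)
   obtain t y where ty: "R l (p ** x) t" "T l (r ** x) y"
    using d(4)[of "p ** x" l] T1[of "r ** x" l] x s by auto
   have "p' ** ((i' ** t) \<boxplus> (j' ** y)) = t" "r' ** ((i' ** t) \<boxplus> (j' ** y)) = y"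
    using d(3)[OF ty(1)] T7[OF ty(2)] s' d(2)
    by (simp_all add: acomp_aadd reassoc[OF s'(13)] reassoc[OF s'(14)] reassoc[OF s'(15)] reassoc[OF s'(16)])
   then have "Q l x ((i' ** t) \<boxplus> (j' ** y))"
    using ty x d(3)[OF ty(1)] T7[OF ty(2)] s' by (simp add: Q_def Ar_iff)
   then show ?thesis by blast
  qed
  show "\<exists>x. Q l x y" if "y \<in> Ar C (S2 l) V'" for l y
  proof -
   from that have x: "valid C y" "src y = S2 l" "tgt y = V'" by (auto simp: Ar_iff)
   obtain t x where ty: "R l t (p' ** y)" "T l x (r' ** y)"
    using d(5)[of "p' ** y" l] T2[of "r' ** y" l] x s' by auto
   have "p ** ((i ** t) \<boxplus> (j ** x)) = t" "r ** ((i ** t) \<boxplus> (j ** x)) = x"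
    using d(3)[OF ty(1)] T7[OF ty(2)] s d(1)
    by (simp_all add: acomp_aadd reassoc[OF s(13)] reassoc[OF s(14)] reassoc[OF s(15)] reassoc[OF s(16)])
   then have "Q l ((i ** t) \<boxplus> (j ** x)) y"
    using ty x d(3)[OF ty(1)] T7[OF ty(2)] s by (simp add: Q_def Ar_iff)
   then show ?thesis by blast
  qed
  show "y = y'" if "Q l x y" "Q l x y'" for l x y y'
  proof -
   have "p' ** y = p' ** y'" "r' ** y = r' ** y'" using that d(6) T3 unfolding Q_def by blast+
   then show ?thesis using dec'[of y] dec'[of y'] that by (simp add: Q_def Ar_iff)
  qed
  show "x = x'" if "Q l x y" "Q l x' y" for l x x' y
  proof -
   have "p ** x = p ** x'" "r ** x = r ** x'" using that d(7) T4 unfolding Q_def by blast+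
   then show ?thesis using dec[of x] dec[of x'] that by (simp add: Q_def Ar_iff)
  qed
  show "Q l (x \<boxplus> x') (y \<boxplus> y')" if "Q l x y" "Q l x' y'" for l x y x' y'
   using that d(8) T5 by (auto simp: Q_def Ar_iff acomp_aadd)
  show "Q l (c \<odot>\<^sub>s x) (c \<odot>\<^sub>s y)" if "Q l x y" for l x y c
   using that d(9) T6 by (auto simp: Q_def Ar_iff)
 qed
 then show ?case by blast
qed

end

section \<open>Linear equivalences that permute the generators\<close>

context pointed_family
begin

lemma generators_S: "generators C S"
 unfolding generators_def using S_scalar S_orth S_covers by blast

lemma generators_perm:
 assumes "bij \<beta>"
 shows "generators C (\<lambda>l. S (\<beta> l))"
proof -
 have r: "range (\<lambda>l. S (\<beta> l)) = range S"
  using bij_is_surj[OF assms] by (metis image_image)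
 have "f = azero C (S (\<beta> l)) (S (\<beta> m))"
  if "valid C f" "src f = S (\<beta> l)" "tgt f = S (\<beta> m)" "l ~= m" for f l m
  using S_orth[OF that(1-3)] that(4) bij_is_inj[OF assms] by (auto dest: injD)
 then show ?thesis unfolding generators_def r using S_scalar S_covers by blast
qed

text \<open>An isomorphism onto a sum of generators reduces this to
  \<open>mult_rel_dsum\<close>.\<close>

lemma ex_mult_rel:
 assumes b: "bij \<beta>" and Z: "Z \<in> Ob C"
 shows "\<exists>W R. mult_rel C S (\<lambda>l. S (\<beta> l)) Z W R"
proof -
 obtain Z0 f where Z0: "dsum C S Z0" and f: "aiso C f" "src f = Z" "tgt f = Z0" by (rule ex_dsum_iso[OF Z])
 obtain W R where R: "mult_rel C S (\<lambda>l. S (\<beta> l)) Z0 W R"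
  using mult_rel_dsum[OF generators_S generators_perm[OF b] Z0 S_sum ex_zero] by blast
 note d = mult_relD[OF R]
 have "mult_rel C S (\<lambda>l. S (\<beta> l)) Z W (\<lambda>l s t. s \<in> Ar C (S l) Z \<and> R l (f ** s) t)"
  unfolding mult_rel_def
 proof (intro conjI allI ballI impI)
  show "\<exists>t. s \<in> Ar C (S l) Z \<and> R l (f ** s) t" if "s \<in> Ar C (S l) Z" for l s
   using d(4)[of "f ** s" l] that f by (auto simp: Ar_iff)
  show "\<exists>s. s \<in> Ar C (S l) Z \<and> R l (f ** s) t" if "t \<in> Ar C (S (\<beta> l)) W" for l t
  proof -
   from d(5)[of t l] that obtain s where s: "R l s t" by (auto simp: Ar_iff)
   then show ?thesis using d(3)[OF s] f by (intro exI[of _ "ainv C f ** s"]) (auto simp: Ar_iff)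
  qed
  show "s = s'" if "s \<in> Ar C (S l) Z \<and> R l (f ** s) t" "s' \<in> Ar C (S l) Z \<and> R l (f ** s') t" for l s s' t
  proof -
   have eq: "f ** s = f ** s'" using that d(7) by blast
   have v: "valid C s" "tgt s = Z" "valid C s'" "tgt s' = Z" using that by (simp_all add: Ar_iff)
   show ?thesis by (rule aiso_monic[OF f(1) eq v(1,3)]) (simp_all add: v f)
  qed
  show "R l (f ** (s \<boxplus> s')) (t \<boxplus> t')" if "s \<in> Ar C (S l) Z \<and> R l (f ** s) t" "s' \<in> Ar C (S l) Z \<and> R l (f ** s') t'" for l s t s' t'
   using that d(8) by (simp add: acomp_aadd)
  show "R l (f ** (c \<odot>\<^sub>s s)) (c \<odot>\<^sub>s t)" if "s \<in> Ar C (S l) Z \<and> R l (f ** s) t" for l s t c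
   using that d(9) by simp
 qed (use Z d in \<open>auto simp: Ar_iff\<close>)
 then show ?thesis by blast
qed

text \<open>\<open>FO Z\<close> is any object whose multiplicity spaces are those of
  \<open>Z\<close> with the labels moved by \<open>\<beta>\<close>. On morphisms there is exactly
  one choice compatible with the relations, so identities, composites and linear combinations are
  respected.\<close>

theorem ex_permuting_functor:
 assumes b: "bij \<beta>"
 obtains FO FA where "lfun C C FO FA"
  "!!X Y f g. valid C f ==> valid C g ==> src f = X ==> src g = X ==> tgt f = Y ==> tgt g = Y ==> FA f = FA g ==> f = g"
  "!!X Y h. X \<in> Ob C ==> Y \<in> Ob C ==> valid C h ==> src h = FO X ==> tgt h = FO Y ==>
    \<exists>f. valid C f \<and> src f = X \<and> tgt f = Y \<and> FA f = h"
  "!!Y. Y \<in> Ob C ==> \<exists>X\<in>Ob C. isomorphic C (FO X) Y"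
  "!!l. isomorphic C (FO (S l)) (S (\<beta> l))"
proof -
 let ?T = "\<lambda>l. S (\<beta> l)"
 note g1 = generators_S and g2 = generators_perm[OF b]
 from ex_mult_rel[OF b] obtain FO R where R: "!!Z. Z \<in> Ob C ==> mult_rel C S ?T Z (FO Z) (R Z)" by metis
 define FA where "FA f = (THE h. valid C h \<and> src h = FO (src f) \<and> tgt h = FO (tgt f) \<and>
   (\<forall>l s t. R (src f) l s t --> R (tgt f) l (f ** s) (h ** t)))" for f
 have ex1: "\<exists>!h. valid C h \<and> src h = FO (src f) \<and> tgt h = FO (tgt f) \<and>
   (\<forall>l s t. R (src f) l s t --> R (tgt f) l (f ** s) (h ** t))" if "valid C f" for f
  by (rule mult_rel_transfer[OF g1 g2 R R]) (use that in auto)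
 have FA: "valid C (FA f)" "src (FA f) = FO (src f)" "tgt (FA f) = FO (tgt f)"
  "R (src f) l s t ==> R (tgt f) l (f ** s) (FA f ** t)" if "valid C f" for f l s t
  using theI'[OF ex1[OF that]] unfolding FA_def[of f, symmetric] by auto
 have FA_eqI: "FA f = h" if "valid C f" "valid C h" "src h = FO (src f)" "tgt h = FO (tgt f)"
  "!!l s t. R (src f) l s t ==> R (tgt f) l (f ** s) (h ** t)" for f h
  unfolding FA_def by (rule the1_equality[OF ex1[OF that(1)]]) (use that in auto)
 have Rd: "valid C s \<and> src s = S l \<and> tgt s = Z \<and> valid C t \<and> src t = ?T l \<and> tgt t = FO Z" if "R Z l s t" "Z \<in> Ob C" for Z l s t
  using mult_relD(3)[OF R[OF that(2)] that(1)] .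
 have L: "lfun C C FO FA"
  unfolding lfun_def
 proof (intro conjI ballI allI impI)
  show "FO X \<in> Ob C" if "X \<in> Ob C" for X using mult_relD(2)[OF R[OF that]] .
  then show "FA (idt C X) = idt C (FO X)" if "X \<in> Ob C" for X
   using that Rd by (intro FA_eqI) auto
  show "FA (g ** f) = FA g ** FA f" if fg: "valid C f" "valid C g" "tgt f = src g" for f g
  proof (rule FA_eqI)
   fix l s t assume r: "R (src (g ** f)) l s t"
   then have "R (src f) l s t" using fg by simp
   from FA(4)[OF fg(2), unfolded fg(3)[symmetric], OF FA(4)[OF fg(1) this]]
   show "R (tgt (g ** f)) l ((g ** f) ** s) ((FA g ** FA f) ** t)"
    using fg by (simp add: acomp_assoc)
  qed (use fg FA in auto)
  show "FA (f \<boxplus> g) = FA f \<boxplus> FA g" if fg: "valid C f" "valid C g" "src f = src g" "tgt f = tgt g" for f g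
  proof (rule FA_eqI)
   fix l s t assume "R (src (f \<boxplus> g)) l s t"
   then have r: "R (src f) l s t" "R (src g) l s t" using fg by auto
   have "R (tgt g) l ((f ** s) \<boxplus> (g ** s)) ((FA f ** t) \<boxplus> (FA g ** t))"
    using mult_relD(8)[OF R FA(4)[OF fg(1) r(1), unfolded fg(4)] FA(4)[OF fg(2) r(2)]] fg by simp
   then show "R (tgt (f \<boxplus> g)) l ((f \<boxplus> g) ** s) ((FA f \<boxplus> FA g) ** t)"
    using fg by (simp add: aadd_acomp)
  qed (use fg FA in auto)
  show "FA (c \<odot>\<^sub>s f) = c \<odot>\<^sub>s FA f" if f: "valid C f" for c f
  proof (rule FA_eqI)
   fix l s t assume "R (src (c \<odot>\<^sub>s f)) l s t"
   then have r: "R (src f) l s t" using f by auto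
   show "R (tgt (c \<odot>\<^sub>s f)) l ((c \<odot>\<^sub>s f) ** s) ((c \<odot>\<^sub>s FA f) ** t)"
    using mult_relD(9)[OF R FA(4)[OF f r], of c] f by simp
  qed (use f FA in auto)
 qed (use FA in auto)
 note L' = L[unfolded lfun_def]
 have inj: "f = g" if fg: "valid C f" "valid C g" "src f = X" "src g = X" "tgt f = Y" "tgt g = Y" "FA f = FA g" for X Y f g
 proof (rule covers_eqI[OF S_covers[of X]])
  have X: "X \<in> Ob C" and Y: "Y \<in> Ob C" using fg by auto
  fix s assume s: "s \<in> Sg" "valid C s" "tgt s = X"
  then obtain l where l: "src s = S l" by auto
  obtain t where t: "R X l s t" using mult_relD(4)[OF R[OF X] s(2) l s(3)] by blast
  have "R Y l (f ** s) (FA f ** t)" "R Y l (g ** s) (FA f ** t)"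
   using FA(4)[OF fg(1)] FA(4)[OF fg(2)] fg t by auto
  then show "f ** s = g ** s" by (rule mult_relD(7)[OF R[OF Y]])
 qed (use fg in auto)
 have surj: "\<exists>f. valid C f \<and> src f = X \<and> tgt f = Y \<and> FA f = h"
  if h: "X \<in> Ob C" "Y \<in> Ob C" "valid C h" "src h = FO X" "tgt h = FO Y" for X Y h
 proof -
  obtain f where f: "valid C f" "src f = X" "tgt f = Y" "!!l t s. R X l s t ==> R Y l (f ** s) (h ** t)"
   using mult_rel_transfer[OF g2 g1 mult_rel_converse[OF R[OF h(1)]] mult_rel_converse[OF R[OF h(2)]] h(3-5)] by blast
  then have "FA f = h" using h by (intro FA_eqI) auto
  with f show ?thesis by blast
 qed
 \<comment> \<open>\<open>X\<close> is built from \<open>Y\<close> with the inverse permutation.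
   Then \<open>FO X\<close> and \<open>Y\<close> are both partners of \<open>X\<close>, and
   uniqueness of transfers makes them isomorphic.\<close>
 have ess: "\<exists>X\<in>Ob C. isomorphic C (FO X) Y" if Y: "Y \<in> Ob C" for Y
 proof -
  have bi: "bij (Hilbert_Choice.inv \<beta>)" using b by (rule bij_imp_bij_inv)
  have inv: "\<beta> (Hilbert_Choice.inv \<beta> l) = l" "Hilbert_Choice.inv \<beta> (\<beta> l) = l" for l
   using b by (simp_all add: surj_f_inv_f bij_is_surj inv_f_f bij_is_inj)
  obtain X Q where Q: "mult_rel C S (\<lambda>l. S (Hilbert_Choice.inv \<beta> l)) Y X Q" using ex_mult_rel[OF bi Y] by blast
  note q = mult_relD[OF Q]
  have Q': "mult_rel C S ?T X Y (\<lambda>l s t. Q (\<beta> l) t s)"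
   unfolding mult_rel_def
  proof (intro conjI allI ballI impI)
   show "s \<in> Ar C (S l) X" "t \<in> Ar C (S (\<beta> l)) Y" if "Q (\<beta> l) t s" for l s t
    using q(3)[OF that] by (simp_all add: inv Ar_iff)
   show "\<exists>t. Q (\<beta> l) t s" if "s \<in> Ar C (S l) X" for l s
    using q(5)[of s "\<beta> l"] that by (simp add: inv Ar_iff)
   show "\<exists>s. Q (\<beta> l) t s" if "t \<in> Ar C (S (\<beta> l)) Y" for l t
    using q(4)[of t "\<beta> l"] that by (simp add: inv Ar_iff)
   show "t = t'" if "Q (\<beta> l) t s" "Q (\<beta> l) t' s" for l s t t' using q(7)[OF that] .
   show "s = s'" if "Q (\<beta> l) t s" "Q (\<beta> l) t s'" for l s s' t using q(6)[OF that] .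
  qed (use q in auto)
  have X: "X \<in> Ob C" using q by blast
  let ?P = "\<lambda>A B W W' f h. valid C h \<and> src h = W \<and> tgt h = W' \<and> (\<forall>l s t. A l s t --> B l (f ** s) (h ** t))"
  let ?Q = "\<lambda>l s t. Q (\<beta> l) t s"
  have t1: "\<exists>!h. ?P (R X) ?Q (FO X) Y (idt C X) h" and t2: "\<exists>!h. ?P ?Q (R X) Y (FO X) (idt C X) h"
   and t3: "\<exists>!h. ?P (R X) (R X) (FO X) (FO X) (idt C X) h" and t4: "\<exists>!h. ?P ?Q ?Q Y Y (idt C X) h"
   by (rule mult_rel_transfer[OF g1 g2], use R[OF X] Q' X in simp_all)+
  obtain h where h: "?P (R X) ?Q (FO X) Y (idt C X) h" using t1 by blast
  obtain k where k: "?P ?Q (R X) Y (FO X) (idt C X) k" using t2 by blast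
  have idR: "idt C X ** s = s" if "R X l s t" for l s t using Rd[OF that X] by simp
  have idQ: "idt C X ** s = s" if "?Q l s t" for l s t using q(3)[OF that] by (simp add: inv)
  have "?P (R X) (R X) (FO X) (FO X) (idt C X) (k ** h)"
   using h k by (auto simp: acomp_assoc) (metis idR idQ)
  moreover have "?P (R X) (R X) (FO X) (FO X) (idt C X) (idt C (FO X))"
   using idR Rd[OF _ X] lfun_def L' X by auto
  ultimately have kh: "k ** h = idt C (FO X)" using t3 by blast
  have "?P ?Q ?Q Y Y (idt C X) (h ** k)"
   using h k by (auto simp: acomp_assoc) (metis idR idQ)
  moreover have "?P ?Q ?Q Y Y (idt C X) (idt C Y)"
   using idQ q Y by auto
  ultimately have hk: "h ** k = idt C Y" using t4 by blast
  have "aiso C h" using h k kh hk by (intro aisoI[of h k]) auto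
  then show ?thesis using h X unfolding isomorphic_iff by blast
 qed
 \<comment> \<open>Every arrow from a generator into \<open>FO (S l)\<close> is a multiple of the
   partner \<open>t\<close> of the identity of \<open>S l\<close>, so the identity of
   \<open>FO (S l)\<close> factors through \<open>t\<close>; the other factor is an inverse.\<close>
 have lab: "isomorphic C (FO (S l)) (S (\<beta> l))" for l
 proof -
  let ?W = "FO (S l)"
  note r = mult_relD[OF R[OF S_Ob[of l]]]
  obtain t where t: "R (S l) l (idt C (S l)) t" using r(4)[of "idt C (S l)" l] by auto
  note td = r(3)[OF t]
  have az: "R (S l) m (azero C (S m) (S l)) (azero C (S (\<beta> m)) ?W)" for m
   by (rule mult_rel_azero[OF R]) simp_all
  have tz: "t ~= azero C (S (\<beta> l)) ?W" using r(7)[OF t] az[of l] S_idt_nz by metis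
  have "idt C ?W \<in> Span C {t} ?W ?W"
  proof -
   have "covers C ?W {t}"
   proof (rule covers_trans[OF S_covers[OF r(2)]])
    fix g assume g: "g \<in> Sg" "valid C g" "tgt g = ?W"
    then obtain m' where "src g = S m'" by auto
    then obtain m where m: "src g = S (\<beta> m)" using bij_is_surj[OF b] by (metis surjD)
    obtain u where u: "R (S l) m u g" using r(5)[OF g(2) m g(3)] by blast
    note ud = r(3)[OF u]
    show "g \<in> Span C {t} (src g) ?W"
    proof (rule S_hom[of u m l])
     assume "u = azero C (S m) (S l)"
     then have "g = azero C (S (\<beta> m)) ?W" using r(6)[OF u] az[of m] by simp
     then show ?thesis using r(2) by (auto intro: Span.zero)
    next
     fix c assume c: "m = l" "u = c \<odot>\<^sub>s idt C (S m)"
     then have "g = c \<odot>\<^sub>s t" using r(6)[OF u] r(9)[OF t, of c] by simp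
     then show ?thesis using Span_asmult[OF Span_gen[of t "{t}"], of c] td by simp
    qed (use ud in auto)
   qed
   then show ?thesis by (simp add: covers_def)
  qed
  from Span_singleton[OF this] obtain p where p: "valid C p" "src p = ?W" "tgt p = S (\<beta> l)" "idt C ?W = t ** p"
   using td r(2) by metis
  have "valid C (p ** t)" "src (p ** t) = S (\<beta> l)" "tgt (p ** t) = S (\<beta> l)" using p td by auto
  then obtain c where c: "p ** t = c \<odot>\<^sub>s idt C (S (\<beta> l))" using S_scalar unfolding scalar_def by blast
  have "t = idt C ?W ** t" using td by simp
  also have "\<dots> = (t ** p) ** t" by (simp only: p(4))
  also have "\<dots> = c \<odot>\<^sub>s t" using c td by (simp add: acomp_assoc)
  finally have "1 \<odot>\<^sub>s t = c \<odot>\<^sub>s t" using td by simp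
  then have "c = 1" using asmult_right_cancel[of 1 t c] tz td by auto
  then have "aiso C t" using p c td by (intro aisoI[of t p]) auto
  then have "isomorphic C (S (\<beta> l)) ?W" using td unfolding isomorphic_iff by blast
  then show ?thesis by (rule isomorphic_sym)
 qed
 show thesis by (rule that[OF L inj surj ess lab])
qed

end

section \<open>Braided autoequivalences\<close>

lemma bfun_cong:
 assumes B: "bfun C D FO FA FT" and C: "braided_monoidal_category C"
  and FA: "!!f. valid C f ==> FA' f = FA f"
  and FT: "!!X Y. X \<in> Ob C ==> Y \<in> Ob C ==> FT' X Y = FT X Y"
 shows "bfun C D FO FA' FT'"
proof -
 interpret C: braided_monoidal_category C by fact
 show ?thesis
  using B unfolding bfun_def lfun_def by (simp add: FA FT)
qed

definition monfun_of :: "('o1 => 'o2) => (('o1, 'm1) arrow => ('o2, 'm2) arrow) =>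
  ('o1 => 'o1 => ('o2, 'm2) arrow) => ('o1, 'm1, 'o2, 'm2) monfun" where
 "monfun_of FO FA FT = \<lparr>FOb = FO, FMor = (\<lambda>X Y f. mor (FA (Arrow X f Y))), FTen = (\<lambda>X Y. mor (FT X Y))\<rparr>"

context two_braided
begin

lemma bfunD:
 assumes "bfun C D FO FA FT"
 shows "lfun C D FO FA" "isomorphic D (FO (Unit C)) (Unit D)"
  "X \<in> Ob C ==> Y \<in> Ob C ==> aiso D (FT X Y)" "X \<in> Ob C ==> Y \<in> Ob C ==> valid D (FT X Y)"
  "X \<in> Ob C ==> Y \<in> Ob C ==> src (FT X Y) = FO X \<boxtimes>\<^bsub>D\<^esub> FO Y"
  "X \<in> Ob C ==> Y \<in> Ob C ==> tgt (FT X Y) = FO (X \<boxtimes> Y)"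
  "valid C f ==> valid C g ==>
    FT (tgt f) (tgt g) \<bullet> (FA f \<otimes>\<^sub>D FA g) = FA (f \<otimes>\<^sub>a g) \<bullet> FT (src f) (src g)"
  "X \<in> Ob C ==> Y \<in> Ob C ==> Z \<in> Ob C ==>
    FA (aass C X Y Z) \<bullet> FT (X \<boxtimes> Y) Z \<bullet> (FT X Y \<otimes>\<^sub>D idt D (FO Z)) =
    FT X (Y \<boxtimes> Z) \<bullet> (idt D (FO X) \<otimes>\<^sub>D FT Y Z) \<bullet> aass D (FO X) (FO Y) (FO Z)"
  "X \<in> Ob C ==> Y \<in> Ob C ==> FA (abr C X Y) \<bullet> FT X Y = FT Y X \<bullet> abr D (FO X) (FO Y)"
 using assms unfolding bfun_def by (blast intro: D.aiso_valid)+

lemma braided_functor_monfun_of: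
 assumes B: "bfun C D FO FA FT"
 shows "braided_functor C D (monfun_of FO FA FT)"
proof -
 note b = bfunD[OF B] and d = lfunD[OF bfunD(1)[OF B]]
 have "bfun C D FO (arrow_map (monfun_of FO FA FT)) (arrow_ten C D (monfun_of FO FA FT))"
 proof (rule bfun_cong[OF B C.braided_monoidal_category_axioms])
  show "arrow_map (monfun_of FO FA FT) f = FA f" if "valid C f" for f
   using that d(2-4)[OF that] D.Arrow_mor[of "FA f"] by (simp add: arrow_map_def monfun_of_def)
  show "arrow_ten C D (monfun_of FO FA FT) X Y = FT X Y" if "X \<in> Ob C" "Y \<in> Ob C" for X Y
   using b(4-6)[OF that] D.Arrow_mor[of "FT X Y"] by (simp add: arrow_ten_def monfun_of_def)
 qed
 then show ?thesis by (simp add: braided_functor_iff) (simp add: monfun_of_def)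
qed

end

context pointed_source
begin

theorem tensor_iso_if_agree:
 assumes fin: "finite (UNIV :: 'b set)" and dv: "divisible TYPE('k munit)"
  and F: "braided_functor C D F" and G: "braided_functor C D G"
  and sc: "!!l. scalar D (FOb F (S l))" and iso: "!!l. isomorphic D (FOb F (S l)) (FOb G (S l))"
 shows "tensor_iso C D F G"
proof -
 note F' = F[unfolded braided_functor_iff] and G' = G[unfolded braided_functor_iff]
 obtain \<eta> where \<eta>: "!!X. X \<in> Ob C ==> aiso D (\<eta> X) \<and> src (\<eta> X) = FOb F X \<and> tgt (\<eta> X) = FOb G X"
  "!!f. valid C f ==> \<eta> (tgt f) \<bullet> arrow_map F f = arrow_map G f \<bullet> \<eta> (src f)"
  "!!X Y. X \<in> Ob C ==> Y \<in> Ob C ==>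
    \<eta> (X \<boxtimes> Y) \<bullet> arrow_ten C D F X Y = arrow_ten C D G X Y \<bullet> (\<eta> X \<otimes>\<^sub>D \<eta> Y)"
  using braided_functor_unique[OF fin dv F' G' sc iso] by blast
 show ?thesis by (rule tensor_isoI[OF \<eta>(1) F' G' \<eta>(2,3)])
qed

end

lemma bfun_comp:
 assumes C: "braided_monoidal_category C" and D: "braided_monoidal_category D" and E: "braided_monoidal_category E"
  and F: "bfun C D FO FA FT" and G: "bfun D E GO GA GT"
 shows "bfun C E (\<lambda>X. GO (FO X)) (\<lambda>f. GA (FA f)) (\<lambda>X Y. GA (FT X Y) **\<^bsub>E\<^esub> GT (FO X) (FO Y))"
proof -
 interpret C: braided_monoidal_category C by fact
 interpret D: braided_monoidal_category D by fact
 interpret E: braided_monoidal_category E by fact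
 interpret CD: two_braided C D by unfold_locales
 interpret DE: two_braided D E by unfold_locales
 note f = CD.bfunD[OF F] and lf = CD.lfunD[OF CD.bfunD(1)[OF F]]
 note g = DE.bfunD[OF G] and lg = DE.lfunD[OF DE.bfunD(1)[OF G]]
 note lgi = DE.lfun_aiso[OF DE.bfunD(1)[OF G]]
 note simps = f(3-6) lf(1-5) g(3-6) lg(1-5) lgi(1)
 show ?thesis
  unfolding bfun_def
 proof (intro conjI ballI allI impI)
  show "lfun C E (\<lambda>X. GO (FO X)) (\<lambda>f. GA (FA f))"
   unfolding lfun_def by (auto simp: lf lg)
  show "isomorphic E (GO (FO (Unit C))) (Unit E)"
   using DE.lfun_isomorphic[OF g(1) f(2)] g(2) by (rule E.isomorphic_trans)
  fix a b assume ab: "valid C a" "valid C b"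
  have "(GA (FT (tgt a) (tgt b)) **\<^bsub>E\<^esub> GT (FO (tgt a)) (FO (tgt b))) **\<^bsub>E\<^esub> (GA (FA a) \<otimes>\<^sub>a\<^bsub>E\<^esub> GA (FA b)) =
    GA (FT (tgt a) (tgt b)) **\<^bsub>E\<^esub> GA (FA a \<otimes>\<^sub>a\<^bsub>D\<^esub> FA b) **\<^bsub>E\<^esub> GT (FO (src a)) (FO (src b))"
   using g(7)[of "FA a" "FA b"] ab by (simp add: lf E.acomp_assoc)
  also have "\<dots> = GA (FT (tgt a) (tgt b) **\<^bsub>D\<^esub> (FA a \<otimes>\<^sub>a\<^bsub>D\<^esub> FA b)) **\<^bsub>E\<^esub> GT (FO (src a)) (FO (src b))"
   using ab by (subst lg(6)) (simp_all add: simps E.acomp_assoc)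
  also have "\<dots> = GA (FA (a \<otimes>\<^sub>a\<^bsub>C\<^esub> b)) **\<^bsub>E\<^esub> GA (FT (src a) (src b)) **\<^bsub>E\<^esub> GT (FO (src a)) (FO (src b))"
   unfolding f(7)[OF ab] using ab by (subst lg(6)) (simp_all add: simps E.acomp_assoc)
  finally show "(GA (FT (tgt a) (tgt b)) **\<^bsub>E\<^esub> GT (FO (tgt a)) (FO (tgt b))) **\<^bsub>E\<^esub> (GA (FA a) \<otimes>\<^sub>a\<^bsub>E\<^esub> GA (FA b)) =
   GA (FA (a \<otimes>\<^sub>a\<^bsub>C\<^esub> b)) **\<^bsub>E\<^esub> GA (FT (src a) (src b)) **\<^bsub>E\<^esub> GT (FO (src a)) (FO (src b))" .
 next
  fix X Y Z assume XYZ: "X \<in> Ob C" "Y \<in> Ob C" "Z \<in> Ob C"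
  let ?T = "\<lambda>X Y. GA (FT X Y) **\<^bsub>E\<^esub> GT (FO X) (FO Y)"
  have n1: "GT (FO (X \<boxtimes>\<^bsub>C\<^esub> Y)) (FO Z) **\<^bsub>E\<^esub> (GA (FT X Y) \<otimes>\<^sub>a\<^bsub>E\<^esub> idt E (GO (FO Z))) =
    GA (FT X Y \<otimes>\<^sub>a\<^bsub>D\<^esub> idt D (FO Z)) **\<^bsub>E\<^esub> GT (FO X \<boxtimes>\<^bsub>D\<^esub> FO Y) (FO Z)"
   using g(7)[of "FT X Y" "idt D (FO Z)"] XYZ by (simp add: simps)
  have n2: "GT (FO X) (FO (Y \<boxtimes>\<^bsub>C\<^esub> Z)) **\<^bsub>E\<^esub> (idt E (GO (FO X)) \<otimes>\<^sub>a\<^bsub>E\<^esub> GA (FT Y Z)) =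
    GA (idt D (FO X) \<otimes>\<^sub>a\<^bsub>D\<^esub> FT Y Z) **\<^bsub>E\<^esub> GT (FO X) (FO Y \<boxtimes>\<^bsub>D\<^esub> FO Z)"
   using g(7)[of "idt D (FO X)" "FT Y Z"] XYZ by (simp add: simps)
  have sp: "idt E (GO (FO X)) \<otimes>\<^sub>a\<^bsub>E\<^esub> ?T Y Z = (idt E (GO (FO X)) \<otimes>\<^sub>a\<^bsub>E\<^esub> GA (FT Y Z)) **\<^bsub>E\<^esub> (idt E (GO (FO X)) \<otimes>\<^sub>a\<^bsub>E\<^esub> GT (FO Y) (FO Z))"
   using XYZ by (simp add: simps E.interchange)
  have "GA (FA (aass C X Y Z)) **\<^bsub>E\<^esub> ?T (X \<boxtimes>\<^bsub>C\<^esub> Y) Z **\<^bsub>E\<^esub> (?T X Y \<otimes>\<^sub>a\<^bsub>E\<^esub> idt E (GO (FO Z))) =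
    GA (FA (aass C X Y Z)) **\<^bsub>E\<^esub> GA (FT (X \<boxtimes>\<^bsub>C\<^esub> Y) Z) **\<^bsub>E\<^esub> (GT (FO (X \<boxtimes>\<^bsub>C\<^esub> Y)) (FO Z) **\<^bsub>E\<^esub> (GA (FT X Y) \<otimes>\<^sub>a\<^bsub>E\<^esub> idt E (GO (FO Z)))) **\<^bsub>E\<^esub> (GT (FO X) (FO Y) \<otimes>\<^sub>a\<^bsub>E\<^esub> idt E (GO (FO Z)))"
   using XYZ by (simp add: simps E.acomp_assoc E.interchange)
  also have "\<dots> = GA (FA (aass C X Y Z) **\<^bsub>D\<^esub> FT (X \<boxtimes>\<^bsub>C\<^esub> Y) Z **\<^bsub>D\<^esub> (FT X Y \<otimes>\<^sub>a\<^bsub>D\<^esub> idt D (FO Z))) **\<^bsub>E\<^esub>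
    GT (FO X \<boxtimes>\<^bsub>D\<^esub> FO Y) (FO Z) **\<^bsub>E\<^esub> (GT (FO X) (FO Y) \<otimes>\<^sub>a\<^bsub>E\<^esub> idt E (GO (FO Z)))"
   unfolding n1 using XYZ by (simp add: simps lg(6) E.acomp_assoc)
  also have "\<dots> = GA (FT X (Y \<boxtimes>\<^bsub>C\<^esub> Z)) **\<^bsub>E\<^esub> GA (idt D (FO X) \<otimes>\<^sub>a\<^bsub>D\<^esub> FT Y Z) **\<^bsub>E\<^esub> GA (aass D (FO X) (FO Y) (FO Z)) **\<^bsub>E\<^esub>
    GT (FO X \<boxtimes>\<^bsub>D\<^esub> FO Y) (FO Z) **\<^bsub>E\<^esub> (GT (FO X) (FO Y) \<otimes>\<^sub>a\<^bsub>E\<^esub> idt E (GO (FO Z)))"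
   unfolding f(8)[OF XYZ] using XYZ by (simp add: simps lg(6) E.acomp_assoc)
  also have "GA (aass D (FO X) (FO Y) (FO Z)) **\<^bsub>E\<^esub> GT (FO X \<boxtimes>\<^bsub>D\<^esub> FO Y) (FO Z) **\<^bsub>E\<^esub> (GT (FO X) (FO Y) \<otimes>\<^sub>a\<^bsub>E\<^esub> idt E (GO (FO Z))) =
    GT (FO X) (FO Y \<boxtimes>\<^bsub>D\<^esub> FO Z) **\<^bsub>E\<^esub> (idt E (GO (FO X)) \<otimes>\<^sub>a\<^bsub>E\<^esub> GT (FO Y) (FO Z)) **\<^bsub>E\<^esub> aass E (GO (FO X)) (GO (FO Y)) (GO (FO Z))"
   by (rule g(8)) (use XYZ in \<open>simp_all add: simps\<close>)
  also have "GA (idt D (FO X) \<otimes>\<^sub>a\<^bsub>D\<^esub> FT Y Z) **\<^bsub>E\<^esub> GT (FO X) (FO Y \<boxtimes>\<^bsub>D\<^esub> FO Z) **\<^bsub>E\<^esub> (idt E (GO (FO X)) \<otimes>\<^sub>a\<^bsub>E\<^esub> GT (FO Y) (FO Z)) **\<^bsub>E\<^esub> aass E (GO (FO X)) (GO (FO Y)) (GO (FO Z)) =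
    GT (FO X) (FO (Y \<boxtimes>\<^bsub>C\<^esub> Z)) **\<^bsub>E\<^esub> (idt E (GO (FO X)) \<otimes>\<^sub>a\<^bsub>E\<^esub> ?T Y Z) **\<^bsub>E\<^esub> aass E (GO (FO X)) (GO (FO Y)) (GO (FO Z))"
   unfolding sp using E.reassoc[OF n2] by (simp add: E.acomp_assoc)
  finally show "GA (FA (aass C X Y Z)) **\<^bsub>E\<^esub> ?T (X \<boxtimes>\<^bsub>C\<^esub> Y) Z **\<^bsub>E\<^esub> (?T X Y \<otimes>\<^sub>a\<^bsub>E\<^esub> idt E (GO (FO Z))) =
    ?T X (Y \<boxtimes>\<^bsub>C\<^esub> Z) **\<^bsub>E\<^esub> (idt E (GO (FO X)) \<otimes>\<^sub>a\<^bsub>E\<^esub> ?T Y Z) **\<^bsub>E\<^esub> aass E (GO (FO X)) (GO (FO Y)) (GO (FO Z))"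
   by (simp add: E.acomp_assoc)
 next
  fix X Y assume XY: "X \<in> Ob C" "Y \<in> Ob C"
  have "GA (FA (abr C X Y)) **\<^bsub>E\<^esub> GA (FT X Y) **\<^bsub>E\<^esub> GT (FO X) (FO Y) = GA (FT Y X **\<^bsub>D\<^esub> abr D (FO X) (FO Y)) **\<^bsub>E\<^esub> GT (FO X) (FO Y)"
   unfolding f(9)[OF XY, symmetric] using XY by (simp add: simps lg(6) E.acomp_assoc)
  also have "\<dots> = GA (FT Y X) **\<^bsub>E\<^esub> GT (FO Y) (FO X) **\<^bsub>E\<^esub> abr E (GO (FO X)) (GO (FO Y))"
   using XY g(9)[of "FO X" "FO Y"] by (simp add: simps lg(6) E.acomp_assoc)
  finally show "GA (FA (abr C X Y)) **\<^bsub>E\<^esub> GA (FT X Y) **\<^bsub>E\<^esub> GT (FO X) (FO Y) =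
    (GA (FT Y X) **\<^bsub>E\<^esub> GT (FO Y) (FO X)) **\<^bsub>E\<^esub> abr E (GO (FO X)) (GO (FO Y))"
   by (simp add: E.acomp_assoc)
 qed (use simps in auto)
qed

lemma braided_functor_comp:
 assumes C: "braided_monoidal_category C" and D: "braided_monoidal_category D" and E: "braided_monoidal_category E"
  and F: "braided_functor C D F" and G: "braided_functor D E G"
 shows "braided_functor C E (comp_monfun C D E G F)"
proof -
 interpret C: braided_monoidal_category C by fact
 interpret D: braided_monoidal_category D by fact
 interpret E: braided_monoidal_category E by fact
 interpret CD: two_braided C D by unfold_locales
 interpret DE: two_braided D E by unfold_locales
 interpret CE: two_braided C E by unfold_locales
 note F' = F[unfolded CD.braided_functor_iff] and G' = G[unfolded DE.braided_functor_iff]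
 note f = CD.bfunD[OF F'] and lf = CD.lfunD[OF CD.bfunD(1)[OF F']]
 note g = DE.bfunD[OF G'] and lg = DE.lfunD[OF DE.bfunD(1)[OF G']]
 have o: "FOb (comp_monfun C D E G F) = (\<lambda>X. FOb G (FOb F X))" by (simp add: comp_monfun_def)
 show ?thesis
  unfolding CE.braided_functor_iff o
 proof (rule bfun_cong[OF bfun_comp[OF C D E F' G'] C])
  show "arrow_map (comp_monfun C D E G F) f = arrow_map G (arrow_map F f)" for f
   by (simp add: arrow_map_def comp_monfun_def)
  fix X Y assume XY: "X \<in> Ob C" "Y \<in> Ob C"
  have v: "valid E (arrow_map G (arrow_ten C D F X Y))" "valid E (arrow_ten D E G (FOb F X) (FOb F Y))"
   "tgt (arrow_ten D E G (FOb F X) (FOb F Y)) = src (arrow_map G (arrow_ten C D F X Y))"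
   using XY lf(1) by (simp_all add: f lg g)
  show "arrow_ten C E (comp_monfun C D E G F) X Y =
    arrow_map G (arrow_ten C D F X Y) **\<^bsub>E\<^esub> arrow_ten D E G (FOb F X) (FOb F Y)"
   unfolding acomp_def using v by (simp add: arrow_map_def arrow_ten_def comp_monfun_def)
 qed
qed

section \<open>Autoequivalences and automorphisms of the labels\<close>

context pointed_family
begin

lemma equivalence_comp:
 assumes F: "lfun C C (FOb F) (arrow_map F)" and G: "lfun C C (FOb G) (arrow_map G)"
  and EF: "equivalence_functor C C F" and EG: "equivalence_functor C C G"
 shows "equivalence_functor C C (comp_monfun C C C G F)"
proof -
 interpret CC: two_braided C C by unfold_locales
 note lf = CC.lfunD[OF F] and lg = CC.lfunD[OF G]
 show ?thesis
  unfolding equivalence_functor_def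
 proof (intro conjI ballI)
  fix X Y assume "X \<in> Ob C" "Y \<in> Ob C"
  then have "bij_betw (FMor F X Y) (Hom C X Y) (Hom C (FOb F X) (FOb F Y))"
   "bij_betw (FMor G (FOb F X) (FOb F Y)) (Hom C (FOb F X) (FOb F Y)) (Hom C (FOb G (FOb F X)) (FOb G (FOb F Y)))"
   using EF EG lf(1) by (simp_all add: equivalence_functor_def)
  from bij_betw_trans[OF this] show "bij_betw (FMor (comp_monfun C C C G F) X Y) (Hom C X Y)
    (Hom C (FOb (comp_monfun C C C G F) X) (FOb (comp_monfun C C C G F) Y))"
   by (simp add: comp_monfun_def o_def)
 next
  fix Z assume "Z \<in> Ob C"
  then obtain Y where Y: "Y \<in> Ob C" "isomorphic C (FOb G Y) Z" using EG by (auto simp: equivalence_functor_def)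
  then obtain X where X: "X \<in> Ob C" "isomorphic C (FOb F X) Y" using EF by (auto simp: equivalence_functor_def)
  have "isomorphic C (FOb G (FOb F X)) (FOb G Y)" by (rule CC.lfun_isomorphic[OF G X(2)])
  from isomorphic_trans[OF this Y(2)] X(1)
  show "\<exists>X\<in>Ob C. isomorphic C (FOb (comp_monfun C C C G F) X) Z"
   by (auto simp: comp_monfun_def)
 qed
qed

lemma comp_autoequivs:
 assumes "F \<in> braided_autoequivs C" "G \<in> braided_autoequivs C"
 shows "comp_monfun C C C F G \<in> braided_autoequivs C"
proof -
 note BM = braided_monoidal_category_axioms
 interpret CC: two_braided C C by unfold_locales
 from assms have L: "linear_functor C C F" "linear_functor C C G"
  by (simp_all add: braided_autoequivs_def braided_functor_def tensor_functor_def)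
 then show ?thesis
  using assms braided_functor_comp[OF BM BM BM, of G F] equivalence_comp[of G F]
  unfolding braided_autoequivs_def CC.linear_functor_iff by blast
qed

text \<open>A fully faithful linear functor keeps endomorphisms scalar, so the image of
  \<open>S l\<close> is isomorphic to some \<open>S (\<beta> l)\<close>. Additivity of
  \<open>\<beta>\<close> comes from the tensor structure, bijectivity from fullness and finiteness,
  and the statement on self-braidings from compatibility with the braiding.\<close>

lemma autoequiv_label:
 assumes fin: "finite (UNIV :: 'b set)" and F: "F \<in> braided_autoequivs C"
 obtains \<beta> where "bij \<beta>" "!!l m. \<beta> (l + m) = \<beta> l + \<beta> m" "!!l. isomorphic C (FOb F (S l)) (S (\<beta> l))"
  "!!l t. abr C (S l) (S l) = t \<odot>\<^sub>s idt C (S l \<boxtimes> S l) ==>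
    abr C (S (\<beta> l)) (S (\<beta> l)) = t \<odot>\<^sub>s idt C (S (\<beta> l) \<boxtimes> S (\<beta> l))"
proof -
 interpret CC: two_braided C C by unfold_locales
 from F have B: "bfun C C (FOb F) (arrow_map F) (arrow_ten C C F)" and E: "equivalence_functor C C F"
  by (simp_all add: braided_autoequivs_def CC.braided_functor_iff)
 let ?O = "FOb F" and ?A = "arrow_map F" and ?T = "arrow_ten C C F"
 note b = CC.bfunD[OF B] and d = CC.lfunD[OF CC.bfunD(1)[OF B]]
 have inj: "f = g" if "valid C f" "valid C g" "src f = src g" "tgt f = tgt g" "?A f = ?A g" for f g
 proof -
  have "bij_betw (FMor F (src f) (tgt f)) (Hom C (src f) (tgt f)) (Hom C (?O (src f)) (?O (tgt f)))"
   using E that by (simp add: equivalence_functor_def)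
  then have "mor f = mor g" using that by (auto simp: arrow_map_def bij_betw_def dest!: inj_onD)
  then show ?thesis using that by (intro arrow_eqI)
 qed
 have surj: "\<exists>f. valid C f \<and> src f = X \<and> tgt f = Y \<and> ?A f = h"
  if "X \<in> Ob C" "Y \<in> Ob C" "valid C h" "src h = ?O X" "tgt h = ?O Y" for X Y h
 proof -
  have "bij_betw (FMor F X Y) (Hom C X Y) (Hom C (?O X) (?O Y))"
   using E that by (simp add: equivalence_functor_def)
  moreover have "mor h \<in> Hom C (?O X) (?O Y)" using that by simp
  ultimately obtain f where f: "f \<in> Hom C X Y" "FMor F X Y f = mor h"
   by (metis bij_betw_imp_surj_on imageE)
  then show ?thesis using that Arrow_mor[of h]
   by (intro exI[of _ "Arrow X f Y"]) (simp add: arrow_map_def)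
 qed
 have sc: "scalar C (?O (S l))" for l
  unfolding scalar_def
 proof (intro conjI allI impI)
  show "?O (S l) \<in> Ob C" by (simp add: d)
  show "idt C (?O (S l)) ~= azero C (?O (S l)) (?O (S l))"
  proof
   assume "idt C (?O (S l)) = azero C (?O (S l)) (?O (S l))"
   then have "?A (idt C (S l)) = ?A (azero C (S l) (S l))"
    by (simp add: d CC.lfun_azero[OF b(1)])
   from inj[OF _ _ _ _ this] S_idt_nz[of l] show False by simp
  qed
  fix h assume "valid C h" "src h = ?O (S l)" "tgt h = ?O (S l)"
  then obtain f where f: "valid C f" "src f = S l" "tgt f = S l" "?A f = h" using surj[of "S l" "S l" h] by auto
  obtain c where "f = c \<odot>\<^sub>s idt C (S l)" using S_scalar[of l] f unfolding scalar_def by blast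
  then have "h = c \<odot>\<^sub>s idt C (?O (S l))" using f(4) by (simp add: d)
  then show "\<exists>c. h = c \<odot>\<^sub>s idt C (?O (S l))" ..
 qed
 have "\<exists>m. isomorphic C (?O (S l)) (S m)" for l
  by (rule scalar_iso_S[OF sc]) blast
 then obtain \<beta> where \<beta>: "!!l. isomorphic C (?O (S l)) (S (\<beta> l))" by metis
 have add: "\<beta> (l + m) = \<beta> l + \<beta> m" for l m
 proof -
  have "isomorphic C (?O (S l \<boxtimes> S m)) (?O (S (l + m)))"
   by (rule CC.lfun_isomorphic[OF b(1) S_mult])
  moreover have "isomorphic C (?O (S l) \<boxtimes> ?O (S m)) (?O (S l \<boxtimes> S m))"
   unfolding isomorphic_iff by (intro exI[of _ "?T (S l) (S m)"]) (simp add: b)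
  moreover obtain f g where "aiso C f" "src f = ?O (S l)" "tgt f = S (\<beta> l)" "aiso C g" "src g = ?O (S m)" "tgt g = S (\<beta> m)"
   using \<beta>[of l] \<beta>[of m] unfolding isomorphic_iff by blast
  then have "isomorphic C (?O (S l) \<boxtimes> ?O (S m)) (S (\<beta> l) \<boxtimes> S (\<beta> m))"
   unfolding isomorphic_iff by (intro exI[of _ "f \<otimes>\<^sub>a g"]) simp
  ultimately have "isomorphic C (S (\<beta> (l + m))) (S (\<beta> l + \<beta> m))"
   using \<beta>[of "l + m"] S_mult[of "\<beta> l" "\<beta> m"] by (meson isomorphic_sym isomorphic_trans)
  then show ?thesis by (rule S_isomorphic)
 qed
 \<comment> \<open>By fullness, an isomorphism between the images of \<open>S l\<close> and
   \<open>S m\<close> lifts to a morphism, which is zero if the labels differ.\<close>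
 have "inj \<beta>"
 proof (rule injI)
  fix l m assume "\<beta> l = \<beta> m"
  then have "isomorphic C (?O (S l)) (?O (S m))" using \<beta>[of l] \<beta>[of m] by (metis isomorphic_sym isomorphic_trans)
  then obtain h where h: "aiso C h" "src h = ?O (S l)" "tgt h = ?O (S m)" unfolding isomorphic_iff by blast
  then obtain f where f: "valid C f" "src f = S l" "tgt f = S m" "?A f = h" using surj[of "S l" "S m" h] by auto
  show "l = m"
  proof (rule ccontr)
   assume "l ~= m"
   then have "f = azero C (S l) (S m)" by (intro S_orth f(1-3))
   then have "h = azero C (src h) (tgt h)" using f h by (simp add: CC.lfun_azero[OF b(1)])
   then show False using aiso_not_azero[of h] sc h by simp
  qed
 qed
 then have bij: "bij \<beta>" using fin by (simp add: bij_def finite_UNIV_inj_surj)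
 have br: "abr C (S (\<beta> l)) (S (\<beta> l)) = t \<odot>\<^sub>s idt C (S (\<beta> l) \<boxtimes> S (\<beta> l))"
  if t: "abr C (S l) (S l) = t \<odot>\<^sub>s idt C (S l \<boxtimes> S l)" for l t
 proof -
  let ?X = "?O (S l)"
  have X: "?X \<in> Ob C" by (simp add: d)
  have "?T (S l) (S l) ** abr C ?X ?X = ?T (S l) (S l) ** (t \<odot>\<^sub>s idt C (?X \<boxtimes> ?X))"
   using b(9)[of "S l" "S l"] X by (simp add: t d b)
  then have X_br: "abr C ?X ?X = t \<odot>\<^sub>s idt C (?X \<boxtimes> ?X)"
   by (rule aiso_monic[rotated]) (simp_all add: b X)
  obtain f where f: "aiso C f" "src f = ?X" "tgt f = S (\<beta> l)"
   using \<beta>[of l] unfolding isomorphic_iff by blast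
  have "abr C (S (\<beta> l)) (S (\<beta> l)) ** (f \<otimes>\<^sub>a f) = (t \<odot>\<^sub>s idt C (S (\<beta> l) \<boxtimes> S (\<beta> l))) ** (f \<otimes>\<^sub>a f)"
   using f X by (simp add: abr_natural X_br)
  then show ?thesis by (rule aiso_epic[rotated]) (simp_all add: f)
 qed
 show thesis by (rule that[OF bij add \<beta> br])
qed

text \<open>One direction forgets naturality and tensor structure of the isomorphism. The other is
  \<open>tensor_iso_if_agree\<close>, whose scalar hypothesis is supplied by the labels.\<close>

lemma tensor_iso_autoequivs:
 assumes fin: "finite (UNIV :: 'b set)" and dv: "divisible TYPE('k munit)"
  and F: "F \<in> braided_autoequivs C" and G: "G \<in> braided_autoequivs C"
 shows "tensor_iso C C F G \<longleftrightarrow> (\<forall>l. isomorphic C (FOb F (S l)) (FOb G (S l)))"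
proof
 interpret CC: pointed_source C C S by unfold_locales
 show "\<forall>l. isomorphic C (FOb F (S l)) (FOb G (S l))" if "tensor_iso C C F G"
  using CC.tensor_iso_isomorphic[OF that] by simp
 assume *: "\<forall>l. isomorphic C (FOb F (S l)) (FOb G (S l))"
 obtain \<beta> where \<beta>: "!!l. isomorphic C (FOb F (S l)) (S (\<beta> l))" by (rule autoequiv_label[OF fin F]) blast
 have "scalar C (FOb F (S l))" for l
  using isomorphic_sym[OF \<beta>[of l]] S_scalar[of "\<beta> l"] unfolding isomorphic_iff by (blast intro: scalar_iso)
 then show "tensor_iso C C F G"
  using F G * by (intro CC.tensor_iso_if_agree[OF fin dv]) (auto simp: braided_autoequivs_def)
qed

text \<open>The objects \<open>S (\<beta> l)\<close> have the same self-braidings as the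
  \<open>S l\<close>. By \<open>msys_match\<close> they admit a multiplication with the constants of
  \<open>J\<close>, and \<open>braided_structure\<close> then makes the permuting functor
  braided.\<close>

theorem ex_autoequiv:
 assumes fin: "finite (UNIV :: 'b set)"
  and b: "bij \<beta>" "!!l m. \<beta> (l + m) = \<beta> l + \<beta> m"
  and Q: "!!l. abr C (S l) (S l) = Q l \<odot>\<^sub>s idt C (S l \<boxtimes> S l)" "!!l. Q (\<beta> l) = Q l"
 obtains F where "F \<in> braided_autoequivs C" "!!l. isomorphic C (FOb F (S l)) (S (\<beta> l))"
proof -
 interpret CC: pointed_source C C S by unfold_locales
 obtain FO FA where L: "lfun C C FO FA"
  and inj: "!!X Y f g. valid C f ==> valid C g ==> src f = X ==> src g = X ==> tgt f = Y ==> tgt g = Y ==> FA f = FA g ==> f = g"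
  and surj: "!!X Y h. X \<in> Ob C ==> Y \<in> Ob C ==> valid C h ==> src h = FO X ==> tgt h = FO Y ==>
    \<exists>f. valid C f \<and> src f = X \<and> tgt f = Y \<and> FA f = h"
  and ess: "!!Y. Y \<in> Ob C ==> \<exists>X\<in>Ob C. isomorphic C (FO X) Y"
  and lab: "!!l. isomorphic C (FO (S l)) (S (\<beta> l))"
  using ex_permuting_functor[OF b(1)] by blast
 note d = CC.lfunD[OF L]
 obtain J w c where J: "msys C S J w c" by (rule ex_msys[OF S_scalar S_mult])
 have S\<beta>: "isomorphic C (S (\<beta> l) \<boxtimes> S (\<beta> m)) (S (\<beta> (l + m)))" for l m
  using S_mult by (simp add: b(2))
 obtain \<mu>0 w' c' where \<mu>0: "msys C (\<lambda>l. S (\<beta> l)) \<mu>0 w' c'"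
  by (rule ex_msys[of "\<lambda>l. S (\<beta> l)", OF S_scalar S\<beta>])
 have "c l l = c' l l" for l
  using msys_diag[OF J Q(1)] msys_diag[OF \<mu>0 Q(1)] by (simp add: Q(2))
 then obtain \<mu>1 where \<mu>1: "msys C (\<lambda>l. S (\<beta> l)) \<mu>1 w c"
  using msys_match[OF fin braided_monoidal_category_axioms braided_monoidal_category_axioms J \<mu>0] by blast
 have "\<exists>f. aiso C f \<and> src f = S (\<beta> l) \<and> tgt f = FO (S l)" for l
  using isomorphic_sym[OF lab[of l]] by (simp add: isomorphic_iff)
 then obtain \<theta> where \<theta>: "!!l. aiso C (\<theta> l)" "!!l. src (\<theta> l) = S (\<beta> l)" "!!l. tgt (\<theta> l) = FO (S l)"
  by metis
 note \<mu> = transport_msys[OF \<mu>1 \<theta>]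
 \<comment> \<open>The unit is isomorphic to \<open>S 0\<close>, and an additive
   \<open>\<beta>\<close> fixes 0.\<close>
 have \<beta>0: "\<beta> 0 = 0" using b(2)[of 0 0] by simp
 have un: "isomorphic C (FO (Unit C)) (Unit C)"
  by (rule isomorphic_trans[OF CC.lfun_isomorphic[OF L S_unit] isomorphic_trans[OF lab[of 0, unfolded \<beta>0] isomorphic_sym[OF S_unit]]])
 obtain FT where B: "bfun C C FO FA FT" by (rule CC.braided_structure[OF L J \<mu> un])
 let ?F = "monfun_of FO FA FT"
 have "equivalence_functor C C ?F"
  unfolding equivalence_functor_def
 proof (intro conjI ballI)
  fix X Y assume XY: "X \<in> Ob C" "Y \<in> Ob C"
  have "inj_on (FMor ?F X Y) (Hom C X Y)"
  proof (rule inj_onI)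
   fix f g assume fg: "f \<in> Hom C X Y" "g \<in> Hom C X Y" "FMor ?F X Y f = FMor ?F X Y g"
   then have "FA (Arrow X f Y) = FA (Arrow X g Y)" using d(2-4)[of "Arrow X f Y"] d(2-4)[of "Arrow X g Y"]
    by (intro arrow_eqI) (auto simp: monfun_of_def)
   from inj[OF _ _ _ _ _ _ this] fg show "f = g" by auto
  qed
  moreover have "FMor ?F X Y ` Hom C X Y = Hom C (FOb ?F X) (FOb ?F Y)"
  proof (intro equalityI subsetI)
   fix h assume "h \<in> FMor ?F X Y ` Hom C X Y"
   then obtain f where "f \<in> Hom C X Y" "h = mor (FA (Arrow X f Y))" by (auto simp: monfun_of_def)
   then show "h \<in> Hom C (FOb ?F X) (FOb ?F Y)" using d(2-4)[of "Arrow X f Y"] by (simp add: monfun_of_def)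
  next
   fix h assume h: "h \<in> Hom C (FOb ?F X) (FOb ?F Y)"
   then obtain f where f: "valid C f" "src f = X" "tgt f = Y" "FA f = Arrow (FO X) h (FO Y)"
    using surj[OF XY, of "Arrow (FO X) h (FO Y)"] by (auto simp: monfun_of_def)
   then have "h = FMor ?F X Y (mor f)" using Arrow_mor[OF f(1)] by (simp add: monfun_of_def)
   then show "h \<in> FMor ?F X Y ` Hom C X Y" using f by auto
  qed
  ultimately show "bij_betw (FMor ?F X Y) (Hom C X Y) (Hom C (FOb ?F X) (FOb ?F Y))"
   by (simp add: bij_betw_def)
 qed (use ess in \<open>auto simp: monfun_of_def\<close>)
 then have "?F \<in> braided_autoequivs C"
  using CC.braided_functor_monfun_of[OF B] by (simp add: braided_autoequivs_def)
 then show thesis using lab by (intro that[of ?F]) (auto simp: monfun_of_def)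
qed

end

section \<open>Pointed braided fusion categories\<close>

lemma (in category) mono_mors_iff: "m \<in> mono_mors C X Y \<longleftrightarrow> valid C (Arrow X m Y) \<and>
  (\<forall>g h. valid C g --> valid C h --> tgt g = X --> tgt h = X --> src g = src h -->
   Arrow X m Y ** g = Arrow X m Y ** h --> g = h)" (is "_ \<longleftrightarrow> ?R")
proof
 assume L: "m \<in> mono_mors C X Y"
 then have m: "m \<in> Hom C X Y" by (simp add: mono_mors_def)
 have "g = h" if gh: "valid C g" "valid C h" "tgt g = X" "tgt h = X" "src g = src h" "Arrow X m Y ** g = Arrow X m Y ** h" for g h
 proof (rule arrow_eqI)
  have "m \<cdot> mor g = m \<cdot> mor h" using arg_cong[OF gh(6), of mor] gh(1-5) m by (simp add: mor_acomp)
  moreover have "mor g \<in> Hom C (src g) X" "mor h \<in> Hom C (src g) X" using gh by auto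
  ultimately show "mor g = mor h" using L unfolding mono_mors_def by blast
 qed (use gh in auto)
 with m show ?R by simp
next
 assume R: ?R
 show "m \<in> mono_mors C X Y"
  unfolding mono_mors_def
 proof (intro CollectI conjI allI ballI impI)
  show "m \<in> Hom C X Y" using R by simp
  fix W g h assume gh: "g \<in> Hom C W X" "h \<in> Hom C W X" "m \<cdot> g = m \<cdot> h"
  have "Arrow X m Y ** Arrow W g X = Arrow X m Y ** Arrow W h X"
   using gh R by (simp add: acomp_def)
  then have "Arrow W g X = Arrow W h X" using R gh by (metis arrow.sel(1,3) valid_Arrow)
  then show "g = h" by simp
 qed
qed

context abelian_category
begin

text \<open>The inclusion of the kernel is a monomorphism into the simple object \<open>X\<close>.
  Either the kernel is zero, or the inclusion is invertible and then \<open>f\<close> is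
  zero.\<close>

lemma simple_mono:
 assumes X: "simple C X" and f: "valid C f" "src f = X" "f ~= azero C X (tgt f)"
 shows "mor f \<in> mono_mors C X (tgt f)"
proof -
 have fA: "Arrow X (mor f) (tgt f) = f" using f Arrow_mor[of f] by simp
 have fH: "mor f \<in> Hom C X (tgt f)" using f by simp
 obtain K i0 where ker: "is_kernel C X (tgt f) (mor f) K i0" using ex_kernel[OF fH] by blast
 define i where "i = Arrow K i0 X"
 have i: "valid C i" "src i = K" "tgt i = X" using ker by (simp_all add: is_kernel_def i_def)
 have fi: "f ** i = azero C K (tgt f)"
  using ker i f valid_Ob[OF i(1)] by (intro arrow_eqI) (auto simp: is_kernel_def mor_acomp i_def)
 \<comment> \<open>The universal property of the kernel, restated for typed arrows.\<close>
 have fact: "\<exists>!u. valid C u \<and> src u = src g \<and> tgt u = K \<and> i ** u = g"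
  if g: "valid C g" "tgt g = X" "f ** g = azero C (src g) (tgt f)" for g
 proof -
  have "mor f \<cdot> mor g = Zero C (src g) (tgt f)"
   using arg_cong[OF g(3), of mor] g(1,2) f by (simp add: mor_acomp)
  moreover have "mor g \<in> Hom C (src g) X" using g by simp
  ultimately have "\<exists>!u. u \<in> Hom C (src g) K \<and> i0 \<cdot> u = mor g"
   using ker unfolding is_kernel_def by blast
  then obtain u where u: "u \<in> Hom C (src g) K" "i0 \<cdot> u = mor g"
   "!!u'. u' \<in> Hom C (src g) K ==> i0 \<cdot> u' = mor g ==> u' = u"
   by (elim ex1E conjE) blast
  define w where "w = Arrow (src g) u K"
  have w: "valid C w" "src w = src g" "tgt w = K" using u(1) by (simp_all add: w_def)
  have "i ** w = g"
  proof (rule arrow_eqI)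
   have "mor (i ** w) = i0 \<cdot> u" using mor_acomp[OF w(1) i(1)] w i by (simp add: i_def w_def)
   then show "mor (i ** w) = mor g" using u(2) by simp
  qed (use w i g in simp_all)
  moreover have "v = w" if v: "valid C v \<and> src v = src g \<and> tgt v = K \<and> i ** v = g" for v
  proof (rule arrow_eqI)
   have "i0 \<cdot> mor v = mor (i ** v)" using mor_acomp[of v i] v i by (simp add: i_def)
   then have "mor v = u" using v by (intro u(3)) simp_all
   then show "mor v = mor w" by (simp add: w_def)
  qed (use v w in simp_all)
  ultimately show ?thesis using w by (intro ex1I[of _ w]) blast+
 qed
 have "mor i \<in> mono_mors C K X"
  unfolding mono_mors_iff
 proof (intro conjI allI impI)
  have iA: "Arrow K (mor i) X = i" by (simp add: i_def)
  show "valid C (Arrow K (mor i) X)" using i iA by simp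
  fix g h assume gh: "valid C g" "valid C h" "tgt g = K" "tgt h = K" "src g = src h"
   "Arrow K (mor i) X ** g = Arrow K (mor i) X ** h"
  have ig: "valid C (i ** g)" "tgt (i ** g) = X" "src (i ** g) = src g" using i gh by auto
  have "f ** i ** g = azero C (src g) (tgt f)" using reassoc[OF fi, of g] gh f by simp
  then have "f ** (i ** g) = azero C (src (i ** g)) (tgt f)" using ig by simp
  from fact[OF ig(1,2) this] show "g = h" using gh ig iA by auto
 qed
 then have "zero_object C K \<or> mor i \<in> Iso C K X"
  using X unfolding simple_def by blast
 moreover have "mor i \<notin> Iso C K X"
 proof
  assume "mor i \<in> Iso C K X"
  then have iso: "aiso C i" using i by (simp add: aiso_iff)
  have "f = (f ** i) ** ainv C i" using iso i f by (simp add: acomp_assoc)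
  also have "\<dots> = azero C X (tgt f)" unfolding fi using iso i f by simp
  finally show False using f by simp
 qed
 ultimately have K: "zero_object C K" by simp
 show ?thesis
  unfolding mono_mors_iff fA
 proof (intro conjI allI impI)
  fix g h assume gh: "valid C g" "valid C h" "tgt g = X" "tgt h = X" "src g = src h" "f ** g = f ** h"
  let ?d = "g \<boxplus> (- 1) \<odot>\<^sub>s h"
  have d: "valid C ?d" "src ?d = src h" "tgt ?d = X" using gh by auto
  have "f ** ?d = azero C (src ?d) (tgt f)"
   using gh d f aadd_cancel[of "f ** h"] by (simp add: acomp_aadd)
  from fact[OF d(1,3) this] obtain u where u: "valid C u" "src u = src ?d" "tgt u = K" "i ** u = ?d" by blast
  have "u = azero C (src ?d) K" using zero_object_eq[OF K u(1,3)] u by simp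
  then have "?d = azero C (src g) (tgt g)" using u i gh d by auto
  moreover have "tgt g = tgt h" using gh(3,4) by simp
  ultimately show "g = h" using eq_if_diff_zero[OF gh(1,2,5)] by blast
 qed (use f in simp)
qed

lemma simple_not_zero: "simple C X ==> idt C X ~= azero C X X" "simple C X ==> X \<in> Ob C"
 by (auto simp: simple_def zero_object_iff)

lemma schur:
 assumes X: "simple C X" and Y: "simple C Y" and f: "valid C f" "src f = X" "tgt f = Y" "f ~= azero C X Y"
 shows "aiso C f"
proof -
 have "mor f \<in> mono_mors C X Y" using simple_mono[OF X f(1,2)] f by simp
 then have "zero_object C X \<or> mor f \<in> Iso C X Y" using Y unfolding simple_def by blast
 then show ?thesis using X f by (auto simp: simple_def aiso_iff)
qed

end

section \<open>Endomorphisms of simple objects over an algebraically closed field\<close>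

lemma linear_dependence:
 fixes v :: "nat => nat => 'k::field"
 shows "\<exists>c. (\<exists>j\<le>n. c j ~= 0) \<and> (\<forall>i<n. (\<Sum>j\<le>n. c j * v j i) = 0)"
proof (induction n arbitrary: v)
 case 0
 then show ?case by (intro exI[of _ "\<lambda>_. 1"]) simp
next
 case (Suc n)
 show ?case
 proof (cases "\<exists>p\<le>Suc n. v p n ~= 0")
  case False
  obtain c where c: "\<exists>j\<le>n. c j ~= 0" "\<forall>i<n. (\<Sum>j\<le>n. c j * v j i) = 0" using Suc.IH[of v] by blast
  let ?c = "c(Suc n := 0)"
  have "(\<Sum>j\<le>Suc n. ?c j * v j i) = (\<Sum>j\<le>n. c j * v j i)" for i by simp
  moreover obtain j where "j \<le> n" "c j ~= 0" using c(1) by blast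
  then have "\<exists>j\<le>Suc n. ?c j ~= 0" by (intro exI[of _ j]) simp
  moreover have "(\<Sum>j\<le>n. c j * v j i) = 0" if "i < Suc n" for i
   using c(2) False that by (cases "i = n") auto
  ultimately show ?thesis by (intro exI[of _ ?c]) simp
 next
  case True
  then obtain p where p: "p \<le> Suc n" "v p n ~= 0" by blast
  \<comment> \<open>Gaussian elimination of the last coordinate: the pivot is moved to position
    \<open>Suc n\<close>, so that the vectors reduced by it carry the indices up to
    \<open>n\<close>.\<close>
  define u where "u = v (Suc n := v p, p := v (Suc n))"
  have u: "u (Suc n) n ~= 0" using p by (auto simp: u_def)
  define r where "r j = u j n / u (Suc n) n" for j
  obtain c where c: "\<exists>j\<le>n. c j ~= 0" "\<forall>i<n. (\<Sum>j\<le>n. c j * (u j i - r j * u (Suc n) i)) = 0"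
   using Suc.IH[of "\<lambda>j i. u j i - r j * u (Suc n) i"] by blast
  define d where "d = c(Suc n := - (\<Sum>j\<le>n. c j * r j))"
  have d: "(\<Sum>j\<le>Suc n. d j * u j i) = (\<Sum>j\<le>n. c j * (u j i - r j * u (Suc n) i))" for i
   by (simp add: d_def right_diff_distrib sum_subtractf sum_distrib_right mult.assoc)
  have d0: "(\<Sum>j\<le>Suc n. d j * u j i) = 0" if "i < Suc n" for i
  proof (cases "i = n")
   case True
   then show ?thesis unfolding d using u by (simp add: r_def)
  next
   case False
   then show ?thesis unfolding d using c(2) that by simp
  qed
  obtain j where j: "j \<le> n" "c j ~= 0" using c(1) by blast
  then have dj: "d j ~= 0" by (simp add: d_def)
  let ?s = "\<lambda>j. if j = p then Suc n else if j = Suc n then p else j"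
  have ss: "?s (?s j) = j" "?s j \<in> {..Suc n} \<longleftrightarrow> j \<in> {..Suc n}" for j using p by auto
  have s: "bij_betw ?s {..Suc n} {..Suc n}"
   by (rule bij_betw_byWitness[of _ ?s]) (use ss in blast)+
  define e where "e i = d (?s i)" for i
  have v: "v i = u (?s i)" for i by (auto simp: u_def)
  have "(\<Sum>j\<le>Suc n. e j * v j i) = (\<Sum>j\<le>Suc n. d j * u j i)" for i
   unfolding e_def v by (rule sum.reindex_bij_betw[OF s, of "\<lambda>j. d j * u j i"])
  then have e0: "(\<Sum>j\<le>Suc n. e j * v j i) = 0" if "i < Suc n" for i using d0[OF that] by simp
  have "?s j \<le> Suc n" using ss(2)[of j] j by simp
  moreover have "e (?s j) ~= 0" unfolding e_def ss(1) by (rule dj)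
  ultimately have "\<exists>j\<le>Suc n. e j ~= 0" by blast
  with e0 show ?thesis by blast
 qed
qed

context linear_category
begin

text \<open>Coefficient functions in place of the lists in \<open>lincomb\<close>; addition and
  scaling of combinations become pointwise.\<close>

primrec combination :: "'o => (nat => 'k) => 'm list => ('o, 'm) arrow" where
 "combination X \<phi> [] = azero C X X"
| "combination X \<phi> (b # bs) = \<phi> 0 \<odot>\<^sub>s Arrow X b X \<boxplus> combination X (\<lambda>i. \<phi> (Suc i)) bs"

lemma combination_valid:
 assumes "X \<in> Ob C" "set bs \<subseteq> Hom C X X"
 shows "valid C (combination X \<phi> bs) \<and> src (combination X \<phi> bs) = X \<and> tgt (combination X \<phi> bs) = X"
 using assms(2) by (induction bs arbitrary: \<phi>) (use assms(1) in auto)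

lemma combination_lincomb:
 assumes "X \<in> Ob C" "set bs \<subseteq> Hom C X X" "length cs = length bs"
 shows "Arrow X (lincomb C X X (zip cs bs)) X = combination X (\<lambda>i. cs ! i) bs"
 using assms(3,2)
proof (induction cs bs rule: list_induct2)
 case Nil
 then show ?case by (simp add: lincomb_def azero_def)
next
 case (Cons c cs b bs)
 have b: "valid C (Arrow X b X)" using Cons by simp
 have v: "valid C (combination X (\<lambda>i. cs ! i) bs) \<and> src (combination X (\<lambda>i. cs ! i) bs) = X \<and> tgt (combination X (\<lambda>i. cs ! i) bs) = X"
  using Cons by (intro combination_valid assms) auto
 have "mor (combination X (\<lambda>i. cs ! i) bs) = lincomb C X X (zip cs bs)"
  using Cons by (simp flip: Cons.IH)
 then have "c \<odot>\<^sub>s Arrow X b X \<boxplus> combination X (\<lambda>i. cs ! i) bs = Arrow X (Add C (Smult C c b) (lincomb C X X (zip cs bs))) X"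
  using b v by (simp add: aadd_def asmult_def Smult_in_Hom)
 then show ?case by (simp add: lincomb_def)
qed

lemma combination_add:
 assumes "X \<in> Ob C" "set bs \<subseteq> Hom C X X"
 shows "combination X (\<lambda>i. \<phi> i + \<psi> i) bs = combination X \<phi> bs \<boxplus> combination X \<psi> bs"
 using assms(2)
proof (induction bs arbitrary: \<phi> \<psi>)
 case (Cons b bs)
 let ?b = "Arrow X b X" and ?p = "combination X (\<lambda>i. \<phi> (Suc i)) bs" and ?q = "combination X (\<lambda>i. \<psi> (Suc i)) bs"
 have v: "valid C ?b" "valid C ?p" "valid C ?q" "src ?p = X" "tgt ?p = X" "src ?q = X" "tgt ?q = X"
  using Cons combination_valid[OF assms(1), of bs] by auto
 have "(\<phi> 0 \<odot>\<^sub>s ?b \<boxplus> \<psi> 0 \<odot>\<^sub>s ?b) \<boxplus> (?p \<boxplus> ?q) = \<phi> 0 \<odot>\<^sub>s ?b \<boxplus> ((\<psi> 0 \<odot>\<^sub>s ?b \<boxplus> ?p) \<boxplus> ?q)"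
  using v by (simp add: aadd_assoc)
 also have "\<psi> 0 \<odot>\<^sub>s ?b \<boxplus> ?p = ?p \<boxplus> \<psi> 0 \<odot>\<^sub>s ?b" by (rule aadd_commute)
 also have "\<phi> 0 \<odot>\<^sub>s ?b \<boxplus> ((?p \<boxplus> \<psi> 0 \<odot>\<^sub>s ?b) \<boxplus> ?q) = (\<phi> 0 \<odot>\<^sub>s ?b \<boxplus> ?p) \<boxplus> (\<psi> 0 \<odot>\<^sub>s ?b \<boxplus> ?q)"
  using v by (simp add: aadd_assoc)
 finally show ?case using Cons by (simp add: asmult_add_left)
qed (use assms in simp)

lemma combination_smult:
 assumes "X \<in> Ob C" "set bs \<subseteq> Hom C X X"
 shows "combination X (\<lambda>i. c * \<phi> i) bs = c \<odot>\<^sub>s combination X \<phi> bs"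
 using assms(2) by (induction bs arbitrary: \<phi>) (use assms(1) in \<open>auto simp: asmult_aadd\<close>)

lemma combination_zero:
 assumes "X \<in> Ob C" "set bs \<subseteq> Hom C X X" "!!i. i < length bs ==> \<phi> i = 0"
 shows "combination X \<phi> bs = azero C X X"
 using assms(2,3)
proof (induction bs arbitrary: \<phi>)
 case (Cons b bs)
 have "\<phi> 0 = 0" using Cons(3)[of 0] by simp
 moreover have "combination X (\<lambda>i. \<phi> (Suc i)) bs = azero C X X" using Cons by auto
 ultimately show ?case using Cons assms(1) by simp
qed simp

text \<open>Evaluation of a polynomial at an endomorphism, by Horner's scheme.\<close>

definition poly_arrow :: "('o, 'm) arrow => 'k poly => ('o, 'm) arrow" where
 "poly_arrow f p = fold_coeffs (\<lambda>a g. a \<odot>\<^sub>s idt C (src f) \<boxplus> f ** g) p (azero C (src f) (src f))"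

context
 fixes f X assumes f: "valid C f" "src f = X" "tgt f = X"
begin

lemma poly_arrow_0: "poly_arrow f 0 = azero C X X"
 by (simp add: poly_arrow_def f)

lemma poly_arrow_pCons: "poly_arrow f (pCons a p) = a \<odot>\<^sub>s idt C X \<boxplus> f ** poly_arrow f p"
 using f valid_Ob[OF f(1)] by (cases "p = 0 \<and> a = 0") (auto simp: poly_arrow_def)

lemma poly_arrow_valid: "valid C (poly_arrow f p) \<and> src (poly_arrow f p) = X \<and> tgt (poly_arrow f p) = X"
 using f valid_Ob[OF f(1)] by (induction p) (auto simp: poly_arrow_0 poly_arrow_pCons)

lemma poly_arrow_add: "poly_arrow f (p + q) = poly_arrow f p \<boxplus> poly_arrow f q"
proof (induction p q rule: poly_induct2)
 case 0
 then show ?case using f valid_Ob[OF f(1)] by (simp add: poly_arrow_0)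
next
 case (pCons a p b q)
 note v = poly_arrow_valid[of p] poly_arrow_valid[of q]
 have X: "X \<in> Ob C" using f by auto
 let ?i = "idt C X" and ?p = "f ** poly_arrow f p" and ?q = "f ** poly_arrow f q"
 have "(a \<odot>\<^sub>s ?i \<boxplus> b \<odot>\<^sub>s ?i) \<boxplus> (?p \<boxplus> ?q) = a \<odot>\<^sub>s ?i \<boxplus> ((b \<odot>\<^sub>s ?i \<boxplus> ?p) \<boxplus> ?q)"
  using v X f by (simp add: aadd_assoc)
 also have "b \<odot>\<^sub>s ?i \<boxplus> ?p = ?p \<boxplus> b \<odot>\<^sub>s ?i" by (rule aadd_commute)
 also have "a \<odot>\<^sub>s ?i \<boxplus> ((?p \<boxplus> b \<odot>\<^sub>s ?i) \<boxplus> ?q) = (a \<odot>\<^sub>s ?i \<boxplus> ?p) \<boxplus> (b \<odot>\<^sub>s ?i \<boxplus> ?q)"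
  using v X f by (simp add: aadd_assoc)
 finally show ?case using pCons by (simp add: poly_arrow_pCons asmult_add_left acomp_aadd)
qed

lemma poly_arrow_smult: "poly_arrow f (Polynomial.smult c p) = c \<odot>\<^sub>s poly_arrow f p"
 using f valid_Ob[OF f(1)] by (induction p) (auto simp: poly_arrow_0 poly_arrow_pCons asmult_aadd)

lemma poly_arrow_linear_factor:
 "poly_arrow f ([:- t, 1:] * p) = (f \<boxplus> (- t) \<odot>\<^sub>s idt C X) ** poly_arrow f p"
proof -
 have "[:- t, 1:] * p = Polynomial.smult (- t) p + pCons 0 p" by simp
 then have "poly_arrow f ([:- t, 1:] * p) = (- t) \<odot>\<^sub>s poly_arrow f p \<boxplus> f ** poly_arrow f p"
  using poly_arrow_valid[of p] f valid_Ob[OF f(1)] by (simp only: poly_arrow_add poly_arrow_smult poly_arrow_pCons) simp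
 also have "\<dots> = f ** poly_arrow f p \<boxplus> (- t) \<odot>\<^sub>s poly_arrow f p" by (rule aadd_commute)
 finally show ?thesis using poly_arrow_valid[of p] by (simp add: aadd_acomp)
qed

end

end

text \<open>The powers of \<open>f\<close> up to the exponent \<open>length bs\<close> are one more
  than the spanning arrows, so they are linearly dependent.\<close>

lemma (in finite_semisimple_category) ex_annihilating_poly:
 assumes f: "valid C f" "src f = X" "tgt f = X"
 shows "\<exists>p. p ~= 0 \<and> poly_arrow f p = azero C X X"
proof -
 have X: "X \<in> Ob C" using f by auto
 obtain bs where bs: "set bs \<subseteq> Hom C X X"
  "!!g. g \<in> Hom C X X ==> \<exists>cs. length cs = length bs \<and> g = lincomb C X X (zip cs bs)"
  using Hom_finite_dim[OF X X] by blast
 note v = poly_arrow_valid[OF f]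
 have "\<exists>\<phi>. poly_arrow f (monom 1 j) = combination X \<phi> bs" for j
 proof -
  have "mor (poly_arrow f (monom 1 j)) \<in> Hom C X X" using v by auto
  then obtain cs where "length cs = length bs" "mor (poly_arrow f (monom 1 j)) = lincomb C X X (zip cs bs)"
   using bs(2) by blast
  then have "poly_arrow f (monom 1 j) = combination X (\<lambda>i. cs ! i) bs"
   using combination_lincomb[OF X bs(1)] v[of "monom 1 j"] Arrow_mor[of "poly_arrow f (monom 1 j)"] by metis
  then show ?thesis by blast
 qed
 then obtain \<phi> where \<phi>: "!!j. poly_arrow f (monom 1 j) = combination X (\<phi> j) bs" by metis
 obtain c where c: "\<exists>j\<le>length bs. c j ~= 0" "\<forall>i<length bs. (\<Sum>j\<le>length bs. c j * \<phi> j i) = 0"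
  using linear_dependence[of "length bs" \<phi>] by blast
 have *: "poly_arrow f (\<Sum>j\<le>m. monom (c j) j) = combination X (\<lambda>i. \<Sum>j\<le>m. c j * \<phi> j i) bs" for m
 proof (induction m)
  case 0
  have "monom (c 0) 0 = Polynomial.smult (c 0) (monom 1 0)" by (simp add: smult_monom monom_0)
  then show ?case by (simp only: sum.atMost_Suc atMost_0 sum.insert finite.emptyI empty_iff sum.empty add_0_right not_False_eq_True poly_arrow_smult[OF f] \<phi> combination_smult[OF X bs(1)])
 next
  case (Suc m)
  have "monom (c (Suc m)) (Suc m) = Polynomial.smult (c (Suc m)) (monom 1 (Suc m))" by (simp add: smult_monom)
  with Suc show ?case
   by (simp only: sum.atMost_Suc poly_arrow_add[OF f] poly_arrow_smult[OF f] \<phi> combination_add[OF X bs(1)] combination_smult[OF X bs(1)])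
 qed
 let ?p = "\<Sum>j\<le>length bs. monom (c j) j"
 have "poly_arrow f ?p = azero C X X" unfolding * by (rule combination_zero[OF X bs(1)]) (use c(2) in auto)
 moreover obtain j where j: "j \<le> length bs" "c j ~= 0" using c(1) by blast
 have "coeff ?p j = c j" using j by (simp add: coeff_sum)
 then have "?p ~= 0" using j by auto
 ultimately show ?thesis by blast
qed

text \<open>A root \<open>t\<close> of an annihilating polynomial splits off the factor
  \<open>f - t\<close>. By Schur's lemma this is zero, and then \<open>f\<close> is scalar, or it is
  invertible, and then the cofactor of smaller degree annihilates \<open>f\<close> already.\<close>

lemma simple_scalar:
 fixes C :: "('o, 'm, 'k::alg_closed_field, 'z) lin_cat_scheme"
 assumes "finite_semisimple_category C" and X: "simple C X"
 shows "scalar C X"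
proof -
 interpret finite_semisimple_category C by fact
 note XOb = simple_not_zero(2)[OF X] and Xnz = simple_not_zero(1)[OF X]
 show ?thesis
  unfolding scalar_def
 proof (intro conjI allI impI)
  fix f assume f: "valid C f" "src f = X" "tgt f = X"
  note v = poly_arrow_valid[OF f]
  have "\<exists>c. f = c \<odot>\<^sub>s\<^bsub>C\<^esub> idt C X" if "p ~= 0" "poly_arrow f p = azero C X X" for p
   using that
  proof (induction "degree p" arbitrary: p rule: less_induct)
   case less
   show ?case
   proof (cases "degree p = 0")
    case True
    then obtain a where a: "p = [:a:]" using degree_0_id by metis
    then have "a ~= 0" using less.prems by simp
    have "a \<odot>\<^sub>s\<^bsub>C\<^esub> idt C X = azero C X X"
     using less.prems(2) f XOb unfolding a by (simp add: poly_arrow_pCons[OF f] poly_arrow_0[OF f])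
    then have "inverse a \<odot>\<^sub>s\<^bsub>C\<^esub> a \<odot>\<^sub>s\<^bsub>C\<^esub> idt C X = inverse a \<odot>\<^sub>s\<^bsub>C\<^esub> azero C X X" by simp
    then show ?thesis using \<open>a ~= 0\<close> Xnz XOb by simp
   next
    case False
    then obtain t where "poly p t = 0" using alg_closed_imp_poly_has_root[of p] by auto
    then obtain r where r: "p = [:- t, 1:] * r" by (metis dvdE poly_eq_0_iff_dvd)
    have "r ~= 0" using r less.prems by auto
    then have "degree ([:- t, 1:] * r) = degree [:- t, 1:] + degree r" by (intro degree_mult_eq) auto
    also have "\<dots> = Suc (degree r)" by simp
    finally have deg: "degree r < degree p" unfolding r[symmetric] by simp
    let ?g = "f \<boxplus>\<^bsub>C\<^esub> (- t) \<odot>\<^sub>s\<^bsub>C\<^esub> idt C X"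
    have g: "valid C ?g" "src ?g = X" "tgt ?g = X" using f XOb by auto
    have gr: "?g **\<^bsub>C\<^esub> poly_arrow f r = azero C X X"
     using less.prems(2) unfolding r poly_arrow_linear_factor[OF f] .
    show ?thesis
    proof (cases "?g = azero C X X")
     case True
     have "f = t \<odot>\<^sub>s\<^bsub>C\<^esub> idt C X"
      by (rule eq_if_diff_zero) (use f XOb True in auto)
     then show ?thesis ..
    next
     case False
     then have "aiso C ?g" using schur[OF X X g] by simp
     then have "poly_arrow f r = azero C X X"
      by (rule aiso_monic) (use gr v g XOb in auto)
     then show ?thesis using less.hyps[OF deg \<open>r ~= 0\<close>] by blast
    qed
   qed
  qed
  then show "\<exists>c. f = c \<odot>\<^sub>s\<^bsub>C\<^esub> idt C X" using ex_annihilating_poly[OF f] by blast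
 qed (use XOb Xnz in auto)
qed

lemma (in pointed_category_of) pointed_family_if_scalar:
 assumes sc: "!!a. scalar C (S a)"
 shows "pointed_family C S"
proof -
 have Ob [simp]: "S a \<in> Ob C" for a using simple_S by (simp add: simple_def)
 show ?thesis
 proof
  show "scalar C (S l)" for l by (rule sc)
  show "f = azero C (S l) (S m)" if "valid C f" "src f = S l" "tgt f = S m" "l ~= m" for f l m
  proof (rule ccontr)
   assume "f ~= azero C (S l) (S m)"
   then have "aiso C f" by (rule schur[OF simple_S simple_S that(1-3)])
   then have "isomorphic C (S l) (S m)" using that unfolding isomorphic_iff by blast
   then show False using S_inj that by blast
  qed
  show "isomorphic C (S l \<boxtimes> S m) (S (l + m))" for l m by (rule S_add)
  show "isomorphic C (Unit C) (S 0)"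
  proof -
   \<comment> \<open>The unit is isomorphic to some \<open>S u\<close>. Since it is idempotent under
     the tensor product, \<open>u + u = u\<close>.\<close>
   obtain u where u: "isomorphic C (Unit C) (S u)" using S_surj[OF simple_Unit] by blast
   then obtain f where f: "aiso C f" "src f = Unit C" "tgt f = S u" unfolding isomorphic_iff by blast
   have "aiso C (f ** alu C (Unit C) ** ainv C (f \<otimes>\<^sub>a f))" using f by simp
   moreover have "src (f ** alu C (Unit C) ** ainv C (f \<otimes>\<^sub>a f)) = S u \<boxtimes> S u"
    "tgt (f ** alu C (Unit C) ** ainv C (f \<otimes>\<^sub>a f)) = S u" using f by simp_all
   ultimately have "isomorphic C (S u \<boxtimes> S u) (S u)" unfolding isomorphic_iff by blast
   then have "isomorphic C (S (u + u)) (S u)" using S_add isomorphic_sym isomorphic_trans by blast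
   then have "u + u = u" by (rule S_inj)
   then show ?thesis using u by simp
  qed
  show "covers C Z {s. src s \<in> range S}" if "Z \<in> Ob C" for Z
   using semisimple[OF that]
  proof (induction rule: sum_of_simples.induct)
   case (zero Z)
   then show ?case by (auto simp: covers_def zero_object_iff intro: Span.zero)
  next
   case (add X Y V)
   from direct_sumE[OF add(3)] obtain i j p r where s: "valid C i" "src i = X" "tgt i = V" "valid C j" "src j = Y" "tgt j = V"
    "valid C p" "src p = V" "tgt p = X" "valid C r" "src r = V" "tgt r = Y" "(i ** p) \<boxplus> (j ** r) = idt C V" by metis
   obtain a g where g: "aiso C g" "src g = Y" "tgt g = S a"
    using S_surj[OF add(2)] unfolding isomorphic_iff by blast
   let ?G = "{s :: ('o, 'm) arrow. src s \<in> range S}"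
   have "i ** idt C X \<in> Span C ?G X (tgt i)"
   proof (rule Span_acomp_left[where G = ?G])
    show "idt C X \<in> Span C ?G X X" using add(4) by (simp add: covers_def)
    show "i ** x \<in> Span C ?G (src x) (tgt i)" if "x \<in> ?G" "valid C x" "tgt x = X" for x
     using Span_gen[of "i ** x" ?G] that s by simp
   qed (use s in auto)
   then have "i \<in> Span C ?G X V" using s by simp
   from Span_acomp_right[OF this s(7,9)] have 1: "i ** p \<in> Span C ?G V V" using s by simp
   have "(j ** ainv C g) ** (g ** r) \<in> Span C ?G V V"
    by (rule Span.comp) (use s g in auto)
   then have 2: "j ** r \<in> Span C ?G V V" using s g by (simp add: acomp_assoc)
   have "V \<in> Ob C" using s by auto
   then show ?case using Span.add[OF 1 2] s by (simp add: covers_def)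
  qed
  show "\<exists>V. direct_sum C Z (S l) V" if "Z \<in> Ob C" for Z l by (rule ex_direct_sum[OF that Ob])
  show "\<exists>Z. zero_object C Z" by (rule ex_zero_object)
 qed
qed

theorem pointed_family_pointed_category:
 fixes C :: "('o, 'm, 'k::alg_closed_field, 'z) btc_scheme"
 assumes "pointed_category_of C S q"
 shows "pointed_family C S"
proof -
 interpret pointed_category_of C S q by fact
 show ?thesis
  by (rule pointed_family_if_scalar, rule simple_scalar[OF finite_semisimple_category_axioms simple_S])
qed

section \<open>Characters and their projections\<close>

text \<open>All character values are roots of \<open>x^N - 1\<close> with \<open>N\<close> the group
  order, because the product of the values over the group is invariant under translation.\<close>

lemma finite_characters: "finite (UNIV :: ('a::{ab_group_add,finite}, 'k::field) dual set)"
proof -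
 let ?N = "card (UNIV :: 'a set)" and ?p = "monom 1 (card (UNIV :: 'a set)) - 1 :: 'k poly"
 have "ev \<phi> x ^ ?N = 1" for \<phi> :: "('a, 'k) dual" and x
 proof -
  have "bij ((+) x)" by (rule bijI') (auto intro: exI[of _ "_ - x"])
  then have "(\<Prod>y\<in>UNIV. ev \<phi> y) = (\<Prod>y\<in>UNIV. ev \<phi> (x + y))"
   by (rule prod.reindex_bij_betw[symmetric])
  also have "\<dots> = ev \<phi> x ^ ?N * (\<Prod>y\<in>UNIV. ev \<phi> y)"
   by (simp add: character_add prod.distrib)
  finally show ?thesis by simp
 qed
 then have "range (ev :: ('a, 'k) dual => _) \<subseteq> (\<Pi>\<^sub>E x\<in>UNIV. {z. poly ?p z = 0})"
  by (auto simp: poly_monom)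
 moreover have "?p ~= 0"
 proof
  assume "?p = 0"
  then have "coeff ?p ?N = 0" by simp
  then show False by simp
 qed
 then have "finite (\<Pi>\<^sub>E x\<in>(UNIV :: 'a set). {z. poly ?p z = 0})"
  by (intro finite_PiE poly_roots_finite) simp_all
 ultimately have "finite (range (ev :: ('a, 'k) dual => _))" by (rule finite_subset)
 then show ?thesis by (rule finite_imageD) (simp add: inj_on_def ev_inject)
qed

text \<open>Translate the sum by a character that is not 1 at \<open>b\<close>.\<close>

lemma character_sum_eq_0:
 fixes b :: "'a::{ab_group_add,finite}"
 assumes "b ~= 0"
 shows "(\<Sum>\<phi>\<in>UNIV. ev (\<phi> :: ('a, 'k::{alg_closed_field,field_char_0}) dual) b) = 0"
proof -
 obtain f :: "'a => 'k munit" where f: "!!x y. f (x + y) = f x + f y" "f b ~= 0"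
  using separating_hom[OF finite divisible_munit torsion_munit assms] by blast
 define \<psi> :: "('a, 'k) dual" where "\<psi> = Abs_dual (\<lambda>x. mval (f x))"
 have \<psi>: "ev \<psi> x = mval (f x)" for x
  unfolding \<psi>_def by (subst Abs_dual_inverse) (simp_all add: f plus_munit.rep_eq)
 have "ev \<psi> b ~= 1" using f(2) mval_inject[of "f b" 0] by (simp add: \<psi> zero_munit.rep_eq)
 have "bij ((+) \<psi>)" by (rule bijI') (auto intro: exI[of _ "_ - \<psi>"])
 then have "(\<Sum>\<phi>\<in>UNIV. ev \<phi> b) = (\<Sum>\<phi>\<in>UNIV. ev (\<psi> + \<phi>) b)"
  by (rule sum.reindex_bij_betw[symmetric])
 also have "\<dots> = ev \<psi> b * (\<Sum>\<phi>\<in>UNIV. ev \<phi> b)"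
  by (simp add: plus_dual.rep_eq sum_distrib_left)
 finally show ?thesis using \<open>ev \<psi> b ~= 1\<close> by simp
qed

text \<open>Addition of arrows is partial, so finite sums of endomorphisms are taken with
  \<open>finsum\<close> in this structure.\<close>

definition End_ring :: "('o, 'm, 'k, 'z) lin_cat_scheme => 'o => ('o, 'm) arrow ring" where
 "End_ring C X = \<lparr> carrier = Ar C X X, monoid.mult = acomp C, one = idt C X,
   zero = azero C X X, add = aadd C \<rparr>"

lemma (in linear_category) semiring_End_ring:
 assumes "X \<in> Ob C"
 shows "semiring (End_ring C X)"
 by unfold_locales
  (use assms in \<open>auto simp: End_ring_def Ar_iff aadd_assoc acomp_assoc aadd_acomp acomp_aadd intro: aadd_commute\<close>)

text \<open>\<open>e \<phi>\<close> averages the action \<open>T\<close> against the inverse of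
  \<open>\<phi>\<close>. The last conclusion expresses that the \<open>e \<phi>\<close> add up to
  the identity: every set that contains them and zero and is closed under addition contains
  it.\<close>

lemma character_projections:
 fixes T :: "'a::{ab_group_add,finite} => ('o, 'm) arrow"
  and C :: "('o, 'm, 'k::{alg_closed_field,field_char_0}, 'z) lin_cat_scheme" (structure)
 assumes C: "linear_category C" and X: "X \<in> Ob C"
  and Tv: "!!b. valid C (T b)" "!!b. src (T b) = X" "!!b. tgt (T b) = X"
  and T_add: "!!b c. T (b + c) = T b ** T c" and T_0: "T 0 = idt C X"
 obtains e :: "('a, 'k) dual => ('o, 'm) arrow" and d where
  "!!\<phi>. valid C (e \<phi>)" "!!\<phi>. src (e \<phi>) = X" "!!\<phi>. tgt (e \<phi>) = X"
  "!!\<phi> b. T b ** e \<phi> = ev \<phi> b \<odot>\<^sub>s e \<phi>" "!!\<phi> b. e \<phi> ** T b = ev \<phi> b \<odot>\<^sub>s e \<phi>"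
  "!!\<phi>. e \<phi> = d \<odot>\<^sub>s (e \<phi> ** e \<phi>)"
  "!!K. azero C X X \<in> K ==> (!!f g. f \<in> K ==> g \<in> K ==> f \<boxplus> g \<in> K) ==> (!!\<phi>. e \<phi> \<in> K) ==> idt C X \<in> K"
proof -
 interpret linear_category C by fact
 interpret R: semiring "End_ring C X" by (rule semiring_End_ring[OF X])
 have R [simp]: "carrier (End_ring C X) = Ar C X X" "monoid.mult (End_ring C X) = acomp C"
   "add (End_ring C X) = aadd C" "\<zero>\<^bsub>End_ring C X\<^esub> = azero C X X"
  by (simp_all add: End_ring_def)
 \<comment> \<open>Dividing by the number \<open>M\<close> of characters makes the
   \<open>e \<phi>\<close> sum to the identity. The square of \<open>e \<phi>\<close> then carries
   the factor \<open>N / M\<close>, whence the constant \<open>d = M / N\<close>.\<close>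
 define M N :: 'k where "M = of_nat (card (UNIV :: ('a, 'k) dual set))" and "N = of_nat (card (UNIV :: 'a set))"
 have MN: "M ~= 0" "N ~= 0" using finite_characters by (auto simp: M_def N_def card_eq_0_iff)
 define L where "L a = finsum (End_ring C X) (\<lambda>b. a b \<odot>\<^sub>s T b) UNIV" for a :: "'a => 'k"
 have aT [simp]: "(\<lambda>b. a b \<odot>\<^sub>s T b) \<in> UNIV \<rightarrow> Ar C X X" for a :: "'a => 'k" by (auto simp: Ar_iff Tv)
 have "L a \<in> Ar C X X" for a unfolding L_def using R.finsum_closed[of "\<lambda>b. a b \<odot>\<^sub>s T b" UNIV] by simp
 then have Lv [simp]: "valid C (L a)" "src (L a) = X" "tgt (L a) = X" for a by (simp_all add: Ar_iff)
 have L_add: "L (\<lambda>b. a b + a' b) = L a \<boxplus> L a'" for a a'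
  unfolding L_def using R.finsum_addf[of "\<lambda>b. a b \<odot>\<^sub>s T b" UNIV "\<lambda>b. a' b \<odot>\<^sub>s T b"] by (simp add: asmult_add_left)
 have L_left: "f ** L a = finsum (End_ring C X) (\<lambda>b. a b \<odot>\<^sub>s (f ** T b)) UNIV" if "f \<in> Ar C X X" for f a
  unfolding L_def using R.finsum_rdistr[of UNIV f "\<lambda>b. a b \<odot>\<^sub>s T b"] that by simp
 have L_right: "L a ** f = finsum (End_ring C X) (\<lambda>b. a b \<odot>\<^sub>s (T b ** f)) UNIV" if "f \<in> Ar C X X" for f a
  unfolding L_def using R.finsum_ldistr[of UNIV f "\<lambda>b. a b \<odot>\<^sub>s T b"] that by simp
 have L_smult: "L (\<lambda>b. c * a b) = c \<odot>\<^sub>s L a" for c a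
  using L_left[of "c \<odot>\<^sub>s idt C X" a] X by (simp add: Ar_iff L_def[of "\<lambda>b. c * a b"] Tv mult.commute[of _ c])
 have L_0: "L (\<lambda>b. 0) = azero C X X" using L_smult[of 0 "\<lambda>_. 0"] by simp
 \<comment> \<open>Composition with \<open>T c\<close> shifts the coefficients; when these are given
   by a character, the shift is multiplication by a scalar.\<close>
 have L_T: "T c ** L a = L (\<lambda>b. a (b - c))" for c a
 proof -
  have "L (\<lambda>b. a (b - c)) = finsum (End_ring C X) (\<lambda>b. a (b - c) \<odot>\<^sub>s T b) ((+) c ` UNIV)" by (simp add: L_def)
  also have "\<dots> = finsum (End_ring C X) (\<lambda>b. a b \<odot>\<^sub>s T (c + b)) UNIV"
   by (subst R.finsum_reindex) (auto simp: Ar_iff Tv)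
  also have "\<dots> = T c ** L a" by (subst L_left) (simp_all add: Ar_iff Tv T_add)
  finally show ?thesis ..
 qed
 have L_delta: "L (\<lambda>b. if b = 0 then 1 else 0) = idt C X"
 proof -
  have "L (\<lambda>b. if b = 0 then 1 else 0) = finsum (End_ring C X) (\<lambda>b. if 0 = b then T b else azero C X X) UNIV"
   unfolding L_def by (rule R.finsum_cong') (auto simp: Ar_iff Tv X)
  then show ?thesis using R.finsum_singleton[of 0 UNIV T] by (simp add: Ar_iff Tv T_0 Pi_def cong: if_cong)
 qed
 define e where "e \<phi> = L (\<lambda>b. ev \<phi> (- b) / M)" for \<phi> :: "('a, 'k) dual"
 have ev: "valid C (e \<phi>)" "src (e \<phi>) = X" "tgt (e \<phi>) = X" for \<phi> by (simp_all add: e_def)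
 have Te: "T b ** e \<phi> = ev \<phi> b \<odot>\<^sub>s e \<phi>" for b \<phi>
 proof -
  have "ev \<phi> (- (x - b)) / M = ev \<phi> b * (ev \<phi> (- x) / M)" for x
   using character_add[of \<phi> b "- x"] by simp
  then show ?thesis unfolding e_def L_T L_smult[symmetric] by (simp only:)
 qed
 have eT: "e \<phi> ** T b = ev \<phi> b \<odot>\<^sub>s e \<phi>" for b \<phi>
 proof -
  have "e \<phi> ** T b = finsum (End_ring C X) (\<lambda>c. (ev \<phi> (- c) / M) \<odot>\<^sub>s (T c ** T b)) UNIV"
   unfolding e_def by (rule L_right) (simp add: Ar_iff Tv)
  also have "\<dots> = T b ** e \<phi>"
   unfolding e_def by (subst L_left) (simp_all add: Ar_iff Tv add.commute flip: T_add)
  finally show ?thesis by (simp only: Te)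
 qed
 have "e \<phi> ** e \<phi> = (N / M) \<odot>\<^sub>s e \<phi>" for \<phi>
 proof -
  have "e \<phi> ** e \<phi> = finsum (End_ring C X) (\<lambda>c. (ev \<phi> (- c) / M) \<odot>\<^sub>s (T c ** e \<phi>)) UNIV"
   using L_right[of "e \<phi>" "\<lambda>b. ev \<phi> (- b) / M"] unfolding e_def[symmetric] by (simp add: Ar_iff ev)
  also have "\<dots> = finsum (End_ring C X) (\<lambda>c. (1 / M) \<odot>\<^sub>s e \<phi>) (UNIV :: 'a set)"
   by (simp add: Te)
  also have "\<dots> = (of_nat (card (UNIV :: 'a set)) / M) \<odot>\<^sub>s e \<phi>"
  proof -
   have "finsum (End_ring C X) (\<lambda>c. (1 / M) \<odot>\<^sub>s e \<phi>) A = (of_nat (card A) / M) \<odot>\<^sub>s e \<phi>" for A :: "'a set"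
    using finite[of A] by (induction A) (simp_all add: Ar_iff ev add_divide_distrib asmult_add_left)
   then show ?thesis .
  qed
  finally show ?thesis by (simp add: N_def)
 qed
 then have ee: "e \<phi> = (M / N) \<odot>\<^sub>s (e \<phi> ** e \<phi>)" for \<phi> using MN ev by simp
 \<comment> \<open>Adding coefficient functions instead of arrows turns the sum of the
   \<open>e \<phi>\<close> into \<open>L\<close> of a character sum, which is the delta function at
   0.\<close>
 have span: "idt C X \<in> K" if K: "azero C X X \<in> K" "!!f g. f \<in> K ==> g \<in> K ==> f \<boxplus> g \<in> K" "!!\<phi>. e \<phi> \<in> K" for K
 proof -
  have "L (\<lambda>b. (\<Sum>\<phi>\<in>\<Phi>. ev \<phi> (- b)) / M) \<in> K" if "finite \<Phi>" for \<Phi> :: "('a, 'k) dual set"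
   using that
  proof induction
   case empty
   then show ?case using K(1) by (simp add: L_0)
  next
   case (insert \<phi> \<Phi>)
   then show ?case using K(2)[OF K(3)[of \<phi>] insert.IH] by (simp add: e_def add_divide_distrib flip: L_add)
  qed
  from this[OF finite_characters] have "L (\<lambda>b. (\<Sum>\<phi>\<in>UNIV. ev (\<phi> :: ('a, 'k) dual) (- b)) / M) \<in> K" .
  also have "(\<lambda>b. (\<Sum>\<phi>\<in>UNIV. ev (\<phi> :: ('a, 'k) dual) (- b)) / M) = (\<lambda>b. if b = 0 then 1 else 0)"
  proof
   fix b :: 'a
   show "(\<Sum>\<phi>\<in>UNIV. ev (\<phi> :: ('a, 'k) dual) (- b)) / M = (if b = 0 then 1 else 0)"
    using character_sum_eq_0[of "- b"] MN by (cases "b = 0") (simp_all add: M_def del: character_minus)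
  qed
  finally show ?thesis by (simp only: L_delta)
 qed
 show thesis by (rule that[OF ev Te eT ee span])
qed

section \<open>The braiding with the unit object\<close>

context braided_monoidal_category
begin

text \<open>Tensoring with the unit is faithful, because it is naturally isomorphic to doing
  nothing.\<close>

lemma Unit_lwhisk_cancel:
 assumes "valid C f" "valid C g" "src f = src g" "tgt f = tgt g" "Unit C \<rhd> f = Unit C \<rhd> g"
 shows "f = g"
proof (rule aiso_epic[of "alu C (src f)"])
 show "f ** alu C (src f) = g ** alu C (src f)"
  using alu_natural[OF assms(1)] alu_natural[OF assms(2)] assms by simp
qed (use assms in auto)

lemma Unit_rwhisk_cancel:
 assumes "valid C f" "valid C g" "src f = src g" "tgt f = tgt g" "f \<lhd> Unit C = g \<lhd> Unit C"
 shows "f = g"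
proof (rule aiso_epic[of "aru C (src f)"])
 show "f ** aru C (src f) = g ** aru C (src f)"
  using aru_natural[OF assms(1)] aru_natural[OF assms(2)] assms by simp
qed (use assms in auto)

text \<open>Kelly's argument: after tensoring with the unit, pentagon and triangle give the claim.\<close>

lemma alu_aten:
 assumes [simp]: "X \<in> Ob C" "Y \<in> Ob C"
 shows "alu C (X \<boxtimes> Y) ** aass C (Unit C) X Y = alu C X \<lhd> Y"
proof (rule Unit_lwhisk_cancel)
 let ?I = "Unit C"
 let ?w = "aass C ?I (?I \<boxtimes> X) Y ** (aass C ?I ?I X \<lhd> Y)"
 have "(?I \<rhd> (alu C (X \<boxtimes> Y) ** aass C ?I X Y)) ** ?w = (?I \<rhd> alu C (X \<boxtimes> Y)) ** (?I \<rhd> aass C ?I X Y) ** ?w"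
  by (simp add: interchange')
 also have "\<dots> = (?I \<rhd> alu C (X \<boxtimes> Y)) ** aass C ?I ?I (X \<boxtimes> Y) ** aass C (?I \<boxtimes> ?I) X Y"
  by (simp add: a_pentagon)
 also have "\<dots> = (aru C ?I \<lhd> (X \<boxtimes> Y)) ** aass C (?I \<boxtimes> ?I) X Y"
  by (simp add: reassoc[OF a_triangle])
 also have "\<dots> = aass C ?I X Y ** ((aru C ?I \<lhd> X) \<lhd> Y)"
  using aass_natural[of "aru C ?I" "idt C X" "idt C Y"] by simp
 also have "aru C ?I \<lhd> X = (?I \<rhd> alu C X) ** aass C ?I ?I X"
  by (simp add: a_triangle)
 also have "aass C ?I X Y ** (((?I \<rhd> alu C X) ** aass C ?I ?I X) \<lhd> Y) =
   aass C ?I X Y ** ((?I \<rhd> alu C X) \<lhd> Y) ** (aass C ?I ?I X \<lhd> Y)"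
  by (simp add: interchange)
 also have "\<dots> = (?I \<rhd> (alu C X \<lhd> Y)) ** ?w"
  by (simp add: reassoc[OF aass_natural] acomp_assoc)
 finally show "?I \<rhd> (alu C (X \<boxtimes> Y) ** aass C ?I X Y) = ?I \<rhd> (alu C X \<lhd> Y)"
  by (rule aiso_epic[rotated]) simp_all
qed simp_all

text \<open>The hexagon at \<open>X\<close> and twice the unit yields the claim tensored with the
  unit and preceded by \<open>d\<close>, an isomorphism that cancels. The result identifies the unit
  of the center in \<open>Unit_center\<close>.\<close>

lemma alu_abr_Unit:
 assumes [simp]: "X \<in> Ob C"
 shows "alu C X ** abr C X (Unit C) = aru C X"
proof (rule Unit_rwhisk_cancel)
 let ?I = "Unit C"
 define d where "d = alu C X ** abr C X ?I"
 have d: "aiso C d" "src d = X \<boxtimes> ?I" "tgt d = X" by (simp_all add: d_def)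
 have "d ** (d \<lhd> ?I) = d ** (alu C X \<lhd> ?I) ** (abr C X ?I \<lhd> ?I)"
  by (simp add: d_def interchange)
 also have "\<dots> = d ** alu C (X \<boxtimes> ?I) ** aass C ?I X ?I ** (abr C X ?I \<lhd> ?I)"
  by (simp add: acomp_assoc flip: alu_aten)
 also have "\<dots> = alu C X ** (?I \<rhd> d) ** aass C ?I X ?I ** (abr C X ?I \<lhd> ?I)"
  using reassoc[OF alu_natural[of d]] d by (simp add: acomp_assoc)
 also have "?I \<rhd> d = (?I \<rhd> alu C X) ** (?I \<rhd> abr C X ?I)"
  by (simp add: d_def interchange)
 also have "alu C X ** ((?I \<rhd> alu C X) ** (?I \<rhd> abr C X ?I)) ** aass C ?I X ?I ** (abr C X ?I \<lhd> ?I) =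
   alu C X ** (?I \<rhd> alu C X) ** aass C ?I ?I X ** abr C X (?I \<boxtimes> ?I) ** aass C X ?I ?I"
  using a_hexagon1[of X ?I ?I] by (simp add: acomp_assoc)
 also have "\<dots> = alu C X ** alu C (?I \<boxtimes> X) ** aass C ?I ?I X ** abr C X (?I \<boxtimes> ?I) ** aass C X ?I ?I"
  using reassoc[OF alu_natural[of "alu C X"]] by (simp add: acomp_assoc)
 also have "\<dots> = alu C X ** (alu C ?I \<lhd> X) ** abr C X (?I \<boxtimes> ?I) ** aass C X ?I ?I"
  by (simp add: reassoc[OF alu_aten])
 also have "\<dots> = alu C X ** abr C X ?I ** (X \<rhd> alu C ?I) ** aass C X ?I ?I"
  using reassoc[OF abr_natural[of "idt C X" "alu C ?I" X ?I]] by (simp add: acomp_assoc)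
 also have "\<dots> = d ** (aru C X \<lhd> ?I)"
  by (simp add: a_triangle d_def acomp_assoc)
 finally have "d \<lhd> ?I = aru C X \<lhd> ?I"
  by (rule aiso_monic[rotated]) (use d in simp_all)
 then show "(alu C X ** abr C X ?I) \<lhd> ?I = aru C X \<lhd> ?I" by (simp only: d_def)
qed simp_all

end

section \<open>Twisted braidings\<close>

text \<open>The endomorphism of \<open>Z\<close> that multiplies by \<open>t l\<close> on the part
  generated by \<open>S l\<close>; the lemmas \<open>grading\<close> and \<open>grading_eqI\<close>
  give existence and uniqueness. For multiplicative \<open>t\<close> it is a monoidal automorphism
  of the identity functor.\<close>

definition grading :: "('o, 'm, 'k, 'z) lin_cat_scheme => ('b => 'o) => ('b => 'k) => 'o => ('o, 'm) arrow" where
 "grading C S t Z = (SOME h. valid C h \<and> src h = Z \<and> tgt h = Z \<and>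
   (\<forall>l s. valid C s --> src s = S l --> tgt s = Z --> h **\<^bsub>C\<^esub> s = t l \<odot>\<^sub>s\<^bsub>C\<^esub> s))"

context pointed_family
begin

abbreviation gr where "gr \<equiv> grading C S"

lemma grading:
 assumes Z: "Z \<in> Ob C"
 shows "valid C (gr t Z)" "src (gr t Z) = Z" "tgt (gr t Z) = Z"
  "!!l s. valid C s ==> src s = S l ==> tgt s = Z ==> gr t Z ** s = t l \<odot>\<^sub>s s"
proof -
 interpret CC: pointed_source C C S by unfold_locales
 have id: "lfun C C (\<lambda>X. X) (\<lambda>f. f)" by (simp add: lfun_def)
 obtain h where h: "valid C h" "src h = Z" "tgt h = Z"
  "!!l s. valid C s ==> src s = S l ==> tgt s = Z ==> h ** s = s ** (t l \<odot>\<^sub>s idt C (S l))"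
  by (rule CC.extend_nat[OF id id, of "\<lambda>l. t l \<odot>\<^sub>s idt C (S l)" Z]) (use Z in auto)
 have "h ** s = t l \<odot>\<^sub>s s" if "valid C s" "src s = S l" "tgt s = Z" for l s
  using h(4)[OF that] that by simp
 with h(1-3) have "\<exists>h. valid C h \<and> src h = Z \<and> tgt h = Z \<and>
   (\<forall>l s. valid C s --> src s = S l --> tgt s = Z --> h ** s = t l \<odot>\<^sub>s s)" by blast
 from someI_ex[OF this]
 show "valid C (gr t Z)" "src (gr t Z) = Z" "tgt (gr t Z) = Z"
  "!!l s. valid C s ==> src s = S l ==> tgt s = Z ==> gr t Z ** s = t l \<odot>\<^sub>s s"
  unfolding grading_def by blast+
qed

declare grading(1-3) [simp]

lemma grading_eqI:
 assumes "Z \<in> Ob C" "valid C h" "src h = Z" "tgt h = Z"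
  "!!l s. valid C s ==> src s = S l ==> tgt s = Z ==> h ** s = t l \<odot>\<^sub>s s"
 shows "h = gr t Z"
 by (rule covers_eqI[OF S_covers[OF assms(1)]]) (use assms grading(4)[OF assms(1)] in auto)

lemma grading_S: "gr t (S l) = t l \<odot>\<^sub>s idt C (S l)"
proof (rule grading_eqI[symmetric])
 fix m s assume s: "valid C s" "src s = S m" "tgt s = S l"
 then show "(t l \<odot>\<^sub>s idt C (S l)) ** s = t m \<odot>\<^sub>s s"
  by (cases rule: S_hom) (auto simp: mult.commute)
qed simp_all

lemma grading_natural:
 assumes f: "valid C f"
 shows "gr t (tgt f) ** f = f ** gr t (src f)"
proof (rule covers_eqI[OF S_covers[of "src f"]])
 fix g assume g: "g \<in> Sg" "valid C g" "tgt g = src f"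
 then obtain l where l: "src g = S l" by auto
 show "(gr t (tgt f) ** f) ** g = (f ** gr t (src f)) ** g"
  using f g l grading(4)[of "tgt f" "f ** g" l t] grading(4)[of "src f" g l t] by (simp add: acomp_assoc)
qed (use f in simp_all)

lemma grading_1: "Z \<in> Ob C ==> gr (\<lambda>_. 1) Z = idt C Z"
 by (rule grading_eqI[symmetric]) simp_all

lemma grading_mult: "Z \<in> Ob C ==> gr (\<lambda>l. t l * t' l) Z = gr t Z ** gr t' Z"
 by (rule grading_eqI[symmetric]) (simp_all add: acomp_assoc grading(4) mult.commute)

text \<open>An arrow \<open>s \<otimes>\<^sub>a u\<close> from \<open>S l \<boxtimes> S m\<close>
  factors through \<open>S (l + m)\<close>, where multiplicativity of \<open>t\<close> compares the
  two sides.\<close>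

lemma grading_aten:
 assumes [simp]: "X \<in> Ob C" "Y \<in> Ob C" and t: "!!l m. t (l + m) = t l * t m"
 shows "gr t (X \<boxtimes> Y) = gr t X \<otimes>\<^sub>a gr t Y"
proof (rule covers_eqI[OF Sg_covers2[of X Y]])
 fix g assume "g \<in> {s \<otimes>\<^sub>a u | s u. valid C s \<and> valid C u \<and> src s \<in> range S \<and> src u \<in> range S \<and> tgt s = X \<and> tgt u = Y}"
 then obtain s u l m where g: "g = s \<otimes>\<^sub>a u" and s: "valid C s" "src s = S l" "tgt s = X"
  and u: "valid C u" "src u = S m" "tgt u = Y" by blast
 obtain \<mu> where \<mu>: "aiso C \<mu>" "src \<mu> = S l \<boxtimes> S m" "tgt \<mu> = S (l + m)"
  using S_mult[of l m] unfolding isomorphic_iff by blast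
 have "gr t (X \<boxtimes> Y) ** g = gr t (X \<boxtimes> Y) ** (g ** ainv C \<mu>) ** \<mu>"
  using \<mu> s u by (simp add: g acomp_assoc)
 also have "\<dots> = (gr t (X \<boxtimes> Y) ** (g ** ainv C \<mu>)) ** \<mu>" by (simp only: acomp_assoc)
 also have "gr t (X \<boxtimes> Y) ** (g ** ainv C \<mu>) = t (l + m) \<odot>\<^sub>s (g ** ainv C \<mu>)"
  by (rule grading(4)) (use \<mu> s u in \<open>simp_all add: g\<close>)
 also have "(t (l + m) \<odot>\<^sub>s (g ** ainv C \<mu>)) ** \<mu> = (t l * t m) \<odot>\<^sub>s g"
  using \<mu> s u by (simp add: g acomp_assoc t)
 also have "\<dots> = (gr t X \<otimes>\<^sub>a gr t Y) ** g"
  using s u grading(4)[of X s l t] grading(4)[of Y u m t] by (simp add: g interchange mult.commute)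
 finally show "gr t (X \<boxtimes> Y) ** g = (gr t X \<otimes>\<^sub>a gr t Y) ** g" .
qed simp_all

text \<open>The braiding twisted by a character in its left argument. For fixed \<open>X\<close> it
  is a half braiding on \<open>X\<close>, and for \<open>X = S a\<close> it gives the object of the
  center labelled \<open>(a, \<phi>)\<close>.\<close>

definition bx :: "('b, 'k) dual => 'o => 'o => ('o, 'm) arrow" where
 "bx \<phi> U X = abr C U X ** (gr (ev \<phi>) U \<lhd> X)"

lemma aiso_grading: "Z \<in> Ob C ==> aiso C (gr (ev \<phi>) Z)"
proof (rule aisoI[of _ "gr (ev (- \<phi>)) Z"])
 assume Z: "Z \<in> Ob C"
 have 1: "(\<lambda>l. ev (- \<phi>) l * ev \<phi> l) = (\<lambda>_. 1)" "(\<lambda>l. ev \<phi> l * ev (- \<phi>) l) = (\<lambda>_. 1)"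
  by (simp_all add: uminus_dual.rep_eq)
 show "gr (ev (- \<phi>)) Z ** gr (ev \<phi>) Z = idt C (src (gr (ev \<phi>) Z))"
  "gr (ev \<phi>) Z ** gr (ev (- \<phi>)) Z = idt C (tgt (gr (ev \<phi>) Z))"
  using Z by (simp_all add: 1 grading_1 flip: grading_mult)
qed simp_all

lemma bx_simps [simp]:
 assumes "U \<in> Ob C" "X \<in> Ob C"
 shows "aiso C (bx \<phi> U X)" "valid C (bx \<phi> U X)" "src (bx \<phi> U X) = U \<boxtimes> X" "tgt (bx \<phi> U X) = X \<boxtimes> U"
 using assms aiso_grading[of U \<phi>] by (simp_all add: bx_def)

lemma bx_S: "X \<in> Ob C ==> bx \<phi> (S b) X = ev \<phi> b \<odot>\<^sub>s abr C (S b) X"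
 by (simp add: bx_def grading_S)

lemma bx_0: "U \<in> Ob C ==> X \<in> Ob C ==> bx 0 U X = abr C U X"
 using grading_1[of U] by (simp add: bx_def zero_dual.rep_eq)

lemma bx_natural:
 assumes f: "valid C f" and g: "valid C g"
 shows "bx \<phi> (tgt f) (tgt g) ** (f \<otimes>\<^sub>a g) = (g \<otimes>\<^sub>a f) ** bx \<phi> (src f) (src g)"
proof -
 have "bx \<phi> (tgt f) (tgt g) ** (f \<otimes>\<^sub>a g) = abr C (tgt f) (tgt g) ** ((gr (ev \<phi>) (tgt f) ** f) \<otimes>\<^sub>a g)"
  using f g by (simp add: bx_def acomp_assoc interchange)
 also have "\<dots> = abr C (tgt f) (tgt g) ** (f \<otimes>\<^sub>a g) ** (gr (ev \<phi>) (src f) \<lhd> src g)"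
  using f g by (simp add: grading_natural interchange)
 also have "\<dots> = (g \<otimes>\<^sub>a f) ** bx \<phi> (src f) (src g)"
  using f g by (simp add: bx_def reassoc[OF abr_natural] acomp_assoc)
 finally show ?thesis .
qed

text \<open>The half braiding axiom: the second hexagon of the braiding, with the gradings of
  \<open>U\<close> and \<open>V\<close> carried to their factors by naturality. The grading of the
  product splits because \<open>\<phi>\<close> is multiplicative.\<close>

lemma bx_aten_left:
 assumes [simp]: "U \<in> Ob C" "V \<in> Ob C" "X \<in> Ob C"
 shows "bx \<phi> (U \<boxtimes> V) X =
   aass C X U V ** (bx \<phi> U X \<lhd> V) ** ainv C (aass C U X V) ** (U \<rhd> bx \<phi> V X) ** aass C U V X"
proof -
 let ?u = "gr (ev \<phi>) U" and ?v = "gr (ev \<phi>) V"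
 have "bx \<phi> (U \<boxtimes> V) X = aass C X U V ** (abr C U X \<lhd> V) ** ainv C (aass C U X V) ** (U \<rhd> abr C V X) **
   aass C U V X ** ((?u \<otimes>\<^sub>a ?v) \<lhd> X)"
  by (simp add: bx_def grading_aten character_add a_hexagon2 acomp_assoc)
 also have "aass C U V X ** ((?u \<otimes>\<^sub>a ?v) \<lhd> X) = (?u \<otimes>\<^sub>a ?v \<lhd> X) ** aass C U V X"
  by (simp add: aass_natural)
 also have "(U \<rhd> abr C V X) ** (?u \<otimes>\<^sub>a ?v \<lhd> X) ** aass C U V X = (?u \<otimes>\<^sub>a idt C X \<otimes>\<^sub>a idt C V) ** (U \<rhd> bx \<phi> V X) ** aass C U V X"
  by (simp add: interchange' bx_def)
 also have "ainv C (aass C U X V) ** (?u \<otimes>\<^sub>a idt C X \<otimes>\<^sub>a idt C V) ** (U \<rhd> bx \<phi> V X) ** aass C U V X =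
   ((?u \<lhd> X) \<lhd> V) ** ainv C (aass C U X V) ** (U \<rhd> bx \<phi> V X) ** aass C U V X"
  by (simp add: reassoc[OF aass_natural_inv] acomp_assoc del: aten_idt)
 finally show ?thesis by (simp add: interchange' bx_def)
qed

text \<open>Half braidings twisted by \<open>\<phi>\<close> and \<open>\<psi>\<close> have a tensor
  product twisted by the sum: the grading for \<open>\<psi>\<close> is moved past the braiding with
  \<open>X\<close>. This makes the labels of the center add up.\<close>

lemma bx_aten_right:
 assumes [simp]: "U \<in> Ob C" "X \<in> Ob C" "Y \<in> Ob C"
 shows "aass C X Y U ** bx (\<phi> + \<psi>) U (X \<boxtimes> Y) ** aass C U X Y =
   (X \<rhd> bx \<psi> U Y) ** aass C X U Y ** (bx \<phi> U X \<lhd> Y)"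
proof -
 let ?u = "gr (ev \<phi>) U" and ?v = "gr (ev \<psi>) U"
 have uv: "gr (ev (\<phi> + \<psi>)) U = ?v ** ?u"
  unfolding plus_dual.rep_eq grading_mult[OF assms(1), symmetric] by (simp add: mult.commute)
 have "abr C U X ** ((?v ** ?u) \<lhd> X) = abr C U X ** (?v \<lhd> X) ** (?u \<lhd> X)"
  by (simp add: interchange)
 also have "\<dots> = (X \<rhd> ?v) ** bx \<phi> U X"
  by (simp add: bx_def reassoc[OF abr_natural] acomp_assoc)
 finally have abr: "abr C U X ** ((?v ** ?u) \<lhd> X) = (X \<rhd> ?v) ** bx \<phi> U X" .
 have "aass C X Y U ** bx (\<phi> + \<psi>) U (X \<boxtimes> Y) ** aass C U X Y =
   aass C X Y U ** abr C U (X \<boxtimes> Y) ** ((?v ** ?u) \<lhd> (X \<boxtimes> Y)) ** aass C U X Y"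
  by (simp add: bx_def uv acomp_assoc)
 also have "((?v ** ?u) \<lhd> (X \<boxtimes> Y)) ** aass C U X Y = aass C U X Y ** (((?v ** ?u) \<lhd> X) \<lhd> Y)"
  using aass_natural[of "?v ** ?u" "idt C X" "idt C Y"] by simp
 also have "aass C X Y U ** abr C U (X \<boxtimes> Y) ** aass C U X Y ** (((?v ** ?u) \<lhd> X) \<lhd> Y) =
   (X \<rhd> abr C U Y) ** aass C X U Y ** (abr C U X \<lhd> Y) ** (((?v ** ?u) \<lhd> X) \<lhd> Y)"
  using reassoc[OF a_hexagon1[of U X Y]] by (simp add: acomp_assoc)
 also have "(abr C U X \<lhd> Y) ** (((?v ** ?u) \<lhd> X) \<lhd> Y) = ((X \<rhd> ?v) \<lhd> Y) ** (bx \<phi> U X \<lhd> Y)"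
  by (simp add: interchange abr)
 also have "aass C X U Y ** ((X \<rhd> ?v) \<lhd> Y) ** (bx \<phi> U X \<lhd> Y) = (X \<rhd> (?v \<lhd> Y)) ** aass C X U Y ** (bx \<phi> U X \<lhd> Y)"
  by (simp add: reassoc[OF aass_natural] acomp_assoc)
 also have "(X \<rhd> abr C U Y) ** (X \<rhd> (?v \<lhd> Y)) ** aass C X U Y ** (bx \<phi> U X \<lhd> Y) =
   (X \<rhd> bx \<psi> U Y) ** aass C X U Y ** (bx \<phi> U X \<lhd> Y)"
  by (simp add: interchange' bx_def)
 finally show ?thesis .
qed

end

section \<open>Half braidings\<close>

definition hb :: "('o, 'm, 'k, 'z) btc_scheme => 'o \<times> ('o => 'm) => 'o => ('o, 'm) arrow" where
 "hb C x U = Arrow (U \<boxtimes>\<^bsub>C\<^esub> fst x) (snd x U) (fst x \<boxtimes>\<^bsub>C\<^esub> U)"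

text \<open>Restriction to \<open>Ob C\<close> supplies the extensionality demanded by
  \<open>half_braiding\<close>.\<close>

definition half_braided :: "('o, 'm, 'k, 'z) btc_scheme => 'o => ('o => ('o, 'm) arrow) => 'o \<times> ('o => 'm)" where
 "half_braided C X \<Gamma> = (X, \<lambda>U\<in>Ob C. mor (\<Gamma> U))"

definition HB :: "('o, 'm, 'k, 'z) btc_scheme => 'o \<times> ('o => 'm) => bool" where
 "HB C x \<longleftrightarrow> half_braiding C (fst x) (snd x)"

lemma hb_ends [simp]: "src (hb C x U) = U \<boxtimes>\<^bsub>C\<^esub> fst x" "tgt (hb C x U) = fst x \<boxtimes>\<^bsub>C\<^esub> U" "mor (hb C x U) = snd x U"
 by (simp_all add: hb_def)

lemma half_braided_simps [simp]: "fst (half_braided C X \<Gamma>) = X" "snd (half_braided C X \<Gamma>) \<in> extensional (Ob C)"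
 by (simp_all add: half_braided_def)

context braided_monoidal_category
begin

lemma hb_half_braided: "U \<in> Ob C ==> valid C (\<Gamma> U) ==> src (\<Gamma> U) = U \<boxtimes> X ==> tgt (\<Gamma> U) = X \<boxtimes> U ==>
  hb C (half_braided C X \<Gamma>) U = \<Gamma> U"
 using Arrow_mor[of "\<Gamma> U"] by (simp add: hb_def half_braided_def)

lemma HB_Ob [simp]: "HB C x ==> fst x \<in> Ob C"
 by (simp add: HB_def half_braiding_def)

lemma HB_aiso [simp]: "HB C x ==> U \<in> Ob C ==> aiso C (hb C x U)"
 by (simp add: HB_def half_braiding_def hb_def Iso_iff)

lemma HB_valid [simp]: "HB C x ==> U \<in> Ob C ==> valid C (hb C x U)"
 by simp

lemma hb_natural:
 assumes x: "HB C x" and f: "valid C f"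
 shows "hb C x (tgt f) ** (f \<lhd> fst x) = (fst x \<rhd> f) ** hb C x (src f)"
proof (rule arrow_eqI)
 have "snd x (tgt f) \<cdot> (mor f \<odot> Id C (fst x)) = (Id C (fst x) \<odot> mor f) \<cdot> snd x (src f)"
  using x mor_in_Hom[OF f] unfolding HB_def half_braiding_def by blast
 then show "mor (hb C x (tgt f) ** (f \<lhd> fst x)) = mor ((fst x \<rhd> f) ** hb C x (src f))"
  using x f by (simp add: mor_acomp mor_aten mor_idt)
qed (use x f in simp_all)

lemma hb_aten:
 assumes x: "HB C x" and [simp]: "U \<in> Ob C" "V \<in> Ob C"
 shows "hb C x (U \<boxtimes> V) = aass C (fst x) U V ** (hb C x U \<lhd> V) ** ainv C (aass C U (fst x) V) **
  (U \<rhd> hb C x V) ** aass C U V (fst x)"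
proof (rule arrow_eqI)
 have "snd x (U \<boxtimes> V) = Assoc C (fst x) U V \<cdot> (snd x U \<odot> Id C V) \<cdot>
   Inv C ((U \<boxtimes> fst x) \<boxtimes> V) (U \<boxtimes> fst x \<boxtimes> V) (Assoc C U (fst x) V) \<cdot> (Id C U \<odot> snd x V) \<cdot> Assoc C U V (fst x)"
  using x assms(2,3) unfolding HB_def half_braiding_def by blast
 then show "mor (hb C x (U \<boxtimes> V)) = mor (aass C (fst x) U V ** (hb C x U \<lhd> V) ** ainv C (aass C U (fst x) V) **
   (U \<rhd> hb C x V) ** aass C U V (fst x))"
  using x by (simp add: mor_acomp mor_aten mor_idt mor_struct mor_ainv_aass)
qed (use x in simp_all)

lemma HB_I:
 assumes X: "fst x \<in> Ob C" and ext: "snd x \<in> extensional (Ob C)" and iso: "!!U. U \<in> Ob C ==> aiso C (hb C x U)"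
  and nat: "!!f. valid C f ==> hb C x (tgt f) ** (f \<lhd> fst x) = (fst x \<rhd> f) ** hb C x (src f)"
  and ten: "!!U V. U \<in> Ob C ==> V \<in> Ob C ==> hb C x (U \<boxtimes> V) = aass C (fst x) U V ** (hb C x U \<lhd> V) **
   ainv C (aass C U (fst x) V) ** (U \<rhd> hb C x V) ** aass C U V (fst x)"
 shows "HB C x"
 unfolding HB_def half_braiding_def
proof (intro conjI ballI allI)
 show "snd x U \<in> Iso C (U \<boxtimes> fst x) (fst x \<boxtimes> U)" if "U \<in> Ob C" for U
  using iso[OF that] by (simp add: Iso_iff hb_def)
 show "snd x V \<cdot> (f \<odot> Id C (fst x)) = (Id C (fst x) \<odot> f) \<cdot> snd x U" if f: "f \<in> Hom C U V" for U V f
  using arg_cong[OF nat[of "Arrow U f V"], of mor] f Hom_Ob[OF f] X iso[of U] iso[of V]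
  by (simp add: mor_acomp mor_aten mor_idt)
 show "snd x (U \<boxtimes> V) = Assoc C (fst x) U V \<cdot> (snd x U \<odot> Id C V) \<cdot>
   Inv C ((U \<boxtimes> fst x) \<boxtimes> V) (U \<boxtimes> fst x \<boxtimes> V) (Assoc C U (fst x) V) \<cdot> (Id C U \<odot> snd x V) \<cdot> Assoc C U V (fst x)"
  if UV: "U \<in> Ob C" "V \<in> Ob C" for U V
  using arg_cong[OF ten[OF UV], of mor] UV X iso[of U] iso[of V]
  by (simp add: mor_acomp mor_aten mor_idt mor_struct mor_ainv_aass)
qed (use X ext in simp_all)

lemma lwhisk_covers:
 assumes "U \<in> Ob C" "covers C X G"
 shows "covers C (U \<boxtimes> X) {U \<rhd> g | g. g \<in> G \<and> valid C g \<and> tgt g = X}"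
 by (rule covers_mono[OF covers_aten[OF covers_idt[of U "{idt C U}"] assms(2)]]) (use assms(1) in auto)

text \<open>Morphisms of the center, kept as arrows of \<open>C\<close>: calculations stay in
  \<open>C\<close>, and \<open>lift\<close> carries the results over to the center.\<close>

definition cmor :: "'o \<times> ('o => 'm) => 'o \<times> ('o => 'm) => ('o, 'm) arrow => bool" where
 "cmor x y f \<longleftrightarrow> HB C x \<and> HB C y \<and> valid C f \<and> src f = fst x \<and> tgt f = fst y \<and>
   (\<forall>U\<in>Ob C. (f \<lhd> U) ** hb C x U = hb C y U ** (U \<rhd> f))"

lemma cmorD:
 assumes "cmor x y f"
 shows "HB C x" "HB C y" "valid C f" "src f = fst x" "tgt f = fst y"
  "!!U. U \<in> Ob C ==> (f \<lhd> U) ** hb C x U = hb C y U ** (U \<rhd> f)"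
 using assms by (simp_all add: cmor_def)

lemma cmor_idt: "HB C x ==> cmor x x (idt C (fst x))"
 by (simp add: cmor_def)

lemma cmor_acomp:
 assumes f: "cmor x y f" and g: "cmor y z g"
 shows "cmor x z (g ** f)"
 unfolding cmor_def
proof (intro conjI ballI)
 note fD = cmorD[OF f] and gD = cmorD[OF g]
 fix U assume U: "U \<in> Ob C"
 have "((g ** f) \<lhd> U) ** hb C x U = (g \<lhd> U) ** (f \<lhd> U) ** hb C x U"
  using fD(3-5) gD(3-5) U by (simp add: interchange')
 also have "\<dots> = (g \<lhd> U) ** hb C y U ** (U \<rhd> f)" by (simp only: fD(6)[OF U])
 also have "\<dots> = (hb C z U ** (U \<rhd> g)) ** (U \<rhd> f)" by (simp only: gD(6)[OF U] flip: acomp_assoc)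
 also have "\<dots> = hb C z U ** (U \<rhd> (g ** f))"
  using fD(3-5) gD(3-5) U by (simp add: interchange acomp_assoc)
 finally show "((g ** f) \<lhd> U) ** hb C x U = hb C z U ** (U \<rhd> (g ** f))" .
qed (use cmorD[OF f] cmorD[OF g] in simp_all)

lemma cmor_azero: "HB C x ==> HB C y ==> cmor x y (azero C (fst x) (fst y))"
 by (simp add: cmor_def)

lemma cmor_aadd: "cmor x y f ==> cmor x y g ==> cmor x y (f \<boxplus> g)"
 by (simp add: cmor_def aadd_aten aten_aadd aadd_acomp acomp_aadd)

lemma cmor_asmult: "cmor x y f ==> cmor x y (c \<odot>\<^sub>s f)"
 by (simp add: cmor_def)

lemma cmor_ainv:
 assumes f: "cmor x y f" and iso: "aiso C f"
 shows "cmor y x (ainv C f)"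
 unfolding cmor_def
proof (intro conjI ballI)
 note fD = cmorD[OF f]
 fix U assume U: "U \<in> Ob C"
 show "(ainv C f \<lhd> U) ** hb C y U = hb C x U ** (U \<rhd> ainv C f)"
 proof (rule aiso_epic[of "U \<rhd> f"])
  have "((ainv C f \<lhd> U) ** hb C y U) ** (U \<rhd> f) = (ainv C f \<lhd> U) ** (f \<lhd> U) ** hb C x U"
   by (simp only: fD(6)[OF U] acomp_assoc)
  also have "\<dots> = hb C x U" using fD(1-5) iso U by (simp add: interchange')
  also have "\<dots> = (hb C x U ** (U \<rhd> ainv C f)) ** (U \<rhd> f)"
   using fD(1-5) iso U by (simp add: interchange acomp_assoc)
  finally show "((ainv C f \<lhd> U) ** hb C y U) ** (U \<rhd> f) = (hb C x U ** (U \<rhd> ainv C f)) ** (U \<rhd> f)" .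
 qed (use fD(1-5) iso U in simp_all)
qed (use cmorD[OF f] iso in simp_all)

end

context pointed_family
begin

text \<open>\<open>cen x \<phi> g\<close> says that \<open>g\<close> is a morphism of half braidings from \<open>bx \<phi>\<close> on its source to \<open>x\<close>, except that
 \<open>x\<close> need not be known to be a half braiding.\<close>

definition cen :: "'o \<times> ('o => 'm) => ('b, 'k) dual => ('o, 'm) arrow => bool" where
 "cen x \<phi> g \<longleftrightarrow> valid C g \<and> tgt g = fst x \<and>
   (\<forall>U\<in>Ob C. hb C x U ** (U \<rhd> g) = (g \<lhd> U) ** bx \<phi> U (src g))"

lemma cenD: "cen x \<phi> g ==> valid C g" "cen x \<phi> g ==> tgt g = fst x"
 "cen x \<phi> g ==> U \<in> Ob C ==> hb C x U ** (U \<rhd> g) = (g \<lhd> U) ** bx \<phi> U (src g)"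
 by (simp_all add: cen_def)

lemma cen_acomp:
 assumes g: "cen x \<phi> g" and p: "valid C p" "tgt p = src g"
 shows "cen x \<phi> (g ** p)"
 unfolding cen_def
proof (intro conjI ballI)
 note gD = cenD(1,2)[OF g]
 fix U assume U: "U \<in> Ob C"
 have "hb C x U ** (U \<rhd> (g ** p)) = hb C x U ** (U \<rhd> g) ** (U \<rhd> p)"
  using gD p U by (simp add: interchange)
 also have "\<dots> = (g \<lhd> U) ** bx \<phi> U (src g) ** (U \<rhd> p)" by (simp add: reassoc[OF cenD(3)[OF g U]] acomp_assoc)
 also have "bx \<phi> U (src g) ** (U \<rhd> p) = (p \<lhd> U) ** bx \<phi> U (src p)"
  using bx_natural[of "idt C U" p \<phi>] U p by simp
 also have "(g \<lhd> U) ** (p \<lhd> U) ** bx \<phi> U (src p) = ((g ** p) \<lhd> U) ** bx \<phi> U (src (g ** p))"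
  using gD p U by (simp add: interchange')
 finally show "hb C x U ** (U \<rhd> (g ** p)) = ((g ** p) \<lhd> U) ** bx \<phi> U (src (g ** p))" .
qed (use cenD(1,2)[OF g] p in simp_all)

lemma cen_cmor:
 assumes f: "cmor x y f" and g: "cen x \<phi> g"
 shows "cen y \<phi> (f ** g)"
 unfolding cen_def
proof (intro conjI ballI)
 note fD = cmorD[OF f] and gD = cenD(1,2)[OF g]
 fix U assume U: "U \<in> Ob C"
 have "hb C y U ** (U \<rhd> (f ** g)) = hb C y U ** (U \<rhd> f) ** (U \<rhd> g)"
  using fD(3-5) gD U by (simp add: interchange)
 also have "\<dots> = (f \<lhd> U) ** hb C x U ** (U \<rhd> g)"
  by (simp add: fD(6)[OF U] flip: acomp_assoc)
 also have "\<dots> = (f \<lhd> U) ** (g \<lhd> U) ** bx \<phi> U (src g)" by (simp only: cenD(3)[OF g U])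
 also have "\<dots> = ((f ** g) \<lhd> U) ** bx \<phi> U (src (f ** g))"
  using fD(3-5) gD U by (simp add: interchange')
 finally show "hb C y U ** (U \<rhd> (f ** g)) = ((f ** g) \<lhd> U) ** bx \<phi> U (src (f ** g))" .
qed (use cmorD[OF f] cenD(1,2)[OF g] in simp_all)

text \<open>Compatibility with the half braidings is tested on a cover by arrows along which both
  half braidings become the same twisted braiding.\<close>

lemma cmorI:
 assumes x: "HB C x" and y: "HB C y" and f: "valid C f" "src f = fst x" "tgt f = fst y"
  and cov: "covers C (fst x) G"
  and gen: "!!g. g \<in> G ==> valid C g ==> tgt g = fst x ==> \<exists>\<phi>. cen x \<phi> g \<and> cen y \<phi> (f ** g)"
 shows "cmor x y f"
 unfolding cmor_def
proof (intro conjI ballI)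
 fix U assume U: "U \<in> Ob C"
 show "(f \<lhd> U) ** hb C x U = hb C y U ** (U \<rhd> f)"
 proof (rule covers_eqI[OF lwhisk_covers[OF U cov]])
  fix h assume "h \<in> {U \<rhd> g | g. g \<in> G \<and> valid C g \<and> tgt g = fst x}"
  then obtain g \<phi> where h: "h = U \<rhd> g" and g: "valid C g" "tgt g = fst x" "cen x \<phi> g" "cen y \<phi> (f ** g)"
   using gen by blast
  have "((f \<lhd> U) ** hb C x U) ** h = (f \<lhd> U) ** (g \<lhd> U) ** bx \<phi> U (src g)"
   by (simp only: h acomp_assoc cenD(3)[OF g(3) U])
  also have "\<dots> = ((f ** g) \<lhd> U) ** bx \<phi> U (src (f ** g))" using f g U by (simp add: interchange')
  also have "\<dots> = hb C y U ** (U \<rhd> (f ** g))" by (simp only: cenD(3)[OF g(4) U])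
  also have "\<dots> = (hb C y U ** (U \<rhd> f)) ** h" using f g U by (simp add: h interchange acomp_assoc)
  finally show "((f \<lhd> U) ** hb C x U) ** h = (hb C y U ** (U \<rhd> f)) ** h" .
 qed (use x y f U in simp_all)
qed (use assms in simp_all)

text \<open>A candidate that agrees with twisted braidings along a cover inherits naturality and
  multiplicativity from \<open>bx\<close>. The half braidings constructed later, on tensor products,
  direct sums and units, are verified in this way.\<close>

lemma HB_if_generated:
 assumes X: "fst x \<in> Ob C" and ext: "snd x \<in> extensional (Ob C)" and iso: "!!U. U \<in> Ob C ==> aiso C (hb C x U)"
  and cov: "covers C (fst x) {g. \<exists>\<phi>. cen x \<phi> g}"
 shows "HB C x"
proof (rule HB_I[OF X ext iso])
 note [simp] = X iso
 have v [simp]: "valid C (hb C x U)" if "U \<in> Ob C" for U using iso[OF that] by simp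
 fix f assume f: "valid C f"
 show "hb C x (tgt f) ** (f \<lhd> fst x) = (fst x \<rhd> f) ** hb C x (src f)"
 proof (rule covers_eqI[OF lwhisk_covers[OF _ cov]])
  fix h assume "h \<in> {src f \<rhd> g | g. g \<in> {g. \<exists>\<phi>. cen x \<phi> g} \<and> valid C g \<and> tgt g = fst x}"
  then obtain g \<phi> where h: "h = src f \<rhd> g" and g: "cen x \<phi> g" "valid C g" "tgt g = fst x" by blast
  have "(hb C x (tgt f) ** (f \<lhd> fst x)) ** h = hb C x (tgt f) ** (tgt f \<rhd> g) ** (f \<lhd> src g)"
   using f g by (simp add: h interchange acomp_assoc)
  also have "\<dots> = (g \<lhd> tgt f) ** bx \<phi> (tgt f) (src g) ** (f \<lhd> src g)"
   using f by (simp add: reassoc[OF cenD(3)[OF g(1)]] acomp_assoc)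
  also have "bx \<phi> (tgt f) (src g) ** (f \<lhd> src g) = (src g \<rhd> f) ** bx \<phi> (src f) (src g)"
   using bx_natural[of f "idt C (src g)"] f g by simp
  also have "(g \<lhd> tgt f) ** (src g \<rhd> f) ** bx \<phi> (src f) (src g) = (fst x \<rhd> f) ** (g \<lhd> src f) ** bx \<phi> (src f) (src g)"
   using f g by (simp add: interchange')
  also have "\<dots> = ((fst x \<rhd> f) ** hb C x (src f)) ** h"
   using f by (simp add: h cenD(3)[OF g(1)] acomp_assoc)
  finally show "(hb C x (tgt f) ** (f \<lhd> fst x)) ** h = ((fst x \<rhd> f) ** hb C x (src f)) ** h" .
 qed (use f in simp_all)
next
 note [simp] = X iso
 have v [simp]: "valid C (hb C x U)" if "U \<in> Ob C" for U using iso[OF that] by simp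
 fix U V assume UV [simp]: "U \<in> Ob C" "V \<in> Ob C"
 let ?R = "aass C (fst x) U V ** (hb C x U \<lhd> V) ** ainv C (aass C U (fst x) V) ** (U \<rhd> hb C x V) ** aass C U V (fst x)"
 show "hb C x (U \<boxtimes> V) = ?R"
 proof (rule covers_eqI[OF lwhisk_covers[OF _ cov]])
  fix h assume "h \<in> {(U \<boxtimes> V) \<rhd> g | g. g \<in> {g. \<exists>\<phi>. cen x \<phi> g} \<and> valid C g \<and> tgt g = fst x}"
  then obtain g \<phi> where h: "h = (U \<boxtimes> V) \<rhd> g" and c: "cen x \<phi> g" and g: "valid C g" "tgt g = fst x" by blast
  let ?W = "src g"
  have "?R ** h = aass C (fst x) U V ** (hb C x U \<lhd> V) ** ainv C (aass C U (fst x) V) ** (U \<rhd> hb C x V) **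
    aass C U V (fst x) ** ((U \<boxtimes> V) \<rhd> g)" by (simp add: h acomp_assoc)
  also have "aass C U V (fst x) ** ((U \<boxtimes> V) \<rhd> g) = (U \<rhd> (V \<rhd> g)) ** aass C U V ?W"
   using aass_natural[of "idt C U" "idt C V" g U V "fst x"] g by simp
  also have "(U \<rhd> hb C x V) ** (U \<rhd> (V \<rhd> g)) ** aass C U V ?W = (U \<rhd> (g \<lhd> V)) ** (U \<rhd> bx \<phi> V ?W) ** aass C U V ?W"
   using g by (simp add: interchange' cenD(3)[OF c])
  also have "ainv C (aass C U (fst x) V) ** (U \<rhd> (g \<lhd> V)) ** (U \<rhd> bx \<phi> V ?W) ** aass C U V ?W =
    ((U \<rhd> g) \<lhd> V) ** ainv C (aass C U ?W V) ** (U \<rhd> bx \<phi> V ?W) ** aass C U V ?W"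
   using g by (simp add: reassoc[OF aass_natural_inv] acomp_assoc)
  also have "(hb C x U \<lhd> V) ** ((U \<rhd> g) \<lhd> V) ** ainv C (aass C U ?W V) ** (U \<rhd> bx \<phi> V ?W) ** aass C U V ?W =
    ((g \<lhd> U) \<lhd> V) ** (bx \<phi> U ?W \<lhd> V) ** ainv C (aass C U ?W V) ** (U \<rhd> bx \<phi> V ?W) ** aass C U V ?W"
   using g by (simp add: interchange' cenD(3)[OF c])
  also have "aass C (fst x) U V ** ((g \<lhd> U) \<lhd> V) ** (bx \<phi> U ?W \<lhd> V) ** ainv C (aass C U ?W V) ** (U \<rhd> bx \<phi> V ?W) ** aass C U V ?W
    = (g \<lhd> (U \<boxtimes> V)) ** aass C ?W U V ** (bx \<phi> U ?W \<lhd> V) ** ainv C (aass C U ?W V) ** (U \<rhd> bx \<phi> V ?W) ** aass C U V ?W"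
   using g reassoc[OF aass_natural[of g "idt C U" "idt C V" "fst x" U V]] by (simp add: acomp_assoc)
  also have "\<dots> = (g \<lhd> (U \<boxtimes> V)) ** bx \<phi> (U \<boxtimes> V) ?W" using g by (simp add: bx_aten_left)
  also have "\<dots> = hb C x (U \<boxtimes> V) ** h" by (simp add: h cenD(3)[OF c])
  finally show "hb C x (U \<boxtimes> V) ** h = ?R ** h" by (rule sym)
 qed simp_all
qed

text \<open>It suffices to test at the objects \<open>S b\<close>: both sides are natural in
  \<open>U\<close>, and every \<open>U\<close> is covered by arrows from these objects.\<close>

lemma cenI_S:
 assumes x: "HB C x" and g: "valid C g" "tgt g = fst x"
  and S: "!!b. hb C x (S b) ** (S b \<rhd> g) = ev \<phi> b \<odot>\<^sub>s ((g \<lhd> S b) ** abr C (S b) (src g))"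
 shows "cen x \<phi> g"
 unfolding cen_def
proof (intro conjI ballI)
 fix U assume U: "U \<in> Ob C"
 show "hb C x U ** (U \<rhd> g) = (g \<lhd> U) ** bx \<phi> U (src g)"
 proof (rule covers_eqI[OF covers_aten[OF S_covers[OF U] covers_idt[of "src g" "{idt C (src g)}"]]])
  fix h assume "h \<in> {s \<otimes>\<^sub>a i | s i. s \<in> Sg \<and> i \<in> {idt C (src g)} \<and> valid C s \<and> valid C i \<and> tgt s = U \<and> tgt i = src g}"
  then obtain s b where h: "h = s \<lhd> src g" and s: "valid C s" "src s = S b" "tgt s = U" by blast
  have "(hb C x U ** (U \<rhd> g)) ** h = (hb C x (tgt s) ** (s \<lhd> fst x)) ** (S b \<rhd> g)"
   using s g x by (simp add: h interchange acomp_assoc)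
  also have "\<dots> = (fst x \<rhd> s) ** hb C x (S b) ** (S b \<rhd> g)" by (simp only: hb_natural[OF x s(1)] s(2) acomp_assoc)
  also have "\<dots> = (fst x \<rhd> s) ** (g \<lhd> S b) ** bx \<phi> (S b) (src g)" using g by (simp add: S bx_S)
  also have "\<dots> = (g \<lhd> U) ** (src g \<rhd> s) ** bx \<phi> (S b) (src g)" using s g x by (simp add: interchange')
  also have "(src g \<rhd> s) ** bx \<phi> (S b) (src g) = bx \<phi> U (src g) ** h"
   using bx_natural[of s "idt C (src g)" \<phi>] s g by (simp add: h)
  finally show "(hb C x U ** (U \<rhd> g)) ** h = ((g \<lhd> U) ** bx \<phi> U (src g)) ** h" by (simp add: acomp_assoc)
 qed (use x g U in simp_all)
qed (use g in simp_all)

text \<open>\<open>S (- b)\<close> is a tensor inverse of \<open>S b\<close>. Hence tensoring with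
  \<open>S b\<close> is faithful, and full on endomorphisms, as the next two lemmas
  conclude.\<close>

lemma ex_lwhisk_S_inverse:
 obtains \<rho> where "!!X. X \<in> Ob C ==> aiso C (\<rho> X)" "!!X. X \<in> Ob C ==> src (\<rho> X) = S (- b) \<boxtimes> S b \<boxtimes> X"
  "!!X. X \<in> Ob C ==> tgt (\<rho> X) = X"
  "!!t. valid C t ==> t ** \<rho> (src t) = \<rho> (tgt t) ** (S (- b) \<rhd> (S b \<rhd> t))"
proof -
 have "isomorphic C (S (- b) \<boxtimes> S b) (Unit C)"
  using isomorphic_trans[OF S_mult[of "- b" b]] isomorphic_sym[OF S_unit] by simp
 then obtain \<epsilon> where \<epsilon>: "aiso C \<epsilon>" "src \<epsilon> = S (- b) \<boxtimes> S b" "tgt \<epsilon> = Unit C"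
  unfolding isomorphic_iff by blast
 define \<rho> where "\<rho> X = alu C X ** (\<epsilon> \<lhd> X) ** ainv C (aass C (S (- b)) (S b) X)" for X
 show thesis
 proof
  show "t ** \<rho> (src t) = \<rho> (tgt t) ** (S (- b) \<rhd> (S b \<rhd> t))" if t: "valid C t" for t
  proof -
   have "\<rho> (tgt t) ** (S (- b) \<rhd> (S b \<rhd> t)) =
     alu C (tgt t) ** (\<epsilon> \<lhd> tgt t) ** ((S (- b) \<boxtimes> S b) \<rhd> t) ** ainv C (aass C (S (- b)) (S b) (src t))"
    using aass_natural_inv[of "idt C (S (- b))" "idt C (S b)" t] t by (simp add: \<rho>_def acomp_assoc)
   also have "\<dots> = alu C (tgt t) ** (Unit C \<rhd> t) ** (\<epsilon> \<lhd> src t) ** ainv C (aass C (S (- b)) (S b) (src t))"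
    using t \<epsilon> by (simp add: interchange')
   also have "\<dots> = t ** \<rho> (src t)" using t by (simp add: \<rho>_def reassoc[OF alu_natural] acomp_assoc)
   finally show ?thesis ..
  qed
 qed (simp_all add: \<rho>_def \<epsilon>)
qed

lemma lwhisk_S_cancel:
 assumes "valid C f" "valid C g" "src f = src g" "tgt f = tgt g" "S b \<rhd> f = S b \<rhd> g"
 shows "f = g"
proof -
 obtain \<rho> where \<rho>: "!!X. X \<in> Ob C ==> aiso C (\<rho> X)" "!!X. X \<in> Ob C ==> src (\<rho> X) = S (- b) \<boxtimes> S b \<boxtimes> X"
  "!!X. X \<in> Ob C ==> tgt (\<rho> X) = X"
  "!!t. valid C t ==> t ** \<rho> (src t) = \<rho> (tgt t) ** (S (- b) \<rhd> (S b \<rhd> t))"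
  using ex_lwhisk_S_inverse[of b] by blast
 show ?thesis
 proof (rule aiso_epic[of "\<rho> (src f)"])
  show "f ** \<rho> (src f) = g ** \<rho> (src f)"
   using \<rho>(4)[OF assms(1)] \<rho>(4)[OF assms(2)] assms(3-5) by simp
 qed (use assms \<rho>(1-3) in auto)
qed

lemma lwhisk_S_full:
 assumes X: "X \<in> Ob C" and k: "valid C k" "src k = S b \<boxtimes> X" "tgt k = S b \<boxtimes> X"
 obtains t where "valid C t" "src t = X" "tgt t = X" "S b \<rhd> t = k"
proof -
 obtain \<rho> where \<rho>: "!!X. X \<in> Ob C ==> aiso C (\<rho> X)" "!!X. X \<in> Ob C ==> src (\<rho> X) = S (- b) \<boxtimes> S b \<boxtimes> X"
  "!!X. X \<in> Ob C ==> tgt (\<rho> X) = X"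
  "!!t. valid C t ==> t ** \<rho> (src t) = \<rho> (tgt t) ** (S (- b) \<rhd> (S b \<rhd> t))"
  using ex_lwhisk_S_inverse[of b] by blast
 note \<rho>X = \<rho>(1-3)[OF X]
 define t where "t = \<rho> X ** (S (- b) \<rhd> k) ** ainv C (\<rho> X)"
 have t: "valid C t" "src t = X" "tgt t = X" using \<rho>X k by (simp_all add: t_def)
 have "\<rho> X ** (S (- b) \<rhd> (S b \<rhd> t)) = t ** \<rho> X" using \<rho>(4)[OF t(1)] t by simp
 also have "\<dots> = \<rho> X ** (S (- b) \<rhd> k)" using \<rho>X k by (simp add: t_def acomp_assoc)
 finally have "S (- b) \<rhd> (S b \<rhd> t) = S (- b) \<rhd> k"
  by (rule aiso_monic[OF \<rho>X(1)]) (use \<rho>X t k in simp_all)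
 then have "S b \<rhd> t = k" by (rule lwhisk_S_cancel[rotated 4]) (use t k in simp_all)
 with t show thesis by (rule that)
qed

text \<open>The half braiding at \<open>S b\<close> differs from the braiding by an automorphism of
  \<open>S b \<boxtimes> fst x\<close>, which has the form \<open>S b \<rhd> T b\<close> because
  \<open>S b\<close> is invertible. Multiplicativity of both in \<open>S b\<close> makes
  \<open>T\<close> an action of the label group on the underlying object.\<close>

lemma HB_action:
 assumes x: "HB C x"
 obtains T where "!!b. valid C (T b)" "!!b. src (T b) = fst x" "!!b. tgt (T b) = fst x"
  "!!b. hb C x (S b) = abr C (S b) (fst x) ** (S b \<rhd> T b)"
  "!!b c. T (b + c) = T b ** T c" "T 0 = idt C (fst x)"
proof -
 let ?X = "fst x"
 have X [simp]: "?X \<in> Ob C" using x by simp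
 have "\<exists>t. valid C t \<and> src t = ?X \<and> tgt t = ?X \<and> hb C x (S b) = abr C (S b) ?X ** (S b \<rhd> t)" for b
 proof -
  obtain t where t: "valid C t" "src t = ?X" "tgt t = ?X" "S b \<rhd> t = ainv C (abr C (S b) ?X) ** hb C x (S b)"
   by (rule lwhisk_S_full[of ?X "ainv C (abr C (S b) ?X) ** hb C x (S b)" b]) (use x in simp_all)
  then show ?thesis using x by (intro exI[of _ t]) simp
 qed
 then obtain T where T: "!!b. valid C (T b)" "!!b. src (T b) = ?X" "!!b. tgt (T b) = ?X"
  "!!b. hb C x (S b) = abr C (S b) ?X ** (S b \<rhd> T b)" by metis
 have add: "T (b + c) = T b ** T c" for b c
 proof -
  obtain \<mu> where \<mu>: "aiso C \<mu>" "src \<mu> = S b \<boxtimes> S c" "tgt \<mu> = S (b + c)"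
   using S_mult[of b c] unfolding isomorphic_iff by blast
  let ?U = "S b" and ?V = "S c"
  have "hb C x (?U \<boxtimes> ?V) = aass C ?X ?U ?V ** (abr C ?U ?X \<lhd> ?V) ** ((?U \<rhd> T b) \<lhd> ?V) ** ainv C (aass C ?U ?X ?V) **
    (?U \<rhd> (abr C ?V ?X ** (?V \<rhd> T c))) ** aass C ?U ?V ?X"
   using T(1-3) by (simp add: hb_aten[OF x] T(4) interchange')
  also have "((?U \<rhd> T b) \<lhd> ?V) ** ainv C (aass C ?U ?X ?V) ** (?U \<rhd> (abr C ?V ?X ** (?V \<rhd> T c))) ** aass C ?U ?V ?X =
    ainv C (aass C ?U ?X ?V) ** (?U \<rhd> (T b \<lhd> ?V)) ** (?U \<rhd> (abr C ?V ?X ** (?V \<rhd> T c))) ** aass C ?U ?V ?X"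
   using reassoc[OF aass_natural_inv[of "idt C ?U" "T b" "idt C ?V" ?U ?X ?V]] T(1-3) by (simp add: acomp_assoc)
  also have "(?U \<rhd> (T b \<lhd> ?V)) ** (?U \<rhd> (abr C ?V ?X ** (?V \<rhd> T c))) ** aass C ?U ?V ?X =
    (?U \<rhd> (abr C ?V ?X ** (?V \<rhd> (T b ** T c)))) ** aass C ?U ?V ?X"
  proof -
   have "(T b \<lhd> ?V) ** abr C ?V ?X ** (?V \<rhd> T c) = abr C ?V ?X ** (?V \<rhd> T b) ** (?V \<rhd> T c)"
    using reassoc[OF abr_natural[of "idt C ?V" "T b" ?V ?X]] T(1-3) by (simp add: acomp_assoc)
   then show ?thesis using T(1-3) by (simp add: interchange interchange')
  qed
  also have "\<dots> = (?U \<rhd> abr C ?V ?X) ** aass C ?U ?V ?X ** ((?U \<boxtimes> ?V) \<rhd> (T b ** T c))"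
   using aass_natural[of "idt C ?U" "idt C ?V" "T b ** T c" ?U ?V ?X] T(1-3) by (simp add: interchange')
  finally have 1: "hb C x (?U \<boxtimes> ?V) = abr C (?U \<boxtimes> ?V) ?X ** ((?U \<boxtimes> ?V) \<rhd> (T b ** T c))"
   by (simp add: a_hexagon2 acomp_assoc)
  have "abr C (S (b + c)) ?X ** (S (b + c) \<rhd> T (b + c)) ** (\<mu> \<lhd> ?X) = hb C x (tgt \<mu>) ** (\<mu> \<lhd> ?X)"
   by (simp add: \<mu> T(4) acomp_assoc)
  also have "\<dots> = (?X \<rhd> \<mu>) ** hb C x (src \<mu>)" by (rule hb_natural[OF x]) (use \<mu> in simp)
  also have "\<dots> = (?X \<rhd> \<mu>) ** abr C (?U \<boxtimes> ?V) ?X ** ((?U \<boxtimes> ?V) \<rhd> (T b ** T c))" by (simp only: \<mu> 1)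
  also have "\<dots> = abr C (S (b + c)) ?X ** (\<mu> \<lhd> ?X) ** ((?U \<boxtimes> ?V) \<rhd> (T b ** T c))"
   using reassoc[OF abr_natural[of \<mu> "idt C ?X" "S (b + c)" ?X]] \<mu> by (simp add: acomp_assoc)
  also have "\<dots> = abr C (S (b + c)) ?X ** (S (b + c) \<rhd> (T b ** T c)) ** (\<mu> \<lhd> ?X)"
   using \<mu> T(1-3) by (simp add: interchange)
  finally have "(S (b + c) \<rhd> T (b + c)) ** (\<mu> \<lhd> ?X) = (S (b + c) \<rhd> (T b ** T c)) ** (\<mu> \<lhd> ?X)"
   by (rule aiso_monic[rotated]) (use \<mu> T(1-3) in simp_all)
  then have "S (b + c) \<rhd> T (b + c) = S (b + c) \<rhd> (T b ** T c)"
   by (rule aiso_epic[rotated]) (use \<mu> T(1-3) in simp_all)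
  then show ?thesis by (rule lwhisk_S_cancel[rotated 4]) (use T(1-3) in simp_all)
 qed
 \<comment> \<open>\<open>S 0 \<rhd> T 0\<close> is idempotent and invertible.\<close>
 have "T 0 = idt C ?X"
 proof (rule lwhisk_S_cancel[of _ _ 0])
  have iso: "aiso C (S 0 \<rhd> T 0)"
  proof -
   have "S 0 \<rhd> T 0 = ainv C (abr C (S 0) ?X) ** hb C x (S 0)" using T(1-3) by (simp add: T(4))
   then show ?thesis using x by simp
  qed
  have "(S 0 \<rhd> T 0) ** (S 0 \<rhd> T 0) = (S 0 \<rhd> T 0) ** (S 0 \<rhd> idt C ?X)"
   using add[of 0 0] T(1-3) by (simp add: interchange)
  then show "S 0 \<rhd> T 0 = S 0 \<rhd> idt C ?X"
   by (rule aiso_monic[OF iso]) (use T(1-3) in simp_all)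
 qed (use T(1-3) in simp_all)
 with T add show thesis by (rule that)
qed

end

section \<open>The center of a pointed category\<close>

locale pointed_center = pointed_family C S
 for C :: "('o, 'm, 'k::{alg_closed_field,field_char_0}) btc" (structure)
  and S :: "'a::{ab_group_add,finite} => 'o"
begin

text \<open>As in \<open>cenI_S\<close>, naturality in \<open>U\<close> reduces the condition to the
  objects \<open>S b\<close>.\<close>

lemma cmorI_S:
 assumes x: "HB C x" and y: "HB C y" and f: "valid C f" "src f = fst x" "tgt f = fst y"
  and S: "!!b. (f \<lhd> S b) ** hb C x (S b) = hb C y (S b) ** (S b \<rhd> f)"
 shows "cmor x y f"
 unfolding cmor_def
proof (intro conjI ballI)
 fix U assume U: "U \<in> Ob C"
 show "(f \<lhd> U) ** hb C x U = hb C y U ** (U \<rhd> f)"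
 proof (rule covers_eqI[OF covers_aten[OF S_covers[OF U] covers_idt[of "fst x" "{idt C (fst x)}"]]])
  fix h assume "h \<in> {s \<otimes>\<^sub>a i | s i. s \<in> Sg \<and> i \<in> {idt C (fst x)} \<and> valid C s \<and> valid C i \<and> tgt s = U \<and> tgt i = fst x}"
  then obtain s b where h: "h = s \<lhd> fst x" and s: "valid C s" "src s = S b" "tgt s = U" by blast
  have "((f \<lhd> U) ** hb C x U) ** h = (f \<lhd> U) ** (fst x \<rhd> s) ** hb C x (S b)"
   using hb_natural[OF x s(1)] by (simp add: h s acomp_assoc)
  also have "\<dots> = (fst y \<rhd> s) ** (f \<lhd> S b) ** hb C x (S b)"
   using f s y by (simp add: interchange')
  also have "\<dots> = ((fst y \<rhd> s) ** hb C y (src s)) ** (S b \<rhd> f)" by (simp only: S s(2) acomp_assoc)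
  also have "\<dots> = hb C y U ** (s \<lhd> fst y) ** (S b \<rhd> f)"
   by (simp only: hb_natural[OF y s(1), symmetric] s(3) acomp_assoc)
  also have "\<dots> = (hb C y U ** (U \<rhd> f)) ** h" using f s by (simp add: h interchange acomp_assoc)
  finally show "((f \<lhd> U) ** hb C x U) ** h = (hb C y U ** (U \<rhd> f)) ** h" .
 qed (use x y f U in simp_all)
qed (use assms in simp_all)

text \<open>The chosen representative for the label \<open>l\<close>, playing the role of
  \<open>S\<close> in the center.\<close>

definition pl :: "'a \<times> ('a, 'k) dual => 'o \<times> ('o => 'm)" where
 "pl l = half_braided C (S (fst l)) (\<lambda>U. bx (snd l) U (S (fst l)))"

lemma fst_pl [simp]: "fst (pl l) = S (fst l)"
 by (simp add: pl_def)

lemma hb_pl [simp]: "U \<in> Ob C ==> hb C (pl l) U = bx (snd l) U (S (fst l))"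
 by (simp add: pl_def hb_half_braided)

lemma cen_pl: "cen (pl l) (snd l) (idt C (S (fst l)))"
 by (simp add: cen_def)

lemma HB_pl [simp]: "HB C (pl l)"
proof (rule HB_if_generated)
 show "covers C (fst (pl l)) {g. \<exists>\<phi>. cen (pl l) \<phi> g}"
  by (rule covers_idt) (use cen_pl[of l] in auto)
qed (simp_all add: pl_def[of l, THEN arg_cong[of _ _ snd]])

text \<open>The character projections for the action from \<open>HB_action\<close>. On the piece cut
  out by \<open>e \<phi>\<close> the half braiding is the braiding twisted by \<open>\<phi>\<close>,
  so composites of \<open>e \<phi>\<close> with arrows to \<open>S a\<close> are morphisms of the
  center to \<open>pl (a, \<phi>)\<close>.\<close>

lemma HB_projections:
 assumes x: "HB C x"
 obtains e :: "('a, 'k) dual => ('o, 'm) arrow" and d where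
  "!!\<phi>. valid C (e \<phi>)" "!!\<phi>. src (e \<phi>) = fst x" "!!\<phi>. tgt (e \<phi>) = fst x"
  "!!\<phi>. cen x \<phi> (e \<phi>)"
  "!!\<phi> p a. valid C p ==> src p = fst x ==> tgt p = S a ==> cmor x (pl (a, \<phi>)) (p ** e \<phi>)"
  "!!\<phi>. e \<phi> = d \<odot>\<^sub>s (e \<phi> ** e \<phi>)"
  "!!K. azero C (fst x) (fst x) \<in> K ==> (!!f g. f \<in> K ==> g \<in> K ==> f \<boxplus> g \<in> K) ==> (!!\<phi>. e \<phi> \<in> K) ==> idt C (fst x) \<in> K"
proof -
 let ?X = "fst x"
 have X [simp]: "?X \<in> Ob C" using x by simp
 obtain T where T: "!!b. valid C (T b)" "!!b. src (T b) = ?X" "!!b. tgt (T b) = ?X"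
  "!!b. hb C x (S b) = abr C (S b) ?X ** (S b \<rhd> T b)"
  "!!b c. T (b + c) = T b ** T c" "T 0 = idt C ?X"
  by (rule HB_action[OF x]) blast
 obtain e :: "('a, 'k) dual => ('o, 'm) arrow" and d where
  e: "!!\<phi>. valid C (e \<phi>)" "!!\<phi>. src (e \<phi>) = ?X" "!!\<phi>. tgt (e \<phi>) = ?X"
  and Te: "!!\<phi> b. T b ** e \<phi> = ev \<phi> b \<odot>\<^sub>s e \<phi>" and eT: "!!\<phi> b. e \<phi> ** T b = ev \<phi> b \<odot>\<^sub>s e \<phi>"
  and ee: "!!\<phi>. e \<phi> = d \<odot>\<^sub>s (e \<phi> ** e \<phi>)"
  and K: "!!K. azero C ?X ?X \<in> K ==> (!!f g. f \<in> K ==> g \<in> K ==> f \<boxplus> g \<in> K) ==> (!!\<phi>. e \<phi> \<in> K) ==> idt C ?X \<in> K"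
  by (rule character_projections[OF linear_category_axioms X T(1,2,3,5,6)]) blast
 have cen: "cen x \<phi> (e \<phi>)" for \<phi>
 proof (rule cenI_S[OF x e(1,3)])
  fix b
  have "hb C x (S b) ** (S b \<rhd> e \<phi>) = ev \<phi> b \<odot>\<^sub>s (abr C (S b) ?X ** (S b \<rhd> e \<phi>))"
   using T(1-3) e by (simp add: T(4) acomp_assoc interchange Te)
  also have "abr C (S b) ?X ** (S b \<rhd> e \<phi>) = (e \<phi> \<lhd> S b) ** abr C (S b) (src (e \<phi>))"
   using abr_natural[of "idt C (S b)" "e \<phi>" "S b" ?X] e by simp
  finally show "hb C x (S b) ** (S b \<rhd> e \<phi>) = ev \<phi> b \<odot>\<^sub>s ((e \<phi> \<lhd> S b) ** abr C (S b) (src (e \<phi>)))" .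
 qed
 have "cmor x (pl (a, \<phi>)) (p ** e \<phi>)" if p: "valid C p" "src p = ?X" "tgt p = S a" for \<phi> p a
 proof (rule cmorI_S)
  fix b
  have "((p ** e \<phi>) \<lhd> S b) ** hb C x (S b) = (((p ** e \<phi>) \<lhd> S b) ** abr C (S b) ?X) ** (S b \<rhd> T b)"
   by (simp only: T(4) acomp_assoc)
  also have "((p ** e \<phi>) \<lhd> S b) ** abr C (S b) ?X = abr C (S b) (S a) ** (S b \<rhd> (p ** e \<phi>))"
   using abr_natural[of "idt C (S b)" "p ** e \<phi>" "S b" "S a"] e p by simp
  also have "(abr C (S b) (S a) ** (S b \<rhd> (p ** e \<phi>))) ** (S b \<rhd> T b) = hb C (pl (a, \<phi>)) (S b) ** (S b \<rhd> (p ** e \<phi>))"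
   using T(1-3) e p by (simp add: acomp_assoc interchange eT bx_S)
  finally show "((p ** e \<phi>) \<lhd> S b) ** hb C x (S b) = hb C (pl (a, \<phi>)) (S b) ** (S b \<rhd> (p ** e \<phi>))" .
 qed (use x e p in simp_all)
 from that[OF e cen this ee K] show thesis .
qed

text \<open>The projections belong to the span and add up to the identity. With this, every object
  of the center satisfies the covering hypothesis of \<open>cmorI\<close>.\<close>

lemma HB_generated:
 assumes x: "HB C x"
 shows "covers C (fst x) {g. \<exists>\<phi>. cen x \<phi> g}"
proof -
 let ?K = "Span C {g. \<exists>\<phi>. cen x \<phi> g} (fst x) (fst x)"
 obtain e where e: "!!\<phi>. valid C (e \<phi>)" "!!\<phi>. src (e \<phi>) = fst x" "!!\<phi>. tgt (e \<phi>) = fst x"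
  "!!\<phi>. cen x \<phi> (e \<phi>)"
  "!!K. azero C (fst x) (fst x) \<in> K ==> (!!f g. f \<in> K ==> g \<in> K ==> f \<boxplus> g \<in> K) ==> (!!\<phi>. e \<phi> \<in> K) ==> idt C (fst x) \<in> K"
  by (rule HB_projections[OF x]) blast
 have "idt C (fst x) \<in> ?K"
 proof (rule e(5))
  show "e \<phi> \<in> ?K" for \<phi>
   using Span_gen[of "e \<phi>" "{g. \<exists>\<phi>. cen x \<phi> g}"] e(1-3)[of \<phi>] e(4)[of \<phi>] by (metis mem_Collect_eq)
 qed (use x in \<open>auto intro: Span.zero Span.add\<close>)
 with x show ?thesis by (simp add: covers_def)
qed

definition hten :: "'o \<times> ('o => 'm) => 'o \<times> ('o => 'm) => 'o \<times> ('o => 'm)" where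
 "hten x y = (fst x \<boxtimes> fst y, half_braiding_tensor C (fst x) (snd x) (fst y) (snd y))"

lemma fst_hten [simp]: "fst (hten x y) = fst x \<boxtimes> fst y"
 by (simp add: hten_def)

lemma hb_hten:
 assumes x: "HB C x" and y: "HB C y" and [simp]: "U \<in> Ob C"
 shows "hb C (hten x y) U = ainv C (aass C (fst x) (fst y) U) ** (fst x \<rhd> hb C y U) ** aass C (fst x) U (fst y) **
   (hb C x U \<lhd> fst y) ** ainv C (aass C U (fst x) (fst y))" (is "_ = ?R")
proof -
 note [simp] = HB_Ob[OF x] HB_Ob[OF y] HB_valid[OF x] HB_valid[OF y]
 have R: "valid C ?R" "src ?R = U \<boxtimes> fst x \<boxtimes> fst y" "tgt ?R = (fst x \<boxtimes> fst y) \<boxtimes> U" by simp_all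
 have m: "snd (hten x y) U = mor ?R"
  by (simp add: hten_def half_braiding_tensor_def mor_acomp mor_aten mor_idt mor_struct mor_ainv_aass)
 have "hb C (hten x y) U = Arrow (src ?R) (mor ?R) (tgt ?R)"
  unfolding hb_def[of C "hten x y"] m R(2,3) fst_hten ..
 also have "\<dots> = ?R" by (rule Arrow_mor[OF R(1)])
 finally show ?thesis .
qed

text \<open>Along \<open>g\<close> and \<open>h\<close> the half braiding of the tensor product is
  assembled from two twisted braidings by \<open>bx_aten_right\<close>, so the characters
  add.\<close>

lemma cen_aten:
 assumes x: "HB C x" and y: "HB C y" and g: "cen x \<phi> g" and h: "cen y \<psi> h"
 shows "cen (hten x y) (\<phi> + \<psi>) (g \<otimes>\<^sub>a h)"
 unfolding cen_def
proof (intro conjI ballI)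
 note [simp] = HB_Ob[OF x] HB_Ob[OF y] HB_valid[OF x] HB_valid[OF y] cenD(1,2)[OF g] cenD(1,2)[OF h]
 fix U assume U [simp]: "U \<in> Ob C"
 let ?X = "fst x" and ?Y = "fst y" and ?W = "src g" and ?V = "src h"
 have "hb C (hten x y) U ** (U \<rhd> (g \<otimes>\<^sub>a h)) = ainv C (aass C ?X ?Y U) ** (?X \<rhd> hb C y U) ** aass C ?X U ?Y **
   (hb C x U \<lhd> ?Y) ** ((U \<rhd> g) \<otimes>\<^sub>a h) ** ainv C (aass C U ?W ?V)"
  by (simp add: hb_hten[OF x y] acomp_assoc aass_natural_inv)
 also have "(hb C x U \<lhd> ?Y) ** ((U \<rhd> g) \<otimes>\<^sub>a h) ** ainv C (aass C U ?W ?V) =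
   ((g \<lhd> U) \<otimes>\<^sub>a h) ** (bx \<phi> U ?W \<lhd> ?V) ** ainv C (aass C U ?W ?V)"
  by (simp add: interchange' cenD(3)[OF g])
 also have "aass C ?X U ?Y ** ((g \<lhd> U) \<otimes>\<^sub>a h) ** (bx \<phi> U ?W \<lhd> ?V) ** ainv C (aass C U ?W ?V) =
   (g \<otimes>\<^sub>a (U \<rhd> h)) ** aass C ?W U ?V ** (bx \<phi> U ?W \<lhd> ?V) ** ainv C (aass C U ?W ?V)"
  by (simp add: reassoc[OF aass_natural] acomp_assoc)
 also have "(?X \<rhd> hb C y U) ** (g \<otimes>\<^sub>a (U \<rhd> h)) ** aass C ?W U ?V ** (bx \<phi> U ?W \<lhd> ?V) ** ainv C (aass C U ?W ?V) =
   (g \<otimes>\<^sub>a (h \<lhd> U)) ** (?W \<rhd> bx \<psi> U ?V) ** aass C ?W U ?V ** (bx \<phi> U ?W \<lhd> ?V) ** ainv C (aass C U ?W ?V)"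
  by (simp add: interchange' cenD(3)[OF h])
 also have "\<dots> = (g \<otimes>\<^sub>a (h \<lhd> U)) ** ((?W \<rhd> bx \<psi> U ?V) ** aass C ?W U ?V ** (bx \<phi> U ?W \<lhd> ?V)) ** ainv C (aass C U ?W ?V)"
  by (simp only: acomp_assoc)
 also have "(?W \<rhd> bx \<psi> U ?V) ** aass C ?W U ?V ** (bx \<phi> U ?W \<lhd> ?V) = aass C ?W ?V U ** bx (\<phi> + \<psi>) U (?W \<boxtimes> ?V) ** aass C U ?W ?V"
  by (rule bx_aten_right[symmetric]) simp_all
 also have "(g \<otimes>\<^sub>a (h \<lhd> U)) ** (aass C ?W ?V U ** bx (\<phi> + \<psi>) U (?W \<boxtimes> ?V) ** aass C U ?W ?V) ** ainv C (aass C U ?W ?V) =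
   (g \<otimes>\<^sub>a (h \<lhd> U)) ** aass C ?W ?V U ** bx (\<phi> + \<psi>) U (?W \<boxtimes> ?V)"
  by (simp add: acomp_assoc)
 also have "ainv C (aass C ?X ?Y U) ** (g \<otimes>\<^sub>a (h \<lhd> U)) ** aass C ?W ?V U ** bx (\<phi> + \<psi>) U (?W \<boxtimes> ?V) =
   ((g \<otimes>\<^sub>a h) \<lhd> U) ** bx (\<phi> + \<psi>) U (src (g \<otimes>\<^sub>a h))"
  by (simp add: reassoc[OF aass_natural_inv] acomp_assoc)
 finally show "hb C (hten x y) U ** (U \<rhd> (g \<otimes>\<^sub>a h)) = ((g \<otimes>\<^sub>a h) \<lhd> U) ** bx (\<phi> + \<psi>) U (src (g \<otimes>\<^sub>a h))" .
qed (use cenD(1,2)[OF g] cenD(1,2)[OF h] in simp_all)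

lemma hten_generated:
 assumes x: "HB C x" and y: "HB C y"
 shows "covers C (fst x \<boxtimes> fst y) {g \<otimes>\<^sub>a h | g h. (\<exists>\<phi>. cen x \<phi> g) \<and> (\<exists>\<psi>. cen y \<psi> h)}"
 by (rule covers_mono[OF covers_aten[OF HB_generated[OF x] HB_generated[OF y]]]) blast

lemma HB_hten [simp]:
 assumes x: "HB C x" and y: "HB C y"
 shows "HB C (hten x y)"
proof (rule HB_if_generated)
 note [simp] = HB_Ob[OF x] HB_Ob[OF y] HB_aiso[OF x] HB_aiso[OF y]
 show "covers C (fst (hten x y)) {g. \<exists>\<phi>. cen (hten x y) \<phi> g}"
  unfolding fst_hten by (rule covers_mono[OF hten_generated[OF x y]]) (use cen_aten[OF x y] in blast)
 show "snd (hten x y) \<in> extensional (Ob C)" by (simp add: hten_def half_braiding_tensor_def)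
 show "aiso C (hb C (hten x y) U)" if "U \<in> Ob C" for U using that by (simp add: hb_hten[OF x y])
qed (use x y in simp)

lemma cmorI2:
 assumes x: "HB C x" and y: "HB C y" and z: "HB C z" and f: "valid C f" "src f = fst x \<boxtimes> fst y" "tgt f = fst z"
  and gen: "!!\<phi> \<psi> g h. cen x \<phi> g ==> cen y \<psi> h ==> cen z (\<phi> + \<psi>) (f ** (g \<otimes>\<^sub>a h))"
 shows "cmor (hten x y) z f"
proof (rule cmorI)
 fix k assume "k \<in> {g \<otimes>\<^sub>a h | g h. (\<exists>\<phi>. cen x \<phi> g) \<and> (\<exists>\<psi>. cen y \<psi> h)}"
 then obtain g h \<phi> \<psi> where k: "k = g \<otimes>\<^sub>a h" "cen x \<phi> g" "cen y \<psi> h" by blast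
 then show "\<exists>\<phi>. cen (hten x y) \<phi> k \<and> cen z \<phi> (f ** k)"
  using gen[OF k(2,3)] cen_aten[OF x y k(2,3)] by blast
qed (use hten_generated[OF x y] x y z f in simp_all)

lemma cmor_aten:
 assumes f: "cmor x x' f" and g: "cmor y y' g"
 shows "cmor (hten x y) (hten x' y') (f \<otimes>\<^sub>a g)"
proof (rule cmorI2)
 note fD = cmorD[OF f] and gD = cmorD[OF g]
 fix \<phi> \<psi> a b assume a: "cen x \<phi> a" and b: "cen y \<psi> b"
 have "(f \<otimes>\<^sub>a g) ** (a \<otimes>\<^sub>a b) = (f ** a) \<otimes>\<^sub>a (g ** b)"
  using fD(4) gD(4) cenD(2)[OF a] cenD(2)[OF b] by (simp add: interchange)
 then show "cen (hten x' y') (\<phi> + \<psi>) ((f \<otimes>\<^sub>a g) ** (a \<otimes>\<^sub>a b))"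
  using cen_aten[OF fD(2) gD(2) cen_cmor[OF f a] cen_cmor[OF g b]] by simp
qed (use cmorD(1-5)[OF f] cmorD(1-5)[OF g] in simp_all)

text \<open>The structure maps of the center are those of \<open>C\<close>. Here and in the
  following lemmas each is shown to be a morphism of the center by testing on generators, where
  naturality replaces it by a map between twisted braidings.\<close>

lemma cmor_aass:
 assumes x: "HB C x" and y: "HB C y" and z: "HB C z"
 shows "cmor (hten (hten x y) z) (hten x (hten y z)) (aass C (fst x) (fst y) (fst z))"
proof (rule cmorI)
 let ?G = "{(g \<otimes>\<^sub>a h) \<otimes>\<^sub>a k | g h k. (\<exists>\<phi>. cen x \<phi> g) \<and> (\<exists>\<psi>. cen y \<psi> h) \<and> (\<exists>\<rho>. cen z \<rho> k)}"
 show "covers C (fst (hten (hten x y) z)) ?G"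
  unfolding fst_hten by (rule covers_mono[OF covers_aten[OF hten_generated[OF x y] HB_generated[OF z]]]) blast
 fix u assume "u \<in> ?G"
 then obtain g h k \<phi> \<psi> \<rho> where u: "u = (g \<otimes>\<^sub>a h) \<otimes>\<^sub>a k" and g: "cen x \<phi> g" and h: "cen y \<psi> h" and k: "cen z \<rho> k"
  by blast
 note [simp] = cenD(1,2)[OF g] cenD(1,2)[OF h] cenD(1,2)[OF k]
 have "cen (hten (hten x y) z) ((\<phi> + \<psi>) + \<rho>) u"
  unfolding u by (intro cen_aten HB_hten x y z g h k)
 moreover have "cen (hten x (hten y z)) (\<phi> + (\<psi> + \<rho>)) ((g \<otimes>\<^sub>a h \<otimes>\<^sub>a k) ** aass C (src g) (src h) (src k))"
  by (intro cen_acomp cen_aten HB_hten x y z g h k) simp_all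
 then have "cen (hten x (hten y z)) ((\<phi> + \<psi>) + \<rho>) (aass C (fst x) (fst y) (fst z) ** u)"
  by (simp add: u aass_natural add.assoc)
 ultimately show "\<exists>\<phi>. cen (hten (hten x y) z) \<phi> u \<and> cen (hten x (hten y z)) \<phi> (aass C (fst x) (fst y) (fst z) ** u)"
  by blast
qed (use x y z in simp_all)

text \<open>Given by the braiding, hence twisted by the trivial character, which makes the tests on
  generators available for it.\<close>

definition hunit :: "'o \<times> ('o => 'm)" where
 "hunit = half_braided C (Unit C) (\<lambda>U. abr C U (Unit C))"

lemma fst_hunit [simp]: "fst hunit = Unit C"
 by (simp add: hunit_def)

lemma hb_hunit: "U \<in> Ob C ==> hb C hunit U = abr C U (Unit C)"
 by (simp add: hunit_def hb_half_braided)

lemma cen_hunit: "cen hunit 0 (idt C (Unit C))"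
 by (simp add: cen_def hb_hunit bx_0)

lemma HB_hunit [simp]: "HB C hunit"
proof (rule HB_if_generated)
 show "covers C (fst hunit) {g. \<exists>\<phi>. cen hunit \<phi> g}"
  by (rule covers_idt) (use cen_hunit in auto)
qed (simp_all add: hb_hunit hunit_def[THEN arg_cong[of _ _ snd]])

text \<open>The unit of the center is defined by unit isomorphisms, \<open>hunit\<close> by the
  braiding; \<open>alu_abr_Unit\<close> says that they agree.\<close>

lemma Unit_center: "Unit (center C) = hunit"
proof -
 have "Inv C (Unit C \<boxtimes> U) U (LUnit C U) \<cdot> RUnit C U = Braid C U (Unit C)" if U [simp]: "U \<in> Ob C" for U
 proof -
  have "ainv C (alu C U) ** aru C U = abr C U (Unit C)"
   using alu_abr_Unit[OF U, symmetric] by simp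
  from arg_cong[OF this, of mor] show ?thesis
   using Inv_eq[of "alu C U"] by (simp add: mor_acomp mor_struct)
 qed
 then show ?thesis
  by (auto simp: center_def hunit_def half_braided_def mor_struct fun_eq_iff restrict_def)
qed

lemma cmor_alu:
 assumes x: "HB C x"
 shows "cmor (hten hunit x) x (alu C (fst x))"
proof (rule cmorI)
 let ?G = "{Unit C \<rhd> g | g. (\<exists>\<phi>. cen x \<phi> g)}"
 show "covers C (fst (hten hunit x)) ?G"
  unfolding fst_hten fst_hunit by (rule covers_mono[OF lwhisk_covers[OF _ HB_generated[OF x]]]) auto
 fix u assume "u \<in> ?G"
 then obtain g \<phi> where u: "u = Unit C \<rhd> g" and g: "cen x \<phi> g" by blast
 have "cen x \<phi> (g ** alu C (src g))" by (rule cen_acomp[OF g]) (use cenD(1)[OF g] in simp_all)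
 then have "cen x \<phi> (alu C (fst x) ** u)" using alu_natural[OF cenD(1)[OF g]] cenD(2)[OF g] by (simp add: u)
 moreover have "cen (hten hunit x) \<phi> u" using cen_aten[OF HB_hunit x cen_hunit g] by (simp add: u)
 ultimately show "\<exists>\<phi>. cen (hten hunit x) \<phi> u \<and> cen x \<phi> (alu C (fst x) ** u)" by blast
qed (use x in simp_all)

lemma cmor_aru:
 assumes x: "HB C x"
 shows "cmor (hten x hunit) x (aru C (fst x))"
proof (rule cmorI)
 let ?G = "{g \<lhd> Unit C | g. (\<exists>\<phi>. cen x \<phi> g)}"
 show "covers C (fst (hten x hunit)) ?G"
  unfolding fst_hten fst_hunit
  by (rule covers_mono[OF covers_aten[OF HB_generated[OF x] covers_idt[of "Unit C" "{idt C (Unit C)}"]]]) auto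
 fix u assume "u \<in> ?G"
 then obtain g \<phi> where u: "u = g \<lhd> Unit C" and g: "cen x \<phi> g" by blast
 have "cen x \<phi> (g ** aru C (src g))" by (rule cen_acomp[OF g]) (use cenD(1)[OF g] in simp_all)
 then have "cen x \<phi> (aru C (fst x) ** u)" using aru_natural[OF cenD(1)[OF g]] cenD(2)[OF g] by (simp add: u)
 moreover have "cen (hten x hunit) \<phi> u" using cen_aten[OF x HB_hunit g cen_hunit] by (simp add: u)
 ultimately show "\<exists>\<phi>. cen (hten x hunit) \<phi> u \<and> cen x \<phi> (aru C (fst x) ** u)" by blast
qed (use x in simp_all)

text \<open>On generators the braiding of the center exchanges the characters \<open>\<phi>\<close>
  and \<open>\<psi>\<close>; since they are added, both sides carry the same twist.\<close>

lemma cmor_hb: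
 assumes x: "HB C x" and y: "HB C y"
 shows "cmor (hten x y) (hten y x) (hb C y (fst x))"
proof (rule cmorI2)
 note [simp] = HB_Ob[OF x] HB_Ob[OF y] HB_valid[OF x] HB_valid[OF y]
 fix \<phi> \<psi> g h assume g: "cen x \<phi> g" and h: "cen y \<psi> h"
 note [simp] = cenD(1,2)[OF g] cenD(1,2)[OF h]
 have "hb C y (fst x) ** (g \<otimes>\<^sub>a h) = hb C y (fst x) ** (fst x \<rhd> h) ** (g \<lhd> src h)"
  by (simp add: interchange)
 also have "\<dots> = (h \<lhd> fst x) ** bx \<psi> (fst x) (src h) ** (g \<lhd> src h)"
  by (simp add: reassoc[OF cenD(3)[OF h]] acomp_assoc)
 also have "bx \<psi> (fst x) (src h) ** (g \<lhd> src h) = (src h \<rhd> g) ** bx \<psi> (src g) (src h)"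
  using bx_natural[of g "idt C (src h)" \<psi>] by simp
 also have "(h \<lhd> fst x) ** (src h \<rhd> g) ** bx \<psi> (src g) (src h) = (h \<otimes>\<^sub>a g) ** bx \<psi> (src g) (src h)"
  by (simp add: interchange')
 finally have "hb C y (fst x) ** (g \<otimes>\<^sub>a h) = (h \<otimes>\<^sub>a g) ** bx \<psi> (src g) (src h)" .
 moreover have "cen (hten y x) (\<psi> + \<phi>) ((h \<otimes>\<^sub>a g) ** bx \<psi> (src g) (src h))"
  by (intro cen_acomp cen_aten x y g h) simp_all
 ultimately show "cen (hten y x) (\<phi> + \<psi>) (hb C y (fst x) ** (g \<otimes>\<^sub>a h))" by (simp add: add.commute)
qed (use x y in simp_all)

lemma center_simps:
 "Ob (center C) = {x. HB C x}" "Comp (center C) = Comp C" "Id (center C) x = Id C (fst x)"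
 "Zero (center C) x y = Zero C (fst x) (fst y)" "Add (center C) = Add C" "Smult (center C) = Smult C"
 "TenOb (center C) x y = hten x y" "TenMor (center C) = TenMor C" "Unit (center C) = hunit"
 "Assoc (center C) x y z = Assoc C (fst x) (fst y) (fst z)" "LUnit (center C) x = LUnit C (fst x)"
 "RUnit (center C) x = RUnit C (fst x)" "Braid (center C) x y = snd y (fst x)"
 "Hom (center C) x y = {m. cmor x y (Arrow (fst x) m (fst y))}"
proof -
 show "Hom (center C) x y = {m. cmor x y (Arrow (fst x) m (fst y))}"
 proof (intro equalityI subsetI)
  fix m assume "m \<in> Hom (center C) x y"
  then have m: "m \<in> Hom C (fst x) (fst y)" and xy: "HB C x" "HB C y"
   and c: "!!U. U \<in> Ob C ==> (m \<odot> Id C U) \<cdot> snd x U = snd y U \<cdot> (Id C U \<odot> m)"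
   by (auto simp: center_def HB_def split: prod.splits)
  have "(Arrow (fst x) m (fst y) \<lhd> U) ** hb C x U = hb C y U ** (U \<rhd> Arrow (fst x) m (fst y))" if "U \<in> Ob C" for U
   using c[OF that] m xy that by (intro arrow_eqI) (simp_all add: mor_acomp mor_aten mor_idt)
  with m xy show "m \<in> {m. cmor x y (Arrow (fst x) m (fst y))}" by (simp add: cmor_def)
 next
  fix m assume "m \<in> {m. cmor x y (Arrow (fst x) m (fst y))}"
  then have c: "cmor x y (Arrow (fst x) m (fst y))" by simp
  have m: "m \<in> Hom C (fst x) (fst y)" using cmorD(3)[OF c] by simp
  note xy = cmorD(1,2)[OF c]
  have "(m \<odot> Id C U) \<cdot> snd x U = snd y U \<cdot> (Id C U \<odot> m)" if "U \<in> Ob C" for U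
   using arg_cong[OF cmorD(6)[OF c that], of mor] m xy that by (simp add: mor_acomp mor_aten mor_idt)
  with m xy show "m \<in> Hom (center C) x y" by (auto simp: center_def HB_def split: prod.splits)
 qed
qed (simp_all add: Unit_center, auto simp: center_def hten_def HB_def split: prod.splits)

lemma Hom_centerD:
 assumes "m \<in> Hom (center C) x y"
 shows "m \<in> Hom C (fst x) (fst y)" "HB C x" "HB C y" "cmor x y (Arrow (fst x) m (fst y))"
 using assms cmorD(1-3)[of x y "Arrow (fst x) m (fst y)"] by (simp_all add: center_simps)

lemma Hom_centerI: "cmor x y f ==> mor f \<in> Hom (center C) x y"
 using cmorD(3-5)[of x y f] Arrow_mor[of f] by (simp add: center_simps)

lemma category_center: "category (center C)"
proof unfold_locales
 show "x \<in> Ob (center C) \<and> y \<in> Ob (center C)" if "f \<in> Hom (center C) x y" for f x y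
  using Hom_centerD(2,3)[OF that] by (simp add: center_simps)
 show "Id (center C) x \<in> Hom (center C) x x" if "x \<in> Ob (center C)" for x
  using Hom_centerI[OF cmor_idt[of x]] that by (simp add: center_simps mor_idt)
 show "g \<cdot>\<^bsub>center C\<^esub> f \<in> Hom (center C) x z" if "f \<in> Hom (center C) x y" "g \<in> Hom (center C) y z" for f g x y z
  using Hom_centerI[OF cmor_acomp[OF Hom_centerD(4)[OF that(1)] Hom_centerD(4)[OF that(2)]]]
   Hom_centerD(1)[OF that(1)] Hom_centerD(1)[OF that(2)] by (simp add: center_simps(2) mor_acomp)
 show "(h \<cdot>\<^bsub>center C\<^esub> g) \<cdot>\<^bsub>center C\<^esub> f = h \<cdot>\<^bsub>center C\<^esub> (g \<cdot>\<^bsub>center C\<^esub> f)"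
  if "f \<in> Hom (center C) w x" "g \<in> Hom (center C) x y" "h \<in> Hom (center C) y z" for f g h w x y z
  using Comp_assoc[OF that[THEN Hom_centerD(1)]] by (simp add: center_simps(2))
 show "f \<cdot>\<^bsub>center C\<^esub> Id (center C) x = f" "Id (center C) y \<cdot>\<^bsub>center C\<^esub> f = f" if "f \<in> Hom (center C) x y" for f x y
  using Comp_Id[OF Hom_centerD(1)[OF that]] Id_Comp[OF Hom_centerD(1)[OF that]] by (simp_all add: center_simps(2,3))
qed

lemma linear_category_center: "linear_category (center C)"
proof (intro linear_category.intro linear_category_axioms.intro, rule category_center)
 show "Zero (center C) x y \<in> Hom (center C) x y" if "x \<in> Ob (center C)" "y \<in> Ob (center C)" for x y
  using Hom_centerI[OF cmor_azero[of x y]] that by (simp add: center_simps)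
 show "Add (center C) f g \<in> Hom (center C) x y" if "f \<in> Hom (center C) x y" "g \<in> Hom (center C) x y" for f g x y
  using Hom_centerI[OF cmor_aadd[OF Hom_centerD(4)[OF that(1)] Hom_centerD(4)[OF that(2)]]]
   Hom_centerD(1)[OF that(1)] Hom_centerD(1)[OF that(2)] by (simp add: center_simps(5) mor_aadd)
 show "Smult (center C) c f \<in> Hom (center C) x y" if "f \<in> Hom (center C) x y" for f c x y
  using Hom_centerI[OF cmor_asmult[OF Hom_centerD(4)[OF that], of c]]
   Hom_centerD(1)[OF that] by (simp add: center_simps(6) mor_asmult)
qed (unfold center_simps(2-6);
 (rule Add_assoc Add_commute Add_Zero Smult_zero Smult_one Smult_Smult Smult_add_left Smult_Add
  Comp_Add_left Comp_Add_right Comp_Smult_left Comp_Smult_right; erule Hom_centerD(1)))+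

text \<open>The inverse in \<open>C\<close> is again compatible with the half braidings, by
  \<open>cmor_ainv\<close>.\<close>

lemma Iso_center:
 assumes f: "cmor x y f" and iso: "aiso C f"
 shows "mor f \<in> Iso (center C) x y" "Inv (center C) x y (mor f) = mor (ainv C f)"
proof -
 interpret Z: category "center C" by (rule category_center)
 let ?f = "Arrow x (mor f) y" and ?g = "Arrow y (mor (ainv C f)) x"
 note fD = cmorD(3-5)[OF f]
 have "valid (center C) ?f" "valid (center C) ?g"
  using Hom_centerI[OF f] Hom_centerI[OF cmor_ainv[OF f iso]] by simp_all
 moreover have "mor (ainv C f) \<cdot> mor f = Id C (fst x)" "mor f \<cdot> mor (ainv C f) = Id C (fst y)"
  using mor_acomp[of f "ainv C f"] mor_acomp[of "ainv C f" f] iso fD by (simp_all add: mor_idt)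
 ultimately have inv: "inverse_arrows (center C) ?f ?g"
  by (simp add: inverse_arrows_def acomp_def idt_def center_simps(2,3))
 then have "aiso (center C) ?f" unfolding aiso_def by blast
 then show "mor f \<in> Iso (center C) x y" "Inv (center C) x y (mor f) = mor (ainv C f)"
  using Z.Inv_eq[of ?f] Z.ainv_eqI[OF inv] by (simp_all add: Z.Iso_iff)
qed

end

section \<open>The center as a braided category generated by its labelled objects\<close>

context pointed_center
begin

lemma hb_natural2:
 assumes g: "cmor y y' g" and f: "valid C f"
 shows "hb C y' (tgt f) ** (f \<otimes>\<^sub>a g) = (g \<otimes>\<^sub>a f) ** hb C y (src f)"
proof -
 note gD = cmorD[OF g]
 have "hb C y' (tgt f) ** (f \<otimes>\<^sub>a g) = (hb C y' (tgt f) ** (tgt f \<rhd> g)) ** (f \<lhd> fst y)"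
  using gD(3-5) f by (simp add: interchange acomp_assoc)
 also have "\<dots> = (g \<lhd> tgt f) ** hb C y (tgt f) ** (f \<lhd> fst y)"
  by (simp only: gD(6)[OF valid_Ob(2)[OF f], symmetric] acomp_assoc)
 also have "\<dots> = (g \<lhd> tgt f) ** (fst y \<rhd> f) ** hb C y (src f)" by (simp only: hb_natural[OF gD(1) f])
 also have "\<dots> = (g \<otimes>\<^sub>a f) ** hb C y (src f)" using gD(3-5) f by (simp add: interchange')
 finally show ?thesis .
qed

text \<open>Most equations are those of \<open>C\<close>. The hexagons come from the half braidings:
  the first is the definition of their tensor product, the second their multiplicativity.\<close>

theorem braided_monoidal_category_center: "braided_monoidal_category (center C)"
proof (intro braided_monoidal_category.intro braided_monoidal_category_axioms.intro, rule linear_category_center)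
 note [simp] = center_simps(1-13)
 show "x \<boxtimes>\<^bsub>center C\<^esub> y \<in> Ob (center C)" if "x \<in> Ob (center C)" "y \<in> Ob (center C)" for x y
  using that by simp
 show "Unit (center C) \<in> Ob (center C)" by simp
 show "f \<odot>\<^bsub>center C\<^esub> g \<in> Hom (center C) (x \<boxtimes>\<^bsub>center C\<^esub> y) (x' \<boxtimes>\<^bsub>center C\<^esub> y')"
  if "f \<in> Hom (center C) x x'" "g \<in> Hom (center C) y y'" for f g x x' y y'
  using Hom_centerI[OF cmor_aten[OF that[THEN Hom_centerD(4)]]] that[THEN Hom_centerD(1)] by (simp add: mor_aten)
 show "Id (center C) x \<odot>\<^bsub>center C\<^esub> Id (center C) y = Id (center C) (x \<boxtimes>\<^bsub>center C\<^esub> y)"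
  if "x \<in> Ob (center C)" "y \<in> Ob (center C)" for x y
  using that by (simp add: TenMor_Id)
 show "Assoc (center C) x y z \<in> Iso (center C) ((x \<boxtimes>\<^bsub>center C\<^esub> y) \<boxtimes>\<^bsub>center C\<^esub> z) (x \<boxtimes>\<^bsub>center C\<^esub> y \<boxtimes>\<^bsub>center C\<^esub> z)"
  if "x \<in> Ob (center C)" "y \<in> Ob (center C)" "z \<in> Ob (center C)" for x y z
  using Iso_center(1)[OF cmor_aass[of x y z]] that by (simp add: mor_struct)
 show "LUnit (center C) x \<in> Iso (center C) (Unit (center C) \<boxtimes>\<^bsub>center C\<^esub> x) x" if "x \<in> Ob (center C)" for x
  using Iso_center(1)[OF cmor_alu[of x]] that by (simp add: mor_struct)
 show "RUnit (center C) x \<in> Iso (center C) (x \<boxtimes>\<^bsub>center C\<^esub> Unit (center C)) x" if "x \<in> Ob (center C)" for x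
  using Iso_center(1)[OF cmor_aru[of x]] that by (simp add: mor_struct)
 show "Braid (center C) x y \<in> Iso (center C) (x \<boxtimes>\<^bsub>center C\<^esub> y) (y \<boxtimes>\<^bsub>center C\<^esub> x)"
  if "x \<in> Ob (center C)" "y \<in> Ob (center C)" for x y
  using Iso_center(1)[OF cmor_hb[of x y]] that by simp
 show "LUnit (center C) y \<cdot>\<^bsub>center C\<^esub> (Id (center C) (Unit (center C)) \<odot>\<^bsub>center C\<^esub> f) = f \<cdot>\<^bsub>center C\<^esub> LUnit (center C) x"
  if "f \<in> Hom (center C) x y" for f x y
  using LUnit_natural[OF Hom_centerD(1)[OF that]] by simp
 show "RUnit (center C) y \<cdot>\<^bsub>center C\<^esub> (f \<odot>\<^bsub>center C\<^esub> Id (center C) (Unit (center C))) = f \<cdot>\<^bsub>center C\<^esub> RUnit (center C) x"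
  if "f \<in> Hom (center C) x y" for f x y
  using RUnit_natural[OF Hom_centerD(1)[OF that]] by simp
 show "Assoc (center C) w x (y \<boxtimes>\<^bsub>center C\<^esub> z) \<cdot>\<^bsub>center C\<^esub> Assoc (center C) (w \<boxtimes>\<^bsub>center C\<^esub> x) y z =
   (Id (center C) w \<odot>\<^bsub>center C\<^esub> Assoc (center C) x y z) \<cdot>\<^bsub>center C\<^esub> Assoc (center C) w (x \<boxtimes>\<^bsub>center C\<^esub> y) z
    \<cdot>\<^bsub>center C\<^esub> (Assoc (center C) w x y \<odot>\<^bsub>center C\<^esub> Id (center C) z)"
  if "w \<in> Ob (center C)" "x \<in> Ob (center C)" "y \<in> Ob (center C)" "z \<in> Ob (center C)" for w x y z
  using that by (simp add: pentagon)
 show "Assoc (center C) x' y' z' \<cdot>\<^bsub>center C\<^esub> ((f \<odot>\<^bsub>center C\<^esub> g) \<odot>\<^bsub>center C\<^esub> h) =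
   (f \<odot>\<^bsub>center C\<^esub> g \<odot>\<^bsub>center C\<^esub> h) \<cdot>\<^bsub>center C\<^esub> Assoc (center C) x y z"
  if "f \<in> Hom (center C) x x'" "g \<in> Hom (center C) y y'" "h \<in> Hom (center C) z z'" for f g h x x' y y' z z'
  using Assoc_natural[OF that[THEN Hom_centerD(1)]] by simp
 show "(Id (center C) x \<odot>\<^bsub>center C\<^esub> LUnit (center C) y) \<cdot>\<^bsub>center C\<^esub> Assoc (center C) x (Unit (center C)) y =
   RUnit (center C) x \<odot>\<^bsub>center C\<^esub> Id (center C) y"
  if "x \<in> Ob (center C)" "y \<in> Ob (center C)" for x y
  using that by (simp add: triangle)
 show "Braid (center C) x' y' \<cdot>\<^bsub>center C\<^esub> (f \<odot>\<^bsub>center C\<^esub> g) = (g \<odot>\<^bsub>center C\<^esub> f) \<cdot>\<^bsub>center C\<^esub> Braid (center C) x y"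
  if f: "f \<in> Hom (center C) x x'" and g: "g \<in> Hom (center C) y y'" for f g x x' y y'
  using arg_cong[OF hb_natural2[OF Hom_centerD(4)[OF g], of "Arrow (fst x) f (fst x')"], of mor]
   Hom_centerD(1-3)[OF f] Hom_centerD(1-3)[OF g] by (simp add: mor_acomp mor_aten)
 show "Assoc (center C) y z x \<cdot>\<^bsub>center C\<^esub> Braid (center C) x (y \<boxtimes>\<^bsub>center C\<^esub> z) \<cdot>\<^bsub>center C\<^esub> Assoc (center C) x y z =
   (Id (center C) y \<odot>\<^bsub>center C\<^esub> Braid (center C) x z) \<cdot>\<^bsub>center C\<^esub> Assoc (center C) y x z
    \<cdot>\<^bsub>center C\<^esub> (Braid (center C) x y \<odot>\<^bsub>center C\<^esub> Id (center C) z)"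
  if "x \<in> Ob (center C)" "y \<in> Ob (center C)" "z \<in> Ob (center C)" for x y z
 proof -
  have xyz: "HB C x" "HB C y" "HB C z" using that by simp_all
  have "aass C (fst y) (fst z) (fst x) ** hb C (hten y z) (fst x) ** aass C (fst x) (fst y) (fst z) =
    (fst y \<rhd> hb C z (fst x)) ** aass C (fst y) (fst x) (fst z) ** (hb C y (fst x) \<lhd> fst z)"
   using xyz by (simp add: hb_hten[OF xyz(2,3)] acomp_assoc)
  from arg_cong[OF this, of mor] show ?thesis
   using xyz by (simp add: mor_acomp mor_aten mor_idt mor_struct)
 qed
 show "Braid (center C) (x \<boxtimes>\<^bsub>center C\<^esub> y) z =
   Assoc (center C) z x y \<cdot>\<^bsub>center C\<^esub> (Braid (center C) x z \<odot>\<^bsub>center C\<^esub> Id (center C) y) \<cdot>\<^bsub>center C\<^esub>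
   Inv (center C) ((x \<boxtimes>\<^bsub>center C\<^esub> z) \<boxtimes>\<^bsub>center C\<^esub> y) (x \<boxtimes>\<^bsub>center C\<^esub> z \<boxtimes>\<^bsub>center C\<^esub> y) (Assoc (center C) x z y) \<cdot>\<^bsub>center C\<^esub>
   (Id (center C) x \<odot>\<^bsub>center C\<^esub> Braid (center C) y z) \<cdot>\<^bsub>center C\<^esub> Assoc (center C) x y z"
  if "x \<in> Ob (center C)" "y \<in> Ob (center C)" "z \<in> Ob (center C)" for x y z
 proof -
  have xyz: "HB C x" "HB C y" "HB C z" using that by simp_all
  have "Inv (center C) (hten (hten x z) y) (hten x (hten z y)) (Assoc C (fst x) (fst z) (fst y)) =
    mor (ainv C (aass C (fst x) (fst z) (fst y)))"
   using Iso_center(2)[OF cmor_aass[OF xyz(1,3,2)]] xyz by (simp add: mor_struct)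
  then show ?thesis
   using arg_cong[OF hb_aten[OF xyz(3), of "fst x" "fst y"], of mor] xyz
   by (simp add: mor_acomp mor_aten mor_idt mor_struct)
 qed
qed (unfold center_simps(2-8);
 (rule TenMor_Comp TenMor_Add_left TenMor_Add_right TenMor_Smult_left TenMor_Smult_right;
  erule Hom_centerD(1)))+

definition lift :: "'o \<times> ('o => 'm) => ('o, 'm) arrow => 'o \<times> ('o => 'm) => ('o \<times> ('o => 'm), 'm) arrow" where
 "lift x f y = Arrow x (mor f) y"

lemma lift_ends [simp]: "src (lift x f y) = x" "tgt (lift x f y) = y" "mor (lift x f y) = mor f"
 by (simp_all add: lift_def)

sublocale Z: braided_monoidal_category "center C"
 by (rule braided_monoidal_category_center)

lemma valid_lift [simp]: "cmor x y f ==> valid (center C) (lift x f y)"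
 by (simp add: lift_def Hom_centerI)

lemma lift_inject: "cmor x y f ==> cmor x y g ==> lift x f y = lift x g y ==> f = g"
 by (rule arrow_eqI) (simp_all add: cmorD lift_def)

lemma lift_surj:
 assumes "valid (center C) f"
 obtains g where "cmor (src f) (tgt f) g" "f = lift (src f) g (tgt f)"
proof
 let ?g = "Arrow (fst (src f)) (mor f) (fst (tgt f))"
 show "cmor (src f) (tgt f) ?g" using Z.mor_in_Hom[OF assms] by (rule Hom_centerD(4))
 show "f = lift (src f) ?g (tgt f)" using Z.Arrow_mor[OF assms] by (simp add: lift_def)
qed

lemma lift_acomp:
 assumes f: "cmor x y f" and g: "cmor y z g"
 shows "lift y g z **\<^bsub>center C\<^esub> lift x f y = lift x (g ** f) z"
 using cmorD(3-5)[OF f] cmorD(3-5)[OF g] cmor_acomp[OF f g] f g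
 by (intro Z.arrow_eqI) (simp_all add: Z.mor_acomp mor_acomp center_simps(2))

lemma lift_idt: "lift x (idt C (fst x)) x = idt (center C) x"
 by (simp add: lift_def idt_def center_simps(3))

lemma lift_azero: "lift x (azero C (fst x) (fst y)) y = azero (center C) x y"
 by (simp add: lift_def azero_def center_simps(4))

lemma lift_aadd:
 assumes f: "cmor x y f" and g: "cmor x y g"
 shows "lift x f y \<boxplus>\<^bsub>center C\<^esub> lift x g y = lift x (f \<boxplus> g) y"
 using cmorD(3-5)[OF f] cmorD(3-5)[OF g] cmor_aadd[OF f g] f g
 by (intro Z.arrow_eqI) (simp_all add: Z.mor_aadd mor_aadd center_simps(5))

lemma lift_asmult:
 assumes f: "cmor x y f"
 shows "c \<odot>\<^sub>s\<^bsub>center C\<^esub> lift x f y = lift x (c \<odot>\<^sub>s f) y"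
 using cmorD(3-5)[OF f] cmor_asmult[OF f, of c] f
 by (intro Z.arrow_eqI) (simp_all add: Z.mor_asmult mor_asmult center_simps(6))

lemma lift_aiso: "cmor x y f ==> aiso C f ==> aiso (center C) (lift x f y)"
 using Iso_center(1)[of x y f] by (simp add: Z.aiso_iff)

lemma isomorphic_centerI: "cmor x y f ==> aiso C f ==> isomorphic (center C) x y"
 using lift_aiso[of x y f] unfolding Z.isomorphic_iff by (intro exI[of _ "lift x f y"]) simp

text \<open>As an arrow of \<open>C\<close> a nonzero morphism is a multiple of an identity.
  Compatibility with the half braidings at \<open>S b\<close> then compares the two characters at
  \<open>b\<close>.\<close>

lemma cmor_pl_eq:
 assumes f: "cmor (pl l) (pl m) f" and nz: "f ~= azero C (S (fst l)) (S (fst m))"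
 shows "l = m" "\<exists>c. f = c \<odot>\<^sub>s idt C (S (fst l))"
proof -
 note fD = cmorD[OF f]
 have f': "valid C f" "src f = S (fst l)" "tgt f = S (fst m)" using fD(3-5) by simp_all
 from f' show c: "\<exists>c. f = c \<odot>\<^sub>s idt C (S (fst l))" by (cases rule: S_hom) (use nz in auto)
 from f' have a: "fst l = fst m" by (cases rule: S_hom) (use nz in auto)
 obtain c where c: "f = c \<odot>\<^sub>s idt C (S (fst l))" using c by blast
 have "c ~= 0" using nz a c by auto
 have "ev (snd l) b = ev (snd m) b" for b
 proof -
  let ?X = "S (fst l)"
  \<comment> \<open>The factors are cancelled on \<open>\<mu>\<close>, whose target
    \<open>S (b + fst l)\<close> is an object with scalar endomorphisms; the braiding itself has
    another target.\<close>
  obtain \<mu> where \<mu>: "aiso C \<mu>" "src \<mu> = S b \<boxtimes> ?X" "tgt \<mu> = S (b + fst l)"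
   using S_mult[of b "fst l"] unfolding isomorphic_iff by blast
  have "(c * ev (snd l) b) \<odot>\<^sub>s abr C (S b) ?X = (c * ev (snd m) b) \<odot>\<^sub>s abr C (S b) ?X"
   using fD(6)[of "S b"] by (simp add: c bx_S a mult.commute)
  then have "(c * ev (snd l) b) \<odot>\<^sub>s (\<mu> ** ainv C (abr C (S b) ?X) ** abr C (S b) ?X) =
    (c * ev (snd m) b) \<odot>\<^sub>s (\<mu> ** ainv C (abr C (S b) ?X) ** abr C (S b) ?X)"
   by (simp only: acomp_asmult[symmetric])
  then have "(c * ev (snd l) b) \<odot>\<^sub>s \<mu> = (c * ev (snd m) b) \<odot>\<^sub>s \<mu>" using \<mu> by simp
  then have "c * ev (snd l) b = c * ev (snd m) b" by (rule scalar_cancel[rotated 2]) (use \<mu> S_scalar in simp_all)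
  then show ?thesis using \<open>c ~= 0\<close> by simp
 qed
 then have "snd l = snd m" by (simp add: ev_inject[symmetric] fun_eq_iff)
 with a show "l = m" by (rule prod_eqI)
qed

lemma cmor_cen: "HB C x ==> cen x (snd l) g ==> src g = S (fst l) ==> cmor (pl l) x g"
 by (simp add: cmor_def cen_def)

text \<open>A composite through \<open>S a\<close> need not be a morphism of the center, but with
  \<open>e \<phi>\<close> on both sides it factors through \<open>pl (a, \<phi>)\<close>. As
  \<open>e \<phi>\<close> is a multiple of its own square, it lies in the span, and with all the
  \<open>e \<phi>\<close> so does the identity.\<close>

lemma pl_covers:
 assumes x: "HB C x"
 shows "covers (center C) x {s. src s \<in> range pl}"
proof -
 let ?X = "fst x" and ?P = "{s :: ('o \<times> ('o => 'm), 'm) arrow. src s \<in> range pl}"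
 have X: "?X \<in> Ob C" "x \<in> Ob (center C)" using x by (simp_all add: center_simps(1))
 \<comment> \<open>The set to which the last property of the projections is applied. Membership
   includes being a morphism of the center, so that the lift is valid.\<close>
 let ?K = "{k. cmor x x k \<and> lift x k x \<in> Span (center C) ?P x x}"
 obtain e :: "('a, 'k) dual => ('o, 'm) arrow" and d where
  e: "!!\<phi>. valid C (e \<phi>)" "!!\<phi>. src (e \<phi>) = ?X" "!!\<phi>. tgt (e \<phi>) = ?X"
  and cen: "!!\<phi>. cen x \<phi> (e \<phi>)"
  and pe: "!!\<phi> p a. valid C p ==> src p = ?X ==> tgt p = S a ==> cmor x (pl (a, \<phi>)) (p ** e \<phi>)"
  and ee: "!!\<phi>. e \<phi> = d \<odot>\<^sub>s (e \<phi> ** e \<phi>)"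
  and K: "!!K. azero C ?X ?X \<in> K ==> (!!f g. f \<in> K ==> g \<in> K ==> f \<boxplus> g \<in> K) ==> (!!\<phi>. e \<phi> \<in> K) ==> idt C ?X \<in> K"
  by (rule HB_projections[OF x]) blast
 have zero: "azero C ?X ?X \<in> ?K"
  using x X cmor_azero[OF x x] by (simp add: lift_azero Span.zero)
 have add: "f \<boxplus> g \<in> ?K" if "f \<in> ?K" "g \<in> ?K" for f g
  using that cmor_aadd[of x x f g] lift_aadd[of x x f g] Span.add[of "lift x f x" "center C" ?P x x "lift x g x"] by simp
 have "e \<phi> ** k ** e \<phi> \<in> ?K" if "k \<in> Span C Sg ?X ?X" for k \<phi>
  using that
 proof (induction rule: Span.induct)
  case zero
  then show ?case using \<open>azero C ?X ?X \<in> ?K\<close> e by simp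
 next
  case (add f g)
  have "e \<phi> ** (f \<boxplus> g) ** e \<phi> = (e \<phi> ** f ** e \<phi>) \<boxplus> (e \<phi> ** g ** e \<phi>)"
   by (simp only: aadd_acomp acomp_aadd)
  then show ?case using \<open>!!f g. f \<in> ?K ==> g \<in> ?K ==> f \<boxplus> g \<in> ?K\<close> add.IH by (simp only:)
 next
  case (comp g p)
  then obtain a where a: "src g = S a" by auto
  have 1: "cmor (pl (a, \<phi>)) x (e \<phi> ** g)"
   by (rule cmor_cen[OF x]) (use cen_acomp[OF cen, of g \<phi>] comp e a in simp_all)
  have 2: "cmor x (pl (a, \<phi>)) (p ** e \<phi>)" by (rule pe) (use comp a in simp_all)
  have "lift (pl (a, \<phi>)) (e \<phi> ** g) x **\<^bsub>center C\<^esub> lift x (p ** e \<phi>) (pl (a, \<phi>)) \<in> Span (center C) ?P x x"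
   by (rule Span.comp) (use 1 2 in simp_all)
  moreover have "(e \<phi> ** g) ** (p ** e \<phi>) = e \<phi> ** (g ** p) ** e \<phi>" by (simp only: acomp_assoc)
  ultimately show ?case using lift_acomp[OF 2 1] cmor_acomp[OF 2 1] by simp
 qed
 then have "e \<phi> ** idt C ?X ** e \<phi> \<in> ?K" for \<phi> using S_covers[OF X(1)] unfolding covers_def by blast
 then have ee': "e \<phi> ** e \<phi> \<in> ?K" for \<phi> using e by simp
 have dee: "d \<odot>\<^sub>s (e \<phi> ** e \<phi>) \<in> ?K" for \<phi>
  using ee'[of \<phi>] cmor_asmult[of x x "e \<phi> ** e \<phi>" d] lift_asmult[of x x "e \<phi> ** e \<phi>" d] Z.Span_asmult[of "lift x (e \<phi> ** e \<phi>) x" ?P x x d]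
  by (simp del: acomp_asmult asmult_acomp)
 have "e \<phi> \<in> ?K" for \<phi> by (subst ee) (rule dee)
 from K[OF zero add this] show ?thesis
  using X by (simp add: covers_def lift_idt)
qed

text \<open>The half braiding on the sum is block diagonal. The injections intertwine it with the
  given ones, so the sum is covered by the central arrows of its summands.\<close>

lemma ex_direct_sum_center:
 assumes x: "HB C x" and y: "HB C y" and ds: "direct_sum C (fst x) (fst y) V"
 shows "\<exists>v. direct_sum (center C) x y v"
proof -
 let ?X = "fst x" and ?Y = "fst y"
 from direct_sumE[OF ds] obtain i j p r where
  s [simp]: "valid C i" "src i = ?X" "tgt i = V" "valid C j" "src j = ?Y" "tgt j = V"
   "valid C p" "src p = V" "tgt p = ?X" "valid C r" "src r = V" "tgt r = ?Y"
  and pi: "p ** i = idt C ?X" and rj: "r ** j = idt C ?Y" and pj: "p ** j = azero C ?Y ?X" and ri: "r ** i = azero C ?X ?Y"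
  and sum: "(i ** p) \<boxplus> (j ** r) = idt C V" by metis
 have V [simp]: "V \<in> Ob C" using valid_Ob(2)[OF s(1)] by simp
 note [simp] = HB_Ob[OF x] HB_Ob[OF y] HB_valid[OF x] HB_valid[OF y] HB_aiso[OF x] HB_aiso[OF y]
 define \<Gamma> where "\<Gamma> U = ((i \<lhd> U) ** hb C x U ** (U \<rhd> p)) \<boxplus> ((j \<lhd> U) ** hb C y U ** (U \<rhd> r))" for U
 define v where "v = half_braided C V \<Gamma>"
 have fst_v [simp]: "fst v = V" by (simp add: v_def)
 have hb_v: "hb C v U = \<Gamma> U" if "U \<in> Ob C" for U
  unfolding v_def by (rule hb_half_braided) (use that in \<open>simp_all add: \<Gamma>_def\<close>)
 have \<Gamma>v: "valid C (\<Gamma> U)" "src (\<Gamma> U) = U \<boxtimes> V" "tgt (\<Gamma> U) = V \<boxtimes> U" if "U \<in> Ob C" for U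
  using that by (simp_all add: \<Gamma>_def)
 have vi: "hb C v U ** (U \<rhd> i) = (i \<lhd> U) ** hb C x U" "hb C v U ** (U \<rhd> j) = (j \<lhd> U) ** hb C y U"
  "(p \<lhd> U) ** hb C v U = hb C x U ** (U \<rhd> p)" "(r \<lhd> U) ** hb C v U = hb C y U ** (U \<rhd> r)"
  if U [simp]: "U \<in> Ob C" for U
  by (simp_all add: hb_v \<Gamma>_def aadd_acomp acomp_aadd acomp_assoc interchange interchange' pi rj pj ri)
 have iso: "aiso C (hb C v U)" if U [simp]: "U \<in> Ob C" for U
 proof (rule aisoI)
  let ?D = "((U \<rhd> i) ** ainv C (hb C x U) ** (p \<lhd> U)) \<boxplus> ((U \<rhd> j) ** ainv C (hb C y U) ** (r \<lhd> U))"
  have sums: "(U \<rhd> (i ** p)) \<boxplus> (U \<rhd> (j ** r)) = idt C (U \<boxtimes> V)" "((i ** p) \<lhd> U) \<boxplus> ((j ** r) \<lhd> U) = idt C (V \<boxtimes> U)"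
   using sum by (simp_all flip: aten_aadd aadd_aten)
  show D: "valid C ?D" "src ?D = tgt (hb C v U)" "tgt ?D = src (hb C v U)" by simp_all
  show "?D ** hb C v U = idt C (src (hb C v U))"
   by (simp add: aadd_acomp acomp_assoc vi interchange sums)
  have "hb C v U ** ?D = (hb C v U ** (U \<rhd> i)) ** ainv C (hb C x U) ** (p \<lhd> U) \<boxplus> (hb C v U ** (U \<rhd> j)) ** ainv C (hb C y U) ** (r \<lhd> U)"
   by (simp only: acomp_aadd acomp_assoc)
  also have "\<dots> = idt C (tgt (hb C v U))"
   unfolding vi[OF U] by (simp add: acomp_assoc interchange sums)
  finally show "hb C v U ** ?D = idt C (tgt (hb C v U))" .
 qed (use \<Gamma>v[OF U] in \<open>simp add: hb_v\<close>)
 have ceni: "cen v \<phi> (i ** g)" if g: "cen x \<phi> g" for \<phi> g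
  unfolding cen_def
 proof (intro conjI ballI)
  note [simp] = cenD(1,2)[OF g]
  fix U assume U [simp]: "U \<in> Ob C"
  have "hb C v U ** (U \<rhd> (i ** g)) = (hb C v U ** (U \<rhd> i)) ** (U \<rhd> g)" by (simp add: interchange acomp_assoc)
  also have "\<dots> = ((i ** g) \<lhd> U) ** bx \<phi> U (src (i ** g))"
   unfolding vi(1)[OF U] by (simp add: acomp_assoc cenD(3)[OF g] interchange')
  finally show "hb C v U ** (U \<rhd> (i ** g)) = ((i ** g) \<lhd> U) ** bx \<phi> U (src (i ** g))" .
 qed (use cenD(1,2)[OF g] in simp_all)
 have cenj: "cen v \<phi> (j ** g)" if g: "cen y \<phi> g" for \<phi> g
  unfolding cen_def
 proof (intro conjI ballI)
  note [simp] = cenD(1,2)[OF g]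
  fix U assume U [simp]: "U \<in> Ob C"
  have "hb C v U ** (U \<rhd> (j ** g)) = (hb C v U ** (U \<rhd> j)) ** (U \<rhd> g)" by (simp add: interchange acomp_assoc)
  also have "\<dots> = ((j ** g) \<lhd> U) ** bx \<phi> U (src (j ** g))"
   unfolding vi(2)[OF U] by (simp add: acomp_assoc cenD(3)[OF g] interchange')
  finally show "hb C v U ** (U \<rhd> (j ** g)) = ((j ** g) \<lhd> U) ** bx \<phi> U (src (j ** g))" .
 qed (use cenD(1,2)[OF g] in simp_all)
 let ?G = "{g. \<exists>\<phi>. cen v \<phi> g}"
 have HBv: "HB C v"
 proof (rule HB_if_generated)
  have *: "h \<in> Span C ?G W V"
   if W: "covers C W {g. \<exists>\<phi>. cen w \<phi> g}" and h: "valid C h" "src h = W" "tgt h = V"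
    and c: "!!\<phi> g. cen w \<phi> g ==> cen v \<phi> (h ** g)" for w h W
  proof -
   have "h ** idt C W \<in> Span C ?G W (tgt h)"
   proof (rule Span_acomp_left)
    show "idt C W \<in> Span C {g. \<exists>\<phi>. cen w \<phi> g} W W" using W by (simp add: covers_def)
    show "h ** g \<in> Span C ?G (src g) (tgt h)" if "g \<in> {g. \<exists>\<phi>. cen w \<phi> g}" "valid C g" "tgt g = W" for g
     using Span_gen[of "h ** g" ?G] that c h by auto
   qed (use h in simp_all)
   with h show ?thesis by simp
  qed
  have "i ** p \<in> Span C ?G V V"
   using Span_acomp_right[OF *[OF HB_generated[OF x] s(1-3) ceni] s(7)] by simp
  moreover have "j ** r \<in> Span C ?G V V"
   using Span_acomp_right[OF *[OF HB_generated[OF y] s(4-6) cenj] s(10)] by simp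
  ultimately show "covers C (fst v) ?G" using Span.add[of "i ** p" C ?G V V "j ** r"] sum by (simp add: covers_def)
 qed (use iso in \<open>simp_all add: v_def[THEN arg_cong[of _ _ snd]]\<close>)
 have i: "cmor x v i" "cmor y v j" "cmor v x p" "cmor v y r"
  using x y HBv by (simp_all add: cmor_def vi)
 have "direct_sum (center C) x y v"
 proof (rule Z.direct_sumI)
  show "(lift x i v **\<^bsub>center C\<^esub> lift v p x) \<boxplus>\<^bsub>center C\<^esub> (lift y j v **\<^bsub>center C\<^esub> lift v r y) = idt (center C) v"
   using lift_aadd[OF cmor_acomp[OF i(3,1)] cmor_acomp[OF i(4,2)]] lift_idt[of v]
   by (simp add: lift_acomp[OF i(3,1)] lift_acomp[OF i(4,2)] sum)
  show "lift v p x **\<^bsub>center C\<^esub> lift x i v = idt (center C) x" "lift v r y **\<^bsub>center C\<^esub> lift y j v = idt (center C) y"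
   "lift v p x **\<^bsub>center C\<^esub> lift y j v = azero (center C) y x" "lift v r y **\<^bsub>center C\<^esub> lift x i v = azero (center C) x y"
   by (simp_all add: lift_acomp[OF i(1,3)] lift_acomp[OF i(2,4)] lift_acomp[OF i(2,3)] lift_acomp[OF i(1,4)] pi rj pj ri lift_idt lift_azero)
 qed (use i in simp_all)
 then show ?thesis ..
qed

lemma ex_zero_center: "\<exists>z. zero_object (center C) z"
proof -
 obtain N where N: "zero_object C N" using ex_zero by blast
 then have [simp]: "N \<in> Ob C" and N0: "idt C N = azero C N N" by (simp_all add: zero_object_iff)
 define z where "z = half_braided C N (\<lambda>U. azero C (U \<boxtimes> N) (N \<boxtimes> U))"
 have hb: "hb C z U = azero C (U \<boxtimes> N) (N \<boxtimes> U)" if "U \<in> Ob C" for U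
  unfolding z_def by (rule hb_half_braided) (use that in simp_all)
 have "HB C z"
 proof (rule HB_if_generated)
  show "aiso C (hb C z U)" if U [simp]: "U \<in> Ob C" for U
  proof (rule aisoI)
   have "U \<rhd> idt C N = azero C (U \<boxtimes> N) (U \<boxtimes> N)" "idt C N \<lhd> U = azero C (N \<boxtimes> U) (N \<boxtimes> U)"
    unfolding N0 by simp_all
   then show "azero C (N \<boxtimes> U) (U \<boxtimes> N) ** hb C z U = idt C (src (hb C z U))"
    "hb C z U ** azero C (N \<boxtimes> U) (U \<boxtimes> N) = idt C (tgt (hb C z U))" by (simp_all add: hb)
  qed (simp_all add: hb)
  show "covers C (fst z) {g. \<exists>\<phi>. cen z \<phi> g}" by (simp add: covers_def z_def N0 Span.zero)
 qed (simp_all add: z_def)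
 moreover have "idt (center C) z = azero (center C) z z"
  using lift_idt[of z] lift_azero[of z z] N0 by (simp add: z_def)
 ultimately have "zero_object (center C) z" by (simp add: Z.zero_object_iff center_simps(1))
 then show ?thesis ..
qed

theorem pointed_family_center: "pointed_family (center C) pl"
proof
 show "scalar (center C) (pl l)" for l
  unfolding scalar_def
 proof (intro conjI allI impI)
  show "pl l \<in> Ob (center C)" by (simp add: center_simps(1))
  show "idt (center C) (pl l) ~= azero (center C) (pl l) (pl l)"
  proof
   assume "idt (center C) (pl l) = azero (center C) (pl l) (pl l)"
   then have "idt C (fst (pl l)) = azero C (fst (pl l)) (fst (pl l))"
    by (intro lift_inject[OF cmor_idt cmor_azero]) (simp_all add: lift_idt lift_azero del: fst_pl)
   then show False using S_idt_nz by simp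
  qed
  fix f assume f: "valid (center C) f" "src f = pl l" "tgt f = pl l"
  obtain g where g: "cmor (pl l) (pl l) g" "f = lift (pl l) g (pl l)" using lift_surj[OF f(1)] f by metis
  have "\<exists>c. g = c \<odot>\<^sub>s idt C (fst (pl l))"
  proof (cases "g = azero C (S (fst l)) (S (fst l))")
   case True
   then show ?thesis by (intro exI[of _ 0]) simp
  next
   case False
   then show ?thesis using cmor_pl_eq(2)[OF g(1)] by simp
  qed
  then obtain c where "g = c \<odot>\<^sub>s idt C (fst (pl l))" by blast
  then have "f = c \<odot>\<^sub>s\<^bsub>center C\<^esub> idt (center C) (pl l)"
   unfolding g(2) lift_idt[symmetric] using lift_asmult[OF cmor_idt[OF HB_pl], of c l] by (simp del: fst_pl)
  then show "\<exists>c. f = c \<odot>\<^sub>s\<^bsub>center C\<^esub> idt (center C) (pl l)" ..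
 qed
 show "f = azero (center C) (pl l) (pl m)"
  if f: "valid (center C) f" "src f = pl l" "tgt f = pl m" and lm: "l ~= m" for f l m
 proof -
  obtain g where g: "cmor (pl l) (pl m) g" "f = lift (pl l) g (pl m)" using lift_surj[OF f(1)] f by metis
  have "g = azero C (fst (pl l)) (fst (pl m))" using cmor_pl_eq(1)[OF g(1)] lm by auto
  then show ?thesis using g(2) by (simp only: lift_azero)
 qed
 show "isomorphic (center C) (pl l \<boxtimes>\<^bsub>center C\<^esub> pl m) (pl (l + m))" for l m
 proof -
  let ?X = "S (fst l)" and ?Y = "S (fst m)"
  obtain \<mu> where \<mu>: "aiso C \<mu>" "src \<mu> = ?X \<boxtimes> ?Y" "tgt \<mu> = S (fst l + fst m)"
   using S_mult unfolding isomorphic_iff by blast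
  have "cmor (hten (pl l) (pl m)) (pl (l + m)) \<mu>"
  proof (rule cmorI)
   show "covers C (fst (hten (pl l) (pl m))) {idt C (?X \<boxtimes> ?Y)}" by (rule covers_idt) simp_all
   fix g assume "g \<in> {idt C (?X \<boxtimes> ?Y)}"
   then have g: "g = idt C ?X \<otimes>\<^sub>a idt C ?Y" by simp
   have "cen (pl (l + m)) (snd (l + m)) (idt C (S (fst (l + m))) ** \<mu>)"
    by (rule cen_acomp[OF cen_pl]) (use \<mu> in simp_all)
   then have "cen (pl (l + m)) (snd l + snd m) (\<mu> ** g)" using \<mu> by (simp add: g)
   moreover have "cen (hten (pl l) (pl m)) (snd l + snd m) g"
    unfolding g by (intro cen_aten HB_pl cen_pl)
   ultimately show "\<exists>\<phi>. cen (hten (pl l) (pl m)) \<phi> g \<and> cen (pl (l + m)) \<phi> (\<mu> ** g)" by blast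
  qed (use \<mu> in simp_all)
  then show ?thesis using isomorphic_centerI \<mu>(1) by (simp add: center_simps(7))
 qed
 show "isomorphic (center C) (Unit (center C)) (pl 0)"
 proof -
  obtain \<iota> where \<iota>: "aiso C \<iota>" "src \<iota> = Unit C" "tgt \<iota> = S 0" using S_unit unfolding isomorphic_iff by blast
  have "cmor hunit (pl 0) \<iota>"
  proof (rule cmorI)
   show "covers C (fst hunit) {idt C (Unit C)}" by (rule covers_idt) simp_all
   fix g assume "g \<in> {idt C (Unit C)}"
   then have g: "g = idt C (Unit C)" by simp
   have "cen (pl 0) (snd (0 :: 'a \<times> ('a, 'k) dual)) (idt C (S (fst (0 :: 'a \<times> ('a, 'k) dual))) ** \<iota>)"
    by (rule cen_acomp[OF cen_pl]) (use \<iota> in simp_all)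
   then have "cen (pl 0) 0 (\<iota> ** g)" using \<iota> by (simp add: g)
   then show "\<exists>\<phi>. cen hunit \<phi> g \<and> cen (pl 0) \<phi> (\<iota> ** g)" using cen_hunit unfolding g by blast
  qed (use \<iota> in simp_all)
  then show ?thesis using isomorphic_centerI \<iota>(1) by (simp add: center_simps(9))
 qed
 show "covers (center C) z {s. src s \<in> range pl}" if "z \<in> Ob (center C)" for z
  using pl_covers[of z] that by (simp add: center_simps(1))
 show "\<exists>v. direct_sum (center C) z (pl l) v" if "z \<in> Ob (center C)" for z l
 proof -
  have z: "HB C z" using that by (simp add: center_simps(1))
  obtain V where "direct_sum C (fst z) (fst (pl l)) V" using S_sum[OF HB_Ob[OF z]] by auto
  then show ?thesis by (rule ex_direct_sum_center[OF z HB_pl])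
 qed
qed (rule ex_zero_center)

end

section \<open>Braided autoequivalences of the center\<close>

context pointed_center
begin

text \<open>The inverse in the center is also an inverse in \<open>C\<close> after the half
  braidings are forgotten.\<close>

lemma aiso_if_lift:
 assumes f: "cmor x y f" and iso: "aiso (center C) (lift x f y)"
 shows "aiso C f"
proof -
 note fD = cmorD[OF f]
 have "valid (center C) (ainv (center C) (lift x f y))" using iso by simp
 from lift_surj[OF this] iso obtain g where g: "cmor y x g" "ainv (center C) (lift x f y) = lift y g x" by auto
 note gD = cmorD[OF g(1)]
 have "lift x (g ** f) x = lift x (idt C (fst x)) x"
  using Z.ainv_simps(4)[OF iso] by (simp add: g(2) lift_acomp[OF f g(1)] lift_idt)
 then have 1: "g ** f = idt C (fst x)" by (rule lift_inject[OF cmor_acomp[OF f g(1)] cmor_idt[OF fD(1)]])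
 have "lift y (f ** g) y = lift y (idt C (fst y)) y"
  using Z.ainv_simps(5)[OF iso] by (simp add: g(2) lift_acomp[OF g(1) f] lift_idt)
 then have "f ** g = idt C (fst y)" by (rule lift_inject[OF cmor_acomp[OF g(1) f] cmor_idt[OF fD(2)]])
 with 1 show ?thesis using fD(3-5) gD(3-5) by (intro aisoI[of f g]) simp_all
qed

text \<open>A label prescribes the half braiding at the objects \<open>S b\<close> only. By
  \<open>cmorI_S\<close> this suffices for an isomorphism of underlying objects to be a morphism of
  the center.\<close>

lemma center_label_iff: "center_label C S z l \<longleftrightarrow> isomorphic (center C) z (pl l)"
proof
 assume L: "center_label C S z l"
 then have z: "HB C z" and "isomorphic C (fst z) (S (fst l))"
  and s: "!!b. snd z (S b) = Smult C (ev (snd l) b) (Braid C (S b) (fst z))"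
  by (auto simp: center_label_def center_simps(1))
 then obtain f where f: "aiso C f" "src f = fst z" "tgt f = S (fst l)" unfolding isomorphic_iff by blast
 have hb: "hb C z (S b) = ev (snd l) b \<odot>\<^sub>s abr C (S b) (fst z)" for b
  using z by (intro arrow_eqI) (simp_all add: s mor_asmult mor_struct)
 have "cmor z (pl l) f"
 proof (rule cmorI_S)
  fix b
  show "(f \<lhd> S b) ** hb C z (S b) = hb C (pl l) (S b) ** (S b \<rhd> f)"
   using f abr_natural[of "idt C (S b)" f "S b" "S (fst l)"] by (simp add: hb bx_S)
 qed (use z f in simp_all)
 then show "isomorphic (center C) z (pl l)" using f(1) by (rule isomorphic_centerI)
next
 assume "isomorphic (center C) z (pl l)"
 then obtain F where F: "aiso (center C) F" "src F = z" "tgt F = pl l" unfolding Z.isomorphic_iff by blast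
 obtain f where f: "cmor z (pl l) f" "F = lift z f (pl l)" using lift_surj[of F] F by auto
 have iso: "aiso C f" using aiso_if_lift[OF f(1)] F f(2) by simp
 note fD = cmorD[OF f(1)]
 have "snd z (S b) = Smult C (ev (snd l) b) (Braid C (S b) (fst z))" for b
 proof -
  have "hb C z (S b) = ev (snd l) b \<odot>\<^sub>s abr C (S b) (fst z)"
  proof (rule aiso_monic[of "f \<lhd> S b"])
   show "(f \<lhd> S b) ** hb C z (S b) = (f \<lhd> S b) ** ev (snd l) b \<odot>\<^sub>s abr C (S b) (fst z)"
    using fD abr_natural[of "idt C (S b)" f "S b" "S (fst l)"] by (simp add: bx_S)
  qed (use fD iso in simp_all)
  from arg_cong[OF this, of mor] show ?thesis using fD(1) by (simp add: mor_asmult mor_struct)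
 qed
 moreover have "isomorphic C (fst z) (S (fst l))" unfolding isomorphic_iff using iso fD(4,5) by auto
 ultimately show "center_label C S z l" using fD(1) by (simp add: center_label_def center_simps(1))
qed

sublocale P: pointed_family "center C" pl
 by (rule pointed_family_center)

sublocale ZZ: two_braided "center C" "center C"
 by unfold_locales

text \<open>Labels are invariant under isomorphism, so it is enough to follow the representatives
  \<open>pl l\<close>.\<close>

lemma autoequivs_inducing_iff:
 "F \<in> autoequivs_inducing C S \<beta> \<longleftrightarrow>
   F \<in> braided_autoequivs (center C) \<and> (\<forall>l. isomorphic (center C) (FOb F (pl l)) (pl (\<beta> l)))"
proof (cases "F \<in> braided_autoequivs (center C)")
 case True
 then have L: "lfun (center C) (center C) (FOb F) (arrow_map F)"
  by (simp add: braided_autoequivs_def braided_functor_def tensor_functor_def ZZ.linear_functor_iff)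
 show ?thesis
  unfolding autoequivs_inducing_def mem_Collect_eq center_label_iff
  using True ZZ.lfun_isomorphic[OF L] Z.isomorphic_refl[OF P.S_Ob] Z.isomorphic_trans by blast
qed (simp add: autoequivs_inducing_def)

text \<open>An embedded object has the braiding itself as half braiding, which is the twist by the
  trivial character.\<close>

lemma center_embedding_simps:
 "FOb (center_embedding C) X = half_braided C X (\<lambda>U. bx 0 U X)" if "X \<in> Ob C"
 using that by (auto simp: center_embedding_def half_braided_def bx_0 mor_struct)

lemma embedded:
 assumes [simp]: "X \<in> Ob C"
 shows "fst (FOb (center_embedding C) X) = X"
  "!!U. U \<in> Ob C ==> hb C (FOb (center_embedding C) X) U = abr C U X"
  "cen (FOb (center_embedding C) X) 0 (idt C X)"
  "HB C (FOb (center_embedding C) X)"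
proof -
 note [simp] = center_embedding_simps
 show hb: "hb C (FOb (center_embedding C) X) U = abr C U X" if "U \<in> Ob C" for U
  using that by (simp add: hb_half_braided bx_0)
 show cen: "cen (FOb (center_embedding C) X) 0 (idt C X)"
  unfolding cen_def by (simp add: hb_half_braided)
 show "HB C (FOb (center_embedding C) X)"
 proof (rule HB_if_generated)
  show "covers C (fst (FOb (center_embedding C) X)) {g. \<exists>\<phi>. cen (FOb (center_embedding C) X) \<phi> g}"
   by (rule covers_idt) (use cen in auto)
  show "aiso C (hb C (FOb (center_embedding C) X) U)" if "U \<in> Ob C" for U
   unfolding hb[OF that] using that by simp
 qed simp_all
 show "fst (FOb (center_embedding C) X) = X" by simp
qed

lemma embedded_S: "FOb (center_embedding C) (S a) = pl (a, 0)"
 by (simp add: center_embedding_simps pl_def)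

text \<open>The tensor structure consists of identities of \<open>C\<close>. They are morphisms of
  the center because both half braidings are twisted by the trivial character.\<close>

lemma braided_functor_center_embedding: "braided_functor C (center C) (center_embedding C)"
proof -
 let ?E = "center_embedding C"
 have E: "FMor ?E X Y f = f" "FTen ?E X Y = Id C (X \<boxtimes> Y)" for X Y f
  by (simp_all add: center_embedding_def)
 have hom: "f \<in> Hom (center C) (FOb ?E X) (FOb ?E Y)" if f: "f \<in> Hom C X Y" for f X Y
 proof -
  have XY: "X \<in> Ob C" "Y \<in> Ob C" using Hom_Ob[OF f] by simp_all
  have "cmor (FOb ?E X) (FOb ?E Y) (Arrow X f Y)"
   unfolding cmor_def
  proof (intro conjI ballI)
   fix U assume "U \<in> Ob C"
   then show "(Arrow X f Y \<lhd> U) ** hb C (FOb ?E X) U = hb C (FOb ?E Y) U ** (U \<rhd> Arrow X f Y)"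
    using abr_natural[of "idt C U" "Arrow X f Y" U Y] f XY by (simp add: embedded(2))
  qed (use embedded(1,4) f XY in simp_all)
  from Hom_centerI[OF this] show ?thesis by simp
 qed
 have ten: "cmor (hten (FOb ?E X) (FOb ?E Y)) (FOb ?E (X \<boxtimes> Y)) (idt C (X \<boxtimes> Y))"
  if XY [simp]: "X \<in> Ob C" "Y \<in> Ob C" for X Y
 proof (rule cmorI)
  show "covers C (fst (hten (FOb ?E X) (FOb ?E Y))) {idt C (X \<boxtimes> Y)}"
   by (rule covers_idt) (simp_all add: embedded(1))
  fix g assume "g \<in> {idt C (X \<boxtimes> Y)}"
  then have g: "g = idt C X \<otimes>\<^sub>a idt C Y" by simp
  have "cen (hten (FOb ?E X) (FOb ?E Y)) (0 + 0) g"
   unfolding g by (intro cen_aten embedded(3,4) XY)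
  moreover have "cen (FOb ?E (X \<boxtimes> Y)) 0 (idt C (X \<boxtimes> Y) ** g)"
   using embedded(3)[of "X \<boxtimes> Y"] by (simp add: g)
  ultimately show "\<exists>\<phi>. cen (hten (FOb ?E X) (FOb ?E Y)) \<phi> g \<and> cen (FOb ?E (X \<boxtimes> Y)) \<phi> (idt C (X \<boxtimes> Y) ** g)" by auto
 qed (simp_all add: embedded(1,4))
 have lin: "linear_functor C (center C) ?E"
  unfolding linear_functor_def
  using hom embedded(1,4) by (simp add: E center_simps(1-6))
 have "FOb ?E (Unit C) = hunit"
  by (auto simp: center_embedding_simps hunit_def half_braided_def bx_0)
 then have unit: "isomorphic (center C) (FOb ?E (Unit C)) (Unit (center C))"
  by (simp add: center_simps(9) Z.isomorphic_refl center_simps(1))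
 have iso: "FTen ?E X Y \<in> Iso (center C) (FOb ?E X \<boxtimes>\<^bsub>center C\<^esub> FOb ?E Y) (FOb ?E (X \<boxtimes> Y))"
  if "X \<in> Ob C" "Y \<in> Ob C" for X Y
  using Iso_center(1)[OF ten[OF that]] that by (simp add: E center_simps(7) mor_idt)
 have nat: "Id C (X' \<boxtimes> Y') \<cdot> (f \<odot> g) = (f \<odot> g) \<cdot> Id C (X \<boxtimes> Y)"
  if "f \<in> Hom C X X'" "g \<in> Hom C Y Y'" for f g X X' Y Y'
  using Comp_Id[OF TenMor_in_Hom[OF that]] Id_Comp[OF TenMor_in_Hom[OF that]] by simp
 have assoc: "Assoc C X Y W \<cdot> Id C ((X \<boxtimes> Y) \<boxtimes> W) \<cdot> (Id C (X \<boxtimes> Y) \<odot> Id C W) =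
   Id C (X \<boxtimes> Y \<boxtimes> W) \<cdot> (Id C X \<odot> Id C (Y \<boxtimes> W)) \<cdot> Assoc C X Y W"
  if [simp]: "X \<in> Ob C" "Y \<in> Ob C" "W \<in> Ob C" for X Y W
 proof -
  have "aass C X Y W ** idt C ((X \<boxtimes> Y) \<boxtimes> W) ** (idt C (X \<boxtimes> Y) \<lhd> W) =
    idt C (X \<boxtimes> Y \<boxtimes> W) ** (X \<rhd> idt C (Y \<boxtimes> W)) ** aass C X Y W" by simp
  from arg_cong[OF this, of mor] show ?thesis
   by (simp add: mor_acomp mor_aten mor_idt mor_struct del: idt_acomp idt_acomp' acomp_idt aten_idt)
 qed
 have braid: "Braid C X Y \<cdot> Id C (X \<boxtimes> Y) = Id C (Y \<boxtimes> X) \<cdot> Braid C X Y" if "X \<in> Ob C" "Y \<in> Ob C" for X Y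
  using Comp_Id[of "Braid C X Y" "X \<boxtimes> Y" "Y \<boxtimes> X"] Id_Comp[of "Braid C X Y" "X \<boxtimes> Y" "Y \<boxtimes> X"] that
   mor_in_Hom[of "abr C X Y"] by (simp add: mor_struct)
 have br: "snd (FOb ?E Y) X = Braid C X Y" if "X \<in> Ob C" for X Y using that by (simp add: center_embedding_def)
 show ?thesis
  unfolding braided_functor_def tensor_functor_def
  using lin unit iso nat assoc braid
  by (simp add: E center_simps(2,3,8,10,13) embedded(1) br)
qed

lemma divisible_units: "divisible TYPE('k munit)"
 by (rule divisible_munit)

lemma finite_labels: "finite (UNIV :: ('a \<times> ('a, 'k) dual) set)"
 using finite_characters[where 'a = 'a and 'k = 'k] by (simp add: finite_prod)

text \<open>The restriction of \<open>F\<close> and the embedding are braided functors out of a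
  pointed category, so by \<open>tensor_iso_if_agree\<close> their values on the \<open>S a\<close>
  decide whether they are isomorphic.\<close>

lemma fixes_embedding_iff:
 assumes F: "F \<in> braided_autoequivs (center C)"
 shows "tensor_iso C (center C) (comp_monfun C (center C) (center C) F (center_embedding C)) (center_embedding C)
  \<longleftrightarrow> (\<forall>a. isomorphic (center C) (FOb F (pl (a, 0))) (pl (a, 0)))"
  (is "tensor_iso C _ ?G _ \<longleftrightarrow> _")
proof
 interpret CZ: pointed_source C "center C" S by unfold_locales
 have G: "FOb ?G X = FOb F (FOb (center_embedding C) X)" for X by (simp add: comp_monfun_def)
 show "\<forall>a. isomorphic (center C) (FOb F (pl (a, 0))) (pl (a, 0))" if "tensor_iso C (center C) ?G (center_embedding C)"
  using CZ.tensor_iso_isomorphic[OF that S_Ob] by (simp add: G embedded_S)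
 assume *: "\<forall>a. isomorphic (center C) (FOb F (pl (a, 0))) (pl (a, 0))"
 have "scalar (center C) (FOb F (pl (a, 0)))" for a
  using Z.isomorphic_sym[OF *[rule_format, of a]] P.S_scalar[of "(a, 0)"] unfolding Z.isomorphic_iff
  by (blast intro: Z.scalar_iso)
 moreover have "braided_functor C (center C) ?G"
  using braided_functor_comp[OF braided_monoidal_category_axioms Z.braided_monoidal_category_axioms
    Z.braided_monoidal_category_axioms braided_functor_center_embedding] F
  by (simp add: braided_autoequivs_def)
 ultimately show "tensor_iso C (center C) ?G (center_embedding C)"
  using * by (intro CZ.tensor_iso_if_agree[OF finite divisible_units _ braided_functor_center_embedding])
   (simp_all add: G embedded_S)
qed

text \<open>Braided autoequivalences are isomorphic exactly when they act alike on labels, so a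
  nonempty set attached to \<open>\<beta>\<close> is a single isomorphism class.\<close>

lemma autoequiv_class_eq:
 assumes F: "F \<in> autoequivs_inducing C S \<beta>"
 shows "autoequiv_class (center C) F = autoequivs_inducing C S \<beta>"
proof (intro equalityI subsetI)
 note F' = F[unfolded autoequivs_inducing_iff]
 show "G \<in> autoequivs_inducing C S \<beta>" if G: "G \<in> autoequiv_class (center C) F" for G
  unfolding autoequivs_inducing_iff
 proof (intro conjI allI)
  show GA: "G \<in> braided_autoequivs (center C)" using G by (simp add: autoequiv_class_def)
  fix l
  have "tensor_iso (center C) (center C) F G" using G by (simp add: autoequiv_class_def)
  then have "isomorphic (center C) (FOb F (pl l)) (FOb G (pl l))" by (rule ZZ.tensor_iso_isomorphic) simp
  then show "isomorphic (center C) (FOb G (pl l)) (pl (\<beta> l))"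
   using Z.isomorphic_sym Z.isomorphic_trans F' by blast
 qed
 show "G \<in> autoequiv_class (center C) F" if "G \<in> autoequivs_inducing C S \<beta>" for G
 proof -
  note G = that[unfolded autoequivs_inducing_iff]
  have "tensor_iso (center C) (center C) F G"
   unfolding P.tensor_iso_autoequivs[OF finite_labels divisible_units conjunct1[OF F'] conjunct1[OF G]]
   using F' G Z.isomorphic_sym Z.isomorphic_trans by blast
  with G show ?thesis by (simp add: autoequiv_class_def)
 qed
qed

lemma autoequivs_inducing_inject:
 assumes "F \<in> autoequivs_inducing C S \<beta>" "F \<in> autoequivs_inducing C S \<beta>'"
 shows "\<beta> = \<beta>'"
proof
 fix l
 have "isomorphic (center C) (pl (\<beta> l)) (pl (\<beta>' l))"
  using assms Z.isomorphic_sym Z.isomorphic_trans unfolding autoequivs_inducing_iff by blast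
 then show "\<beta> l = \<beta>' l" by (rule P.S_isomorphic)
qed

lemma comp_autoequivs_inducing:
 assumes F: "F \<in> autoequivs_inducing C S \<beta>" and G: "G \<in> autoequivs_inducing C S \<beta>'"
 shows "comp_monfun (center C) (center C) (center C) F G \<in> autoequivs_inducing C S (\<beta> \<circ> \<beta>')"
proof -
 note F' = F[unfolded autoequivs_inducing_iff] and G' = G[unfolded autoequivs_inducing_iff]
 have L: "lfun (center C) (center C) (FOb F) (arrow_map F)"
  using F' by (simp add: braided_autoequivs_def braided_functor_def tensor_functor_def ZZ.linear_functor_iff)
 have "isomorphic (center C) (FOb F (FOb G (pl l))) (pl (\<beta> (\<beta>' l)))" for l
  using ZZ.lfun_isomorphic[OF L, of "FOb G (pl l)" "pl (\<beta>' l)"] F' G' Z.isomorphic_trans by blast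
 then show ?thesis
  unfolding autoequivs_inducing_iff using P.comp_autoequivs[of F G] F' G' by (simp add: comp_monfun_def)
qed

text \<open>All composites of representatives induce \<open>\<beta> \<circ> \<beta>'\<close>, hence
  lie in one class. The members \<open>F\<close> and \<open>G\<close> make sure that the product is
  not empty.\<close>

lemma mult_autoequivs_inducing:
 assumes ne: "F \<in> autoequivs_inducing C S \<beta>" "G \<in> autoequivs_inducing C S \<beta>'"
 shows "autoequivs_inducing C S (\<beta> \<circ> \<beta>') =
  autoequivs_inducing C S \<beta> \<otimes>\<^bsub>Aut_br_center_rel C\<^esub> autoequivs_inducing C S \<beta>'"
proof -
 have m: "K \<otimes>\<^bsub>Aut_br_center_rel C\<^esub> L = {H \<in> braided_autoequivs (center C). \<exists>F\<in>K. \<exists>G\<in>L.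
   H \<in> autoequiv_class (center C) (comp_monfun (center C) (center C) (center C) F G)}" for K L
  by (auto simp: Aut_br_center_rel_def Aut_br_def autoequiv_class_def)
 show ?thesis
  unfolding m
  using ne comp_autoequivs_inducing autoequiv_class_eq autoequivs_inducing_iff by blast
qed

text \<open>The self-braiding of \<open>pl l\<close> is \<open>q.Q l\<close>. Thus the braided
  autoequivalences that are trivial on the embedded category induce exactly the elements of
  \<open>q.O_fix\<close> on labels, and \<open>alpha q\<close> parametrizes these by
  \<open>P_group q\<close>.\<close>

theorem iso_autoequivs_inducing:
 assumes q: "quadratic_form q" and Sq: "!!a. Braid C (S a) (S a) = Smult C (q a) (Id C (S a \<boxtimes> S a))"
 shows "(\<lambda>f. autoequivs_inducing C S (alpha q f)) \<in> iso (P_group q) (Aut_br_center_rel C)"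
proof -
 interpret q: quad_form q by standard (rule q)
 let ?AI = "autoequivs_inducing C S" and ?B = "braided_autoequivs (center C)"
 \<comment> \<open>At its own underlying object, the half braiding of \<open>pl l\<close> is the
   self-braiding of \<open>S (fst l)\<close> times the value of the character \<open>snd l\<close>
   at \<open>fst l\<close>.\<close>
 have abr: "abr (center C) (pl l) (pl l) = q.Q l \<odot>\<^sub>s\<^bsub>center C\<^esub> idt (center C) (pl l \<boxtimes>\<^bsub>center C\<^esub> pl l)" for l
 proof (rule Z.arrow_eqI)
  let ?a = "fst l"
  have "abr C (S ?a) (S ?a) = q ?a \<odot>\<^sub>s idt C (S ?a \<boxtimes> S ?a)"
   by (intro arrow_eqI) (simp_all add: mor_struct mor_asmult mor_idt Sq)
  then have hb: "hb C (pl l) (S ?a) = q.Q l \<odot>\<^sub>s idt C (S ?a \<boxtimes> S ?a)"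
   by (simp add: bx_S q.Q_def)
  have "snd (pl l) (S ?a) = mor (hb C (pl l) (S ?a))" by (simp only: hb_ends)
  also have "\<dots> = Smult C (q.Q l) (Id C (S ?a \<boxtimes> S ?a))" unfolding hb by (simp add: mor_asmult mor_idt)
  finally show "mor (abr (center C) (pl l) (pl l)) = mor (q.Q l \<odot>\<^sub>s\<^bsub>center C\<^esub> idt (center C) (pl l \<boxtimes>\<^bsub>center C\<^esub> pl l))"
   by (simp add: Z.mor_struct Z.mor_asmult Z.mor_idt center_simps(1,3,6,7,13))
 qed simp_all
 have ex: "\<exists>F. F \<in> ?AI (alpha q f)" if f: "f \<in> carrier (P_group q)" for f
 proof -
  from q.alpha_in_O_fix[OF f] have \<beta>: "bij (alpha q f)" "!!l m. alpha q f (l + m) = alpha q f l + alpha q f m"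
   "!!l. q.Q (alpha q f l) = q.Q l" by (auto simp: q.O_fix_def)
  obtain F where "F \<in> ?B" "!!l. isomorphic (center C) (FOb F (pl l)) (pl (alpha q f l))"
   by (rule P.ex_autoequiv[OF finite_labels \<beta>(1,2) abr \<beta>(3)]) blast
  then show ?thesis by (auto simp: autoequivs_inducing_iff)
 qed
 have "bij_betw (\<lambda>f. ?AI (alpha q f)) (carrier (P_group q)) (carrier (Aut_br_center_rel C))"
  unfolding bij_betw_def
 proof
  show "inj_on (\<lambda>f. ?AI (alpha q f)) (carrier (P_group q))"
  proof (rule inj_onI)
   fix f g assume f: "f \<in> carrier (P_group q)" and eq: "?AI (alpha q f) = ?AI (alpha q g)"
   obtain F where "F \<in> ?AI (alpha q f)" using ex[OF f] by blast
   then have "alpha q f = alpha q g" using eq by (intro autoequivs_inducing_inject) simp_all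
   then show "f = g" by (simp only: q.alpha_inject)
  qed
  have carrier: "carrier (Aut_br_center_rel C) = autoequiv_class (center C) `
    {F \<in> ?B. \<forall>a. isomorphic (center C) (FOb F (pl (a, 0))) (pl (a, 0))}"
   using fixes_embedding_iff by (auto simp: Aut_br_center_rel_def)
  show "(\<lambda>f. ?AI (alpha q f)) ` carrier (P_group q) = carrier (Aut_br_center_rel C)"
   unfolding carrier
  proof (intro equalityI subsetI)
   fix K assume "K \<in> (\<lambda>f. ?AI (alpha q f)) ` carrier (P_group q)"
   then obtain f where f: "f \<in> carrier (P_group q)" "K = ?AI (alpha q f)" by blast
   obtain F where F: "F \<in> ?AI (alpha q f)" using ex[OF f(1)] by blast
   have "alpha q f (a, 0) = (a, 0)" for a using q.alpha_in_O_fix[OF f(1)] by (simp add: q.O_fix_def)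
   then have "isomorphic (center C) (FOb F (pl (a, 0))) (pl (a, 0))" for a
    using F unfolding autoequivs_inducing_iff by metis
   then show "K \<in> autoequiv_class (center C) ` {F \<in> ?B. \<forall>a. isomorphic (center C) (FOb F (pl (a, 0))) (pl (a, 0))}"
    using autoequiv_class_eq[OF F] F f(2) unfolding autoequivs_inducing_iff by blast
  next
   fix K assume "K \<in> autoequiv_class (center C) ` {F \<in> ?B. \<forall>a. isomorphic (center C) (FOb F (pl (a, 0))) (pl (a, 0))}"
   then obtain F where F: "F \<in> ?B" "!!a. isomorphic (center C) (FOb F (pl (a, 0))) (pl (a, 0))"
    and K: "K = autoequiv_class (center C) F" by blast
   obtain \<beta> where \<beta>: "bij \<beta>" "!!l m. \<beta> (l + m) = \<beta> l + \<beta> m" "!!l. isomorphic (center C) (FOb F (pl l)) (pl (\<beta> l))"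
    and t: "!!l t. abr (center C) (pl l) (pl l) = t \<odot>\<^sub>s\<^bsub>center C\<^esub> idt (center C) (pl l \<boxtimes>\<^bsub>center C\<^esub> pl l) ==>
     abr (center C) (pl (\<beta> l)) (pl (\<beta> l)) = t \<odot>\<^sub>s\<^bsub>center C\<^esub> idt (center C) (pl (\<beta> l) \<boxtimes>\<^bsub>center C\<^esub> pl (\<beta> l))"
    by (rule P.autoequiv_label[OF finite_labels F(1)]) blast
   \<comment> \<open>Both are the factor of the self-braiding of \<open>pl (\<beta> l)\<close>; the
     factors are compared after composition with an isomorphism onto a scalar object.\<close>
   have "q.Q (\<beta> l) = q.Q l" for l
   proof -
    obtain \<mu> where \<mu>: "aiso (center C) \<mu>" "src \<mu> = pl (\<beta> l) \<boxtimes>\<^bsub>center C\<^esub> pl (\<beta> l)" "tgt \<mu> = pl (\<beta> l + \<beta> l)"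
     using P.S_mult unfolding Z.isomorphic_iff by blast
    let ?i = "idt (center C) (pl (\<beta> l) \<boxtimes>\<^bsub>center C\<^esub> pl (\<beta> l))"
    have "q.Q (\<beta> l) \<odot>\<^sub>s\<^bsub>center C\<^esub> ?i = q.Q l \<odot>\<^sub>s\<^bsub>center C\<^esub> ?i" using t[OF abr[of l]] abr[of "\<beta> l"] by simp
    then have "\<mu> **\<^bsub>center C\<^esub> (q.Q (\<beta> l) \<odot>\<^sub>s\<^bsub>center C\<^esub> ?i) = \<mu> **\<^bsub>center C\<^esub> (q.Q l \<odot>\<^sub>s\<^bsub>center C\<^esub> ?i)" by (rule arg_cong)
    then have "q.Q (\<beta> l) \<odot>\<^sub>s\<^bsub>center C\<^esub> \<mu> = q.Q l \<odot>\<^sub>s\<^bsub>center C\<^esub> \<mu>" using \<mu> by simp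
    then show ?thesis by (rule Z.scalar_cancel[rotated 2]) (use \<mu> P.S_scalar in simp_all)
   qed
   moreover have "\<beta> (a, 0) = (a, 0)" for a
    using P.S_isomorphic[OF Z.isomorphic_trans[OF Z.isomorphic_sym[OF \<beta>(3)[of "(a, 0)"]] F(2)[of a]]] .
   ultimately have "\<beta> \<in> q.O_fix" unfolding q.O_fix_def using \<beta>(1,2) by blast
   then obtain f where f: "f \<in> carrier (P_group q)" "\<beta> = alpha q f" by (rule q.O_fix_eq_alpha)
   have "F \<in> ?AI \<beta>" using F(1) \<beta>(3) by (simp add: autoequivs_inducing_iff)
   from autoequiv_class_eq[OF this] show "K \<in> (\<lambda>f. ?AI (alpha q f)) ` carrier (P_group q)"
    using f K by blast
  qed
 qed
 moreover have "?AI (alpha q (f \<otimes>\<^bsub>P_group q\<^esub> g)) = ?AI (alpha q f) \<otimes>\<^bsub>Aut_br_center_rel C\<^esub> ?AI (alpha q g)"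
  if f: "f \<in> carrier (P_group q)" and g: "g \<in> carrier (P_group q)" for f g
 proof -
  obtain F G where "F \<in> ?AI (alpha q f)" "G \<in> ?AI (alpha q g)" using ex[OF f] ex[OF g] by blast
  from mult_autoequivs_inducing[OF this] show ?thesis by (simp only: q.alpha_mult[OF f])
 qed
 ultimately show ?thesis by (auto simp: iso_def hom_def bij_betw_def)
qed

end

theorem proposition5p12:
  fixes q :: "'a::{ab_group_add, finite} \<Rightarrow> 'k::{alg_closed_field, field_char_0}"
    and C :: "('o, 'm, 'k) btc"
    and S :: "'a \<Rightarrow> 'o"
  assumes "quadratic_form q"
  shows "group (P_group q) \<and>
         (pointed_category_of C S q \<longrightarrow>
           (\<lambda>f. autoequivs_inducing C S (alpha q f)) \<in> iso (P_group q) (Aut_br_center_rel C))"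
proof (intro conjI impI)
 interpret quad_form q by standard (rule assms)
 show "group (P_group q)" by (rule group_P)
 assume C: "pointed_category_of C S q"
 interpret pointed_center C S
  by (rule pointed_center.intro, rule pointed_family_pointed_category[OF C])
 show "(\<lambda>f. autoequivs_inducing C S (alpha q f)) \<in> iso (P_group q) (Aut_br_center_rel C)"
  by (rule iso_autoequivs_inducing[OF assms pointed_category_of.Braid_S[OF C]])
qed

end
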